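(* Let $d,s,n\ge 1$ be integers, let $p\in(1,+\infty)$, let $\Omega\subset\mathbb{R}^d$ be a (nonempty) bounded open domain, and let $\square=[0,1)^d$. Let $\{\mathcal{W}_k:\mathbb{M}^{s\times d}\to[0,+\infty)\}_{k=1,\dots,n}$ be a family of continuous functions, let $\{P_k\}_{k=1,\dots,n}$ be a measurable partition of $\square$, and let $\mathcal{W}(y,\Lambda):=\sum_{k=1}^n\chi_{P_k}(y)\,\mathcal{W}_k(\Lambda)$. Suppose that for every $k\in\{1,\dots,n\}$: (i) $\mathcal{W}_k$ satisfies coerciveness and growth conditions of order $p$; (ii) the set $\mathfrak{A}_k:=\mathcal{W}_k^{-1}(0)$ is not empty. Then $$\mathfrak{A}_{hom}=\mathcal{W}_{hom}^{-1}(0),$$ i.e. the zero-level set of the homogenized integrand $\mathcal{W}_{hom}$ related to $\mathcal{W}$ coincides with the homogenized set $\mathfrak{A}_{hom}$ related to $\{(\mathfrak{A}_k,P_k)\}_{k=1,\dots,n}$.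
   Context: Notation. $\mathbb{M}^{s\times d}$ is the space of real $s\times d$ matrices. $\chi_S$ is the characteristic function of $S$. For $x\in\mathbb{R}^d$, $\langle x\rangle\in\square$ denotes the componentwise fractional part, $\langle x\rangle_k=x_k-\lfloor x_k\rfloor$. Measurable means Lebesgue measurable. Coerciveness and growth conditions of order $p$. A function $\mathcal{V}:\mathbb{M}^{s\times d}\to[0,+\infty)$ satisfies them if there are constants $c_1,c_2,c_3>0$ with $c_1|\Lambda|^p-c_2\le\mathcal{V}(\Lambda)\le c_3(1+|\Lambda|^p)$ for all $\Lambda\in\mathbb{M}^{s\times d}$. (Hence each $\mathfrak{A}_k$ above is compact.) Homogenized set. Given a measurable partition $\{P_k\}_{k=1,\dots,n}$ of $\square$ and compact sets $\mathfrak{A}_1,\dots,\mathfrak{A}_n\subseteq\mathbb{M}^{s\times d}$, the homogenized set $\mathfrak{A}_{hom}$ related to $\{(\mathfrak{A}_k,P_k)\}_{k}$ is the set of matrices $A\in\mathbb{M}^{s\times d}$ such that for every sequence $\varepsilon_h\to0^+$ there exists a sequence $u_h\in W^{1,\infty}(\Omega,\mathbb{R}^s)$ with: (a) $u_h\rightharpoonup Ax$ weakly* in $W^{1,\infty}(\Omega,\mathbb{R}^s)$ (here $Ax$ denotes the map $x\mapsto Ax$); (b) $\sum_{k=1}^n\chi_{P_k}(\langle x/\varepsilon_h\rangle)\,\mathrm{dist}(\nabla u_h(x),\mathfrak{A}_k)\to0$ in measure on $\Omega$. $\Gamma$-convergence. Let $L^p(\Omega,\mathbb{R}^s)$ carry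 its strong topology. A functional $E:L^p(\Omega,\mathbb{R}^s)\to[0,+\infty]$ is the $\Gamma(L^p)$-limit of a sequence $E_h$ if for every $u$: $E(u)\le\inf\{\liminf_h E_h(u_h): u_h\to u\}$ and $E(u)\ge\inf\{\limsup_h E_h(u_h): u_h\to u\}$, where the infima are over sequences converging to $u$ in $L^p$. $E$ is the $\Gamma(L^p)$-limit of a family $(E_\varepsilon)_{\varepsilon>0}$ as $\varepsilon\to0^+$ if it is the $\Gamma(L^p)$-limit of $E_{\varepsilon_h}$ for every sequence $\varepsilon_h\to0^+$. Homogenized integrand. For $\varepsilon>0$ let $E_\varepsilon:L^p(\Omega,\mathbb{R}^s)\to[0,+\infty]$ be $E_\varepsilon(u)=\int_\Omega\mathcal{W}(\langle x/\varepsilon\rangle,\nabla u(x))\,dx$ if $u\in W^{1,p}(\Omega,\mathbb{R}^s)$ and $+\infty$ otherwise. It is a standard theorem that $E_\varepsilon$ $\Gamma(L^p)$-converges as $\varepsilon\to0^+$ to a functional of the form $E_{hom}(u)=\int_\Omega\mathcal{W}_{hom}(\nabla u(x))\,dx$ if $u\in W^{1,p}(\Omega,\mathbb{R}^s)$ and $+\infty$ otherwise, for a (unique) quasiconvex function $\mathcal{W}_{hom}:\mathbb{M}^{s\times d}\to[0,+\infty)$; this function is called the homogenized integrand related to $\mathcal{W}$. *)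

theory Defs
  imports "HOL-Analysis.Analysis"
begin

text \<open>
  Real \<open>s \<times> d\<close> matrices are elements of \<open>real^'d^'s\<close>; the norm there is the Frobenius norm.
  A map on \<open>\<Omega>\<close> is represented by a total function whose values outside \<open>\<Omega>\<close> are ignored, and
  functions are not quotiented by equality almost everywhere: every notion below concerning
  Lebesgue or Sobolev maps is invariant under changing them on a null subset of \<open>\<Omega>\<close>.
\<close>

section \<open>Function spaces\<close>

primrec Ck :: "nat \<Rightarrow> ('a::real_normed_vector \<Rightarrow> 'b::real_normed_vector) \<Rightarrow> bool" where
  "Ck 0 f \<longleftrightarrow> continuous_on UNIV f"
| "Ck (Suc k) f \<longleftrightarrow> (\<exists>f'. (\<forall>x. (f has_derivative f' x) (at x)) \<and> (\<forall>v. Ck k (\<lambda>x. f' x v)))"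

definition test_function :: "'a::real_normed_vector set \<Rightarrow> ('a \<Rightarrow> 'b::real_normed_vector) \<Rightarrow> bool" where
  "test_function \<Omega> \<phi> \<longleftrightarrow>
     (\<forall>k. Ck k \<phi>) \<and> compact (closure {x. \<phi> x \<noteq> 0}) \<and> closure {x. \<phi> x \<noteq> 0} \<subseteq> \<Omega>"

definition locally_integrable :: "'a::euclidean_space set \<Rightarrow> ('a \<Rightarrow> 'b::euclidean_space) \<Rightarrow> bool" where
  "locally_integrable \<Omega> f \<longleftrightarrow> (\<forall>K. compact K \<and> K \<subseteq> \<Omega> \<longrightarrow> set_integrable lebesgue K f)"

definition has_weak_gradient ::
  "(real^'d) set \<Rightarrow> (real^'d \<Rightarrow> real^'s) \<Rightarrow> (real^'d \<Rightarrow> real^'d^'s) \<Rightarrow> bool" where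
  "has_weak_gradient \<Omega> u G \<longleftrightarrow>
     locally_integrable \<Omega> u \<and> locally_integrable \<Omega> G \<and>
     (\<forall>\<phi> :: real^'d \<Rightarrow> real. test_function \<Omega> \<phi> \<longrightarrow>
       (\<forall>i j. (LINT x:\<Omega>|lebesgue. u x $ i * frechet_derivative \<phi> (at x) (axis j 1)) =
              - (LINT x:\<Omega>|lebesgue. G x $ i $ j * \<phi> x)))"

text \<open>The choice below is immaterial: weak gradients are unique almost everywhere on an open \<open>\<Omega>\<close>.\<close>

definition weak_grad :: "(real^'d) set \<Rightarrow> (real^'d \<Rightarrow> real^'s) \<Rightarrow> real^'d \<Rightarrow> real^'d^'s" where
  "weak_grad \<Omega> u = (SOME G. has_weak_gradient \<Omega> u G)"

definition Lp :: "'a::euclidean_space set \<Rightarrow> real \<Rightarrow> ('a \<Rightarrow> 'b::euclidean_space) set" where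
  "Lp \<Omega> p = {u. set_borel_measurable lebesgue \<Omega> u \<and>
                 set_integrable lebesgue \<Omega> (\<lambda>x. norm (u x) powr p)}"

definition Linf :: "'a::euclidean_space set \<Rightarrow> ('a \<Rightarrow> 'b::euclidean_space) set" where
  "Linf \<Omega> = {u. set_borel_measurable lebesgue \<Omega> u \<and>
                 (\<exists>M. AE x in lebesgue. x \<in> \<Omega> \<longrightarrow> norm (u x) \<le> M)}"

definition W1p :: "(real^'d) set \<Rightarrow> real \<Rightarrow> (real^'d \<Rightarrow> real^'s) set" where
  "W1p \<Omega> p = {u \<in> Lp \<Omega> p. \<exists>G \<in> Lp \<Omega> p. has_weak_gradient \<Omega> u G}"

definition W1inf :: "(real^'d) set \<Rightarrow> (real^'d \<Rightarrow> real^'s) set" where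
  "W1inf \<Omega> = {u \<in> Linf \<Omega>. \<exists>G \<in> Linf \<Omega>. has_weak_gradient \<Omega> u G}"

definition converges_Lp ::
  "'a::euclidean_space set \<Rightarrow> real \<Rightarrow> (nat \<Rightarrow> 'a \<Rightarrow> 'b::euclidean_space) \<Rightarrow> ('a \<Rightarrow> 'b) \<Rightarrow> bool" where
  "converges_Lp \<Omega> p v u \<longleftrightarrow>
     (\<lambda>h. LINT x:\<Omega>|lebesgue. norm (v h x - u x) powr p) \<longlonglongrightarrow> 0"

definition weakstar_Linf ::
  "'a::euclidean_space set \<Rightarrow> (nat \<Rightarrow> 'a \<Rightarrow> 'b::euclidean_space) \<Rightarrow> ('a \<Rightarrow> 'b) \<Rightarrow> bool" where
  "weakstar_Linf \<Omega> v u \<longleftrightarrow>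
     (\<forall>g. set_integrable lebesgue \<Omega> g \<longrightarrow>
       (\<lambda>h. LINT x:\<Omega>|lebesgue. v h x \<bullet> g x) \<longlonglongrightarrow> (LINT x:\<Omega>|lebesgue. u x \<bullet> g x))"

definition weakstar_W1inf ::
  "(real^'d) set \<Rightarrow> (nat \<Rightarrow> real^'d \<Rightarrow> real^'s) \<Rightarrow> (real^'d \<Rightarrow> real^'s) \<Rightarrow> bool" where
  "weakstar_W1inf \<Omega> v u \<longleftrightarrow>
     weakstar_Linf \<Omega> v u \<and> weakstar_Linf \<Omega> (\<lambda>h. weak_grad \<Omega> (v h)) (weak_grad \<Omega> u)"

definition converges_in_measure ::
  "'a::euclidean_space set \<Rightarrow> (nat \<Rightarrow> 'a \<Rightarrow> real) \<Rightarrow> ('a \<Rightarrow> real) \<Rightarrow> bool" where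
  "converges_in_measure \<Omega> f g \<longleftrightarrow>
     (\<forall>\<delta>>0. (\<lambda>h. emeasure lebesgue {x \<in> \<Omega>. \<bar>f h x - g x\<bar> > \<delta>}) \<longlonglongrightarrow> 0)"

section \<open>The periodicity cell and the homogenized set\<close>

definition unit_cell :: "(real^'d) set" where
  "unit_cell = {x. \<forall>i. 0 \<le> x $ i \<and> x $ i < 1}"

definition frac_vec :: "real^'d \<Rightarrow> real^'d" where
  "frac_vec x = (\<chi> i. frac (x $ i))"

definition measurable_partition :: "nat \<Rightarrow> (nat \<Rightarrow> (real^'d) set) \<Rightarrow> bool" where
  "measurable_partition n P \<longleftrightarrow>
     (\<forall>k\<in>{1..n}. P k \<in> sets lebesgue) \<and> disjoint_family_on P {1..n} \<and>
     (\<Union>k\<in>{1..n}. P k) = unit_cell"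

definition vanishing_positive :: "(nat \<Rightarrow> real) \<Rightarrow> bool" where
  "vanishing_positive \<epsilon> \<longleftrightarrow> (\<forall>h. 0 < \<epsilon> h) \<and> \<epsilon> \<longlonglongrightarrow> 0"

text \<open>The library's \<open>infdist\<close> is the usual distance for nonempty sets (and \<open>0\<close> for the empty set).\<close>

definition homogenized_set ::
  "(real^'d) set \<Rightarrow> nat \<Rightarrow> (nat \<Rightarrow> (real^'d^'s) set) \<Rightarrow> (nat \<Rightarrow> (real^'d) set) \<Rightarrow> (real^'d^'s) set" where
  "homogenized_set \<Omega> n \<AA> P = {A. \<forall>\<epsilon>. vanishing_positive \<epsilon> \<longrightarrow>
     (\<exists>u. (\<forall>h. u h \<in> W1inf \<Omega>) \<and> weakstar_W1inf \<Omega> u (\<lambda>x. A *v x) \<and>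
       converges_in_measure \<Omega>
         (\<lambda>h x. \<Sum>k\<in>{1..n}. indicator (P k) (frac_vec (x /\<^sub>R \<epsilon> h)) *
                  infdist (weak_grad \<Omega> (u h) x) (\<AA> k))
         (\<lambda>x. 0))}"

section \<open>Gamma-convergence and the homogenized integrand\<close>

definition coercive_growth :: "real \<Rightarrow> ('a::real_normed_vector \<Rightarrow> real) \<Rightarrow> bool" where
  "coercive_growth p V \<longleftrightarrow> (\<exists>c1>0. \<exists>c2>0. \<exists>c3>0. \<forall>\<Lambda>.
     c1 * norm \<Lambda> powr p - c2 \<le> V \<Lambda> \<and> V \<Lambda> \<le> c3 * (1 + norm \<Lambda> powr p))"

definition gamma_limit ::
  "(real^'d) set \<Rightarrow> real \<Rightarrow> (nat \<Rightarrow> (real^'d \<Rightarrow> real^'s) \<Rightarrow> ennreal) \<Rightarrow>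
   ((real^'d \<Rightarrow> real^'s) \<Rightarrow> ennreal) \<Rightarrow> bool" where
  "gamma_limit \<Omega> p Eh E \<longleftrightarrow> (\<forall>u \<in> Lp \<Omega> p.
     E u \<le> Inf {liminf (\<lambda>h. Eh h (v h)) | v. (\<forall>h. v h \<in> Lp \<Omega> p) \<and> converges_Lp \<Omega> p v u} \<and>
     E u \<ge> Inf {limsup (\<lambda>h. Eh h (v h)) | v. (\<forall>h. v h \<in> Lp \<Omega> p) \<and> converges_Lp \<Omega> p v u})"

definition energy ::
  "(real^'d) set \<Rightarrow> real \<Rightarrow> (real^'d \<Rightarrow> real^'d^'s \<Rightarrow> real) \<Rightarrow> (real^'d \<Rightarrow> real^'s) \<Rightarrow> ennreal" where
  "energy \<Omega> p f u = (if u \<in> W1p \<Omega> p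
     then (\<integral>\<^sup>+x\<in>\<Omega>. ennreal (f x (weak_grad \<Omega> u x)) \<partial>lebesgue) else \<infinity>)"

text \<open>Quasiconvexity in the sense of Morrey, for nonnegative integrands.\<close>

definition quasiconvex :: "(real^'d^'s \<Rightarrow> real) \<Rightarrow> bool" where
  "quasiconvex f \<longleftrightarrow>
     f \<in> borel_measurable borel \<and> (\<forall>K. compact K \<longrightarrow> bounded (f ` K)) \<and>
     (\<forall>A D (\<phi> :: real^'d \<Rightarrow> real^'s). open D \<and> bounded D \<and> test_function D \<phi> \<longrightarrow>
       ennreal (f A) * emeasure lebesgue D
         \<le> (\<integral>\<^sup>+x\<in>D. ennreal (f (A + jacobian \<phi> (at x))) \<partial>lebesgue))"

definition homogenized_integrand ::
  "(real^'d) set \<Rightarrow> real \<Rightarrow> (real^'d \<Rightarrow> real^'d^'s \<Rightarrow> real) \<Rightarrow> (real^'d^'s \<Rightarrow> real) \<Rightarrow> bool" where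
  "homogenized_integrand \<Omega> p W Whom \<longleftrightarrow>
     (\<forall>\<Lambda>. 0 \<le> Whom \<Lambda>) \<and> quasiconvex Whom \<and>
     (\<forall>\<epsilon>. vanishing_positive \<epsilon> \<longrightarrow>
       gamma_limit \<Omega> p (\<lambda>h. energy \<Omega> p (\<lambda>x. W (frac_vec (x /\<^sub>R \<epsilon> h)))) (energy \<Omega> p (\<lambda>x. Whom)))"

end

theory Submission
  imports Defs
begin

text \<open>
  A weakly* convergent sequence in \<open>W\<^sup>1\<^sup>,\<^sup>\<infinity>\<close> has uniformly bounded gradients, hence converges strongly
  in \<open>L\<^sup>p\<close>. If the gradients moreover approach the zero sets of the integrands in measure, the
  energies tend to \<open>0\<close>, and the liminf inequality forces the homogenized integrand to vanish at \<open>A\<close>.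

  Conversely, if it vanishes at \<open>A\<close>, a recovery sequence has energies tending to \<open>0\<close>. By coercivity
  the excess of the gradient over a fixed radius is then small in \<open>L\<^sup>1\<close>, so that a Lipschitz
  truncation changes the gradients only on a set of small measure: off the level set of the maximal
  function of the excess the map is Lipschitz, and it is extended from there by McShane's formula.
  The extension is mollified, and the error is controlled by the continuity of translations
  in \<open>L\<^sup>1\<close> applied to the indicator of the bad set; thus Rademacher's theorem is not needed. A
  diagonal choice over the thresholds yields uniformly convergent maps with bounded gradients.
\<close>

text \<open>The boundary of \<open>\<Omega>\<close> may be rough, so neither a Sobolev extension nor
  compactness up to the boundary is at hand. Compactness is therefore used on a compact part only,
  the remaining layer being cheap since its measure is small and the maps are bounded. Truncation is
  applied to the difference from \<open>A *v x\<close> times a cutoff; where the cutoff varies, no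
  closeness of gradients is claimed, which convergence in measure tolerates.

  The delicate point is uniformity: besides the dimensions, the gradient bound must depend on the
  coercivity radius and on \<open>A\<close> alone, not on the accuracy, or else the diagonal
  sequence might be unbounded in \<open>W1inf\<close>. Hence the maximal function is taken of the
  excess over a radius instead of the gradient itself: its threshold stays at the fixed value 1
  while the excess tends to zero in \<open>L^1\<close>, and the bad set shrinks with it.

  Weak gradients live on the completed Lebesgue measure, whereas Tonelli and translation arguments
  run on \<open>lborel\<close>; Borel representatives vanishing off \<open>\<Omega>\<close> mediate
  between the two.\<close>

section \<open>Affine changes of variables and continuity of translations in
  \<open>L^1\<close>\<close>

lemma nn_integral_lborel_affine:
  fixes f :: "'a::euclidean_space \<Rightarrow> ennreal"
  assumes [measurable]: "f \<in> borel_measurable borel" and c: "c \<noteq> 0"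
  shows "(\<integral>\<^sup>+x. f x \<partial>lborel) = ennreal (\<bar>c\<bar> ^ DIM('a)) * (\<integral>\<^sup>+x. f (t + c *\<^sub>R x) \<partial>lborel)"
  by (subst lborel_affine[OF c, of t])
     (simp add: nn_integral_density nn_integral_distr nn_integral_cmult ennreal_power)

lemma integrable_lborel_affine:
  fixes f :: "'a::euclidean_space \<Rightarrow> 'b::{banach, second_countable_topology}"
  assumes f: "integrable lborel f" and c: "c \<noteq> 0"
  shows "integrable lborel (\<lambda>x. f (t + c *\<^sub>R x))"
  using f f[THEN borel_measurable_integrable] c unfolding integrable_iff_bounded
  by (subst (asm) nn_integral_lborel_affine[where c=c and t=t]) (auto simp: ennreal_mult_less_top)

lemma integral_lborel_affine:
  fixes f :: "'a::euclidean_space \<Rightarrow> 'b::{banach, second_countable_topology}"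
  assumes f: "integrable lborel f" and c: "c \<noteq> 0"
  shows "(LINT x|lborel. f x) = \<bar>c\<bar> ^ DIM('a) *\<^sub>R (LINT x|lborel. f (t + c *\<^sub>R x))"
  using f f[THEN borel_measurable_integrable] integrable_lborel_affine[OF f c, of t]
  by (subst lborel_affine[OF c, of t])
     (simp add: integral_density integral_distr)

lemma integrable_lborel_translate:
  fixes f :: "'a::euclidean_space \<Rightarrow> 'b::{banach, second_countable_topology}"
  assumes "integrable lborel f"
  shows "integrable lborel (\<lambda>x. f (x - a))" "integrable lborel (\<lambda>x. f (a - x))"
  using integrable_lborel_affine[OF assms, of 1 "-a"] integrable_lborel_affine[OF assms, of "-1" a]
  by auto

lemma integral_lborel_translate:
  fixes f :: "'a::euclidean_space \<Rightarrow> 'b::{banach, second_countable_topology}"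
  assumes "integrable lborel f"
  shows "(LINT x|lborel. f (x - a)) = (LINT x|lborel. f x)" "(LINT x|lborel. f (a - x)) = (LINT x|lborel. f x)"
  using integral_lborel_affine[OF assms, of 1 "-a"] integral_lborel_affine[OF assms, of "-1" a]
  by auto

lemma emeasure_lborel_translate:
  fixes A :: "'a::euclidean_space set"
  assumes "A \<in> sets borel"
  shows "emeasure lborel {x. x - y \<in> A} = emeasure lborel A"
proof -
  have m: "{x. x - y \<in> A} \<in> sets borel"
    using measurable_sets[of "\<lambda>x. x - y" borel borel A] assms by (simp add: vimage_def)
  have "emeasure lborel A = (\<integral>\<^sup>+x. indicator A x \<partial>lborel)"
    using assms by simp
  also have "\<dots> = (\<integral>\<^sup>+x. indicator A (x - y) \<partial>lborel)"
    using nn_integral_lborel_affine[of "indicator A" 1 "-y"] assms by simp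
  also have "(\<lambda>x. indicator A (x - y)) = (indicator {x. x - y \<in> A} :: 'a \<Rightarrow> ennreal)"
    by (auto simp: indicator_def)
  finally show ?thesis using m by simp
qed

text \<open>Squeeze \<open>A\<close> between a compact \<open>K\<close> and an open \<open>U\<close>
  with \<open>U - K\<close> of small measure. A sufficiently short shift keeps the shifted
  \<open>K\<close> inside \<open>U\<close>, and this controls the part of \<open>A\<close> that the
  shifted set misses.\<close>

lemma L1_translation_continuous_indicator:
  fixes A :: "'a::euclidean_space set"
  assumes A[measurable]: "A \<in> sets borel" and fin: "emeasure lborel A < \<infinity>" and e: "0 < e"
  shows "\<exists>d>0. \<forall>y. norm y < d \<longrightarrow> (LINT x|lborel. \<bar>indicator A (x - y) - indicator A x :: real\<bar>) < e"
proof -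
  have Al: "A \<in> sets lebesgue" by simp
  have e4: "e/4 > 0" using e by simp
  obtain U where U: "open U" "A \<subseteq> U" "U - A \<in> lmeasurable" "emeasure lebesgue (U - A) < ennreal (e/4)"
    using sets_lebesgue_outer_open[OF Al e4] by blast
  have mA: "A \<in> lmeasurable" using fin by (simp add: fmeasurable_def)
  have Ub: "U \<in> sets borel" using U by simp
  have "\<exists>K. compact K \<and> K \<subseteq> A \<and> measure lebesgue (A - K) < e/4"
  proof -
    \<comment> \<open>Inner regularity gives only a closed set; intersecting it with a large ball
      makes it compact. Each of the two steps costs \<open>e/8\<close>.\<close>
    obtain C where C: "closed C" "C \<subseteq> A" "A - C \<in> lmeasurable" "emeasure lebesgue (A - C) < ennreal (e/8)"
      using sets_lebesgue_inner_closed[OF Al, of "e/8"] e by auto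
    have Cm: "C \<in> lmeasurable" using C mA
      by (metis Diff_Diff_Int fmeasurable.Diff inf.absorb_iff2)
    have "(\<lambda>n. measure lebesgue (C \<inter> cball 0 (real n))) \<longlonglongrightarrow> measure lebesgue (\<Union>n. C \<inter> cball 0 (real n))"
    proof (rule Lim_measure_incseq)
      show "range (\<lambda>n. C \<inter> cball 0 (real n)) \<subseteq> sets lebesgue"
        using C by (auto simp: closed_Int borel_closed)
      show "incseq (\<lambda>n. C \<inter> cball 0 (real n))" by (auto simp: incseq_def)
      have "(\<Union>n. C \<inter> cball 0 (real n)) = C"
        by (auto simp: real_arch_simple)
      then show "emeasure lebesgue (\<Union>n. C \<inter> cball 0 (real n)) \<noteq> \<infinity>"
        using Cm by (auto simp: fmeasurable_def)
    qed
    moreover have "(\<Union>n. C \<inter> cball 0 (real n)) = C"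
      by (auto simp: real_arch_simple)
    ultimately have "(\<lambda>n. measure lebesgue (C \<inter> cball 0 (real n))) \<longlonglongrightarrow> measure lebesgue C" by simp
    from LIMSEQ_D[OF this, of "e/8"] e obtain n where n: "\<bar>measure lebesgue (C \<inter> cball 0 (real n)) - measure lebesgue C\<bar> < e/8"
      by auto
    let ?K = "C \<inter> cball 0 (real n)"
    have K: "?K \<in> lmeasurable" using Cm by (intro fmeasurable_Int_fmeasurable) auto
    have "measure lebesgue (A - C) < e/8" using C(4) unfolding emeasure_eq_measure2[OF C(3)]
      by (simp add: ennreal_less_iff)
    moreover have "measure lebesgue (A - C) = measure lebesgue A - measure lebesgue C"
      using C Cm mA by (simp add: measurable_measure_Diff fmeasurableD)
    moreover have "measure lebesgue (A - ?K) = measure lebesgue A - measure lebesgue ?K"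
      using C(2) K mA by (intro measurable_measure_Diff) (auto intro: fmeasurableD)
    ultimately have "measure lebesgue (A - ?K) < e/4" using n by linarith
    moreover have "compact ?K" using C by (simp add: closed_Int_compact)
    ultimately show ?thesis using C(2) by (intro exI[of _ ?K]) auto
  qed
  then obtain K where K: "compact K" "K \<subseteq> A" "measure lebesgue (A - K) < e/4" by blast
  have Kb: "K \<in> sets borel" using K by (simp add: compact_imp_closed)
  have KU: "K \<subseteq> U" using K U by blast
  obtain d where d0: "d > 0" "(\<Union>x\<in>K. ball x d) \<subseteq> U"
    by (rule compact_subset_open_imp_ball_epsilon_subset[OF K(1) U(1) KU])
  have d: "d > 0" "ball x d \<subseteq> U" if "x \<in> K" for x
    using d0 that by auto
  have mU: "U \<in> lmeasurable"
    using fmeasurable.Un[OF mA U(3)] U(2) by (simp add: Un_absorb1)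
  have mK: "K \<in> lmeasurable" using K by (simp add: lmeasurable_compact)
  have UK: "measure lebesgue (U - K) < e/2"
  proof -
    have "measure lebesgue (U - A) < e/4" using U(4) unfolding emeasure_eq_measure2[OF U(3)]
      by (simp add: ennreal_less_iff)
    moreover have "measure lebesgue (U - K) \<le> measure lebesgue (U - A) + measure lebesgue (A - K)"
    proof -
      have "U - K = (U - A) \<union> (A - K)" using U K by blast
      then show ?thesis
        using mA mK mU by (simp add: measure_Un_le fmeasurableD)
    qed
    ultimately show ?thesis using K(3) by linarith
  qed
  show ?thesis
  proof (intro exI[of _ d] conjI allI impI)
    show "d > 0" by (rule d0)
    fix y :: 'a assume y: "norm y < d"
    define Ay where "Ay = {x. x - y \<in> A}"
    define Ky where "Ky = {x. x - y \<in> K}"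
    have Ayb[measurable]: "Ay \<in> sets borel"
      unfolding Ay_def using measurable_sets[of "\<lambda>x. x - y" borel borel A] A by (simp add: vimage_def)
    have Kyb[measurable]: "Ky \<in> sets borel"
      unfolding Ky_def using measurable_sets[of "\<lambda>x. x - y" borel borel K] Kb by (simp add: vimage_def)
    have eA: "emeasure lborel Ay = emeasure lborel A" unfolding Ay_def by (rule emeasure_lborel_translate[OF A])
    have eK: "emeasure lborel Ky = emeasure lborel K" unfolding Ky_def by (rule emeasure_lborel_translate[OF Kb])
    have mAy: "Ay \<in> fmeasurable lborel" using eA fin by (simp add: fmeasurable_def)
    have mK': "K \<in> fmeasurable lborel" "U \<in> fmeasurable lborel" "A \<in> fmeasurable lborel"
      using mK mU mA Kb Ub A by (auto simp: fmeasurable_def)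
    have mKy: "Ky \<in> fmeasurable lborel" using eK mK' by (simp add: fmeasurable_def)
    have "x \<in> U" if "x \<in> Ky" for x
      using d(2)[of "x - y"] that y by (auto simp: Ky_def dist_norm subset_eq)
    then have KyU: "Ky \<subseteq> U" by blast
    have KyAy: "Ky \<subseteq> Ay" using K by (auto simp: Ky_def Ay_def)
    have le: "measure lborel U - measure lborel K < e/2"
      using UK mU mK Kb Ub KU by (simp add: measurable_measure_Diff fmeasurableD)
    have mKeq: "measure lborel Ky = measure lborel K" using eK by (simp add: measure_def)
    have mAeq: "measure lborel Ay = measure lborel A" using eA by (simp add: measure_def)
    have "measure lborel (A - Ay) \<le> measure lborel (U - Ky)"
      using U KyAy mK' mKy by (intro measure_mono_fmeasurable) auto
    also have "\<dots> = measure lborel U - measure lborel K"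
      using mKeq mK' mKy KyU by (simp add: measurable_measure_Diff fmeasurableD)
    finally have 1: "measure lborel (A - Ay) < e/2" using le by linarith
    \<comment> \<open>\<open>Ay\<close> and \<open>A\<close> have equal finite measure, so the two
      halves of the symmetric difference have equal measure and only one of them needs the
      approximation.\<close>
    have "measure lborel (Ay - A) = measure lborel Ay - measure lborel (Ay \<inter> A)"
    proof -
      have "Ay - A = Ay - (Ay \<inter> A)" by blast
      then show ?thesis using mAy mK' measurable_measure_Diff[of Ay lborel "Ay \<inter> A"] by simp
    qed
    also have "\<dots> = measure lborel A - measure lborel (A \<inter> Ay)" using mAeq by (simp add: Int_commute)
    also have "\<dots> = measure lborel (A - Ay)"
    proof -
      have "A - Ay = A - (A \<inter> Ay)" by blast
      then show ?thesis using mAy mK' measurable_measure_Diff[of A lborel "A \<inter> Ay"] by simp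
    qed
    finally have 2: "measure lborel (Ay - A) < e/2" using 1 by simp
    have int: "integrable lborel (indicator (Ay - A) :: 'a \<Rightarrow> real)" "integrable lborel (indicator (A - Ay) :: 'a \<Rightarrow> real)"
      using fmeasurable.Diff[OF mAy mK'(3)] fmeasurable.Diff[OF mK'(3) mAy]
      by (auto intro!: integrable_real_indicator simp: fmeasurable_def)
    have "(LINT x|lborel. \<bar>indicator A (x - y) - indicator A x :: real\<bar>) = (LINT x|lborel. indicator (Ay - A) x + indicator (A - Ay) x)"
      by (intro Bochner_Integration.integral_cong) (auto simp: indicator_def Ay_def)
    also have "\<dots> = measure lborel (Ay - A) + measure lborel (A - Ay)"
      using int by simp
    finally show "(LINT x|lborel. \<bar>indicator A (x - y) - indicator A x :: real\<bar>) < e" using 1 2 by linarith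
  qed
qed

lemma L1_translation_continuous:
  fixes f :: "'a::euclidean_space \<Rightarrow> real"
  assumes "integrable lborel f" and "0 < e"
  shows "\<exists>d>0. \<forall>y. norm y < d \<longrightarrow> (LINT x|lborel. \<bar>f (x - y) - f x\<bar>) < e"
  using assms
proof (induction f arbitrary: e rule: integrable_induct)
  case (base A c)
  have "e / (\<bar>c\<bar> + 1) > 0" using base by simp
  then obtain d where d: "d > 0" "\<And>y. norm y < d \<Longrightarrow> (LINT x|lborel. \<bar>indicator A (x - y) - indicator A x :: real\<bar>) < e/(\<bar>c\<bar>+1)"
    using L1_translation_continuous_indicator[of A "e / (\<bar>c\<bar>+1)"] base by auto
  show ?case
  proof (intro exI[of _ d] conjI allI impI d(1))
    fix y :: 'a assume "norm y < d"
    have "(LINT x|lborel. \<bar>indicator A (x - y) *\<^sub>R c - indicator A x *\<^sub>R c\<bar>)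
        = (LINT x|lborel. \<bar>indicator A (x - y) - indicator A x\<bar> * \<bar>c\<bar>)"
      by (intro Bochner_Integration.integral_cong) (auto simp: indicator_def)
    also have "\<dots> = (LINT x|lborel. \<bar>indicator A (x - y) - indicator A x\<bar>) * \<bar>c\<bar>" by simp
    also have "\<dots> \<le> e/(\<bar>c\<bar>+1) * \<bar>c\<bar>" using d(2)[OF \<open>norm y < d\<close>] by (intro mult_right_mono) auto
    also have "\<dots> < e" using base by (simp add: field_simps)
    finally show "(LINT x|lborel. \<bar>indicator A (x - y) *\<^sub>R c - indicator A x *\<^sub>R c\<bar>) < e" .
  qed
next
  case (add f g)
  obtain d1 where d1: "d1 > 0" "\<And>y. norm y < d1 \<Longrightarrow> (LINT x|lborel. \<bar>f (x - y) - f x\<bar>) < e/2"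
    using add.IH(1)[of "e/2"] add.prems by auto
  obtain d2 where d2: "d2 > 0" "\<And>y. norm y < d2 \<Longrightarrow> (LINT x|lborel. \<bar>g (x - y) - g x\<bar>) < e/2"
    using add.IH(2)[of "e/2"] add.prems by auto
  show ?case
  proof (intro exI[of _ "min d1 d2"] conjI allI impI)
    show "min d1 d2 > 0" using d1 d2 by simp
    fix y :: 'a assume y: "norm y < min d1 d2"
    have "(LINT x|lborel. \<bar>f (x - y) + g (x - y) - (f x + g x)\<bar>) \<le> (LINT x|lborel. \<bar>f (x - y) - f x\<bar> + \<bar>g (x - y) - g x\<bar>)"
      using add.hyps by (intro integral_mono Bochner_Integration.integrable_add integrable_abs Bochner_Integration.integrable_diff integrable_lborel_translate) auto
    also have "\<dots> = (LINT x|lborel. \<bar>f (x - y) - f x\<bar>) + (LINT x|lborel. \<bar>g (x - y) - g x\<bar>)"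
      using add.hyps by (intro Bochner_Integration.integral_add integrable_abs Bochner_Integration.integrable_diff integrable_lborel_translate)
    also have "\<dots> < e" using d1(2)[of y] d2(2)[of y] y by simp
    finally show "(LINT x|lborel. \<bar>f (x - y) + g (x - y) - (f x + g x)\<bar>) < e" .
  qed
next
  case (lim f s)
  have "(\<lambda>i. LINT x|lborel. \<bar>s i x - f x\<bar>) \<longlonglongrightarrow> (LINT x|(lborel::'a measure). 0)"
  proof (rule integral_dominated_convergence[where w="\<lambda>x. 3 * \<bar>f x\<bar>"])
    show "AE x in lborel. (\<lambda>i. \<bar>s i x - f x\<bar>) \<longlonglongrightarrow> 0"
      using lim.hyps(2) by (intro AE_I2) (auto intro!: tendsto_rabs_zero simp: LIM_zero)
    show "AE x in lborel. norm \<bar>s i x - f x\<bar> \<le> 3 * \<bar>f x\<bar>" for i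
    proof (rule AE_I2)
      fix x :: 'a
      have "\<bar>s i x\<bar> \<le> 2 * \<bar>f x\<bar>" using lim.hyps(3)[of x i] by simp
      then show "norm \<bar>s i x - f x\<bar> \<le> 3 * \<bar>f x\<bar>" by simp
    qed
  qed (use lim.hyps in auto)
  from LIMSEQ_D[OF this, of "e/3"] lim.prems obtain i where i: "(LINT x|lborel. \<bar>s i x - f x\<bar>) < e/3"
    by fastforce
  obtain d where d: "d > 0" "\<And>y. norm y < d \<Longrightarrow> (LINT x|lborel. \<bar>s i (x - y) - s i x\<bar>) < e/3"
    using lim.IH[of "e/3" i] lim.prems by auto
  show ?case
  proof (intro exI[of _ d] conjI allI impI d(1))
    fix y :: 'a assume y: "norm y < d"
    note I = integrable_abs Bochner_Integration.integrable_diff integrable_lborel_translate lim.hyps(1,4) Bochner_Integration.integrable_add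
    have tr: "(LINT x|lborel. \<bar>s i (x - y) - f (x - y)\<bar>) = (LINT x|lborel. \<bar>s i x - f x\<bar>)"
      using integral_lborel_translate(1)[of "\<lambda>x. \<bar>s i x - f x\<bar>" y] lim.hyps(1,4) by simp
    have "(LINT x|lborel. \<bar>f (x - y) - f x\<bar>) \<le> (LINT x|lborel. \<bar>s i (x - y) - f (x - y)\<bar> + \<bar>s i (x - y) - s i x\<bar> + \<bar>s i x - f x\<bar>)"
      by (intro integral_mono I) auto
    also have "\<dots> = (LINT x|lborel. \<bar>s i (x - y) - f (x - y)\<bar>) + (LINT x|lborel. \<bar>s i (x - y) - s i x\<bar>) + (LINT x|lborel. \<bar>s i x - f x\<bar>)"
      by (subst Bochner_Integration.integral_add | intro I refl)+
    also have "\<dots> < e" using i d(2)[OF y] tr by simp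
    finally show "(LINT x|lborel. \<bar>f (x - y) - f x\<bar>) < e" .
  qed
qed


section \<open>Stability of \<open>Ck\<close> under sums, products and affine maps\<close>

lemma Ck_const [simp]: "Ck k (\<lambda>x. c)"
  by (induction k arbitrary: c) (auto intro!: exI[of _ "\<lambda>x v. 0"] derivative_eq_intros)

lemma Ck_add: "Ck k f \<Longrightarrow> Ck k g \<Longrightarrow> Ck k (\<lambda>x. f x + g x)"
proof (induction k arbitrary: f g)
  case (Suc k)
  then obtain f' g' where "\<And>x. (f has_derivative f' x) (at x)" "\<And>v. Ck k (\<lambda>x. f' x v)"
    "\<And>x. (g has_derivative g' x) (at x)" "\<And>v. Ck k (\<lambda>x. g' x v)" by auto
  then show ?case using Suc.IH
    by (auto intro!: exI[of _ "\<lambda>x v. f' x v + g' x v"] derivative_eq_intros)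
qed (auto intro: continuous_intros)

lemma Ck_SucD: "Ck (Suc k) f \<Longrightarrow> Ck k f"
proof (induction k arbitrary: f)
  case 0
  then show ?case
    by (auto simp: continuous_on_eq_continuous_at intro: has_derivative_continuous)
next
  case (Suc k)
  then show ?case by (metis Ck.simps(2))
qed

lemma Ck_mult:
  fixes f g :: "'a::real_normed_vector \<Rightarrow> real"
  shows "Ck k f \<Longrightarrow> Ck k g \<Longrightarrow> Ck k (\<lambda>x. f x * g x)"
proof (induction k arbitrary: f g)
  case (Suc k)
  then obtain f' g' where d: "\<And>x. (f has_derivative f' x) (at x)" "\<And>v. Ck k (\<lambda>x. f' x v)"
    "\<And>x. (g has_derivative g' x) (at x)" "\<And>v. Ck k (\<lambda>x. g' x v)" by auto
  have "Ck k (\<lambda>x. f x * g' x v + f' x v * g x)" for v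
    using Suc d Ck_SucD by (intro Ck_add Suc.IH) blast+
  then show ?case using d
    by (auto intro!: exI[of _ "\<lambda>x v. f x * g' x v + f' x v * g x"] derivative_eq_intros)
qed (auto intro: continuous_intros)

lemma Ck_inner_left: "Ck k (\<lambda>x. x \<bullet> v)"
proof (cases k)
  case (Suc n)
  have "((\<lambda>x. x \<bullet> v) has_derivative (\<lambda>w. w \<bullet> v)) (at x)" for x
    by (auto intro!: derivative_eq_intros)
  then show ?thesis using Suc by (auto intro!: exI[of _ "\<lambda>x w. w \<bullet> v"])
qed (auto intro: continuous_intros)

lemma Ck_compose_affine:
  fixes f :: "'a::real_normed_vector \<Rightarrow> 'b::real_normed_vector"
  assumes "Ck k f"
  shows "Ck k (\<lambda>x. f (t + c *\<^sub>R x))"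
  using assms
proof (induction k arbitrary: f)
  case 0
  then show ?case by (auto intro!: continuous_intros continuous_on_compose2[of UNIV f])
next
  case (Suc k)
  then obtain f' where d: "\<And>x. (f has_derivative f' x) (at x)" "\<And>v. Ck k (\<lambda>x. f' x v)" by auto
  have "((\<lambda>x. f (t + c *\<^sub>R x)) has_derivative (\<lambda>v. f' (t + c *\<^sub>R x) (c *\<^sub>R v))) (at x)" for x
    by (rule has_derivative_compose[OF _ d(1)]) (auto intro!: derivative_eq_intros)
  moreover have "Ck k (\<lambda>x. f' (t + c *\<^sub>R x) (c *\<^sub>R v))" for v
    using Suc.IH[OF d(2)] .
  ultimately show ?case by (auto intro!: exI[of _ "\<lambda>x v. f' (t + c *\<^sub>R x) (c *\<^sub>R v)"])
qed

section \<open>A smooth function that is flat at the origin\<close>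

text \<open>The powers of \<open>t\<close> in the denominator make the family closed under
  differentiation: the derivative of a member is a combination of the next two, so smoothness
  follows by an induction that keeps \<open>n\<close> general.\<close>

definition flat_exp :: "nat \<Rightarrow> real \<Rightarrow> real" where
  "flat_exp n t = (if t > 0 then exp (- 1 / t) / t ^ n else 0)"

lemma flat_exp_at_right_0: "(flat_exp n \<longlongrightarrow> 0) (at_right 0)"
proof -
  have "((\<lambda>t. (inverse t) ^ n / exp (inverse t)) \<longlongrightarrow> (0::real)) (at_right 0)"
    using filterlim_compose[OF tendsto_power_div_exp_0[of n] filterlim_inverse_at_top_right] .
  moreover have "\<forall>\<^sub>F t in at_right (0::real). (inverse t) ^ n / exp (inverse t) = flat_exp n t"
    unfolding eventually_at_right_field
    by (intro exI[of _ 1]) (auto simp: flat_exp_def exp_minus field_simps power_divide inverse_eq_divide)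
  ultimately show ?thesis by (rule Lim_transform_eventually)
qed

lemma flat_exp_deriv:
  "(flat_exp n has_real_derivative (flat_exp (n+2) t - real n * flat_exp (n+1) t)) (at t)"
proof -
  consider "t > 0" | "t < 0" | "t = 0" by linarith
  then show ?thesis
  proof cases
    case 1
    have "((\<lambda>t. exp (- 1 / t) / t ^ n) has_real_derivative (flat_exp (n+2) t - real n * flat_exp (n+1) t)) (at t)"
      using 1 
      by (auto intro!: derivative_eq_intros simp: flat_exp_def field_simps power2_eq_square)
         (cases n; simp add: field_simps)
    moreover have "\<forall>\<^sub>F x in nhds t. flat_exp n x = exp (- 1 / x) / x ^ n"
      using eventually_nhds_in_open[of "{0<..}" t] 1 by (auto elim!: eventually_mono simp: flat_exp_def)
    ultimately show ?thesis by (subst DERIV_cong_ev[OF refl _ refl]) 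
  next
    case 2
    have "\<forall>\<^sub>F x in nhds t. flat_exp n x = 0"
      using eventually_nhds_in_open[of "{..<0}" t] 2 by (auto elim!: eventually_mono simp: flat_exp_def)
    then show ?thesis using 2 by (subst DERIV_cong_ev[OF refl _ refl]) (auto simp: flat_exp_def)
  next
    case 3
    \<comment> \<open>The right difference quotient at 0 is the next member of the family, which
      tends to 0.\<close>
    have "((\<lambda>h. (flat_exp n (0 + h) - flat_exp n 0) / h) \<longlongrightarrow> 0) (at_right 0)"
    proof (rule Lim_transform_eventually[OF flat_exp_at_right_0[of "Suc n"]])
      show "\<forall>\<^sub>F h in at_right 0. flat_exp (Suc n) h = (flat_exp n (0 + h) - flat_exp n 0) / h"
        unfolding eventually_at_right_field
        by (intro exI[of _ 1]) (auto simp: flat_exp_def)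
    qed
    moreover have "((\<lambda>h. (flat_exp n (0 + h) - flat_exp n 0) / h) \<longlongrightarrow> 0) (at_left 0)"
    proof (rule Lim_transform_eventually[OF tendsto_const])
      show "\<forall>\<^sub>F h in at_left 0. 0 = (flat_exp n (0 + h) - flat_exp n 0) / h"
        unfolding eventually_at_left_field
        by (intro exI[of _ "-1"]) (auto simp: flat_exp_def)
    qed
    ultimately have "((\<lambda>h. (flat_exp n (0 + h) - flat_exp n 0) / h) \<longlongrightarrow> 0) (at 0)"
      by (simp add: filterlim_split_at)
    then have "(flat_exp n has_real_derivative 0) (at 0)" by (simp add: DERIV_def)
    then show ?thesis using 3 by (simp add: flat_exp_def)
  qed
qed

lemma Ck_flat_exp_compose:
  fixes g :: "'a::real_normed_vector \<Rightarrow> real"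
  assumes "\<And>k. Ck k g"
  shows "Ck k (\<lambda>x. flat_exp n (g x))"
proof (induction k arbitrary: n)
  case 0
  have "continuous_on UNIV (flat_exp n)"
    by (rule continuous_at_imp_continuous_on) (intro ballI DERIV_isCont[OF flat_exp_deriv])
  then show ?case using assms[of 0] by (auto intro: continuous_on_compose2)
next
  case (Suc k)
  obtain g' where g': "\<And>x. (g has_derivative g' x) (at x)" "\<And>v. Ck k (\<lambda>x. g' x v)"
    using assms[of "Suc k"] by auto
  have "((\<lambda>x. flat_exp n (g x)) has_derivative (\<lambda>v. (flat_exp (n+2) (g x) + - real n * flat_exp (n+1) (g x)) * g' x v)) (at x)" for x
    using has_derivative_compose[OF g'(1)[of x] flat_exp_deriv[of n "g x", unfolded has_field_derivative_def]]
    by simp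
  moreover have "Ck k (\<lambda>x. (flat_exp (n+2) (g x) + - real n * flat_exp (n+1) (g x)) * g' x v)" for v
    by (intro Ck_mult Ck_add Suc.IH Ck_const g'(2))
  ultimately show ?case
    unfolding Ck.simps
    by (intro exI[of _ "\<lambda>x v. (flat_exp (n+2) (g x) + - real n * flat_exp (n+1) (g x)) * g' x v"]) blast
qed

lemma Ck_inner_self: "Ck k (\<lambda>x::'a::euclidean_space. x \<bullet> x)"
proof -
  have "Ck k (\<lambda>x::'a. \<Sum>b\<in>B. (x \<bullet> b) * (x \<bullet> b))" if "finite B" for B
    using that by (induction B) (auto intro!: Ck_add Ck_mult Ck_inner_left)
  from this[OF finite_Basis] show ?thesis
    by (subst euclidean_inner) 
qed

subsection \<open>Test functions\<close>

lemma smooth_has_derivative: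
  assumes "\<And>k. Ck k f"
  shows "(f has_derivative frechet_derivative f (at x)) (at x)"
  using assms[of "Suc 0"] by (auto simp: frechet_derivative_works[symmetric] differentiable_def)

lemma smooth_frechet_derivative:
  assumes "\<And>k. Ck k f"
  shows "Ck k (\<lambda>x. frechet_derivative f (at x) v)"
proof -
  obtain f' where f': "\<And>x. (f has_derivative f' x) (at x)" "\<And>v. Ck k (\<lambda>x. f' x v)"
    using assms[of "Suc k"] by auto
  have "f' x = frechet_derivative f (at x)" for x
    using frechet_derivative_at[OF f'(1)] .
  then show ?thesis using f'(2)[of v] by simp
qed

lemma test_functionD:
  assumes "test_function \<Omega> \<phi>"
  shows "Ck k \<phi>" "compact (closure {x. \<phi> x \<noteq> 0})" "closure {x. \<phi> x \<noteq> 0} \<subseteq> \<Omega>"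
    "\<phi> x \<noteq> 0 \<Longrightarrow> x \<in> \<Omega>" "(\<phi> has_derivative frechet_derivative \<phi> (at x)) (at x)"
    "continuous_on UNIV \<phi>" "bounded {x. \<phi> x \<noteq> 0}"
  using assms closure_subset[of "{x. \<phi> x \<noteq> 0}"]
  by (auto simp: test_function_def intro!: smooth_has_derivative dest: spec[where x=0])
     (meson bounded_subset closure_subset compact_imp_bounded)

lemma test_functionI:
  assumes "\<And>k. Ck k \<phi>" "compact K" "K \<subseteq> \<Omega>" "\<And>x. \<phi> x \<noteq> 0 \<Longrightarrow> x \<in> K"
  shows "test_function \<Omega> \<phi>"
proof -
  have "closure {x. \<phi> x \<noteq> 0} \<subseteq> K"
    using assms by (intro closure_minimal) (auto simp: compact_imp_closed)
  moreover from this have "compact (closure {x. \<phi> x \<noteq> 0})"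
    using compact_Int_closed[OF assms(2) closed_closure[of "{x. \<phi> x \<noteq> 0}"]] by (simp add: Int_absorb1)
  ultimately show ?thesis using assms(1,3) by (auto simp: test_function_def)
qed

lemma test_function_frechet_derivative:
  assumes "test_function \<Omega> \<phi>"
  shows "test_function \<Omega> (\<lambda>x. frechet_derivative \<phi> (at x) v)"
proof (rule test_functionI)
  show "Ck k (\<lambda>x. frechet_derivative \<phi> (at x) v)" for k
    by (rule smooth_frechet_derivative) (rule test_functionD[OF assms])
  show "compact (closure {x. \<phi> x \<noteq> 0})" "closure {x. \<phi> x \<noteq> 0} \<subseteq> \<Omega>"
    by (rule test_functionD[OF assms])+
  fix x assume nz: "frechet_derivative \<phi> (at x) v \<noteq> 0"
  show "x \<in> closure {x. \<phi> x \<noteq> 0}"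
  proof (rule ccontr)
    assume x: "x \<notin> closure {x. \<phi> x \<noteq> 0}"
    have "((\<lambda>x. 0) has_derivative (\<lambda>v. 0)) (at x)" by simp
    then have "(\<phi> has_derivative (\<lambda>v. 0)) (at x)"
      by (rule has_derivative_transform_within_open[where s="- closure {x. \<phi> x \<noteq> 0}"])
         (use x closure_subset[of "{x. \<phi> x \<noteq> 0}"] in auto)
    from frechet_derivative_at[OF this] nz show False by metis
  qed
qed

lemma test_function_mono: "test_function \<Omega> \<phi> \<Longrightarrow> \<Omega> \<subseteq> \<Omega>' \<Longrightarrow> test_function \<Omega>' \<phi>"
  unfolding test_function_def by blast

lemma test_function_mult:
  fixes \<phi> \<psi> :: "'a::real_normed_vector \<Rightarrow> real"
  assumes "test_function \<Omega> \<phi>" "\<And>k. Ck k \<psi>"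
  shows "test_function \<Omega> (\<lambda>x. \<phi> x * \<psi> x)"
  by (rule test_functionI[OF _ test_functionD(2,3)[OF assms(1)]])
     (use assms test_functionD(1)[OF assms(1)] closure_subset[of "{x. \<phi> x \<noteq> 0}"] in \<open>auto intro!: Ck_mult\<close>)

lemma test_function_bounded:
  fixes \<phi> :: "'a::euclidean_space \<Rightarrow> real"
  assumes "test_function \<Omega> \<phi>"
  obtains B where "B > 0" "\<And>x. \<bar>\<phi> x\<bar> \<le> B"
proof -
  let ?K = "closure {x. \<phi> x \<noteq> 0}"
  have "compact (\<phi> ` ?K)"
    using test_functionD[OF assms] by (intro compact_continuous_image) (auto intro: continuous_on_subset)
  then obtain B where B: "B > 0" "\<And>x. x \<in> ?K \<Longrightarrow> \<bar>\<phi> x\<bar> \<le> B"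
    using compact_imp_bounded bounded_pos by (metis imageI real_norm_def)
  have "\<bar>\<phi> x\<bar> \<le> B" for x
    using B closure_subset[of "{x. \<phi> x \<noteq> 0}"] by (cases "\<phi> x = 0") auto
  with B that show ?thesis by blast
qed

lemma test_function_borel [intro]:
  fixes \<phi> :: "'a::euclidean_space \<Rightarrow> real"
  assumes "test_function \<Omega> \<phi>" shows "\<phi> \<in> borel_measurable borel"
  using test_functionD(6)[OF assms] by (rule borel_measurable_continuous_onI)

lemma test_function_integrable:
  fixes \<phi> :: "'a::euclidean_space \<Rightarrow> real"
  assumes "test_function \<Omega> \<phi>"
  shows "integrable lborel \<phi>"
proof -
  let ?K = "closure {x. \<phi> x \<noteq> 0}"
  have "integrable lborel (\<lambda>x. indicator ?K x *\<^sub>R \<phi> x)"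
    using test_functionD[OF assms] by (intro borel_integrable_compact) (auto intro: continuous_on_subset)
  moreover have "(\<lambda>x. indicator ?K x *\<^sub>R \<phi> x) = \<phi>"
    using closure_subset[of "{x. \<phi> x \<noteq> 0}"] by (intro ext) (auto simp: indicator_def)
  ultimately show ?thesis by (simp only:)
qed

lemma test_function_uniformly_continuous:
  fixes \<phi> :: "'a::euclidean_space \<Rightarrow> real"
  assumes "test_function \<Omega> \<phi>" "e > 0"
  shows "\<exists>d>0. \<forall>x y. dist x y < d \<longrightarrow> \<bar>\<phi> x - \<phi> y\<bar> < e"
proof -
  obtain R where R: "\<And>x. \<phi> x \<noteq> 0 \<Longrightarrow> norm x \<le> R"
    using test_functionD(7)[OF assms(1)] by (auto simp: bounded_iff)
  \<comment> \<open>The extra radius 1 keeps both points in the compact ball as soon as one of them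
    has a nonzero value and they are less than 1 apart.\<close>
  have "uniformly_continuous_on (cball 0 (R+1)) \<phi>"
    using test_functionD(6)[OF assms(1)] by (intro compact_uniformly_continuous) (auto intro: continuous_on_subset)
  then obtain d where d: "d > 0" "\<And>x y. x \<in> cball 0 (R+1) \<Longrightarrow> y \<in> cball 0 (R+1) \<Longrightarrow> dist y x < d \<Longrightarrow> dist (\<phi> y) (\<phi> x) < e"
    using assms(2) unfolding uniformly_continuous_on_def by meson
  show ?thesis
  proof (intro exI[of _ "min d 1"] conjI allI impI)
    fix x y :: 'a assume xy: "dist x y < min d 1"
    show "\<bar>\<phi> x - \<phi> y\<bar> < e"
    proof (cases "\<phi> x = 0 \<and> \<phi> y = 0")
      case False
      then have "norm x \<le> R \<or> norm y \<le> R" using R by blast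
      moreover have "norm x \<le> norm y + dist x y" "norm y \<le> norm x + dist x y"
        by (auto simp: dist_norm norm_minus_commute) (metis norm_triangle_sub add.commute norm_minus_commute)+
      ultimately have "norm x \<le> R + 1" "norm y \<le> R + 1" using xy by auto
      then show ?thesis using d(2)[of y x] xy by (auto simp: dist_real_def)
    qed (use assms in auto)
  qed (use d in auto)
qed

lemma test_function_affine:
  fixes \<phi> :: "'a::euclidean_space \<Rightarrow> real"
  assumes "test_function UNIV \<phi>" "c \<noteq> 0"
  shows "test_function UNIV (\<lambda>x. \<phi> (t + c *\<^sub>R x))"
proof -
  obtain R where R: "\<And>x. \<phi> x \<noteq> 0 \<Longrightarrow> norm x \<le> R"
    using test_functionD(7)[OF assms(1)] by (auto simp: bounded_iff)
  show ?thesis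
  proof (rule test_functionI[where K="cball 0 ((R + norm t)/\<bar>c\<bar>)"])
    show "Ck k (\<lambda>x. \<phi> (t + c *\<^sub>R x))" for k
      using Ck_compose_affine test_functionD(1)[OF assms(1)] by blast
    fix x assume "\<phi> (t + c *\<^sub>R x) \<noteq> 0"
    then have "norm (t + c *\<^sub>R x) \<le> R" using R by blast
    moreover have "norm (c *\<^sub>R x) \<le> norm (t + c *\<^sub>R x) + norm t"
      using norm_triangle_ineq4[of "t + c *\<^sub>R x" t] by simp
    ultimately have "\<bar>c\<bar> * norm x \<le> R + norm t" by simp
    then show "x \<in> cball 0 ((R + norm t)/\<bar>c\<bar>)" using assms(2) by (simp add: field_simps)
  qed auto
qed

lemma linear_frechet_test:
  assumes "test_function \<Omega> \<phi>"
  shows "bounded_linear (frechet_derivative \<phi> (at x))"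
  using test_functionD(5)[OF assms] by (rule has_derivative_bounded_linear)

lemma test_function_deriv_bound:
  fixes \<phi> :: "'a::euclidean_space \<Rightarrow> real"
  assumes "test_function \<Omega> \<phi>"
  obtains B where "B > 0" "\<And>x v. \<bar>frechet_derivative \<phi> (at x) v\<bar> \<le> B * norm v"
proof -
  have "\<exists>B>0. \<forall>x. \<bar>frechet_derivative \<phi> (at x) b\<bar> \<le> B" for b
    using test_function_bounded[OF test_function_frechet_derivative[OF assms]] by metis
  then obtain B where B: "\<And>b. B b > 0" "\<And>b x. \<bar>frechet_derivative \<phi> (at x) b\<bar> \<le> B b" by metis
  let ?B = "\<Sum>b\<in>Basis. B b"
  have "\<bar>frechet_derivative \<phi> (at x) v\<bar> \<le> ?B * norm v" for x v
  proof -
    interpret bounded_linear "frechet_derivative \<phi> (at x)" by (rule linear_frechet_test[OF assms])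
    have "frechet_derivative \<phi> (at x) v = frechet_derivative \<phi> (at x) (\<Sum>b\<in>Basis. (v \<bullet> b) *\<^sub>R b)"
      by (simp add: euclidean_representation)
    also have "\<bar>\<dots>\<bar> = \<bar>\<Sum>b\<in>Basis. (v \<bullet> b) * frechet_derivative \<phi> (at x) b\<bar>"
      by (simp add: sum scaleR)
    also have "\<dots> \<le> (\<Sum>b\<in>Basis. \<bar>(v \<bullet> b) * frechet_derivative \<phi> (at x) b\<bar>)" by (rule sum_abs)
    also have "\<dots> \<le> (\<Sum>b\<in>Basis. norm v * B b)"
      by (intro sum_mono) (auto simp: abs_mult intro!: mult_mono B Basis_le_norm)
    finally show ?thesis by (simp add: sum_distrib_left mult.commute)
  qed
  moreover have "?B > 0" using B by (intro sum_pos) auto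
  ultimately show ?thesis using that by blast
qed

text \<open>The derivative is uniformly continuous in operator norm, so the mean value inequality
  gives a Taylor remainder that is uniform in the base point. This uniformity allows differentiation
  under the integral sign, and it replaces the fundamental theorem of calculus in showing that
  derivatives of test functions integrate to zero.\<close>

lemma test_function_uniform_derivative:
  fixes \<phi> :: "'a::euclidean_space \<Rightarrow> real"
  assumes "test_function \<Omega> \<phi>" "e > 0"
  shows "\<exists>d>0. \<forall>x h. norm h < d \<longrightarrow> \<bar>\<phi> (x + h) - \<phi> x - frechet_derivative \<phi> (at x) h\<bar> \<le> e * norm h"
proof -
  let ?D = "\<lambda>x. frechet_derivative \<phi> (at x)"
  let ?e = "e / DIM('a)"
  have "\<exists>d>0. \<forall>x y. dist x y < d \<longrightarrow> \<bar>?D x b - ?D y b\<bar> < ?e" for b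
    using test_function_uniformly_continuous[OF test_function_frechet_derivative[OF assms(1)], of ?e] assms(2) by simp
  then obtain d where d: "\<And>b. d b > 0" "\<And>b x y. dist x y < d b \<Longrightarrow> \<bar>?D x b - ?D y b\<bar> < ?e" by metis
  define d0 where "d0 = Min (d ` Basis)"
  have d0: "d0 > 0" using d by (simp add: d0_def)
  have d0': "\<bar>?D x b - ?D y b\<bar> \<le> ?e" if "dist x y < d0" "b \<in> Basis" for x y b
    using d(2)[of x y b] that by (force simp: d0_def)
  have on: "onorm (\<lambda>v. ?D x v - ?D y v) \<le> e" if "dist x y < d0" for x y
  proof (rule onorm_le)
    fix v
    have L: "bounded_linear (\<lambda>v. ?D x v - ?D y v)"
      by (intro bounded_linear_sub linear_frechet_test[OF assms(1)])
    interpret bounded_linear "\<lambda>v. ?D x v - ?D y v" by (rule L)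
    have "?D x v - ?D y v = (\<Sum>b\<in>Basis. (v \<bullet> b) * (?D x b - ?D y b))"
      using sum[of "\<lambda>b. (v \<bullet> b) *\<^sub>R b" Basis] by (simp add: euclidean_representation scaleR)
    also have "\<bar>\<dots>\<bar> \<le> (\<Sum>b\<in>Basis. \<bar>(v \<bullet> b) * (?D x b - ?D y b)\<bar>)" by (rule sum_abs)
    also have "\<dots> \<le> (\<Sum>b\<in>(Basis::'a set). norm v * ?e)"
      unfolding abs_mult using d0'[OF that] by (intro sum_mono mult_mono) (auto intro: Basis_le_norm)
    also have "\<dots> = e * norm v" by simp
    finally show "norm (?D x v - ?D y v) \<le> e * norm v" by simp
  qed
  show ?thesis
  proof (intro exI[of _ d0] conjI allI impI d0)
    fix x h :: 'a assume h: "norm h < d0"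
    have "norm (\<phi> (x + h) - \<phi> x - ?D x (x + h - x)) \<le> norm (x + h - x) * e"
    proof (rule differentiable_bound_linearization[where S="ball x d0"])
      fix t :: real assume t: "t \<in> {0..1}"
      have "t * norm h \<le> 1 * norm h" using t by (intro mult_right_mono) auto
      then show "x + t *\<^sub>R (x + h - x) \<in> ball x d0" using t h by (simp add: dist_norm)
    next
      show "(\<phi> has_derivative ?D y) (at y within ball x d0)" for y
        by (rule has_derivative_at_withinI) (rule test_functionD[OF assms(1)])
      show "onorm (?D y - ?D x) \<le> e" if "y \<in> ball x d0" for y
        using on[of y x] that by (simp add: dist_commute fun_diff_def)
      show "x \<in> ball x d0" using d0 by simp
    qed
    then show "\<bar>\<phi> (x + h) - \<phi> x - ?D x h\<bar> \<le> e * norm h" by (simp add: mult.commute)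
  qed
qed


subsection \<open>Mollification\<close>

definition conv :: "('a::euclidean_space \<Rightarrow> real) \<Rightarrow> ('a \<Rightarrow> real) \<Rightarrow> 'a \<Rightarrow> real" where
  "conv \<eta> f x = (LINT y|lborel. \<eta> (x - y) * f y)"

lemma conv_integrable:
  fixes f :: "'a::euclidean_space \<Rightarrow> real"
  assumes "test_function UNIV \<eta>" "integrable lborel f"
  shows "integrable lborel (\<lambda>y. \<eta> (x - y) * f y)"
proof -
  obtain B where B: "B > 0" "\<And>x. \<bar>\<eta> x\<bar> \<le> B" using test_function_bounded[OF assms(1)] by blast
  have [measurable]: "\<eta> \<in> borel_measurable borel" using test_function_borel[OF assms(1)] .
  have [measurable]: "f \<in> borel_measurable borel" using assms(2) by auto
  show ?thesis
  proof (rule Bochner_Integration.integrable_bound[where f="\<lambda>y. B * f y"])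
    show "AE y in lborel. norm (\<eta> (x - y) * f y) \<le> norm (B * f y)"
      using B by (intro AE_I2) (auto simp: abs_mult intro!: mult_right_mono)
  qed (use assms in auto)
qed

lemma conv_commute:
  assumes "test_function UNIV \<eta>" "integrable lborel f"
  shows "conv \<eta> f x = (LINT y|lborel. \<eta> y * f (x - y))"
    and "integrable lborel (\<lambda>y. \<eta> y * f (x - y))"
  using integral_lborel_translate(2)[OF conv_integrable[OF assms, of x], of x]
    integrable_lborel_translate(2)[OF conv_integrable[OF assms, of x], of x]
  by (auto simp: conv_def)

text \<open>Every derivative falls on the kernel. The uniform Taylor remainder of
  \<open>\<eta>\<close>, integrated against the absolute value of \<open>f\<close>, is at most
  \<open>e * norm (y - x)\<close> for \<open>y\<close> close to \<open>x\<close>.\<close>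

lemma conv_has_derivative:
  assumes \<eta>: "test_function UNIV \<eta>" and f: "integrable lborel f"
  shows "(conv \<eta> f has_derivative (\<lambda>v. conv (\<lambda>z. frechet_derivative \<eta> (at z) v) f x)) (at x)"
proof -
  let ?D = "\<lambda>z v. frechet_derivative \<eta> (at z) v"
  let ?C = "\<lambda>v. conv (\<lambda>z. ?D z v) f x"
  have T: "test_function UNIV (\<lambda>z. ?D z v)" for v by (rule test_function_frechet_derivative[OF \<eta>])
  note I = conv_integrable[OF T f] conv_integrable[OF \<eta> f]
  obtain B where B: "B > 0" "\<And>x v. \<bar>?D x v\<bar> \<le> B * norm v"
    using test_function_deriv_bound[OF \<eta>] by blast
  have lin: "linear (?D z)" for z using linear_frechet_test[OF \<eta>] by (rule bounded_linear.linear)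
  define F where "F = (LINT y|lborel. \<bar>f y\<bar>)"
  have F0: "F \<ge> 0" by (simp add: F_def)
  have "bounded_linear ?C"
  proof (rule bounded_linear_intro[where K="B * F"])
    show "?C (v + w) = ?C v + ?C w" for v w
      unfolding conv_def using I by (simp add: linear_add[OF lin] distrib_right)
    show "?C (r *\<^sub>R v) = r *\<^sub>R ?C v" for r v
      unfolding conv_def using I by (simp add: linear_cmul[OF lin] mult.assoc)
    show "norm (?C v) \<le> norm v * (B * F)" for v
    proof -
      have "norm (?C v) \<le> (LINT y|lborel. norm (?D (x - y) v * f y))"
        unfolding conv_def by (rule integral_norm_bound)
      also have "\<dots> \<le> (LINT y|lborel. (B * norm v) * \<bar>f y\<bar>)"
        using f B(2) by (intro integral_mono integrable_norm I integrable_mult_right integrable_abs)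
          (auto simp: abs_mult intro!: mult_right_mono)
      finally show ?thesis by (simp add: F_def mult_ac)
    qed
  qed
  moreover have "\<exists>d>0. \<forall>y. norm (y - x) < d \<longrightarrow> norm (conv \<eta> f y - conv \<eta> f x - ?C (y - x)) \<le> e * norm (y - x)" if e: "e > 0" for e
  proof -
    \<comment> \<open>Dividing by \<open>F + 1\<close> instead of \<open>F\<close> covers the case
      that \<open>f\<close> vanishes almost everywhere.\<close>
    have "e / (F + 1) > 0" using e F0 by simp
    then obtain d where d: "d > 0" "\<And>x h. norm h < d \<Longrightarrow> \<bar>\<eta> (x + h) - \<eta> x - ?D x h\<bar> \<le> e / (F + 1) * norm h"
      using test_function_uniform_derivative[OF \<eta>] by blast
    show ?thesis
    proof (intro exI[of _ d] conjI allI impI d(1))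
      fix y assume y: "norm (y - x) < d"
      have "conv \<eta> f y - conv \<eta> f x - ?C (y - x) = (LINT z|lborel. (\<eta> (y - z) - \<eta> (x - z) - ?D (x - z) (y - x)) * f z)"
        unfolding conv_def using I by (simp add: left_diff_distrib)
      then have "norm (conv \<eta> f y - conv \<eta> f x - ?C (y - x)) \<le> (LINT z|lborel. norm ((\<eta> (y - z) - \<eta> (x - z) - ?D (x - z) (y - x)) * f z))"
        by (simp only: integral_norm_bound)
      also have "\<dots> \<le> (LINT z|lborel. (e / (F + 1) * norm (y - x)) * \<bar>f z\<bar>)"
      proof (rule integral_mono)
        show "integrable lborel (\<lambda>z. norm ((\<eta> (y - z) - \<eta> (x - z) - ?D (x - z) (y - x)) * f z))"
          using Bochner_Integration.integrable_diff[OF Bochner_Integration.integrable_diff[OF conv_integrable[OF \<eta> f, of y] conv_integrable[OF \<eta> f, of x]] conv_integrable[OF T f, of x "y - x"]]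
          by (simp add: left_diff_distrib)
        fix z
        show "norm ((\<eta> (y - z) - \<eta> (x - z) - ?D (x - z) (y - x)) * f z) \<le> (e / (F + 1) * norm (y - x)) * \<bar>f z\<bar>"
          using mult_right_mono[OF d(2)[OF y, of "x - z"], of "\<bar>f z\<bar>"] by (simp add: abs_mult add_diff_eq diff_add_eq)
      qed (use f in auto)
      also have "\<dots> = e * norm (y - x) * (F / (F + 1))" by (simp add: F_def)
      also have "\<dots> \<le> e * norm (y - x) * 1"
        using e F0 by (intro mult_left_mono) auto
      finally show "norm (conv \<eta> f y - conv \<eta> f x - ?C (y - x)) \<le> e * norm (y - x)" by simp
    qed
  qed
  ultimately show ?thesis unfolding has_derivative_at_alt by blast
qed

lemma conv_frechet_derivative:
  assumes "test_function UNIV \<eta>" "integrable lborel f"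
  shows "frechet_derivative (conv \<eta> f) (at x) v = conv (\<lambda>z. frechet_derivative \<eta> (at z) v) f x"
  using frechet_derivative_at[OF conv_has_derivative[OF assms]] by metis

lemma Ck_conv:
  assumes "integrable lborel f"
  shows "test_function UNIV \<eta> \<Longrightarrow> Ck k (conv \<eta> f)"
proof (induction k arbitrary: \<eta>)
  case 0
  then show ?case using conv_has_derivative[OF _ assms]
    by (auto simp: continuous_on_eq_continuous_at intro: has_derivative_continuous)
next
  case (Suc k)
  show ?case unfolding Ck.simps
    using conv_has_derivative[OF Suc.prems assms] Suc.IH[OF test_function_frechet_derivative[OF Suc.prems]]
    by (intro exI[of _ "\<lambda>x v. conv (\<lambda>z. frechet_derivative \<eta> (at z) v) f x"]) blast
qed

lemma conv_support:
  assumes "\<And>x. \<eta> x \<noteq> 0 \<Longrightarrow> norm x < \<delta>" "\<And>x. f x \<noteq> 0 \<Longrightarrow> x \<in> K" "conv \<eta> f x \<noteq> 0"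
  shows "\<exists>y\<in>K. dist x y < \<delta>"
proof (rule ccontr)
  assume *: "\<not> ?thesis"
  have "(\<lambda>y. \<eta> (x - y) * f y) = (\<lambda>y. 0)"
    using assms(1)[of "x - _"] assms(2) * by (intro ext) (auto simp: dist_norm)
  then have "conv \<eta> f x = 0" unfolding conv_def by (simp only: Bochner_Integration.integral_zero)
  with assms(3) show False by simp
qed

lemma conv_test_function:
  assumes \<eta>: "test_function UNIV \<eta>" "\<And>x. \<eta> x \<noteq> 0 \<Longrightarrow> norm x < \<delta>" and f: "integrable lborel f"
    and K: "\<And>x. f x \<noteq> 0 \<Longrightarrow> x \<in> K" "compact K" "\<And>x y. y \<in> K \<Longrightarrow> dist x y \<le> \<delta> \<Longrightarrow> x \<in> \<Omega>"
  shows "test_function \<Omega> (conv \<eta> f)"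
proof (rule test_functionI[where K="{x + y |x y. x \<in> K \<and> y \<in> cball 0 \<delta>}"])
  show "Ck k (conv \<eta> f)" for k by (rule Ck_conv[OF f \<eta>(1)])
  show "compact {x + y |x y. x \<in> K \<and> y \<in> cball 0 \<delta>}"
    by (rule compact_sums[OF K(2) compact_cball])
  show "{x + y |x y. x \<in> K \<and> y \<in> cball 0 \<delta>} \<subseteq> \<Omega>"
    using K(3) by (auto simp: dist_norm)
  fix x assume "conv \<eta> f x \<noteq> 0"
  then obtain y where y: "y \<in> K" "dist x y < \<delta>" using conv_support[where \<eta>=\<eta> and f=f] \<eta>(2) K(1) by metis
  then show "x \<in> {x + y |x y. x \<in> K \<and> y \<in> cball 0 \<delta>}"
    by (intro CollectI, rule_tac exI[of _ y], rule_tac exI[of _ "x - y"]) (use norm_minus_commute[of x y] in \<open>auto simp: dist_norm\<close>)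
qed

definition mollifier :: "real \<Rightarrow> ('a::euclidean_space \<Rightarrow> real) \<Rightarrow> bool" where
  "mollifier \<delta> \<eta> \<longleftrightarrow> test_function UNIV \<eta> \<and> (\<forall>x. 0 \<le> \<eta> x) \<and> (\<forall>x. \<eta> x \<noteq> 0 \<longrightarrow> norm x < \<delta>) \<and>
     (LINT x|lborel. \<eta> x) = 1"

lemma mollifierD:
  assumes "mollifier \<delta> \<eta>"
  shows "test_function UNIV \<eta>" "0 \<le> \<eta> x" "\<eta> x \<noteq> 0 \<Longrightarrow> norm x < \<delta>" "(LINT x|lborel. \<eta> x) = 1"
    "integrable lborel \<eta>" "\<eta> \<in> borel_measurable borel"
    "(\<integral>\<^sup>+x. ennreal (\<eta> x) \<partial>lborel) = 1"
proof -
  show *: "test_function UNIV \<eta>" "0 \<le> \<eta> x" "\<eta> x \<noteq> 0 \<Longrightarrow> norm x < \<delta>" "(LINT x|lborel. \<eta> x) = 1" for x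
    using assms by (auto simp: mollifier_def)
  show "integrable lborel \<eta>" using test_function_integrable[OF *(1)] .
  then show "(\<integral>\<^sup>+x. ennreal (\<eta> x) \<partial>lborel) = 1" using * by (simp add: nn_integral_eq_integral)
  show "\<eta> \<in> borel_measurable borel" using test_function_borel[OF *(1)] .
qed

text \<open>The constant is the same for all radii: rescaling a fixed bump by
  \<open>\<delta>\<close> multiplies the \<open>L^1\<close> norm of its derivatives by
  \<open>1 / \<delta>\<close>. This is compensated exactly when the derivative of the kernel is
  later paired with a Lipschitz function, whose oscillation on the support is of order
  \<open>\<delta>\<close>.\<close>

lemma ex_mollifier:
  "\<exists>C>0. \<forall>\<delta>>0. \<exists>\<eta> :: 'a::euclidean_space \<Rightarrow> real. mollifier \<delta> \<eta> \<and>
     (\<forall>b\<in>Basis. (LINT x|lborel. \<bar>frechet_derivative \<eta> (at x) b\<bar>) \<le> C / \<delta>)"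
proof -
  define \<eta> :: "'a \<Rightarrow> real" where "\<eta> x = flat_exp 0 (1 - x \<bullet> x)" for x
  have supp: "\<eta> x \<noteq> 0 \<longleftrightarrow> norm x < 1" for x
  proof -
    have "\<eta> x \<noteq> 0 \<longleftrightarrow> x \<bullet> x < 1" by (simp add: \<eta>_def flat_exp_def)
    also have "\<dots> \<longleftrightarrow> norm x < 1" by (simp add: norm_eq_sqrt_inner)
    finally show ?thesis .
  qed
  have pos: "\<eta> x \<ge> 0" for x by (simp add: \<eta>_def flat_exp_def)
  have "Ck k (\<lambda>x::'a. 1 + (-1) * (x \<bullet> x))" for k
    by (intro Ck_add Ck_mult Ck_const Ck_inner_self)
  then have "Ck k \<eta>" for k unfolding \<eta>_def[abs_def] by (intro Ck_flat_exp_compose) simp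
  then have T: "test_function UNIV \<eta>"
    by (rule test_functionI[where K="cball 0 1"]) (auto simp: supp less_imp_le)
  note I = test_function_integrable[OF T]
  define c where "c = (LINT x|lborel. \<eta> x)"
  \<comment> \<open>A vanishing integral of the nonnegative bump would make the open unit ball,
    where it is positive, a null set.\<close>
  have c: "c > 0"
  proof (rule ccontr)
    assume "\<not> c > 0"
    then have "c = 0" using pos by (simp add: c_def Bochner_Integration.integral_nonneg antisym not_less)
    then have "AE x in lborel. \<eta> x = 0"
      unfolding c_def using integral_nonneg_eq_0_iff_AE[OF I] pos by simp
    then have "AE x in lborel. x \<notin> ball (0::'a) 1" by (auto elim!: eventually_mono simp: supp[symmetric] simp flip: not_less)
    then have "emeasure lborel (ball (0::'a) 1) = 0"
      by (subst (asm) AE_iff_measurable[where N="ball (0::'a) 1"]) auto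
    then show False using emeasure_lborel_ball_finite emeasure_ball[of 1 "0::'a"] by (simp add: unit_ball_vol_pos less_imp_neq[THEN not_sym])
  qed
  have TD: "test_function UNIV (\<lambda>x. frechet_derivative \<eta> (at x) b)" for b
    by (rule test_function_frechet_derivative[OF T])
  define C where "C = (\<Sum>b\<in>Basis. LINT x|lborel. \<bar>frechet_derivative \<eta> (at x) b\<bar>) / c + 1"
  have C: "C > 0" using c unfolding C_def
    by (intro add_nonneg_pos divide_nonneg_pos sum_nonneg) auto
  show ?thesis
  proof (intro exI[of _ C] conjI C allI impI)
    fix \<delta> :: real assume d: "\<delta> > 0"
    define \<rho> where "\<rho> x = \<eta> ((1/\<delta>) *\<^sub>R x) * (1 / (c * \<delta> ^ DIM('a)))" for x
    have T0: "test_function UNIV (\<lambda>x. \<eta> (0 + (1/\<delta>) *\<^sub>R x))"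
      using d by (intro test_function_affine[OF T]) simp
    then have T\<rho>: "test_function UNIV \<rho>"
      unfolding \<rho>_def by (intro test_function_mult) auto
    have sc: "(LINT x|lborel. f ((1/\<delta>) *\<^sub>R x)) = \<delta> ^ DIM('a) * (LINT x|lborel. f x)" if "integrable lborel f" for f :: "'a \<Rightarrow> real"
      using integral_lborel_affine[OF that, of "1/\<delta>" 0] d by (simp add: field_simps power_divide)
    have "(LINT x|lborel. \<rho> x) = 1"
      unfolding \<rho>_def using sc[OF I] c d by (simp add: c_def[symmetric])
    moreover have "\<rho> x \<noteq> 0 \<Longrightarrow> norm x < \<delta>" for x
      using supp[of "(1/\<delta>) *\<^sub>R x"] d by (auto simp: \<rho>_def field_simps)
    moreover have "\<rho> x \<ge> 0" for x using pos c d by (simp add: \<rho>_def)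
    ultimately have "mollifier \<delta> \<rho>" using T\<rho> by (auto simp: mollifier_def)
    moreover have "(LINT x|lborel. \<bar>frechet_derivative \<rho> (at x) b\<bar>) \<le> C / \<delta>" if b: "b \<in> Basis" for b
    proof -
      have "(\<rho> has_derivative (\<lambda>v. frechet_derivative \<eta> (at ((1/\<delta>) *\<^sub>R x)) ((1/\<delta>) *\<^sub>R v) * (1 / (c * \<delta> ^ DIM('a))))) (at x)" for x
        unfolding \<rho>_def
        by (rule has_derivative_mult_left, rule has_derivative_compose[OF _ test_functionD(5)[OF T]])
           (auto intro!: derivative_eq_intros)
      from frechet_derivative_at[OF this]
      have "frechet_derivative \<rho> (at x) b = frechet_derivative \<eta> (at ((1/\<delta>) *\<^sub>R x)) ((1/\<delta>) *\<^sub>R b) * (1 / (c * \<delta> ^ DIM('a)))" for x by metis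
      then have "(LINT x|lborel. \<bar>frechet_derivative \<rho> (at x) b\<bar>) = (LINT x|lborel. (\<lambda>z. \<bar>frechet_derivative \<eta> (at z) b\<bar>) ((1/\<delta>) *\<^sub>R x) * (1 / (c * \<delta> * \<delta> ^ DIM('a))))"
        using d c by (intro Bochner_Integration.integral_cong) (auto simp: linear_cmul[OF bounded_linear.linear[OF linear_frechet_test[OF T]]] abs_mult)
      also have "\<dots> = (LINT x|lborel. (\<lambda>z. \<bar>frechet_derivative \<eta> (at z) b\<bar>) ((1/\<delta>) *\<^sub>R x)) * (1 / (c * \<delta> * \<delta> ^ DIM('a)))"
        by (rule integral_mult_left_zero)
      also have "\<dots> = \<delta> ^ DIM('a) * (LINT z|lborel. \<bar>frechet_derivative \<eta> (at z) b\<bar>) * (1 / (c * \<delta> * \<delta> ^ DIM('a)))"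
        using sc[of "\<lambda>z. \<bar>frechet_derivative \<eta> (at z) b\<bar>"] test_function_integrable[OF TD] by simp
      also have "\<dots> = (LINT z|lborel. \<bar>frechet_derivative \<eta> (at z) b\<bar>) / c / \<delta>"
        using d by simp
      also have "\<dots> \<le> (\<Sum>b\<in>Basis. LINT x|lborel. \<bar>frechet_derivative \<eta> (at x) b\<bar>) / c / \<delta>"
        using d c b by (intro divide_right_mono member_le_sum) auto
      also have "\<dots> \<le> C / \<delta>" unfolding C_def using d by (intro divide_right_mono) auto
      finally show ?thesis .
    qed
    ultimately show "\<exists>\<eta> :: 'a \<Rightarrow> real. mollifier \<delta> \<eta> \<and> (\<forall>b\<in>Basis. (LINT x|lborel. \<bar>frechet_derivative \<eta> (at x) b\<bar>) \<le> C / \<delta>)"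
      by (intro exI[of _ \<rho>] conjI ballI)
  qed
qed

text \<open>By Tonelli, a bound on each slice \<open>y\<close> in the support of \<open>k\<close>
  survives averaging with the total mass of the kernel. It serves both for a mollifier, of mass 1,
  and for the signed derivative of one.\<close>

lemma kernel_L1_bound:
  fixes k :: "'a::euclidean_space \<Rightarrow> real" and g :: "'a \<Rightarrow> 'a \<Rightarrow> ennreal"
  assumes k: "integrable lborel k" and [measurable]: "case_prod g \<in> borel_measurable (lborel \<Otimes>\<^sub>M lborel)"
    and S[measurable]: "S \<in> sets borel"
    and B: "\<And>y. k y \<noteq> 0 \<Longrightarrow> (\<integral>\<^sup>+x\<in>S. g x y \<partial>lborel) \<le> B"
  shows "(\<integral>\<^sup>+x\<in>S. (\<integral>\<^sup>+y. ennreal \<bar>k y\<bar> * g x y \<partial>lborel) \<partial>lborel) \<le> ennreal (LINT y|lborel. \<bar>k y\<bar>) * B"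
proof -
  have [measurable]: "k \<in> borel_measurable borel" using k by auto
  have "(\<integral>\<^sup>+x\<in>S. (\<integral>\<^sup>+y. ennreal \<bar>k y\<bar> * g x y \<partial>lborel) \<partial>lborel) = (\<integral>\<^sup>+x. (\<integral>\<^sup>+y. ennreal \<bar>k y\<bar> * (g x y * indicator S x) \<partial>lborel) \<partial>lborel)"
    by (intro nn_integral_cong) (simp add: nn_integral_multc[symmetric] mult.assoc)
  also have "\<dots> = (\<integral>\<^sup>+y. (\<integral>\<^sup>+x. ennreal \<bar>k y\<bar> * (g x y * indicator S x) \<partial>lborel) \<partial>lborel)"
    by (rule lborel_pair.Fubini'[symmetric]) simp
  also have "\<dots> = (\<integral>\<^sup>+y. ennreal \<bar>k y\<bar> * (\<integral>\<^sup>+x\<in>S. g x y \<partial>lborel) \<partial>lborel)"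
    by (intro nn_integral_cong nn_integral_cmult) simp
  also have "\<dots> \<le> (\<integral>\<^sup>+y. ennreal \<bar>k y\<bar> * B \<partial>lborel)"
  proof (intro nn_integral_mono)
    fix y show "ennreal \<bar>k y\<bar> * (\<integral>\<^sup>+x\<in>S. g x y \<partial>lborel) \<le> ennreal \<bar>k y\<bar> * B"
      using B[of y] by (cases "k y = 0") (auto intro!: mult_left_mono)
  qed
  also have "\<dots> = ennreal (LINT y|lborel. \<bar>k y\<bar>) * B"
    using k by (simp add: nn_integral_multc nn_integral_eq_integral)
  finally show ?thesis .
qed

text \<open>Since \<open>\<eta>\<close> has mass 1, the mollification error is an average of
  translation errors \<open>f (x - y) - f x\<close> over shifts shorter than
  \<open>\<delta>\<close>. Restricting to \<open>S\<close> matters where translations are controlled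
  only away from the boundary.\<close>

lemma conv_L1_diff:
  assumes \<eta>: "mollifier \<delta> \<eta>" and f: "integrable lborel f" and S[measurable]: "S \<in> sets borel"
    and B: "\<And>y. norm y < \<delta> \<Longrightarrow> (\<integral>\<^sup>+x\<in>S. ennreal \<bar>f (x - y) - f x\<bar> \<partial>lborel) \<le> B"
  shows "(\<integral>\<^sup>+x\<in>S. ennreal \<bar>conv \<eta> f x - f x\<bar> \<partial>lborel) \<le> B"
proof -
  note M = mollifierD[OF \<eta>]
  have [measurable]: "f \<in> borel_measurable borel" "\<eta> \<in> borel_measurable borel" using f M by auto
  have "ennreal \<bar>conv \<eta> f x - f x\<bar> \<le> (\<integral>\<^sup>+y. ennreal \<bar>\<eta> y\<bar> * ennreal \<bar>f (x - y) - f x\<bar> \<partial>lborel)" for x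
  proof -
    have i: "integrable lborel (\<lambda>y. \<eta> y * f (x - y))" "integrable lborel (\<lambda>y. \<eta> y * f x)"
      using conv_commute(2)[OF M(1) f] M(5) by auto
    have "conv \<eta> f x - f x = (LINT y|lborel. \<eta> y * (f (x - y) - f x))"
      using i M(4) conv_commute(1)[OF M(1) f] by (simp add: right_diff_distrib)
    also have "ennreal \<bar>\<dots>\<bar> \<le> (\<integral>\<^sup>+y. norm (\<eta> y * (f (x - y) - f x)) \<partial>lborel)"
      using i by (subst real_norm_def[symmetric], intro integral_norm_bound_ennreal) (simp add: right_diff_distrib)
    finally show ?thesis by (simp add: abs_mult ennreal_mult'')
  qed
  then have "(\<integral>\<^sup>+x\<in>S. ennreal \<bar>conv \<eta> f x - f x\<bar> \<partial>lborel) \<le>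
      (\<integral>\<^sup>+x\<in>S. (\<integral>\<^sup>+y. ennreal \<bar>\<eta> y\<bar> * ennreal \<bar>f (x - y) - f x\<bar> \<partial>lborel) \<partial>lborel)"
    by (intro nn_integral_mono mult_right_mono) auto
  also have "\<dots> \<le> ennreal (LINT y|lborel. \<bar>\<eta> y\<bar>) * B"
    using B M by (intro kernel_L1_bound) auto
  finally show ?thesis using M by simp
qed

lemma conv_bounded:
  assumes \<eta>: "mollifier \<delta> \<eta>" and f: "integrable lborel f"
    and B: "AE y in lborel. dist x y < \<delta> \<longrightarrow> \<bar>f y\<bar> \<le> B"
  shows "\<bar>conv \<eta> f x\<bar> \<le> B"
proof -
  note M = mollifierD[OF \<eta>]
  have i: "integrable lborel (\<lambda>y. \<eta> (x - y))" by (rule integrable_lborel_translate[OF M(5)])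
  have "norm (conv \<eta> f x) \<le> (LINT y|lborel. norm (\<eta> (x - y) * f y))"
    unfolding conv_def by (rule integral_norm_bound)
  also have "\<dots> \<le> (LINT y|lborel. \<eta> (x - y) * B)"
  proof (rule integral_mono_AE)
    show "AE y in lborel. norm (\<eta> (x - y) * f y) \<le> \<eta> (x - y) * B"
      using B
    proof eventually_elim
      case (elim y)
      then show ?case using M(2)[of "x - y"] M(3)[of "x - y"]
        by (cases "\<eta> (x - y) = 0") (auto simp: abs_mult dist_norm intro!: mult_left_mono)
    qed
  qed (use i conv_integrable[OF M(1) f] in auto)
  also have "\<dots> = B" using integral_lborel_translate(2)[OF M(5), of x] M(4) by simp
  finally show ?thesis by simp
qed

lemma nn_integral_L1_translation:
  fixes f :: "'a::euclidean_space \<Rightarrow> real"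
  assumes "integrable lborel f" "e > 0"
  shows "\<exists>d>0. \<forall>y. norm y < d \<longrightarrow> (\<integral>\<^sup>+x. ennreal \<bar>f (x - y) - f x\<bar> \<partial>lborel) \<le> ennreal e"
proof -
  obtain d where d: "d > 0" "\<And>y. norm y < d \<Longrightarrow> (LINT x|lborel. \<bar>f (x - y) - f x\<bar>) < e"
    using L1_translation_continuous[OF assms] by blast
  have "(\<integral>\<^sup>+x. ennreal \<bar>f (x - y) - f x\<bar> \<partial>lborel) \<le> ennreal e" if "norm y < d" for y
    using d(2)[OF that] integrable_lborel_translate(1)[OF assms(1), of y] assms
    by (subst nn_integral_eq_integral) (auto intro!: ennreal_leI)
  then show ?thesis using d by blast
qed

lemma conv_L1_tendsto:
  fixes f :: "'a::euclidean_space \<Rightarrow> real"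
  assumes f: "integrable lborel f" "e > 0"
  shows "\<exists>d>0. \<forall>\<delta> \<eta>. \<delta> \<le> d \<longrightarrow> mollifier \<delta> \<eta> \<longrightarrow> integrable lborel (conv \<eta> f) \<and> (LINT x|lborel. \<bar>conv \<eta> f x - f x\<bar>) \<le> e"
proof -
  obtain d where d: "d > 0" "\<And>y. norm y < d \<Longrightarrow> (\<integral>\<^sup>+x. ennreal \<bar>f (x - y) - f x\<bar> \<partial>lborel) \<le> ennreal e"
    using nn_integral_L1_translation[OF assms] by blast
  have "integrable lborel (conv \<eta> f) \<and> (LINT x|lborel. \<bar>conv \<eta> f x - f x\<bar>) \<le> e"
    if "\<delta> \<le> d" and \<eta>: "mollifier \<delta> \<eta>" for \<delta> \<eta>
  proof -
    note M = mollifierD[OF \<eta>]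
    have "(\<integral>\<^sup>+x\<in>UNIV. ennreal \<bar>conv \<eta> f x - f x\<bar> \<partial>lborel) \<le> ennreal e"
      using d that by (intro conv_L1_diff[OF \<eta> f(1)]) auto
    then have le: "(\<integral>\<^sup>+x. ennreal \<bar>conv \<eta> f x - f x\<bar> \<partial>lborel) \<le> ennreal e" by simp
    have [measurable]: "conv \<eta> f \<in> borel_measurable borel"
      using Ck_conv[OF f(1) M(1), of 0] by (auto intro: borel_measurable_continuous_onI)
    have "f \<in> borel_measurable borel" using f by auto
    note [measurable] = this
    have i: "integrable lborel (\<lambda>x. conv \<eta> f x - f x)"
      unfolding integrable_iff_bounded using le by (auto intro: le_less_trans)
    have "integrable lborel (\<lambda>x. (conv \<eta> f x - f x) + f x)"
      by (rule Bochner_Integration.integrable_add[OF i f(1)])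
    moreover have "(LINT x|lborel. \<bar>conv \<eta> f x - f x\<bar>) \<le> e"
      using le i f(2) by (subst (asm) nn_integral_eq_integral) (auto simp: ennreal_le_iff)
    ultimately show ?thesis by simp
  qed
  then show ?thesis using d by blast
qed


subsection \<open>Density of test functions and the fundamental lemma\<close>

lemma compact_exhaustion_indicator_tendsto:
  assumes "\<And>n. C n \<subseteq> interior (C (Suc n))" "(\<Union>n. C n) = \<Omega>"
  shows "(\<lambda>n. indicator (C n) x :: real) \<longlonglongrightarrow> indicator \<Omega> x"
proof -
  have "incseq C" using assms(1) interior_subset by (intro incseq_SucI) blast
  from LIMSEQ_indicator_incseq[OF this] show ?thesis using assms(2) by simp
qed

text \<open>Cutting \<open>f\<close> down to a compact part of \<open>\<Omega>\<close> leaves room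
  to mollify it without leaving \<open>\<Omega>\<close>.\<close>

lemma test_functions_dense_L1:
  fixes f :: "'a::euclidean_space \<Rightarrow> real"
  assumes \<Omega>: "open \<Omega>" and f: "integrable lborel f" and z: "\<And>x. x \<notin> \<Omega> \<Longrightarrow> f x = 0" and e: "e > 0"
  shows "\<exists>\<phi>. test_function \<Omega> \<phi> \<and> (LINT x|lborel. \<bar>f x - \<phi> x\<bar>) < e"
proof -
  obtain C :: "nat \<Rightarrow> 'a set" where C: "\<And>n. compact (C n)" "\<And>n. C n \<subseteq> \<Omega>" "\<And>n. C n \<subseteq> interior (C (Suc n))" "(\<Union>n. C n) = \<Omega>"
    using open_Union_compact_subsets[OF \<Omega>] by metis
  have [measurable]: "C n \<in> sets borel" for n using C(1) by (simp add: compact_imp_closed)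
  have [measurable]: "f \<in> borel_measurable borel" using f by auto
  have "(\<lambda>n. LINT x|lborel. \<bar>f x - f x * indicator (C n) x\<bar>) \<longlonglongrightarrow> (LINT x|(lborel::'a measure). 0)"
  proof (rule integral_dominated_convergence[where w="\<lambda>x. \<bar>f x\<bar>"])
    show "AE x in lborel. (\<lambda>n. \<bar>f x - f x * indicator (C n) x\<bar>) \<longlonglongrightarrow> 0"
    proof (rule AE_I2)
      fix x
      have "(\<lambda>n. f x - f x * indicator (C n) x) \<longlonglongrightarrow> f x - f x * indicator \<Omega> x"
        by (intro tendsto_intros compact_exhaustion_indicator_tendsto C)
      moreover have "f x - f x * indicator \<Omega> x = 0" using z[of x] by (auto simp: indicator_def)
      ultimately show "(\<lambda>n. \<bar>f x - f x * indicator (C n) x\<bar>) \<longlonglongrightarrow> 0"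
        by (intro tendsto_rabs_zero) simp
    qed
    show "AE x in lborel. norm \<bar>f x - f x * indicator (C n) x\<bar> \<le> \<bar>f x\<bar>" for n
      by (intro AE_I2) (auto simp: indicator_def)
  qed (use f in auto)
  from LIMSEQ_D[OF this, of "e/2"] e obtain n where n: "(LINT x|lborel. \<bar>f x - f x * indicator (C n) x\<bar>) < e/2"
    by fastforce
  define g where "g x = f x * indicator (C n) x" for x
  have g: "integrable lborel g" unfolding g_def using f by (intro integrable_real_mult_indicator) auto
  obtain r where r: "r > 0" "(\<Union>x\<in>C n. ball x r) \<subseteq> \<Omega>"
    by (rule compact_subset_open_imp_ball_epsilon_subset[OF C(1) \<Omega> C(2)])
  obtain d where d: "d > 0" "\<And>\<delta> \<eta>. \<delta> \<le> d \<Longrightarrow> mollifier \<delta> \<eta> \<Longrightarrow> integrable lborel (conv \<eta> g) \<and> (LINT x|lborel. \<bar>conv \<eta> g x - g x\<bar>) \<le> e/2"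
    using conv_L1_tendsto[OF g, of "e/2"] e by auto
  define \<delta> where "\<delta> = min d (r/2)"
  have \<delta>: "\<delta> > 0" "\<delta> \<le> d" "\<delta> < r" using d r by (auto simp: \<delta>_def)
  obtain \<eta> :: "'a \<Rightarrow> real" where \<eta>: "mollifier \<delta> \<eta>" using ex_mollifier \<delta>(1) by metis
  have cg: "integrable lborel (conv \<eta> g)" "(LINT x|lborel. \<bar>conv \<eta> g x - g x\<bar>) \<le> e/2" using d(2)[OF \<delta>(2) \<eta>] by auto
  have "test_function \<Omega> (conv \<eta> g)"
  proof (rule conv_test_function[OF mollifierD(1)[OF \<eta>] mollifierD(3)[OF \<eta>] g _ C(1)[of n]])
    show "x \<in> C n" if "g x \<noteq> 0" for x using that by (auto simp: g_def indicator_def split: if_splits)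
    show "x \<in> \<Omega>" if "y \<in> C n" "dist x y \<le> \<delta>" for x y
      using r(2) that \<delta> by (auto simp: subset_eq dist_commute)
  qed
  moreover have "(LINT x|lborel. \<bar>f x - conv \<eta> g x\<bar>) \<le> (LINT x|lborel. \<bar>f x - g x\<bar> + \<bar>conv \<eta> g x - g x\<bar>)"
    using f g cg by (intro integral_mono) auto
  then have "(LINT x|lborel. \<bar>f x - conv \<eta> g x\<bar>) < e"
    using f g cg n by (simp add: g_def[symmetric])
  ultimately show ?thesis by blast
qed

lemma ex_cutoff:
  fixes \<Omega> :: "'a::euclidean_space set"
  assumes \<Omega>: "open \<Omega>" and K: "compact K" "K \<subseteq> \<Omega>"
  shows "\<exists>\<phi> :: 'a \<Rightarrow> real. test_function \<Omega> \<phi> \<and> (\<forall>x. 0 \<le> \<phi> x \<and> \<phi> x \<le> 1) \<and> (\<forall>x\<in>K. \<phi> x = 1)"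
proof -
  obtain r where r: "r > 0" "(\<Union>x\<in>K. ball x r) \<subseteq> \<Omega>"
    by (rule compact_subset_open_imp_ball_epsilon_subset[OF K(1) \<Omega> K(2)])
  \<comment> \<open>The plateau is thickened by \<open>\<delta>\<close> and mollification spreads it
    by another \<open>\<delta>\<close>; together they stay within \<open>r\<close>.\<close>
  define \<delta> where "\<delta> = r/3"
  have \<delta>: "\<delta> > 0" using r by (simp add: \<delta>_def)
  define K' where "K' = {x + y |x y. x \<in> K \<and> y \<in> cball 0 \<delta>}"
  have K': "compact K'" unfolding K'_def by (rule compact_sums[OF K(1) compact_cball])
  have K'I: "y \<in> K'" if "x \<in> K" "norm (x - y) \<le> \<delta>" for x y
    unfolding K'_def using that norm_minus_commute[of x y]
    by (intro CollectI, rule_tac exI[of _ x], rule_tac exI[of _ "y - x"]) auto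
  obtain \<eta> :: "'a \<Rightarrow> real" where \<eta>: "mollifier \<delta> \<eta>" using ex_mollifier \<delta>(1) by metis
  note M = mollifierD[OF \<eta>]
  have i: "integrable lborel (indicator K' :: 'a \<Rightarrow> real)"
    using K' emeasure_bounded_finite[OF compact_imp_bounded[OF K']] by (intro integrable_real_indicator) (auto simp: compact_imp_closed)
  let ?\<phi> = "conv \<eta> (indicator K')"
  have it: "integrable lborel (\<lambda>y. \<eta> (x - y))" for x by (rule integrable_lborel_translate[OF M(5)])
  have it1: "(LINT y|lborel. \<eta> (x - y)) = 1" for x using integral_lborel_translate(2)[OF M(5), of x] M(4) by simp
  show ?thesis
  proof (intro exI[of _ ?\<phi>] conjI allI ballI)
    show "test_function \<Omega> ?\<phi>"
    proof (rule conv_test_function[OF M(1) M(3) i _ K'])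
      show "x \<in> K'" if "indicator K' x \<noteq> (0::real)" for x using that by (auto simp: indicator_def split: if_splits)
      fix x y assume "y \<in> K'" "dist x y \<le> \<delta>"
      then obtain a b where ab: "y = a + b" "a \<in> K" "norm b \<le> \<delta>" by (auto simp: K'_def)
      have "dist a x \<le> dist a y + dist y x" by (rule dist_triangle)
      also have "\<dots> \<le> \<delta> + \<delta>" using ab \<open>dist x y \<le> \<delta>\<close> by (intro add_mono) (auto simp: dist_norm norm_minus_commute)
      also have "\<dots> < r" using r by (simp add: \<delta>_def)
      finally have "x \<in> ball a r" by simp
      then show "x \<in> \<Omega>" using r(2) ab(2) by blast
    qed
    show "0 \<le> ?\<phi> x" for x
      unfolding conv_def by (intro Bochner_Integration.integral_nonneg) (simp add: M)
    show "?\<phi> x \<le> 1" for x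
    proof -
      have "?\<phi> x \<le> (LINT y|lborel. \<eta> (x - y))"
        unfolding conv_def using M(2) by (intro integral_mono conv_integrable[OF M(1) i] it) (auto simp: indicator_def)
      then show ?thesis using it1 by simp
    qed
    show "?\<phi> x = 1" if "x \<in> K" for x
    proof -
      have "?\<phi> x = (LINT y|lborel. \<eta> (x - y))"
        unfolding conv_def
      proof (intro Bochner_Integration.integral_cong refl)
        show "\<eta> (x - y) * indicator K' y = \<eta> (x - y)" for y
          using M(3)[of "x - y"] K'I[OF that, of y] by (cases "\<eta> (x - y) = 0") (auto simp: indicator_def)
      qed
      then show ?thesis using it1 by simp
    qed
  qed
qed

text \<open>At a point whose closed \<open>\<delta>\<close>-ball lies in \<open>\<Omega>\<close> the
  reflected kernel is an admissible test function, so the mollification of \<open>f\<close> vanishes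
  there. The mollification error is then \<open>f\<close> itself, and it is arbitrarily small in
  \<open>L^1\<close>.\<close>

lemma fundamental_lemma_integrable:
  fixes f :: "'a::euclidean_space \<Rightarrow> real"
  assumes \<Omega>: "open \<Omega>" and f: "integrable lborel f"
    and z: "\<And>\<phi>. test_function \<Omega> \<phi> \<Longrightarrow> (LINT x|lborel. f x * \<phi> x) = 0"
  shows "AE x in lborel. x \<in> \<Omega> \<longrightarrow> f x = 0"
proof -
  obtain C :: "nat \<Rightarrow> 'a set" where C: "\<And>n. compact (C n)" "\<And>n. C n \<subseteq> \<Omega>" "\<And>n. C n \<subseteq> interior (C (Suc n))" "(\<Union>n. C n) = \<Omega>"
    using open_Union_compact_subsets[OF \<Omega>] by metis
  have Cm[measurable]: "C n \<in> sets borel" for n using C(1) by (simp add: compact_imp_closed)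
  have [measurable]: "f \<in> borel_measurable borel" using f by auto
  have "AE x in lborel. x \<in> C n \<longrightarrow> f x = 0" for n
  proof -
    obtain r where r: "r > 0" "(\<Union>x\<in>C n. ball x r) \<subseteq> \<Omega>"
      by (rule compact_subset_open_imp_ball_epsilon_subset[OF C(1) \<Omega> C(2)])
    have small: "(\<integral>\<^sup>+x\<in>C n. ennreal \<bar>f x\<bar> \<partial>lborel) \<le> ennreal e" if e: "e > 0" for e
    proof -
      obtain d where d: "d > 0" "\<And>y. norm y < d \<Longrightarrow> (\<integral>\<^sup>+x. ennreal \<bar>f (x - y) - f x\<bar> \<partial>lborel) \<le> ennreal e"
        using nn_integral_L1_translation[OF f e] by blast
      define \<delta> where "\<delta> = min d (r/2)"
      have \<delta>: "\<delta> > 0" "\<delta> \<le> d" "\<delta> < r" using d r by (auto simp: \<delta>_def)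
      obtain \<eta> :: "'a \<Rightarrow> real" where \<eta>: "mollifier \<delta> \<eta>" using ex_mollifier \<delta>(1) by metis
      note M = mollifierD[OF \<eta>]
      have 0: "conv \<eta> f x = 0" if x: "x \<in> C n" for x
      proof -
        have "test_function UNIV (\<lambda>y. \<eta> (x + (-1) *\<^sub>R y))" by (rule test_function_affine[OF M(1)]) simp
        then have "test_function \<Omega> (\<lambda>y. \<eta> (x - y))"
        proof (intro test_functionI[where K="cball x \<delta>"])
          show "cball x \<delta> \<subseteq> \<Omega>" using r(2) x \<delta> by (auto simp: subset_eq)
          show "y \<in> cball x \<delta>" if "\<eta> (x - y) \<noteq> 0" for y using M(3)[OF that] by (simp add: dist_norm)
        qed (use test_functionD(1) in \<open>force\<close>)+
        from z[OF this] show ?thesis by (simp add: conv_def mult.commute)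
      qed
      have "(\<integral>\<^sup>+x\<in>C n. ennreal \<bar>f x\<bar> \<partial>lborel) = (\<integral>\<^sup>+x\<in>C n. ennreal \<bar>conv \<eta> f x - f x\<bar> \<partial>lborel)"
        using 0 by (intro nn_integral_cong) (auto simp: indicator_def)
      also have "\<dots> \<le> ennreal e"
      proof (rule conv_L1_diff[OF \<eta> f Cm])
        fix y :: 'a assume "norm y < \<delta>"
        then have "(\<integral>\<^sup>+x. ennreal \<bar>f (x - y) - f x\<bar> \<partial>lborel) \<le> ennreal e" using d(2) \<delta> by auto
        moreover have "(\<integral>\<^sup>+x\<in>C n. ennreal \<bar>f (x - y) - f x\<bar> \<partial>lborel) \<le> (\<integral>\<^sup>+x. ennreal \<bar>f (x - y) - f x\<bar> \<partial>lborel)"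
          by (intro nn_integral_mono) (auto simp: indicator_def)
        ultimately show "(\<integral>\<^sup>+x\<in>C n. ennreal \<bar>f (x - y) - f x\<bar> \<partial>lborel) \<le> ennreal e" by (rule order_trans[rotated])
      qed
      finally show ?thesis .
    qed
    have "(\<integral>\<^sup>+x\<in>C n. ennreal \<bar>f x\<bar> \<partial>lborel) \<le> 0"
      by (rule ennreal_le_epsilon) (simp only: add_0 small)
    then have "(\<integral>\<^sup>+x\<in>C n. ennreal \<bar>f x\<bar> \<partial>lborel) = 0" by simp
    then have "AE x in lborel. ennreal \<bar>f x\<bar> * indicator (C n) x = 0"
      by (subst (asm) nn_integral_0_iff_AE) auto
    then show ?thesis by eventually_elim (auto simp: indicator_def)
  qed
  then have "AE x in lborel. \<forall>n. x \<in> C n \<longrightarrow> f x = 0" by (subst AE_all_countable) auto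
  then show ?thesis by eventually_elim (use C(4) in blast)
qed

text \<open>Bridge between the completed measure of the definitions and \<open>lborel\<close>, where
  product measurability and translations are available. The representative vanishes off
  \<open>S\<close>, so later integrals can be taken over the whole space.\<close>

lemma lebesgue_integrable_borel_rep:
  fixes f :: "'a::euclidean_space \<Rightarrow> real"
  assumes f: "set_integrable lebesgue S f" and S[measurable]: "S \<in> sets borel"
  obtains g where "integrable lborel g" "\<And>x. x \<notin> S \<Longrightarrow> g x = 0" "AE x in lborel. x \<in> S \<longrightarrow> f x = g x"
    "AE x in lborel. indicator S x * f x = g x"
proof -
  have i: "integrable lebesgue (\<lambda>x. indicator S x * f x)" using f by (simp add: set_integrable_def)
  then have "(\<lambda>x. indicator S x * f x) \<in> borel_measurable lebesgue" by auto
  from completion_ex_borel_measurable_real[OF this] obtain g0 where g0: "g0 \<in> borel_measurable lborel" "AE x in lborel. indicator S x * f x = g0 x" by blast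
  note [measurable] = g0(1)
  define g where "g x = indicator S x * g0 x" for x
  have ae: "AE x in lborel. indicator S x * f x = g x" using g0(2) by eventually_elim (auto simp: g_def indicator_def)
  have gb: "g \<in> borel_measurable borel" unfolding g_def using g0(1) by simp
  have "integrable lebesgue g"
  proof (rule integrable_cong_AE_imp[OF i])
    show "AE x in lebesgue. indicator S x * f x = g x" using AE_completion[OF ae] .
  qed (use gb in \<open>simp add: measurable_completion\<close>)
  then have "integrable lborel g" using gb by (subst (asm) integrable_completion) auto
  moreover have "AE x in lborel. x \<in> S \<longrightarrow> f x = g x" using ae by eventually_elim auto
  ultimately show ?thesis using that ae by (auto simp: g_def)
qed

lemma locally_integrable_times_test:
  fixes f \<phi> :: "'a::euclidean_space \<Rightarrow> real"
  assumes f: "locally_integrable \<Omega> f" and \<phi>: "test_function \<Omega> \<phi>"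
  shows "set_integrable lebesgue \<Omega> (\<lambda>x. f x * \<phi> x)"
proof -
  let ?K = "closure {x. \<phi> x \<noteq> 0}"
  note T = test_functionD[OF \<phi>]
  have "set_integrable lebesgue ?K f" using f T by (auto simp: locally_integrable_def)
  then have i: "integrable lebesgue (\<lambda>x. indicator ?K x * f x)" by (simp add: set_integrable_def)
  obtain B where B: "B > 0" "\<And>x. \<bar>\<phi> x\<bar> \<le> B" using test_function_bounded[OF \<phi>] by blast
  have [measurable]: "\<phi> \<in> borel_measurable lebesgue"
    using test_function_borel[OF \<phi>] by (intro measurable_completion) simp
  have [measurable]: "(\<lambda>x. indicator ?K x * f x) \<in> borel_measurable lebesgue" using i by auto
  have "integrable lebesgue (\<lambda>x. (indicator ?K x * f x) * \<phi> x)"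
  proof (rule Bochner_Integration.integrable_bound[where f="\<lambda>x. B * (indicator ?K x * f x)"])
    show "AE x in lebesgue. norm ((indicator ?K x * f x) * \<phi> x) \<le> norm (B * (indicator ?K x * f x))"
      using B by (intro AE_I2) (auto simp: abs_mult indicator_def intro!: mult_left_mono simp: mult.commute[of B])
  qed (use i in auto)
  moreover have "(\<lambda>x. (indicator ?K x * f x) * \<phi> x) = (\<lambda>x. indicator \<Omega> x *\<^sub>R (f x * \<phi> x))"
    using closure_subset[of "{x. \<phi> x \<noteq> 0}"] T(3) by (intro ext) (auto simp: indicator_def)
  ultimately show ?thesis by (simp only: set_integrable_def)
qed

lemma fundamental_lemma:
  fixes f :: "'a::euclidean_space \<Rightarrow> real"
  assumes \<Omega>: "open \<Omega>" and f: "locally_integrable \<Omega> f"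
    and z: "\<And>\<phi>. test_function \<Omega> \<phi> \<Longrightarrow> (LINT x:\<Omega>|lebesgue. f x * \<phi> x) = 0"
  shows "AE x in lborel. x \<in> \<Omega> \<longrightarrow> f x = 0"
proof -
  obtain C :: "nat \<Rightarrow> 'a set" where C: "\<And>n. compact (C n)" "\<And>n. C n \<subseteq> \<Omega>" "\<And>n. C n \<subseteq> interior (C (Suc n))" "(\<Union>n. C n) = \<Omega>"
    using open_Union_compact_subsets[OF \<Omega>] by metis
  have Cm[measurable]: "C n \<in> sets borel" for n using C(1) by (simp add: compact_imp_closed)
  \<comment> \<open>The integrable case works on an open set, hence the interiors of the compact
    sets; they still exhaust \<open>\<Omega>\<close>.\<close>
  have "AE x in lborel. x \<in> interior (C n) \<longrightarrow> f x = 0" for n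
  proof -
    have "set_integrable lebesgue (C n) f" using f C by (auto simp: locally_integrable_def)
    then obtain g where g: "integrable lborel g" "\<And>x. x \<notin> C n \<Longrightarrow> g x = 0" "AE x in lborel. x \<in> C n \<longrightarrow> f x = g x"
      "AE x in lborel. indicator (C n) x * f x = g x"
      by (rule lebesgue_integrable_borel_rep) auto
    have [measurable]: "g \<in> borel_measurable borel" using g by auto
    have "AE x in lborel. x \<in> interior (C n) \<longrightarrow> g x = 0"
    proof (rule fundamental_lemma_integrable[OF open_interior g(1)])
      fix \<phi> :: "'a \<Rightarrow> real" assume \<phi>: "test_function (interior (C n)) \<phi>"
      then have \<phi>': "test_function \<Omega> \<phi>" using C(2) interior_subset test_function_mono by (metis order_trans)
      have [measurable]: "\<phi> \<in> borel_measurable borel" using test_function_borel[OF \<phi>] .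
      have i: "set_integrable lebesgue \<Omega> (\<lambda>x. f x * \<phi> x)" by (rule locally_integrable_times_test[OF f \<phi>'])
      have "0 = (LINT x|lebesgue. indicator \<Omega> x * (f x * \<phi> x))" using z[OF \<phi>'] by (simp add: set_lebesgue_integral_def)
      also have "\<dots> = (LINT x|lebesgue. g x * \<phi> x)"
      proof (rule integral_cong_AE)
        show "(\<lambda>x. indicator \<Omega> x * (f x * \<phi> x)) \<in> borel_measurable lebesgue"
          using i by (auto simp: set_integrable_def)
        show "(\<lambda>x. g x * \<phi> x) \<in> borel_measurable lebesgue" by (intro measurable_completion) measurable
        show "AE x in lebesgue. indicator \<Omega> x * (f x * \<phi> x) = g x * \<phi> x"
          using AE_completion[OF g(3)]
        proof eventually_elim
          case (elim x)
          show ?case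
          proof (cases "\<phi> x = 0")
            case False
            then have "x \<in> C n" using test_functionD(4)[OF \<phi>] interior_subset by blast
            then show ?thesis using elim C(2) by (auto simp: indicator_def)
          qed simp
        qed
      qed
      also have "\<dots> = (LINT x|lborel. g x * \<phi> x)" by (rule integral_completion) measurable
      finally show "(LINT x|lborel. g x * \<phi> x) = 0" by simp
    qed
    then show ?thesis using g(3)
    proof eventually_elim
      case (elim x) then show ?case using interior_subset[of "C n"] by auto
    qed
  qed
  then have "AE x in lborel. \<forall>n. x \<in> interior (C n) \<longrightarrow> f x = 0" by (subst AE_all_countable) auto
  moreover have "\<exists>n. x \<in> interior (C n)" if "x \<in> \<Omega>" for x using C(3,4) that by blast
  ultimately show ?thesis by (auto elim!: eventually_mono)
qed

subsection \<open>Weak gradients\<close>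

abbreviation pdiff :: "'n \<Rightarrow> (real^'n \<Rightarrow> real) \<Rightarrow> real^'n \<Rightarrow> real" where
  "pdiff j f x \<equiv> frechet_derivative f (at x) (axis j 1)"

lemma locally_integrable_component:
  assumes "locally_integrable \<Omega> (u :: 'a::euclidean_space \<Rightarrow> real^'s)"
  shows "locally_integrable \<Omega> (\<lambda>x. u x $ i)"
  unfolding locally_integrable_def set_integrable_def
proof (intro allI impI)
  fix K assume "compact K \<and> K \<subseteq> \<Omega>"
  then have "integrable lebesgue (\<lambda>x. indicator K x *\<^sub>R u x)" using assms by (auto simp: locally_integrable_def set_integrable_def)
  from integrable_bounded_linear[OF bounded_linear_vec_nth this, of i]
  show "integrable lebesgue (\<lambda>x. indicator K x *\<^sub>R u x $ i)" by simp
qed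

lemma locally_integrable_component2:
  assumes "locally_integrable \<Omega> (u :: 'a::euclidean_space \<Rightarrow> real^'d^'s)"
  shows "locally_integrable \<Omega> (\<lambda>x. u x $ i $ j)"
  unfolding locally_integrable_def set_integrable_def
proof (intro allI impI)
  fix K assume "compact K \<and> K \<subseteq> \<Omega>"
  then have "integrable lebesgue (\<lambda>x. indicator K x *\<^sub>R u x)" using assms by (auto simp: locally_integrable_def set_integrable_def)
  from integrable_bounded_linear[OF bounded_linear_vec_nth integrable_bounded_linear[OF bounded_linear_vec_nth this, of i], of j]
  show "integrable lebesgue (\<lambda>x. indicator K x *\<^sub>R u x $ i $ j)" by simp
qed

lemma locally_integrable_diff:
  fixes f g :: "'a::euclidean_space \<Rightarrow> real"
  assumes "locally_integrable \<Omega> f" "locally_integrable \<Omega> g"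
  shows "locally_integrable \<Omega> (\<lambda>x. f x - g x)"
  using assms unfolding locally_integrable_def by (auto intro: set_integral_diff)

lemma has_weak_gradientD:
  fixes u :: "real^'d \<Rightarrow> real^'s"
  assumes "has_weak_gradient \<Omega> u G"
  shows "locally_integrable \<Omega> u" "locally_integrable \<Omega> G"
    and "test_function \<Omega> \<phi> \<Longrightarrow> (LINT x:\<Omega>|lebesgue. u x $ i * pdiff j \<phi> x) = - (LINT x:\<Omega>|lebesgue. G x $ i $ j * \<phi> x)"
  using assms unfolding has_weak_gradient_def by blast+

lemma has_weak_gradient_unique:
  fixes u :: "real^'d \<Rightarrow> real^'s"
  assumes \<Omega>: "open \<Omega>" and G: "has_weak_gradient \<Omega> u G" and H: "has_weak_gradient \<Omega> u H"
  shows "AE x in lebesgue. x \<in> \<Omega> \<longrightarrow> G x = H x"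
proof -
  have "AE x in lborel. x \<in> \<Omega> \<longrightarrow> G x $ i $ j - H x $ i $ j = 0" for i j
  proof (rule fundamental_lemma[OF \<Omega>])
    have GH: "locally_integrable \<Omega> (\<lambda>x. G x $ i $ j)" "locally_integrable \<Omega> (\<lambda>x. H x $ i $ j)"
      using G H by (auto simp: has_weak_gradient_def intro: locally_integrable_component2)
    then show "locally_integrable \<Omega> (\<lambda>x. G x $ i $ j - H x $ i $ j)" by (rule locally_integrable_diff)
    fix \<phi> :: "real^'d \<Rightarrow> real" assume \<phi>: "test_function \<Omega> \<phi>"
    have "(LINT x:\<Omega>|lebesgue. G x $ i $ j * \<phi> x) = (LINT x:\<Omega>|lebesgue. H x $ i $ j * \<phi> x)"
      using has_weak_gradientD(3)[OF G \<phi>, of i j] has_weak_gradientD(3)[OF H \<phi>, of i j] by simp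
    then show "(LINT x:\<Omega>|lebesgue. (G x $ i $ j - H x $ i $ j) * \<phi> x) = 0"
      using locally_integrable_times_test[OF GH(1) \<phi>] locally_integrable_times_test[OF GH(2) \<phi>]
      by (simp add: left_diff_distrib set_integral_diff)
  qed
  then have "AE x in lborel. \<forall>i j. x \<in> \<Omega> \<longrightarrow> G x $ i $ j - H x $ i $ j = 0"
    by (intro AE_all_countable[THEN iffD2] allI)
  then have "AE x in lebesgue. \<forall>i j. x \<in> \<Omega> \<longrightarrow> G x $ i $ j - H x $ i $ j = 0" by (rule AE_completion)
  then show ?thesis by eventually_elim (auto simp: vec_eq_iff)
qed

lemma weak_grad_AE_eq:
  assumes \<Omega>: "open \<Omega>" and G: "has_weak_gradient \<Omega> u G"
  shows "AE x in lebesgue. x \<in> \<Omega> \<longrightarrow> weak_grad \<Omega> u x = G x"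
    and "has_weak_gradient \<Omega> u (weak_grad \<Omega> u)"
proof -
  show *: "has_weak_gradient \<Omega> u (weak_grad \<Omega> u)" unfolding weak_grad_def by (rule someI[of _ G]) (rule G)
  show "AE x in lebesgue. x \<in> \<Omega> \<longrightarrow> weak_grad \<Omega> u x = G x" by (rule has_weak_gradient_unique[OF \<Omega> * G])
qed

text \<open>By translation invariance the integral of
  \<open>\<phi> (x + t *\<^sub>R v) - \<phi> x\<close> is zero for every \<open>t\<close>. After
  division by \<open>t\<close>, the uniform Taylor remainder, supported in a fixed ball, forces the
  integral of the derivative to vanish.\<close>

lemma integral_test_function_derivative:
  fixes \<phi> :: "'a::euclidean_space \<Rightarrow> real"
  assumes \<phi>: "test_function UNIV \<phi>"
  shows "(LINT x|lborel. frechet_derivative \<phi> (at x) v) = 0"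
proof -
  let ?D = "\<lambda>x. frechet_derivative \<phi> (at x)"
  obtain R where R: "\<And>x. \<phi> x \<noteq> 0 \<Longrightarrow> norm x \<le> R" "R > 0"
    using test_functionD(7)[OF \<phi>] unfolding bounded_pos by blast
  have TD: "test_function UNIV (\<lambda>x. ?D x v)" by (rule test_function_frechet_derivative[OF \<phi>])
  define B where "B = cball (0::'a) (R + 1)"
  define I where "I = (LINT x|lborel. ?D x v)"
  have mB: "integrable lborel (indicator B :: 'a \<Rightarrow> real)"
    unfolding B_def using emeasure_bounded_finite[OF bounded_cball] by (intro integrable_real_indicator) auto
  have Dz: "?D x v = 0" if "norm x > R" for x
  proof -
    have "((\<lambda>x. 0) has_derivative (\<lambda>v. 0)) (at x)" by simp
    then have "(\<phi> has_derivative (\<lambda>v. 0)) (at x)"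
      by (rule has_derivative_transform_within_open[where s="- cball 0 R"])
         (use that R(1) in \<open>auto simp: not_le[symmetric]\<close>)
    from frechet_derivative_at[OF this] show ?thesis by metis
  qed
  have "\<bar>I\<bar> \<le> e * (norm v * measure lborel B)" if e: "e > 0" for e
  proof -
    obtain d where d: "d > 0" "\<And>x h. norm h < d \<Longrightarrow> \<bar>\<phi> (x + h) - \<phi> x - ?D x h\<bar> \<le> e * norm h"
      using test_function_uniform_derivative[OF \<phi> e] by blast
    \<comment> \<open>The shift must be shorter than \<open>d\<close> for the remainder estimate and
      at most 1 so that nothing happens outside the ball of radius \<open>R + 1\<close>; the
      denominator allows \<open>v = 0\<close>.\<close>
    define t where "t = min (d/2) 1 / (norm v + 1)"
    have t: "t > 0" using d by (simp add: t_def add_nonneg_pos)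
    have "t * norm v = min (d/2) 1 * (norm v / (norm v + 1))" by (simp add: t_def)
    also have "\<dots> \<le> min (d/2) 1 * 1" using d by (intro mult_left_mono) (auto simp: add_nonneg_pos)
    finally have tv: "t * norm v \<le> min (d/2) 1" by simp
    then have tv': "norm (t *\<^sub>R v) < d" "norm (t *\<^sub>R v) \<le> 1" using t d by auto
    have i1: "integrable lborel (\<lambda>x. \<phi> (x + t *\<^sub>R v))" "(LINT x|lborel. \<phi> (x + t *\<^sub>R v)) = (LINT x|lborel. \<phi> x)"
      using integrable_lborel_translate(1)[OF test_function_integrable[OF \<phi>], of "- t *\<^sub>R v"]
        integral_lborel_translate(1)[OF test_function_integrable[OF \<phi>], of "- t *\<^sub>R v"] by auto
    note i2 = test_function_integrable[OF \<phi>] test_function_integrable[OF TD]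
    have lin: "?D x (t *\<^sub>R v) = t * ?D x v" for x
      using linear_cmul[OF bounded_linear.linear[OF linear_frechet_test[OF \<phi>]]] by simp
    have "(LINT x|lborel. \<phi> (x + t *\<^sub>R v) - \<phi> x - t * ?D x v) = - (t * I)"
      using i1 i2 by (simp add: I_def)
    then have "t * \<bar>I\<bar> = norm (LINT x|lborel. \<phi> (x + t *\<^sub>R v) - \<phi> x - t * ?D x v)" using t by (simp add: abs_mult)
    also have "\<dots> \<le> (LINT x|lborel. norm (\<phi> (x + t *\<^sub>R v) - \<phi> x - t * ?D x v))" by (rule integral_norm_bound)
    also have "\<dots> \<le> (LINT x|lborel. e * (t * norm v) * indicator B x)"
    proof (rule integral_mono)
      show "integrable lborel (\<lambda>x. norm (\<phi> (x + t *\<^sub>R v) - \<phi> x - t * ?D x v))" using i1 i2 by auto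
      show "integrable lborel (\<lambda>x. e * (t * norm v) * indicator B x)" using mB by auto
      fix x
      show "norm (\<phi> (x + t *\<^sub>R v) - \<phi> x - t * ?D x v) \<le> e * (t * norm v) * indicator B x"
      proof (cases "x \<in> B")
        case True
        then show ?thesis using d(2)[OF tv'(1), of x] t by (simp add: lin)
      next
        case False
        then have n: "norm x > R + 1" by (simp add: B_def)
        moreover have "norm x \<le> norm (x + t *\<^sub>R v) + norm (t *\<^sub>R v)"
          using norm_triangle_ineq4[of "x + t *\<^sub>R v" "t *\<^sub>R v"] by simp
        ultimately have "norm (x + t *\<^sub>R v) > R" using tv'(2) by linarith
        then have "\<phi> (x + t *\<^sub>R v) = 0" "\<phi> x = 0" "?D x v = 0" using R(1) n Dz by (force simp: not_le[symmetric])+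
        then show ?thesis using False by simp
      qed
    qed
    also have "\<dots> = t * (e * (norm v * measure lborel B))" using mB by simp
    finally show ?thesis using t by simp
  qed
  then have "\<bar>I\<bar> \<le> 0 + e" if "e > 0" for e
  proof -
    let ?c = "norm v * measure lborel B"
    have "\<bar>I\<bar> \<le> e / (?c + 1) * ?c" using \<open>\<And>e. e > 0 \<Longrightarrow> \<bar>I\<bar> \<le> e * ?c\<close>[of "e / (?c + 1)"] that by (simp add: add_nonneg_pos)
    also have "\<dots> = e * (?c / (?c + 1))" by simp
    also have "\<dots> \<le> e * 1" using that by (intro mult_left_mono) (auto simp: add_nonneg_pos)
    finally show ?thesis by simp
  qed
  then have "\<bar>I\<bar> \<le> 0" by (rule field_le_epsilon)
  then show ?thesis by (simp add: I_def)
qed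

text \<open>The product of \<open>\<phi>\<close> with the smooth \<open>f\<close> is again a test
  function, so its derivative integrates to zero.\<close>

lemma integration_by_parts_test:
  fixes f \<phi> :: "'a::euclidean_space \<Rightarrow> real"
  assumes f: "\<And>k. Ck k f" and \<phi>: "test_function \<Omega> \<phi>"
  shows "(LINT x|lborel. f x * frechet_derivative \<phi> (at x) v) = - (LINT x|lborel. frechet_derivative f (at x) v * \<phi> x)"
proof -
  have T: "test_function UNIV \<phi>" using \<phi> test_function_mono by blast
  have "test_function UNIV (\<lambda>x. \<phi> x * f x)" by (rule test_function_mult[OF T f])
  have D: "frechet_derivative (\<lambda>x. \<phi> x * f x) (at x) v = \<phi> x * frechet_derivative f (at x) v + frechet_derivative \<phi> (at x) v * f x" for x
    using fun_cong[OF frechet_derivative_at[OF has_derivative_mult[OF test_functionD(5)[OF T, of x] smooth_has_derivative[OF f, of x]]], of v] by simp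
  have "(LINT x|lborel. \<phi> x * frechet_derivative f (at x) v + frechet_derivative \<phi> (at x) v * f x) = 0"
    using integral_test_function_derivative[OF \<open>test_function UNIV (\<lambda>x. \<phi> x * f x)\<close>, of v] by (simp add: D)
  moreover have "integrable lborel (\<lambda>x. \<phi> x * frechet_derivative f (at x) v)"
    by (rule test_function_integrable, rule test_function_mult[OF T], rule smooth_frechet_derivative[OF f])
  moreover have "integrable lborel (\<lambda>x. frechet_derivative \<phi> (at x) v * f x)"
    by (rule test_function_integrable, rule test_function_mult[OF test_function_frechet_derivative[OF T] f])
  ultimately show ?thesis by (simp add: mult.commute)
qed

lemma continuous_locally_integrable:
  fixes f :: "'a::euclidean_space \<Rightarrow> 'b::euclidean_space"
  assumes "continuous_on UNIV f"
  shows "locally_integrable \<Omega> f"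
  unfolding locally_integrable_def set_integrable_def
proof (intro allI impI)
  fix K assume "compact K \<and> K \<subseteq> \<Omega>"
  then have K: "compact K" "K \<in> sets borel" by (auto simp: compact_imp_closed)
  have "integrable lborel (\<lambda>x. indicator K x *\<^sub>R f x)"
    using assms K by (intro borel_integrable_compact) (auto intro: continuous_on_subset)
  moreover have "f \<in> borel_measurable borel" using assms by (rule borel_measurable_continuous_onI)
  ultimately show "integrable lebesgue (\<lambda>x. indicator K x *\<^sub>R f x)"
    using K by (subst integrable_completion) auto
qed

lemma smooth_has_weak_gradient:
  fixes u :: "real^'d \<Rightarrow> real^'s"
  assumes \<Omega>: "open \<Omega>" and u: "\<And>i k. Ck k (\<lambda>x. u x $ i)"
  shows "has_weak_gradient \<Omega> u (\<lambda>x. \<chi> i j. pdiff j (\<lambda>x. u x $ i) x)"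
  unfolding has_weak_gradient_def
proof (intro conjI allI impI)
  have c: "continuous_on UNIV (\<lambda>x. u x $ i)" "continuous_on UNIV (\<lambda>x. pdiff j (\<lambda>x. u x $ i) x)" for i j
    using u[of 0 i] smooth_frechet_derivative[OF u, of 0 i "axis j 1"] by auto
  have "continuous_on UNIV (\<lambda>x. \<chi> i. u x $ i)" by (intro continuous_on_vec_lambda c)
  then show "locally_integrable \<Omega> u" by (intro continuous_locally_integrable) simp
  show "locally_integrable \<Omega> (\<lambda>x. \<chi> i j. pdiff j (\<lambda>x. u x $ i) x)"
    by (intro continuous_locally_integrable continuous_on_vec_lambda c)
  fix \<phi> :: "real^'d \<Rightarrow> real" and i j assume \<phi>: "test_function \<Omega> \<phi>"
  have T: "test_function UNIV \<phi>" using \<phi> test_function_mono by blast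
  have Om: "indicator \<Omega> x * (g * \<phi> x) = g * \<phi> x" "indicator \<Omega> x * (g * pdiff j \<phi> x) = g * pdiff j \<phi> x" for g x
    using test_functionD(4)[OF \<phi>, of x] test_functionD(4)[OF test_function_frechet_derivative[OF \<phi>], of x] by (auto simp: indicator_def)
  have m: "(\<lambda>x. u x $ i) \<in> borel_measurable borel" "(\<lambda>x. pdiff j (\<lambda>x. u x $ i) x) \<in> borel_measurable borel"
    "\<phi> \<in> borel_measurable borel" "pdiff j \<phi> \<in> borel_measurable borel"
    using c test_function_borel[OF T] test_function_borel[OF test_function_frechet_derivative[OF T]]
    by (auto intro: borel_measurable_continuous_onI)
  have "(LINT x:\<Omega>|lebesgue. u x $ i * pdiff j \<phi> x) = (LINT x|lborel. u x $ i * pdiff j \<phi> x)"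
    unfolding set_lebesgue_integral_def real_scaleR_def Om using m by (intro integral_completion) auto
  moreover have "(LINT x:\<Omega>|lebesgue. (\<chi> i j. pdiff j (\<lambda>x. u x $ i) x) $ i $ j * \<phi> x) = (LINT x|lborel. pdiff j (\<lambda>x. u x $ i) x * \<phi> x)"
    unfolding set_lebesgue_integral_def real_scaleR_def vec_lambda_beta Om using m by (intro integral_completion) auto
  ultimately show "(LINT x:\<Omega>|lebesgue. u x $ i * pdiff j \<phi> x) = - (LINT x:\<Omega>|lebesgue. (\<chi> i j. pdiff j (\<lambda>x. u x $ i) x) $ i $ j * \<phi> x)"
    using integration_by_parts_test[OF u \<phi>] by simp
qed


section \<open>Weak partial derivatives of Borel representatives, and compactness under gradient
  bounds\<close>

text \<open>Scalar counterpart of \<open>has_weak_gradient\<close> for Borel functions on the whole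
  space. Test functions are supported in \<open>\<Omega>\<close>, so values outside do not enter;
  with \<open>UNIV\<close> in place of \<open>\<Omega>\<close> it expresses a global weak
  derivative, as produced by a cutoff.\<close>

definition weak_pdiff :: "(real^'d) set \<Rightarrow> 'd \<Rightarrow> (real^'d \<Rightarrow> real) \<Rightarrow> (real^'d \<Rightarrow> real) \<Rightarrow> bool" where
  "weak_pdiff \<Omega> j z g \<longleftrightarrow> (\<forall>\<phi>. test_function \<Omega> \<phi> \<longrightarrow>
     (LINT x|lborel. z x * pdiff j \<phi> x) = - (LINT x|lborel. g x * \<phi> x))"

text \<open>As a function of \<open>y\<close>, the kernel \<open>\<eta> (x - y)\<close> is supported
  in the closed \<open>\<delta>\<close>-ball about \<open>x\<close> and is thus a test function on
  \<open>\<Omega>\<close>; the derivative moves from the kernel to \<open>g\<close>.\<close>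

lemma pdiff_conv_weak:
  fixes z g :: "real^'d \<Rightarrow> real"
  assumes w: "weak_pdiff \<Omega> j z g" and z: "integrable lborel z" and \<eta>: "mollifier \<delta> \<eta>" and x: "cball x \<delta> \<subseteq> \<Omega>"
  shows "pdiff j (conv \<eta> z) x = conv \<eta> g x"
proof -
  note M = mollifierD[OF \<eta>]
  have "test_function UNIV (\<lambda>y. \<eta> (x + (-1) *\<^sub>R y))" by (rule test_function_affine[OF M(1)]) simp
  then have T: "test_function \<Omega> (\<lambda>y. \<eta> (x - y))"
  proof (intro test_functionI[where K="cball x \<delta>"])
    show "y \<in> cball x \<delta>" if "\<eta> (x - y) \<noteq> 0" for y using M(3)[OF that] by (simp add: dist_norm)
  qed (use test_functionD(1) x in \<open>force\<close>)+
  have D: "pdiff j (\<lambda>y. \<eta> (x - y)) y = - pdiff j \<eta> (x - y)" for y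
  proof -
    have "((\<lambda>y. \<eta> (x - y)) has_derivative (\<lambda>v. frechet_derivative \<eta> (at (x - y)) (- v))) (at y)"
      by (rule has_derivative_compose[OF _ test_functionD(5)[OF M(1)]]) (auto intro!: derivative_eq_intros)
    from fun_cong[OF frechet_derivative_at[OF this], of "axis j 1"] show ?thesis
      by (simp add: linear_neg[OF bounded_linear.linear[OF linear_frechet_test[OF M(1)]]])
  qed
  have "pdiff j (conv \<eta> z) x = (LINT y|lborel. pdiff j \<eta> (x - y) * z y)"
    by (simp add: conv_frechet_derivative[OF M(1) z] conv_def)
  also have "\<dots> = - (LINT y|lborel. z y * pdiff j (\<lambda>y. \<eta> (x - y)) y)"
    by (simp add: D mult.commute)
  also have "\<dots> = (LINT y|lborel. g y * \<eta> (x - y))"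
    using w T unfolding weak_pdiff_def by simp
  finally show ?thesis by (simp add: conv_def mult.commute)
qed

lemma linear_bound_pdiff:
  fixes L :: "real^'d \<Rightarrow> real"
  assumes L: "linear L" and B: "\<And>j. \<bar>L (axis j 1)\<bar> \<le> M"
  shows "\<bar>L v\<bar> \<le> (real CARD('d) * M) * norm v"
proof -
  have "v = (\<Sum>j\<in>UNIV. (v $ j) *\<^sub>R axis j 1)"
    using basis_expansion[of v] by (simp add: scalar_mult_eq_scaleR)
  then have "L v = (\<Sum>j\<in>UNIV. v $ j * L (axis j 1))"
    using linear_sum[OF L, of "\<lambda>j. (v $ j) *\<^sub>R axis j 1" UNIV] linear_cmul[OF L] by simp
  also have "\<bar>\<dots>\<bar> \<le> (\<Sum>j\<in>UNIV. \<bar>v $ j * L (axis j 1)\<bar>)" by (rule sum_abs)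
  also have "\<dots> \<le> (\<Sum>j\<in>(UNIV::'d set). norm v * M)"
    unfolding abs_mult using B by (intro sum_mono mult_mono component_le_norm_cart) auto
  finally show ?thesis by (simp add: mult_ac)
qed

lemma AE_lborel_nonneg_bound:
  assumes "AE x in (lborel :: 'a::euclidean_space measure). \<bar>f x\<bar> \<le> (M :: real)"
  shows "M \<ge> 0"
proof (rule ccontr)
  assume "\<not> M \<ge> 0"
  then have "AE x in (lborel :: 'a measure). False" using assms by (auto elim!: eventually_mono)
  then have "emeasure (lborel :: 'a measure) UNIV = 0"
    by (subst (asm) AE_iff_measurable[where N=UNIV]) auto
  then show False by simp
qed

text \<open>A bounded weak gradient gives mollifications a Lipschitz bound near \<open>S\<close>
  whose constant is independent of the mollification radius. The radius is taken so small that
  replacing \<open>z\<close> by its mollification costs at most \<open>e\<close>.\<close>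

lemma weak_pdiff_translation_L1:
  fixes z :: "real^'d \<Rightarrow> real"
  assumes w: "\<And>j. weak_pdiff \<Omega> j z (g j)" and z: "integrable lborel z" and g: "\<And>j. integrable lborel (g j)"
    and M: "\<And>j. AE x in lborel. \<bar>g j x\<bar> \<le> M"
    and S[measurable]: "S \<in> sets borel" "emeasure lborel S < \<infinity>" and d: "0 < \<delta>" "\<And>x. x \<in> S \<Longrightarrow> cball x (2 * \<delta>) \<subseteq> \<Omega>"
    and y: "norm y \<le> \<delta>"
  shows "(\<integral>\<^sup>+x\<in>S. ennreal \<bar>z (x - y) - z x\<bar> \<partial>lborel) \<le> ennreal (real CARD('d) * M * \<delta> * measure lborel S)"
proof (rule ennreal_le_epsilon)
  fix e :: real assume e: "e > 0"
  have [measurable]: "z \<in> borel_measurable borel" using z by auto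
  obtain d' where d': "d' > 0" "\<And>\<delta> \<eta>. \<delta> \<le> d' \<Longrightarrow> mollifier \<delta> \<eta> \<Longrightarrow> integrable lborel (conv \<eta> z) \<and> (LINT x|lborel. \<bar>conv \<eta> z x - z x\<bar>) \<le> e/2"
    using conv_L1_tendsto[OF z, of "e/2"] e by auto
  define r where "r = min \<delta> d'"
  have r: "r > 0" "r \<le> \<delta>" "r \<le> d'" using d d' by (auto simp: r_def)
  obtain \<eta> :: "real^'d \<Rightarrow> real" where \<eta>: "mollifier r \<eta>" using ex_mollifier r(1) by metis
  define F where "F = conv \<eta> z"
  have F: "integrable lborel F" "(LINT x|lborel. \<bar>F x - z x\<bar>) \<le> e/2" using d'(2)[OF r(3) \<eta>] by (auto simp: F_def)
  have [measurable]: "F \<in> borel_measurable borel" using F by auto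
  have M0: "M \<ge> 0" using M by (rule AE_lborel_nonneg_bound)
  define K where "K = real CARD('d) * M"
  have K: "K \<ge> 0" using M0 by (simp add: K_def)
  have FD: "(F has_derivative frechet_derivative F (at u)) (at u)" for u
    unfolding F_def by (rule smooth_has_derivative, rule Ck_conv[OF z mollifierD(1)[OF \<eta>]])
  have lip: "\<bar>F (x - y) - F x\<bar> \<le> K * \<delta>" if x: "x \<in> S" for x
  proof -
    have "norm (F (x - y) - F x) \<le> K * norm ((x - y) - x)"
    proof (rule differentiable_bound[where S="cball x \<delta>" and f'="\<lambda>x. frechet_derivative F (at x)"])
      show "(F has_derivative frechet_derivative F (at u)) (at u within cball x \<delta>)" for u
        using FD by (rule has_derivative_at_withinI)
      show "onorm (frechet_derivative F (at u)) \<le> K" if u: "u \<in> cball x \<delta>" for u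
      proof (rule onorm_le)
        \<comment> \<open>Moving along the segment uses up one \<open>\<delta>\<close> and
          mollifying at most another; hence the hypothesis on balls of radius
          \<open>2 * \<delta>\<close>.\<close>
        have "cball u r \<subseteq> cball x (2 * \<delta>)"
          using u r by (intro subsetI) (auto intro: order_trans[OF dist_triangle[of x _ u]])
        then have cu: "cball u r \<subseteq> \<Omega>" using d(2)[OF x] by blast
        have "\<bar>pdiff j F u\<bar> \<le> M" for j
          unfolding F_def pdiff_conv_weak[OF w z \<eta> cu]
          by (rule conv_bounded[OF \<eta> g]) (use M[of j] in eventually_elim, simp)
        moreover have "linear (frechet_derivative F (at u))"
          by (rule has_derivative_linear[OF FD])
        ultimately show "norm (frechet_derivative F (at u) v) \<le> K * norm v" for v
          unfolding K_def real_norm_def by (intro linear_bound_pdiff)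
      qed
    qed (use y d in \<open>auto simp: dist_norm\<close>)
    also have "\<dots> \<le> K * \<delta>" using y K by (intro mult_left_mono) auto
    finally show ?thesis by simp
  qed
  have e1: "(\<integral>\<^sup>+x. ennreal \<bar>F x - z x\<bar> \<partial>lborel) \<le> ennreal (e/2)"
    using F z by (subst nn_integral_eq_integral) (auto intro!: ennreal_leI)
  have e2: "(\<integral>\<^sup>+x. ennreal \<bar>F (x - y) - z (x - y)\<bar> \<partial>lborel) \<le> ennreal (e/2)"
    using e1 nn_integral_lborel_affine[of "\<lambda>x. ennreal \<bar>F x - z x\<bar>" 1 "- y"] by simp
  have "(\<integral>\<^sup>+x\<in>S. ennreal \<bar>z (x - y) - z x\<bar> \<partial>lborel)
      \<le> (\<integral>\<^sup>+x. ennreal \<bar>F (x - y) - z (x - y)\<bar> + (ennreal \<bar>F x - z x\<bar> + ennreal (K * \<delta>) * indicator S x) \<partial>lborel)"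
  proof (rule nn_integral_mono)
    fix x
    show "ennreal \<bar>z (x - y) - z x\<bar> * indicator S x \<le> ennreal \<bar>F (x - y) - z (x - y)\<bar> + (ennreal \<bar>F x - z x\<bar> + ennreal (K * \<delta>) * indicator S x)"
    proof (cases "x \<in> S")
      case True
      have "\<bar>z (x - y) - z x\<bar> \<le> \<bar>F (x - y) - z (x - y)\<bar> + (\<bar>F x - z x\<bar> + K * \<delta>)"
        using lip[OF True] by linarith
      then have "ennreal \<bar>z (x - y) - z x\<bar> \<le> ennreal (\<bar>F (x - y) - z (x - y)\<bar> + (\<bar>F x - z x\<bar> + K * \<delta>))"
        by (rule ennreal_leI)
      then show ?thesis using True K d by (simp add: ennreal_plus)
    qed simp
  qed
  also have "\<dots> = (\<integral>\<^sup>+x. ennreal \<bar>F (x - y) - z (x - y)\<bar> \<partial>lborel) + ((\<integral>\<^sup>+x. ennreal \<bar>F x - z x\<bar> \<partial>lborel) + ennreal (K * \<delta>) * emeasure lborel S)"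
    by (simp add: nn_integral_add nn_integral_cmult)
  also have "\<dots> \<le> ennreal (e/2) + (ennreal (e/2) + ennreal (K * \<delta>) * emeasure lborel S)"
    by (intro add_mono e1 e2 order_refl)
  also have "\<dots> = ennreal (K * \<delta> * measure lborel S) + ennreal e"
    using S(2) K d e by (simp add: emeasure_eq_ennreal_measure ennreal_mult'' add.assoc[symmetric] flip: ennreal_plus)
  finally show "(\<integral>\<^sup>+x\<in>S. ennreal \<bar>z (x - y) - z x\<bar> \<partial>lborel) \<le> ennreal (real CARD('d) * M * \<delta> * measure lborel S) + ennreal e"
    by (simp add: K_def)
qed

text \<open>Compactness of Rellich type. Mollified at a fixed scale, the sequence tends to zero
  pointwise, because the translated kernel is a fixed integrable function to test with. The
  mollification error on a compact part is bounded uniformly in \<open>h\<close> by the gradient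
  bound, and the layer outside is paid for by the sup bound.\<close>

lemma weakstar_bounded_gradient_L1:
  fixes z :: "nat \<Rightarrow> real^'d \<Rightarrow> real"
  assumes \<Omega>: "open \<Omega>" "bounded \<Omega>"
    and w: "\<And>h j. weak_pdiff \<Omega> j (z h) (g h j)" and z: "\<And>h. integrable lborel (z h)" and g: "\<And>h j. integrable lborel (g h j)"
    and M: "\<And>h j. AE x in lborel. \<bar>g h j x\<bar> \<le> M" "\<And>h. AE x in lborel. \<bar>z h x\<bar> \<le> M"
    and off: "\<And>h x. x \<notin> \<Omega> \<Longrightarrow> z h x = 0"
    and wk: "\<And>f. integrable lborel f \<Longrightarrow> (\<lambda>h. LINT x|lborel. z h x * f x) \<longlonglongrightarrow> 0"
  shows "(\<lambda>h. LINT x|lborel. \<bar>z h x\<bar>) \<longlonglongrightarrow> 0"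
proof (rule LIMSEQ_I)
  fix e :: real assume e: "e > 0"
  have M0: "M \<ge> 0" using M(2)[of 0] by (rule AE_lborel_nonneg_bound)
  have Om[measurable]: "\<Omega> \<in> sets borel" using \<Omega> by simp
  have Omf: "emeasure lborel \<Omega> < \<infinity>" using emeasure_bounded_finite[OF \<Omega>(2)] by simp
  have iOm: "integrable lborel (indicator \<Omega> :: _ \<Rightarrow> real)" using Omf by (intro integrable_real_indicator) auto
  obtain C :: "nat \<Rightarrow> (real^'d) set" where C: "\<And>n. compact (C n)" "\<And>n. C n \<subseteq> \<Omega>" "\<And>n. C n \<subseteq> interior (C (Suc n))" "(\<Union>n. C n) = \<Omega>"
    using open_Union_compact_subsets[OF \<Omega>(1)] by metis
  have Cm[measurable]: "C n \<in> sets borel" for n using C(1) by (simp add: compact_imp_closed)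
  have Cf: "emeasure lborel (C n) < \<infinity>" for n using emeasure_bounded_finite[OF compact_imp_bounded[OF C(1)]] by simp
  have iC: "integrable lborel (indicator (C n) :: _ \<Rightarrow> real)" for n using Cf by (intro integrable_real_indicator) auto
  have "(\<lambda>n. LINT x|lborel. indicator (C n) x) \<longlonglongrightarrow> (LINT x|lborel. indicator \<Omega> x :: real)"
  proof (rule integral_dominated_convergence[where w="indicator \<Omega>"])
    show "AE x in lborel. (\<lambda>n. indicator (C n) x :: real) \<longlonglongrightarrow> indicator \<Omega> x"
      by (intro AE_I2 compact_exhaustion_indicator_tendsto C)
    show "AE x in lborel. norm (indicator (C n) x :: real) \<le> indicator \<Omega> x" for n
      using C(2)[of n] by (intro AE_I2) (auto simp: indicator_def)
  qed (use iOm in auto)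
  then have "(\<lambda>n. measure lborel (C n)) \<longlonglongrightarrow> measure lborel \<Omega>" by simp
  moreover have "e / (3 * (M + 1)) > 0" using e M0 by simp
  ultimately obtain n where "norm (measure lborel (C n) - measure lborel \<Omega>) < e / (3 * (M + 1))"
    using LIMSEQ_D by blast
  then have n: "measure lborel \<Omega> - measure lborel (C n) < e / (3 * (M + 1))" by simp
  have mle: "measure lborel (C n) \<le> measure lborel \<Omega>"
    using C(2) Omf by (intro measure_mono_fmeasurable) (auto simp: fmeasurable_def)
  have "M * (measure lborel \<Omega> - measure lborel (C n)) \<le> (M + 1) * (e / (3 * (M + 1)))"
    using n M0 mle by (intro mult_mono) auto
  also have "(M + 1) * (e / (3 * (M + 1))) = e / 3" using M0 by (auto simp: divide_simps)
  finally have n': "M * (measure lborel \<Omega> - measure lborel (C n)) \<le> e / 3" .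
  obtain r where r: "r > 0" "(\<Union>x\<in>C n. ball x r) \<subseteq> \<Omega>"
    by (rule compact_subset_open_imp_ball_epsilon_subset[OF C(1) \<Omega>(1) C(2)])
  define K where "K = real CARD('d) * M * measure lborel (C n)"
  have K: "K \<ge> 0" using M0 by (simp add: K_def)
  \<comment> \<open>The bound \<open>r/3\<close> keeps balls of radius \<open>2 * \<delta>\<close>
    in \<open>\<Omega>\<close>; the other one makes the mollification error at most
    \<open>e/6\<close>. Together with \<open>e/3\<close> for the layer and \<open>e/6\<close> for
    the mollified part the sum stays below \<open>e\<close>.\<close>
  define \<delta> where "\<delta> = min (r/3) (e / (6 * (K + 1)))"
  have \<delta>: "\<delta> > 0" "2 * \<delta> < r" using r e K by (auto simp: \<delta>_def add_nonneg_pos min_def)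
  have "K * \<delta> \<le> (K + 1) * (e / (6 * (K + 1)))"
    using K \<delta> by (intro mult_mono) (auto simp: \<delta>_def)
  also have "(K + 1) * (e / (6 * (K + 1))) = e / 6" using K by (auto simp: divide_simps)
  finally have K\<delta>: "K * \<delta> \<le> e / 6" .
  obtain \<eta> :: "real^'d \<Rightarrow> real" where \<eta>: "mollifier \<delta> \<eta>" using ex_mollifier \<delta>(1) by metis
  note MM = mollifierD[OF \<eta>]
  define F where "F h = conv \<eta> (z h)" for h
  have Fm[measurable]: "F h \<in> borel_measurable borel" for h
    using Ck_conv[OF z MM(1), of 0] by (auto simp: F_def intro: borel_measurable_continuous_onI)
  have zm[measurable]: "z h \<in> borel_measurable borel" for h using z by auto
  have FM: "\<bar>F h x\<bar> \<le> M" for h x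
    unfolding F_def by (rule conv_bounded[OF \<eta> z]) (use M(2)[of h] in eventually_elim, simp)
  have "(\<lambda>h. LINT x|lborel. indicator (C n) x * \<bar>F h x\<bar>) \<longlonglongrightarrow> (LINT x|(lborel::(real^'d) measure). 0)"
  proof (rule integral_dominated_convergence[where w="\<lambda>x. indicator (C n) x * M"])
    show "AE x in lborel. (\<lambda>h. indicator (C n) x * \<bar>F h x\<bar>) \<longlonglongrightarrow> 0"
    proof (rule AE_I2)
      fix x
      have "(\<lambda>h. LINT y|lborel. z h y * \<eta> (x - y)) \<longlonglongrightarrow> 0"
        by (rule wk, rule integrable_lborel_translate[OF MM(5)])
      then have "(\<lambda>h. F h x) \<longlonglongrightarrow> 0" by (simp add: F_def conv_def mult.commute)
      then show "(\<lambda>h. indicator (C n) x * \<bar>F h x\<bar>) \<longlonglongrightarrow> 0"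
        by (intro tendsto_mult_right_zero tendsto_rabs_zero)
    qed
    show "AE x in lborel. norm (indicator (C n) x * \<bar>F h x\<bar>) \<le> indicator (C n) x * M" for h
      using FM by (intro AE_I2) (auto simp: abs_mult indicator_def)
  qed (use iC in auto)
  from LIMSEQ_D[OF this, of "e/6"] e obtain N where N: "\<And>h. h \<ge> N \<Longrightarrow> norm ((LINT x|lborel. indicator (C n) x * \<bar>F h x\<bar>) - (LINT x|(lborel::(real^'d) measure). 0)) < e/6"
    by auto
  show "\<exists>no. \<forall>h\<ge>no. norm ((LINT x|lborel. \<bar>z h x\<bar>) - 0) < e"
  proof (intro exI[of _ N] allI impI)
    fix h assume h: "h \<ge> N"
    have N': "(LINT x|lborel. indicator (C n) x * \<bar>F h x\<bar>) < e/6" using N[OF h] by simp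
    have iF: "integrable lborel (\<lambda>x. indicator (C n) x * \<bar>F h x\<bar>)"
      by (rule Bochner_Integration.integrable_bound[where f="\<lambda>x. indicator (C n) x * M"])
         (use iC FM M0 in \<open>auto intro!: AE_I2 simp: abs_mult split: split_indicator\<close>)
    have iFz: "integrable lborel (\<lambda>x. indicator (C n) x * \<bar>F h x - z h x\<bar>)"
    proof (rule Bochner_Integration.integrable_bound[where f="\<lambda>x. indicator (C n) x * \<bar>F h x\<bar> + \<bar>z h x\<bar>"])
      show "AE x in lborel. norm (indicator (C n) x * \<bar>F h x - z h x\<bar>) \<le> norm (indicator (C n) x * \<bar>F h x\<bar> + \<bar>z h x\<bar>)"
        by (intro AE_I2) (auto simp: indicator_def)
    qed (use iF z in auto)
    have "(\<integral>\<^sup>+x\<in>C n. ennreal \<bar>F h x - z h x\<bar> \<partial>lborel) \<le> ennreal (real CARD('d) * M * \<delta> * measure lborel (C n))"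
      unfolding F_def
    proof (rule conv_L1_diff[OF \<eta> z Cm], rule weak_pdiff_translation_L1[OF w z g M(1) Cm Cf \<delta>(1)])
      show "cball x (2 * \<delta>) \<subseteq> \<Omega>" if "x \<in> C n" for x
        using r(2) that \<delta>(2) by (force simp: subset_eq)
    qed simp
    also have "real CARD('d) * M * \<delta> * measure lborel (C n) = K * \<delta>" by (simp add: K_def)
    also have "ennreal (K * \<delta>) \<le> ennreal (e/6)" by (intro ennreal_leI K\<delta>)
    also have "(\<integral>\<^sup>+x\<in>C n. ennreal \<bar>F h x - z h x\<bar> \<partial>lborel) = (\<integral>\<^sup>+x. ennreal (indicator (C n) x * \<bar>F h x - z h x\<bar>) \<partial>lborel)"
      by (intro nn_integral_cong) (auto simp: indicator_def)
    finally have b1: "(LINT x|lborel. indicator (C n) x * \<bar>F h x - z h x\<bar>) \<le> e/6"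
      using e iFz by (subst (asm) nn_integral_eq_integral) (auto simp: ennreal_le_iff)
    have "(LINT x|lborel. \<bar>z h x\<bar>) \<le> (LINT x|lborel. M * (indicator \<Omega> x - indicator (C n) x) + (indicator (C n) x * \<bar>F h x\<bar> + indicator (C n) x * \<bar>F h x - z h x\<bar>))"
    proof (rule integral_mono_AE)
      show "AE x in lborel. \<bar>z h x\<bar> \<le> M * (indicator \<Omega> x - indicator (C n) x) + (indicator (C n) x * \<bar>F h x\<bar> + indicator (C n) x * \<bar>F h x - z h x\<bar>)"
        using M(2)[of h]
      proof eventually_elim
        case (elim x)
        then show ?case using off[of x h] C(2)[of n] by (cases "x \<in> \<Omega>"; cases "x \<in> C n") auto
      qed
    qed (use z iOm iC iF iFz in auto)
    also have "\<dots> = M * (measure lborel \<Omega> - measure lborel (C n)) + ((LINT x|lborel. indicator (C n) x * \<bar>F h x\<bar>) + (LINT x|lborel. indicator (C n) x * \<bar>F h x - z h x\<bar>))"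
      using iOm iC iF iFz by simp
    also have "\<dots> < e" using n' N' b1 e by linarith
    finally show "norm ((LINT x|lborel. \<bar>z h x\<bar>) - 0) < e" by simp
  qed
qed


subsection \<open>Uniform boundedness in the dual of \<open>L\<^sup>1\<close>\<close>

text \<open>
  One step of the gliding hump argument for the uniform boundedness principle. Summable steps
  \<open>r = (1/3)\<^sup>n\<close> have a tail of half the size of the last step, so a pairing of at least \<open>3/4\<close> of the
  maximal gain cannot be undone by the later steps.
\<close>

lemma Linf_step:
  fixes a :: "'a::euclidean_space \<Rightarrow> real"
  assumes a[measurable]: "a \<in> borel_measurable borel" and S: "S \<in> sets borel" "emeasure lborel S < \<infinity>" "\<And>x. x \<notin> S \<Longrightarrow> a x = 0"
    and bd: "AE x in lborel. \<bar>a x\<bar> \<le> B" and nb: "\<not> (AE x in lborel. \<bar>a x\<bar> \<le> L)" and L: "L > 0"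
    and \<psi>: "integrable lborel \<psi>" and r: "r > 0"
  shows "\<exists>s \<psi>'. integrable lborel \<psi>' \<and> (LINT x|lborel. \<bar>\<psi>' x - \<psi> x\<bar>) \<le> r \<and> s \<ge> L \<and>
    (AE x in lborel. \<bar>a x\<bar> \<le> s) \<and> \<bar>LINT x|lborel. a x * \<psi>' x\<bar> \<ge> 3/4 * s * r"
proof -
  \<comment> \<open>Replaces the essential supremum: for the least \<open>k\<close> satisfying
    \<open>P\<close>, the value \<open>s\<close> bounds \<open>a\<close> almost everywhere while
    \<open>3/4 * s\<close> does not. That \<open>k = 0\<close> fails is the assumption that
    \<open>L\<close> is no bound.\<close>
  define P where "P k \<longleftrightarrow> (AE x in lborel. \<bar>a x\<bar> \<le> L * (4/3) ^ k)" for k :: nat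
  obtain k where "B / L < (4/3) ^ k" using real_arch_pow[of "4/3" "B/L"] by auto
  then have "B \<le> L * (4/3) ^ k" using L by (simp add: field_simps)
  then have "P k" unfolding P_def using bd by (auto elim!: eventually_mono)
  define m where "m = (LEAST k. P k)"
  have Pm: "P m" unfolding m_def by (rule LeastI) (rule \<open>P k\<close>)
  have "m \<noteq> 0" using Pm nb by (intro notI) (simp add: P_def)
  then obtain m' where m': "m = Suc m'" by (cases m) auto
  have nP: "\<not> P m'" using not_less_Least[of m' P] m' by (simp add: m_def)
  define s where "s = L * (4/3) ^ m"
  have s: "s \<ge> L" "s > 0" using L by (auto simp: s_def)
  have sb: "AE x in lborel. \<bar>a x\<bar> \<le> s" using Pm by (simp add: P_def s_def)
  have sn: "\<not> (AE x in lborel. \<bar>a x\<bar> \<le> 3/4 * s)" using nP by (simp add: P_def s_def m' mult.assoc)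
  define E where "E = {x. \<bar>a x\<bar> > 3/4 * s}"
  have Em[measurable]: "E \<in> sets borel" unfolding E_def by measurable
  have ES: "E \<subseteq> S" using S(3) s by (force simp: E_def)
  have Ef: "emeasure lborel E < \<infinity>" using emeasure_mono[OF ES, of lborel] S by (auto intro: le_less_trans)
  have E0: "measure lborel E > 0"
  proof (rule ccontr)
    assume "\<not> ?thesis"
    then have "measure lborel E = 0" using measure_nonneg[of lborel E] by linarith
    then have "emeasure lborel E = 0" using Ef by (simp add: emeasure_eq_ennreal_measure)
    then have "AE x in lborel. x \<notin> E" by (intro AE_not_in) (auto simp: null_sets_def)
    then have "AE x in lborel. \<bar>a x\<bar> \<le> 3/4 * s" by eventually_elim (simp add: E_def)
    with sn show False by simp
  qed
  have iE: "integrable lborel (indicator E :: 'a \<Rightarrow> real)" using Ef by (intro integrable_real_indicator) auto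
  \<comment> \<open>Extremal direction: \<open>L^1\<close> norm at most \<open>r\<close>, all mass
    where \<open>a\<close> exceeds \<open>3/4 * s\<close> in absolute value, sign matched to that of
    \<open>a\<close>.\<close>
  define \<rho> where "\<rho> x = r / measure lborel E * (sgn (a x) * indicator E x)" for x
  have i0: "integrable lborel (\<lambda>x. sgn (a x) * indicator E x)"
    by (rule Bochner_Integration.integrable_bound[OF iE]) (auto intro!: AE_I2 simp: abs_mult abs_sgn_eq split: split_indicator)
  have i\<rho>: "integrable lborel \<rho>" unfolding \<rho>_def using i0 by (intro integrable_mult_right)
  have n\<rho>: "(LINT x|lborel. \<bar>\<rho> x\<bar>) \<le> r"
  proof -
    have "(LINT x|lborel. \<bar>\<rho> x\<bar>) \<le> (LINT x|lborel. r / measure lborel E * indicator E x)"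
    proof (rule integral_mono[OF integrable_abs[OF i\<rho>] integrable_mult_right])
      show "\<bar>\<rho> x\<bar> \<le> r / measure lborel E * indicator E x" for x
        using r E0 by (auto simp: \<rho>_def abs_mult abs_sgn_eq split: split_indicator)
    qed (rule iE)
    then show ?thesis using iE E0 by simp
  qed
  have ai: "integrable lborel (\<lambda>x. a x * f x)" if "integrable lborel f" for f :: "'a \<Rightarrow> real"
  proof (rule Bochner_Integration.integrable_bound[where f="\<lambda>x. s * f x"])
    have [measurable]: "f \<in> borel_measurable borel" using that by auto
    show "(\<lambda>x. a x * f x) \<in> borel_measurable lborel" by measurable
    show "AE x in lborel. norm (a x * f x) \<le> norm (s * f x)"
      using sb by eventually_elim (use s in \<open>auto simp: abs_mult intro!: mult_right_mono\<close>)
  qed (use that in auto)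
  have A\<rho>: "(LINT x|lborel. a x * \<rho> x) \<ge> 3/4 * s * r"
  proof -
    have "3/4 * s * r = (LINT x|lborel. (3/4 * s * (r / measure lborel E)) * indicator E x)"
      using iE E0 by simp
    also have "\<dots> \<le> (LINT x|lborel. a x * \<rho> x)"
    proof (rule integral_mono[OF _ ai[OF i\<rho>]])
      show "integrable lborel (\<lambda>x. (3/4 * s * (r / measure lborel E)) * indicator E x)" using iE by auto
      fix x
      have "a x * \<rho> x = (r / measure lborel E) * (\<bar>a x\<bar> * indicator E x)"
        by (simp add: \<rho>_def abs_sgn mult_ac)
      moreover have "(3/4 * s) * indicator E x \<le> \<bar>a x\<bar> * indicator E x"
        by (auto simp: E_def split: split_indicator)
      then have "(r / measure lborel E) * ((3/4 * s) * indicator E x) \<le> (r / measure lborel E) * (\<bar>a x\<bar> * indicator E x)"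
        using r E0 by (intro mult_left_mono) auto
      ultimately show "(3/4 * s * (r / measure lborel E)) * indicator E x \<le> a x * \<rho> x" by (simp add: mult_ac)
    qed
    finally show ?thesis .
  qed
  let ?I = "LINT x|lborel. a x * \<psi> x" and ?R = "LINT x|lborel. a x * \<rho> x"
  have plus: "(LINT x|lborel. a x * (\<psi> x + \<rho> x)) = ?I + ?R" "(LINT x|lborel. a x * (\<psi> x - \<rho> x)) = ?I - ?R"
    using ai[OF \<psi>] ai[OF i\<rho>] by (simp_all add: distrib_left right_diff_distrib)
  \<comment> \<open>The larger of the absolute values of \<open>?I + ?R\<close> and
    \<open>?I - ?R\<close> is at least that of \<open>?R\<close>, whatever the earlier pairing was;
    the sign of the correction is chosen accordingly.\<close>
  have "\<bar>?I + ?R\<bar> \<ge> 3/4 * s * r \<or> \<bar>?I - ?R\<bar> \<ge> 3/4 * s * r"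
    using A\<rho> by linarith
  then show ?thesis
  proof
    assume "\<bar>?I + ?R\<bar> \<ge> 3/4 * s * r"
    then show ?thesis using \<psi> i\<rho> n\<rho> s sb plus
      by (intro exI[of _ s] exI[of _ "\<lambda>x. \<psi> x + \<rho> x"]) auto
  next
    assume "\<bar>?I - ?R\<bar> \<ge> 3/4 * s * r"
    then show ?thesis using \<psi> i\<rho> n\<rho> s sb plus
      by (intro exI[of _ s] exI[of _ "\<lambda>x. \<psi> x - \<rho> x"]) auto
  qed
qed

text \<open>Completeness of \<open>L^1\<close> with an explicit rate. The factor \<open>3/2\<close>
  is the sum of the geometric series with ratio \<open>1/3\<close>; used at \<open>Suc n\<close>, it
  leaves a tail of at most half the size allowed for step \<open>n\<close>.\<close>

lemma L1_telescoping_limit: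
  fixes \<psi> :: "nat \<Rightarrow> 'a::euclidean_space \<Rightarrow> real"
  assumes \<psi>: "\<And>n. integrable lborel (\<psi> n)" and d: "\<And>n. (LINT x|lborel. \<bar>\<psi> (Suc n) x - \<psi> n x\<bar>) \<le> c * (1/3) ^ n" and c: "c \<ge> 0"
  shows "\<exists>f. integrable lborel f \<and> (\<forall>n. (LINT x|lborel. \<bar>f x - \<psi> n x\<bar>) \<le> c * (3/2) * (1/3) ^ n)"
proof -
  have [measurable]: "\<psi> n \<in> borel_measurable borel" for n using \<psi> by auto
  define D where "D n x = \<psi> (Suc n) x - \<psi> n x" for n x
  have [measurable]: "D n \<in> borel_measurable borel" for n unfolding D_def by measurable
  have iD: "integrable lborel (D n)" for n unfolding D_def using \<psi> by auto
  have nD: "(\<integral>\<^sup>+x. ennreal \<bar>D n x\<bar> \<partial>lborel) \<le> ennreal (c * (1/3) ^ n)" for n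
    using d[of n] integrable_abs[OF iD[of n]] by (subst nn_integral_eq_integral) (auto intro!: ennreal_leI simp: D_def[symmetric])
  have tail: "(\<integral>\<^sup>+x. (\<Sum>k. ennreal \<bar>D (k + n) x\<bar>) \<partial>lborel) \<le> ennreal (c * (3/2) * (1/3) ^ n)" for n
  proof -
    have "(\<integral>\<^sup>+x. (\<Sum>k. ennreal \<bar>D (k + n) x\<bar>) \<partial>lborel) = (\<Sum>k. \<integral>\<^sup>+x. ennreal \<bar>D (k + n) x\<bar> \<partial>lborel)"
      by (rule nn_integral_suminf) measurable
    also have "\<dots> \<le> (\<Sum>k. ennreal (c * (1/3) ^ (k + n)))" by (intro suminf_le nD) auto
    also have "\<dots> = ennreal (\<Sum>k. c * (1/3) ^ (k + n))"
    proof (rule suminf_ennreal2)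
      show "summable (\<lambda>k. c * (1/3::real) ^ (k + n))"
        unfolding power_add by (intro summable_mult summable_mult2 summable_geometric) simp
    qed (use c in auto)
    also have "(\<Sum>k. c * (1/3) ^ (k + n)) = c * (3/2) * (1/3) ^ n"
    proof -
      have "(\<Sum>k. c * (1/3) ^ (k + n)) = (\<Sum>k. (c * (1/3) ^ n) * (1/3) ^ k)" by (simp add: power_add mult_ac)
      also have "\<dots> = (c * (1/3) ^ n) * (\<Sum>k. (1/3) ^ k)" by (rule suminf_mult) (simp add: summable_geometric)
      finally show ?thesis by (simp add: suminf_geometric)
    qed
    finally show ?thesis .
  qed
  have "(\<integral>\<^sup>+x. (\<Sum>k. ennreal \<bar>D k x\<bar>) \<partial>lborel) \<noteq> \<infinity>"
    using tail[of 0] by (auto simp: top_unique)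
  then have "AE x in lborel. (\<Sum>k. ennreal \<bar>D k x\<bar>) \<noteq> \<infinity>"
    by (intro nn_integral_PInf_AE) auto
  then have sm: "AE x in lborel. summable (\<lambda>k. \<bar>D k x\<bar>)"
    by eventually_elim (auto intro!: summable_suminf_not_top)
  define f where "f x = \<psi> 0 x + (\<Sum>k. D k x)" for x
  have [measurable]: "f \<in> borel_measurable borel" unfolding f_def by measurable
  have partial: "\<psi> n x = \<psi> 0 x + (\<Sum>k<n. D k x)" for n x
    by (induction n) (auto simp: D_def)
  have le: "(\<integral>\<^sup>+x. ennreal \<bar>f x - \<psi> n x\<bar> \<partial>lborel) \<le> ennreal (c * (3/2) * (1/3) ^ n)" for n
  proof -
    have "(\<integral>\<^sup>+x. ennreal \<bar>f x - \<psi> n x\<bar> \<partial>lborel) \<le> (\<integral>\<^sup>+x. (\<Sum>k. ennreal \<bar>D (k + n) x\<bar>) \<partial>lborel)"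
    proof (rule nn_integral_mono_AE)
      show "AE x in lborel. ennreal \<bar>f x - \<psi> n x\<bar> \<le> (\<Sum>k. ennreal \<bar>D (k + n) x\<bar>)"
        using sm
      proof eventually_elim
        case (elim x)
        have s1: "summable (\<lambda>k. D k x)" using elim by (rule summable_rabs_cancel)
        have s2: "summable (\<lambda>k. \<bar>D (k + n) x\<bar>)" using elim by (simp add: summable_iff_shift[of "\<lambda>k. \<bar>D k x\<bar>"])
        have "f x - \<psi> n x = (\<Sum>k. D (k + n) x)"
          using suminf_split_initial_segment[OF s1, of n] partial[of n x] by (simp add: f_def)
        also have "\<bar>\<dots>\<bar> \<le> (\<Sum>k. \<bar>D (k + n) x\<bar>)" using s2 by (rule summable_rabs)
        finally have "ennreal \<bar>f x - \<psi> n x\<bar> \<le> ennreal (\<Sum>k. \<bar>D (k + n) x\<bar>)" by (rule ennreal_leI)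
        also have "\<dots> = (\<Sum>k. ennreal \<bar>D (k + n) x\<bar>)" using s2 by (intro suminf_ennreal2[symmetric]) auto
        finally show ?case .
      qed
    qed
    also note tail[of n]
    finally show ?thesis .
  qed
  have ifp: "integrable lborel (\<lambda>x. f x - \<psi> n x)" for n
    unfolding integrable_iff_bounded using le[of n] by (auto intro: le_less_trans)
  have "integrable lborel (\<lambda>x. (f x - \<psi> 0 x) + \<psi> 0 x)" using ifp \<psi> by (rule Bochner_Integration.integrable_add)
  moreover have "(LINT x|lborel. \<bar>f x - \<psi> n x\<bar>) \<le> c * (3/2) * (1/3) ^ n" for n
    using le[of n] ifp[of n] c by (subst (asm) nn_integral_eq_integral) (auto simp: ennreal_le_iff)
  ultimately show ?thesis by auto
qed

text \<open>If no bound works, some member exceeds \<open>4 ^ n\<close> for every \<open>n\<close>.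
  Steps of size \<open>(1/3) ^ n\<close> are summable, yet \<open>4 ^ n * (1/3) ^ n\<close> is
  unbounded, so the limit of the steps has unbounded pairings.\<close>

lemma uniform_boundedness_Linf:
  fixes a :: "nat \<Rightarrow> 'a::euclidean_space \<Rightarrow> real"
  assumes a[measurable]: "\<And>h. a h \<in> borel_measurable borel" and S: "S \<in> sets borel" "emeasure lborel S < \<infinity>" "\<And>h x. x \<notin> S \<Longrightarrow> a h x = 0"
    and bd: "\<And>h. \<exists>B. AE x in lborel. \<bar>a h x\<bar> \<le> B"
    and pb: "\<And>f. integrable lborel f \<Longrightarrow> \<exists>B. \<forall>h. \<bar>LINT x|lborel. a h x * f x\<bar> \<le> B"
  shows "\<exists>M. \<forall>h. AE x in lborel. \<bar>a h x\<bar> \<le> M"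
proof (rule ccontr)
  assume "\<not> ?thesis"
  then have un: "\<exists>h. \<not> (AE x in lborel. \<bar>a h x\<bar> \<le> M)" for M by blast
  define Q where "Q n \<psi> \<psi>' \<longleftrightarrow> (LINT x|lborel. \<bar>\<psi>' x - \<psi> x\<bar>) \<le> 1 * (1/3) ^ n \<and>
    (\<exists>h s. s \<ge> 4 ^ n \<and> (AE x in lborel. \<bar>a h x\<bar> \<le> s) \<and> \<bar>LINT x|lborel. a h x * \<psi>' x\<bar> \<ge> 3/4 * s * (1/3) ^ n)"
    for n :: nat and \<psi> \<psi>' :: "'a \<Rightarrow> real"
  have step: "\<exists>\<psi>'. integrable lborel \<psi>' \<and> Q n \<psi> \<psi>'" if \<psi>: "integrable lborel \<psi>" for n \<psi>
  proof -
    obtain h where h: "\<not> (AE x in lborel. \<bar>a h x\<bar> \<le> 4 ^ n)" using un by blast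
    obtain B where B: "AE x in lborel. \<bar>a h x\<bar> \<le> B" using bd by blast
    have "\<exists>s \<psi>'. integrable lborel \<psi>' \<and> (LINT x|lborel. \<bar>\<psi>' x - \<psi> x\<bar>) \<le> (1/3) ^ n \<and> s \<ge> 4 ^ n \<and>
        (AE x in lborel. \<bar>a h x\<bar> \<le> s) \<and> \<bar>LINT x|lborel. a h x * \<psi>' x\<bar> \<ge> 3/4 * s * (1/3) ^ n"
      by (rule Linf_step[OF a S B h _ \<psi>]) auto
    then show ?thesis unfolding Q_def by auto
  qed
  have "\<exists>\<psi>. \<forall>n. integrable lborel (\<psi> n) \<and> Q n (\<psi> n) (\<psi> (Suc n))"
    by (rule dependent_nat_choice[where P="\<lambda>_ f. integrable lborel f"]) (auto intro: step exI[of _ "\<lambda>x. 0"])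
  then obtain \<psi> where \<psi>: "\<And>n. integrable lborel (\<psi> n)" "\<And>n. Q n (\<psi> n) (\<psi> (Suc n))" by blast
  obtain f where f: "integrable lborel f" "\<And>n. (LINT x|lborel. \<bar>f x - \<psi> n x\<bar>) \<le> 1 * (3/2) * (1/3) ^ n"
    using L1_telescoping_limit[of \<psi> 1] \<psi> unfolding Q_def by auto
  obtain B where B: "\<And>h. \<bar>LINT x|lborel. a h x * f x\<bar> \<le> B" using pb[OF f(1)] by blast
  \<comment> \<open>Of the gain \<open>3/4 * s * (1/3) ^ n\<close> the later steps can destroy at
    most \<open>s * (3/2) * (1/3) ^ Suc n\<close>, which is half of \<open>s * (1/3) ^ n\<close>; a
    quarter remains.\<close>
  have big: "1/4 * (4/3) ^ n \<le> B" for n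
  proof -
    obtain h s where hs: "s \<ge> 4 ^ n" "AE x in lborel. \<bar>a h x\<bar> \<le> s" "\<bar>LINT x|lborel. a h x * \<psi> (Suc n) x\<bar> \<ge> 3/4 * s * (1/3) ^ n"
      using \<psi>(2)[of n] unfolding Q_def by blast
    have s0: "s > 0" using hs(1) less_le_trans[of 0 "4 ^ n" s] by simp
    have ai: "integrable lborel (\<lambda>x. a h x * g x)" if "integrable lborel g" for g :: "'a \<Rightarrow> real"
    proof (rule Bochner_Integration.integrable_bound[where f="\<lambda>x. s * g x"])
      have [measurable]: "g \<in> borel_measurable borel" using that by auto
      show "(\<lambda>x. a h x * g x) \<in> borel_measurable lborel" by measurable
      show "AE x in lborel. norm (a h x * g x) \<le> norm (s * g x)"
        using hs(2) by eventually_elim (use s0 in \<open>auto simp: abs_mult intro!: mult_right_mono\<close>)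
    qed (use that in auto)
    have fi: "integrable lborel (\<lambda>x. f x - \<psi> (Suc n) x)" using f \<psi> by auto
    have "(LINT x|lborel. a h x * f x) - (LINT x|lborel. a h x * \<psi> (Suc n) x) = (LINT x|lborel. a h x * (f x - \<psi> (Suc n) x))"
      using ai[OF f(1)] ai[OF \<psi>(1)] by (simp add: right_diff_distrib)
    then have "\<bar>(LINT x|lborel. a h x * f x) - (LINT x|lborel. a h x * \<psi> (Suc n) x)\<bar> \<le> (LINT x|lborel. norm (a h x * (f x - \<psi> (Suc n) x)))"
      using integral_norm_bound[of lborel "\<lambda>x. a h x * (f x - \<psi> (Suc n) x)"] by simp
    also have "\<dots> \<le> (LINT x|lborel. s * \<bar>f x - \<psi> (Suc n) x\<bar>)"
    proof (rule integral_mono_AE)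
      show "AE x in lborel. norm (a h x * (f x - \<psi> (Suc n) x)) \<le> s * \<bar>f x - \<psi> (Suc n) x\<bar>"
        using hs(2) by eventually_elim (auto simp: abs_mult intro!: mult_right_mono)
    qed (use ai[OF fi] fi in auto)
    also have "\<dots> = s * (LINT x|lborel. \<bar>f x - \<psi> (Suc n) x\<bar>)" by simp
    also have "\<dots> \<le> s * (1 * (3/2) * (1/3) ^ Suc n)" using s0 by (intro mult_left_mono f(2)) simp
    finally have "\<bar>LINT x|lborel. a h x * f x\<bar> \<ge> 3/4 * s * (1/3) ^ n - s * (1 * (3/2) * (1/3) ^ Suc n)"
      using hs(3) by linarith
    also have "3/4 * s * (1/3) ^ n - s * (1 * (3/2) * (1/3) ^ Suc n) = 1/4 * (s * (1/3) ^ n)" by simp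
    finally have "B \<ge> 1/4 * (s * (1/3) ^ n)" using B[of h] by linarith
    moreover have "s * (1/3) ^ n \<ge> 4 ^ n * (1/3) ^ n" using hs(1) by (intro mult_right_mono) auto
    ultimately show ?thesis by (simp add: power_divide)
  qed
  obtain n where "4 * B < (4/3) ^ n" using real_arch_pow[of "4/3" "4*B"] by auto
  with big[of n] show False by linarith
qed


subsection \<open>Integrands and their zero sets\<close>

text \<open>On the compact set where \<open>W\<close> is at least \<open>\<kappa>\<close>, the
  distance to the zero set has a positive minimum. Compactness confines this to bounded matrices,
  which is why the first inclusion relies on uniformly bounded gradients.\<close>

lemma small_near_zero_set:
  fixes W :: "'a::euclidean_space \<Rightarrow> real"
  assumes W: "continuous_on UNIV W" "W -` {0} \<noteq> {}" and k: "\<kappa> > 0"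
  shows "\<exists>\<delta>>0. \<forall>x. norm x \<le> R \<longrightarrow> infdist x (W -` {0}) \<le> \<delta> \<longrightarrow> W x < \<kappa>"
proof -
  let ?Z = "W -` {0}"
  have cZ: "closed ?Z" using continuous_closed_vimage[OF closed_singleton[of 0], of W] W(1) continuous_on_eq_continuous_at open_UNIV by blast
  define K where "K = cball 0 R \<inter> {x. \<kappa> \<le> W x}"
  have cK: "compact K" unfolding K_def using W(1) by (intro compact_Int_closed closed_Collect_le) auto
  show ?thesis
  proof (cases "K = {}")
    case True
    then show ?thesis by (intro exI[of _ 1]) (auto simp: K_def not_le[symmetric])
  next
    case False
    have "continuous_on K (\<lambda>x. infdist x ?Z)" by (intro continuous_intros)
    then obtain m where m: "m \<in> K" "\<And>x. x \<in> K \<Longrightarrow> infdist m ?Z \<le> infdist x ?Z"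
      using continuous_attains_inf[OF cK False] by blast
    have "m \<notin> ?Z" using m(1) k by (auto simp: K_def)
    then have pos: "infdist m ?Z > 0" using infdist_pos_not_in_closed[OF cZ W(2)] by simp
    show ?thesis
    proof (intro exI[of _ "infdist m ?Z / 2"] conjI allI impI)
      fix x assume x: "norm x \<le> R" "infdist x ?Z \<le> infdist m ?Z / 2"
      then have "x \<notin> K" using m(2)[of x] pos by auto
      then show "W x < \<kappa>" using x by (auto simp: K_def)
    qed (use pos in simp)
  qed
qed

text \<open>A linear lower bound is enough, since the excess of the gradient enters the truncation
  only through its \<open>L^1\<close> norm.\<close>

lemma coercive_growth_lower:
  fixes W :: "'a::euclidean_space \<Rightarrow> real"
  assumes "coercive_growth p W" "1 < p"
  shows "\<exists>c R. c > 0 \<and> R \<ge> 1 \<and> (\<forall>x. norm x \<ge> R \<longrightarrow> c * norm x \<le> W x)"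
proof -
  obtain c1 c2 c3 where c: "c1 > 0" "c2 > 0" "\<And>x. c1 * norm x powr p - c2 \<le> W x"
    using assms(1) unfolding coercive_growth_def by blast
  \<comment> \<open>Beyond 1 the power \<open>p\<close> dominates the first power; beyond
    \<open>2 * c2 / c1\<close> the constant \<open>c2\<close> is absorbed by half of the linear
    term.\<close>
  define R where "R = max 1 (2 * c2 / c1)"
  have "c1/2 * norm x \<le> W x" if x: "norm x \<ge> R" for x
  proof -
    have n1: "norm x \<ge> 1" using x by (simp add: R_def)
    have "norm x powr 1 \<le> norm x powr p" using n1 assms(2) by (intro powr_mono) auto
    then have "c1 * norm x \<le> c1 * norm x powr p" using n1 c by simp
    moreover have "2 * c2 / c1 \<le> norm x" using x by (simp add: R_def)
    then have "c2 \<le> c1 / 2 * norm x" using c by (simp add: field_simps)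
    ultimately show ?thesis using c(3)[of x] by simp
  qed
  then show ?thesis using c by (intro exI[of _ "c1/2"] exI[of _ R]) (auto simp: R_def)
qed

text \<open>Coercivity takes care of large matrices, a minimum over a compact set of the remaining
  ones. The bound turns low energy into small measure of the set where the gradient is far from the
  zero sets.\<close>

lemma bounded_below_off_zero_set:
  fixes W :: "'a::euclidean_space \<Rightarrow> real"
  assumes W: "continuous_on UNIV W" "\<And>x. 0 \<le> W x" "W -` {0} \<noteq> {}" "coercive_growth p W" "1 < p" and t: "\<theta> > 0"
  shows "\<exists>c>0. \<forall>x. infdist x (W -` {0}) \<ge> \<theta> \<longrightarrow> c \<le> W x"
proof -
  let ?Z = "W -` {0}"
  obtain c R where cR: "c > 0" "R \<ge> 1" "\<And>x. norm x \<ge> R \<Longrightarrow> c * norm x \<le> W x"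
    using coercive_growth_lower[OF W(4,5)] by blast
  define K where "K = cball 0 R \<inter> {x. \<theta> \<le> infdist x ?Z}"
  have cK: "compact K" unfolding K_def by (intro compact_Int_closed closed_Collect_le continuous_intros) auto
  have out: "c \<le> W x" if "norm x \<ge> R" for x
  proof -
    have "c * 1 \<le> c * norm x" using that cR by (intro mult_left_mono) auto
    then show ?thesis using cR(3)[OF that] by simp
  qed
  show ?thesis
  proof (cases "K = {}")
    case True
    have "c \<le> W x" if "infdist x ?Z \<ge> \<theta>" for x
    proof -
      have "x \<notin> K" using True by simp
      then show ?thesis using that out[of x] by (simp add: K_def)
    qed
    then show ?thesis using cR by (intro exI[of _ c]) auto
  next
    case False
    have "continuous_on K W" using W(1) continuous_on_subset by blast
    then obtain m where m: "m \<in> K" "\<And>x. x \<in> K \<Longrightarrow> W m \<le> W x"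
      using continuous_attains_inf[OF cK False] by blast
    have "W m \<noteq> 0"
    proof
      assume "W m = 0"
      then have "infdist m ?Z = 0" by (intro infdist_zero) simp
      then show False using m(1) t by (simp add: K_def)
    qed
    then have pos: "W m > 0" using W(2)[of m] by simp
    show ?thesis
    proof (intro exI[of _ "min c (W m)"] conjI allI impI)
      fix x assume x: "\<theta> \<le> infdist x ?Z"
      show "min c (W m) \<le> W x"
      proof (cases "norm x \<ge> R")
        case True
        then show ?thesis using out[of x] by simp
      next
        case False
        then have "x \<in> K" using x by (simp add: K_def)
        then show ?thesis using m(2)[of x] by simp
      qed
    qed (use pos cR in simp)
  qed
qed

subsection \<open>Measurability and borel representatives\<close>

text \<open>\<open>P\<close> is only Lebesgue measurable, so Borel measurability of
  \<open>frac_vec\<close> would not suffice. The preimage is a countable union of rescaled integer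
  translates of the part of \<open>P\<close> in the cell, each Lebesgue measurable by affine
  invariance.\<close>

lemma frac_vec_preimage_lebesgue:
  fixes P :: "(real^'d) set"
  assumes P: "P \<in> sets lebesgue" and e: "\<epsilon> > 0"
  shows "{x. frac_vec (x /\<^sub>R \<epsilon>) \<in> P} \<in> sets lebesgue"
proof -
  define Z where "Z = range (\<lambda>f::'d \<Rightarrow> int. (\<chi> i. of_int (f i)) :: real^'d)"
  have cZ: "countable Z" unfolding Z_def by simp
  define Q where "Q = P \<inter> unit_cell"
  have ucb: "(unit_cell :: (real^'d) set) \<in> sets borel"
  proof -
    have "unit_cell = (\<Inter>i. {x::real^'d. 0 \<le> x $ i} \<inter> {x. x $ i < 1})" by (auto simp: unit_cell_def)
    also have "\<dots> \<in> sets borel" by (intro sets.finite_INT) (auto intro!: sets.Int borel_closed borel_open closed_Collect_le open_Collect_less continuous_intros)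
    finally show ?thesis .
  qed
  have Q: "Q \<in> sets lebesgue" unfolding Q_def using P ucb by auto
  have fc: "frac_vec y \<in> unit_cell" for y :: "real^'d" by (auto simp: frac_vec_def unit_cell_def frac_lt_1)
  have "{x. frac_vec (x /\<^sub>R \<epsilon>) \<in> P} = (\<Union>z\<in>Z. {x. -z + (1/\<epsilon>) *\<^sub>R x \<in> Q})"
  proof (intro equalityI subsetI)
    fix x :: "real^'d" assume "x \<in> {x. frac_vec (x /\<^sub>R \<epsilon>) \<in> P}"
    then have "frac_vec (x /\<^sub>R \<epsilon>) \<in> Q" using fc by (simp add: Q_def)
    moreover have "frac_vec (x /\<^sub>R \<epsilon>) = - (\<chi> i. of_int \<lfloor>(x /\<^sub>R \<epsilon>) $ i\<rfloor>) + (1/\<epsilon>) *\<^sub>R x"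
      by (simp add: vec_eq_iff frac_vec_def frac_def inverse_eq_divide)
    ultimately have "- (\<chi> i. of_int \<lfloor>(x /\<^sub>R \<epsilon>) $ i\<rfloor>) + (1/\<epsilon>) *\<^sub>R x \<in> Q" by simp
    moreover have "(\<chi> i. of_int \<lfloor>(x /\<^sub>R \<epsilon>) $ i\<rfloor>) \<in> Z" unfolding Z_def by (rule rangeI)
    ultimately show "x \<in> (\<Union>z\<in>Z. {x. -z + (1/\<epsilon>) *\<^sub>R x \<in> Q})" by blast
  next
    fix x :: "real^'d" assume "x \<in> (\<Union>z\<in>Z. {x. -z + (1/\<epsilon>) *\<^sub>R x \<in> Q})"
    then obtain f :: "'d \<Rightarrow> int" where f: "- (\<chi> i. of_int (f i)) + (1/\<epsilon>) *\<^sub>R x \<in> Q" unfolding Z_def by blast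
    have "frac ((x /\<^sub>R \<epsilon>) $ i) = (- (\<chi> i. of_int (f i)) + (1/\<epsilon>) *\<^sub>R x) $ i" for i
    proof -
      have "0 \<le> (- (\<chi> i. of_int (f i)) + (1/\<epsilon>) *\<^sub>R x) $ i" "(- (\<chi> i. of_int (f i)) + (1/\<epsilon>) *\<^sub>R x) $ i < 1"
        using f unfolding Q_def unit_cell_def by blast+
      then show ?thesis by (subst frac_unique_iff) (auto simp: inverse_eq_divide)
    qed
    then have "frac_vec (x /\<^sub>R \<epsilon>) = - (\<chi> i. of_int (f i)) + (1/\<epsilon>) *\<^sub>R x"
      unfolding frac_vec_def vec_eq_iff by (simp add: inverse_eq_divide)
    then show "x \<in> {x. frac_vec (x /\<^sub>R \<epsilon>) \<in> P}" using f by (simp add: Q_def)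
  qed
  moreover have "{x. -z + (1/\<epsilon>) *\<^sub>R x \<in> Q} \<in> sets lebesgue" for z
  proof -
    have "(\<lambda>x. -z + (\<Sum>j\<in>Basis. ((1/\<epsilon>) * (x \<bullet> j)) *\<^sub>R j)) \<in> lebesgue \<rightarrow>\<^sub>M lebesgue"
      using lebesgue_affine_measurable[of "\<lambda>_. 1/\<epsilon>" "-z"] e by simp
    also have "(\<lambda>x. -z + (\<Sum>j\<in>Basis. ((1/\<epsilon>) * (x \<bullet> j)) *\<^sub>R j)) = (\<lambda>x. -z + (1/\<epsilon>) *\<^sub>R x)"
      by (simp only: scaleR_scaleR[symmetric] scaleR_sum_right[symmetric] euclidean_representation)
    finally have "(\<lambda>x. -z + (1/\<epsilon>) *\<^sub>R x) -` Q \<inter> space lebesgue \<in> sets lebesgue"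
      using Q by (rule measurable_sets)
    then show ?thesis by (simp add: vimage_def)
  qed
  ultimately show ?thesis using cZ by (auto intro: sets.countable_UN')
qed

lemma locally_integrable_measurable:
  fixes f :: "'a::euclidean_space \<Rightarrow> 'b::euclidean_space"
  assumes \<Omega>: "open \<Omega>" and f: "locally_integrable \<Omega> f"
  shows "set_borel_measurable lebesgue \<Omega> f"
  unfolding set_borel_measurable_def
proof -
  obtain C :: "nat \<Rightarrow> 'a set" where C: "\<And>n. compact (C n)" "\<And>n. C n \<subseteq> \<Omega>" "\<And>n. C n \<subseteq> interior (C (Suc n))" "(\<Union>n. C n) = \<Omega>"
    using open_Union_compact_subsets[OF \<Omega>] by metis
  show "(\<lambda>x. indicator \<Omega> x *\<^sub>R f x) \<in> borel_measurable lebesgue"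
  proof (rule borel_measurable_LIMSEQ_metric)
    show "(\<lambda>x. indicator (C n) x *\<^sub>R f x) \<in> borel_measurable lebesgue" for n
      using f C unfolding locally_integrable_def set_integrable_def by (auto intro: borel_measurable_integrable)
    show "(\<lambda>n. indicator (C n) x *\<^sub>R f x) \<longlonglongrightarrow> indicator \<Omega> x *\<^sub>R f x" for x
      by (intro tendsto_intros compact_exhaustion_indicator_tendsto C)
  qed
qed

lemma bounded_set_integrable:
  fixes f :: "'a::euclidean_space \<Rightarrow> real"
  assumes f: "set_borel_measurable lebesgue \<Omega> f" and \<Omega>: "open \<Omega>" "bounded \<Omega>"
    and B: "AE x in lebesgue. x \<in> \<Omega> \<longrightarrow> \<bar>f x\<bar> \<le> B"
  shows "set_integrable lebesgue \<Omega> f"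
  unfolding set_integrable_def
proof (rule Bochner_Integration.integrable_bound[where f="\<lambda>x. B * indicator \<Omega> x"])
  have "\<Omega> \<in> lmeasurable" using \<Omega> by (simp add: lmeasurable_open)
  then show "integrable lebesgue (\<lambda>x. B * indicator \<Omega> x)" by (auto simp: fmeasurable_def intro!: integrable_mult_right integrable_real_indicator)
  show "(\<lambda>x. indicator \<Omega> x *\<^sub>R f x) \<in> borel_measurable lebesgue" using f by (simp add: set_borel_measurable_def)
  show "AE x in lebesgue. norm (indicator \<Omega> x *\<^sub>R f x) \<le> norm (B * indicator \<Omega> x)"
    using B by eventually_elim (auto split: split_indicator)
qed

lemma set_integral_borel_rep:
  fixes f g \<phi> :: "'a::euclidean_space \<Rightarrow> real"
  assumes f: "(\<lambda>x. indicator S x * f x) \<in> borel_measurable lebesgue"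
    and [measurable]: "g \<in> borel_measurable borel" "\<phi> \<in> borel_measurable borel"
    and eq: "AE x in lborel. indicator S x * f x = g x"
  shows "(LINT x:S|lebesgue. f x * \<phi> x) = (LINT x|lborel. g x * \<phi> x)"
proof -
  have \<phi>: "\<phi> \<in> borel_measurable lebesgue" by (intro measurable_completion) measurable
  have "(LINT x:S|lebesgue. f x * \<phi> x) = (LINT x|lebesgue. (indicator S x * f x) * \<phi> x)"
    unfolding set_lebesgue_integral_def by (simp add: mult.assoc)
  also have "\<dots> = (LINT x|lebesgue. g x * \<phi> x)"
  proof (rule integral_cong_AE)
    show "(\<lambda>x. indicator S x * f x * \<phi> x) \<in> borel_measurable lebesgue" using f \<phi> by (rule borel_measurable_times)
    show "(\<lambda>x. g x * \<phi> x) \<in> borel_measurable lebesgue" by (intro measurable_completion) measurable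
    show "AE x in lebesgue. indicator S x * f x * \<phi> x = g x * \<phi> x"
      using AE_completion[OF eq] by eventually_elim simp
  qed
  also have "\<dots> = (LINT x|lborel. g x * \<phi> x)" by (rule integral_completion) measurable
  finally show ?thesis .
qed

lemma weak_pdiff_borel_rep:
  fixes u :: "real^'d \<Rightarrow> real^'s"
  assumes \<Omega>: "open \<Omega>" and u: "has_weak_gradient \<Omega> u G"
    and z: "z \<in> borel_measurable borel" "AE x in lborel. indicator \<Omega> x * u x $ i = z x"
    and g: "g \<in> borel_measurable borel" "AE x in lborel. indicator \<Omega> x * G x $ i $ j = g x"
  shows "weak_pdiff \<Omega> j z g"
  unfolding weak_pdiff_def
proof (intro allI impI)
  fix \<phi> :: "real^'d \<Rightarrow> real" assume \<phi>: "test_function \<Omega> \<phi>"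
  note D = has_weak_gradientD[OF u]
  have m: "(\<lambda>x. indicator \<Omega> x * u x $ i) \<in> borel_measurable lebesgue" "(\<lambda>x. indicator \<Omega> x * G x $ i $ j) \<in> borel_measurable lebesgue"
    using locally_integrable_measurable[OF \<Omega> locally_integrable_component[OF D(1)], of i]
      locally_integrable_measurable[OF \<Omega> locally_integrable_component2[OF D(2)], of i j]
    by (simp_all add: set_borel_measurable_def)
  show "(LINT x|lborel. z x * pdiff j \<phi> x) = - (LINT x|lborel. g x * \<phi> x)"
    using D(3)[OF \<phi>, of i j] set_integral_borel_rep[OF m(1) z(1) test_function_borel[OF test_function_frechet_derivative[OF \<phi>]] z(2)]
      set_integral_borel_rep[OF m(2) g(1) test_function_borel[OF \<phi>] g(2)] by simp
qed

lemma has_weak_gradient_diff: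
  fixes u v :: "real^'d \<Rightarrow> real^'s"
  assumes u: "has_weak_gradient \<Omega> u G" and v: "has_weak_gradient \<Omega> v H"
  shows "has_weak_gradient \<Omega> (\<lambda>x. u x - v x) (\<lambda>x. G x - H x)"
  unfolding has_weak_gradient_def
proof (intro conjI allI impI)
  note U = has_weak_gradientD[OF u] and V = has_weak_gradientD[OF v]
  show "locally_integrable \<Omega> (\<lambda>x. u x - v x)" "locally_integrable \<Omega> (\<lambda>x. G x - H x)"
    using U V unfolding locally_integrable_def by (auto intro: set_integral_diff)
  fix \<phi> :: "real^'d \<Rightarrow> real" and i j assume \<phi>: "test_function \<Omega> \<phi>"
  note I = locally_integrable_times_test[OF locally_integrable_component[OF U(1)] test_function_frechet_derivative[OF \<phi>]]
    locally_integrable_times_test[OF locally_integrable_component[OF V(1)] test_function_frechet_derivative[OF \<phi>]]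
    locally_integrable_times_test[OF locally_integrable_component2[OF U(2)] \<phi>]
    locally_integrable_times_test[OF locally_integrable_component2[OF V(2)] \<phi>]
  show "(LINT x:\<Omega>|lebesgue. (u x - v x) $ i * pdiff j \<phi> x) = - (LINT x:\<Omega>|lebesgue. (G x - H x) $ i $ j * \<phi> x)"
    using U(3)[OF \<phi>, of i j] V(3)[OF \<phi>, of i j] I[of i]
    by (simp add: left_diff_distrib set_integral_diff)
qed

lemma linear_component:
  fixes A :: "real^'d^'s"
  shows "Ck k (\<lambda>x. (A *v x) $ i)" "pdiff j (\<lambda>x. (A *v x) $ i) x = A $ i $ j"
proof -
  have D: "((\<lambda>x. (A *v x) $ i) has_derivative (\<lambda>v. (A *v v) $ i)) (at x)" for i x
    by (intro bounded_linear_imp_has_derivative bounded_linear_compose[OF bounded_linear_vec_nth] matrix_vector_mul_bounded_linear)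
  have "(\<lambda>x. (A *v x) $ i) = (\<lambda>x. x \<bullet> row i A)" for i
    by (simp add: matrix_vector_mul_component row_def inner_commute vec_lambda_eta)
  then show "Ck k (\<lambda>x. (A *v x) $ i)" for k i by (simp only: Ck_inner_left)
  show "pdiff j (\<lambda>x. (A *v x) $ i) x = A $ i $ j"
    using fun_cong[OF frechet_derivative_at[OF D[of i x]], of "axis j 1"]
    by (simp add: matrix_vector_mult_basis column_def)
qed

lemma linear_map_weak_gradient:
  fixes A :: "real^'d^'s"
  assumes "open \<Omega>"
  shows "has_weak_gradient \<Omega> (\<lambda>x. A *v x) (\<lambda>x. A)"
  using smooth_has_weak_gradient[OF assms, of "\<lambda>x. A *v x"]
  by (simp add: linear_component vec_lambda_eta)

subsection \<open>Weak-star convergence implies boundedness and strong convergence\<close>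

lemma bounded_times_set_integrable:
  fixes a f :: "'a::euclidean_space \<Rightarrow> real"
  assumes a: "set_borel_measurable lebesgue \<Omega> a" "AE x in lebesgue. x \<in> \<Omega> \<longrightarrow> \<bar>a x\<bar> \<le> B" and f: "integrable lborel f"
  shows "set_integrable lebesgue \<Omega> (\<lambda>x. a x * f x)"
  unfolding set_integrable_def
proof (rule Bochner_Integration.integrable_bound[where f="\<lambda>x. B * f x"])
  have "f \<in> borel_measurable borel" using f by auto
  then have fl: "integrable lebesgue f" using f by (subst integrable_completion) auto
  then show "integrable lebesgue (\<lambda>x. B * f x)" by simp
  have "(\<lambda>x. (indicator \<Omega> x *\<^sub>R a x) * f x) \<in> borel_measurable lebesgue"
    using a(1) fl by (intro borel_measurable_times) (auto simp: set_borel_measurable_def)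
  then show "(\<lambda>x. indicator \<Omega> x *\<^sub>R (a x * f x)) \<in> borel_measurable lebesgue" by (simp add: mult.assoc)
  show "AE x in lebesgue. norm (indicator \<Omega> x *\<^sub>R (a x * f x)) \<le> norm (B * f x)"
    using a(2) by eventually_elim (auto simp: abs_mult intro!: mult_right_mono split: split_indicator)
qed

lemma set_borel_measurable_inner:
  fixes U :: "'a::euclidean_space \<Rightarrow> 'b::euclidean_space"
  assumes "set_borel_measurable lebesgue \<Omega> U"
  shows "set_borel_measurable lebesgue \<Omega> (\<lambda>x. U x \<bullet> b)"
proof -
  have "(\<lambda>x. (indicator \<Omega> x *\<^sub>R U x) \<bullet> b) \<in> borel_measurable lebesgue"
    using assms unfolding set_borel_measurable_def by (intro borel_measurable_inner) auto
  then show ?thesis by (simp add: set_borel_measurable_def)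
qed

lemma weakstar_Linf_tested:
  fixes U :: "nat \<Rightarrow> 'a::euclidean_space \<Rightarrow> 'b::euclidean_space"
  assumes w: "weakstar_Linf \<Omega> U V" and \<Omega>: "\<Omega> \<in> sets borel"
    and U: "\<And>h. set_borel_measurable lebesgue \<Omega> (U h)" "\<And>h. \<exists>B. AE x in lebesgue. x \<in> \<Omega> \<longrightarrow> norm (U h x) \<le> B"
    and V: "set_borel_measurable lebesgue \<Omega> V" "\<exists>B. AE x in lebesgue. x \<in> \<Omega> \<longrightarrow> norm (V x) \<le> B"
    and f: "integrable lborel f"
  shows "(\<lambda>h. LINT x:\<Omega>|lebesgue. ((U h x - V x) \<bullet> b) * f x) \<longlonglongrightarrow> 0"
proof -
  have "f \<in> borel_measurable borel" using f by auto
  then have "integrable lebesgue f" using f by (subst integrable_completion) auto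
  then have "set_integrable lebesgue \<Omega> (\<lambda>x. f x *\<^sub>R b)"
    unfolding set_integrable_def using \<Omega> by (intro integrable_mult_indicator integrable_scaleR_left) auto
  then have "(\<lambda>h. LINT x:\<Omega>|lebesgue. U h x \<bullet> (f x *\<^sub>R b)) \<longlonglongrightarrow> (LINT x:\<Omega>|lebesgue. V x \<bullet> (f x *\<^sub>R b))"
    using w unfolding weakstar_Linf_def by blast
  then have lim: "(\<lambda>h. (LINT x:\<Omega>|lebesgue. U h x \<bullet> (f x *\<^sub>R b)) - (LINT x:\<Omega>|lebesgue. V x \<bullet> (f x *\<^sub>R b))) \<longlonglongrightarrow> 0"
    by (rule LIM_zero)
  have I: "set_integrable lebesgue \<Omega> (\<lambda>x. (X x \<bullet> b) * f x)"
    if X: "set_borel_measurable lebesgue \<Omega> X" "\<exists>B. AE x in lebesgue. x \<in> \<Omega> \<longrightarrow> norm (X x) \<le> B" for X :: "'a \<Rightarrow> 'b"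
  proof -
    obtain B where B: "AE x in lebesgue. x \<in> \<Omega> \<longrightarrow> norm (X x) \<le> B" using X(2) by blast
    have "AE x in lebesgue. x \<in> \<Omega> \<longrightarrow> \<bar>X x \<bullet> b\<bar> \<le> B * norm b"
      using B by eventually_elim (meson Cauchy_Schwarz_ineq2 mult_right_mono norm_ge_zero order_trans)
    from bounded_times_set_integrable[OF set_borel_measurable_inner[OF X(1)] this f] show ?thesis .
  qed
  have "(LINT x:\<Omega>|lebesgue. U h x \<bullet> (f x *\<^sub>R b)) - (LINT x:\<Omega>|lebesgue. V x \<bullet> (f x *\<^sub>R b)) = (LINT x:\<Omega>|lebesgue. ((U h x - V x) \<bullet> b) * f x)" for h
    using set_integral_diff(2)[OF I[OF U] I[OF V], of h] by (simp add: inner_diff_left left_diff_distrib right_diff_distrib mult.commute)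
  with lim show ?thesis by simp
qed

lemma uniform_boundedness_weakstar:
  fixes z :: "nat \<Rightarrow> 'a::euclidean_space \<Rightarrow> real"
  assumes \<Omega>: "open \<Omega>" "bounded \<Omega>" and z: "\<And>h. integrable lborel (z h)" "\<And>h x. x \<notin> \<Omega> \<Longrightarrow> z h x = 0"
    and b: "\<And>h. \<exists>B. AE x in lborel. \<bar>z h x\<bar> \<le> B"
    and lim: "\<And>f. integrable lborel f \<Longrightarrow> (\<lambda>h. LINT x|lborel. z h x * f x) \<longlonglongrightarrow> 0"
  shows "\<exists>M. \<forall>h. AE x in lborel. \<bar>z h x\<bar> \<le> M"
proof (rule uniform_boundedness_Linf)
  show "z h \<in> borel_measurable borel" for h using z(1)[of h] by auto
  show "\<Omega> \<in> sets borel" using \<Omega> by simp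
  show "emeasure lborel \<Omega> < \<infinity>" using emeasure_bounded_finite[OF \<Omega>(2)] by simp
  fix f :: "'a \<Rightarrow> real" assume f: "integrable lborel f"
  from lim[OF f] have "Bseq (\<lambda>h. LINT x|lborel. z h x * f x)" by (intro convergent_imp_Bseq) (auto simp: convergent_def)
  then show "\<exists>B. \<forall>h. \<bar>LINT x|lborel. z h x * f x\<bar> \<le> B" by (auto simp: Bseq_def)
qed (use z b in auto)

text \<open>A predicate, so that representatives for all members of a sequence and all components
  can be chosen at once.\<close>

definition bounded_rep :: "'a::euclidean_space set \<Rightarrow> ('a \<Rightarrow> real) \<Rightarrow> ('a \<Rightarrow> real) \<Rightarrow> bool" where
  "bounded_rep \<Omega> v z \<longleftrightarrow> integrable lborel z \<and> (\<forall>x. x \<notin> \<Omega> \<longrightarrow> z x = 0) \<and>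
     (AE x in lborel. indicator \<Omega> x * v x = z x) \<and> (\<exists>B. AE x in lborel. \<bar>z x\<bar> \<le> B)"

lemma bounded_repD:
  assumes "bounded_rep \<Omega> v z"
  shows "integrable lborel z" "x \<notin> \<Omega> \<Longrightarrow> z x = 0" "AE x in lborel. indicator \<Omega> x * v x = z x"
    "\<exists>B. AE x in lborel. \<bar>z x\<bar> \<le> B" "z \<in> borel_measurable borel"
  using assms by (auto simp: bounded_rep_def)

lemma ex_bounded_rep:
  fixes v :: "'a::euclidean_space \<Rightarrow> real"
  assumes \<Omega>: "open \<Omega>" "bounded \<Omega>" and v: "set_borel_measurable lebesgue \<Omega> v" "\<exists>B. AE x in lebesgue. x \<in> \<Omega> \<longrightarrow> \<bar>v x\<bar> \<le> B"
  shows "\<exists>z. bounded_rep \<Omega> v z"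
proof -
  obtain B where B: "AE x in lebesgue. x \<in> \<Omega> \<longrightarrow> \<bar>v x\<bar> \<le> B" using v(2) by blast
  have "set_integrable lebesgue \<Omega> v" by (rule bounded_set_integrable[OF v(1) \<Omega> B])
  then obtain z where z: "integrable lborel z" "\<And>x. x \<notin> \<Omega> \<Longrightarrow> z x = 0" "AE x in lborel. x \<in> \<Omega> \<longrightarrow> v x = z x"
    "AE x in lborel. indicator \<Omega> x * v x = z x"
    using \<Omega> by (rule_tac lebesgue_integrable_borel_rep) auto
  have "AE x in lborel. x \<in> \<Omega> \<longrightarrow> \<bar>v x\<bar> \<le> B" using B by (simp add: AE_completion_iff)
  then have "AE x in lborel. \<bar>z x\<bar> \<le> max B 0"
    using z(3) by eventually_elim (use z(2) in \<open>force simp: max_def\<close>)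
  with z show ?thesis unfolding bounded_rep_def by blast
qed

lemma axis_inner_matrix: "(X :: real^'d^'s) \<bullet> axis i (axis j 1) = X $ i $ j"
  by (simp add: inner_axis)

lemma AE_bounded_minus_linear:
  fixes A :: "real^'d^'s"
  assumes \<Omega>: "bounded \<Omega>" and u: "AE x in lebesgue. x \<in> \<Omega> \<longrightarrow> norm (u x) \<le> B"
  shows "\<exists>B. AE x in lebesgue. x \<in> \<Omega> \<longrightarrow> norm (u x - A *v x) \<le> B"
proof -
  obtain R where R: "\<And>x. x \<in> \<Omega> \<Longrightarrow> norm x \<le> R" using \<Omega> by (auto simp: bounded_iff)
  have bl: "bounded_linear ((*v) A)" by (rule matrix_vector_mul_bounded_linear)
  have "AE x in lebesgue. x \<in> \<Omega> \<longrightarrow> norm (u x - A *v x) \<le> B + onorm ((*v) A) * R"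
    using u
  proof (eventually_elim, intro impI)
    fix x assume *: "x \<in> \<Omega> \<longrightarrow> norm (u x) \<le> B" and x: "x \<in> \<Omega>"
    have "norm (A *v x) \<le> onorm ((*v) A) * norm x" by (rule onorm[OF bl])
    also have "\<dots> \<le> onorm ((*v) A) * R" using R[OF x] onorm_pos_le[OF bl] by (rule mult_left_mono)
    finally show "norm (u x - A *v x) \<le> B + onorm ((*v) A) * R"
      using * x norm_triangle_ineq4[of "u x" "A *v x"] by simp
  qed
  then show ?thesis by blast
qed

text \<open>Subtracting the limit turns every component of the maps and of their gradients into a
  sequence with null pairings. Convergent pairings are bounded, so the uniform boundedness principle
  applies to each of the finitely many components, and the maximum \<open>M\<close> of the bounds
  feeds the compactness result.\<close>

lemma weakstar_W1inf_strong:
  fixes u :: "nat \<Rightarrow> real^'d \<Rightarrow> real^'s" and A :: "real^'d^'s"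
  assumes \<Omega>: "open \<Omega>" "bounded \<Omega>" and u: "\<And>h. u h \<in> W1inf \<Omega>" and w: "weakstar_W1inf \<Omega> u (\<lambda>x. A *v x)"
  shows "\<exists>M. (\<forall>h i. AE x in lebesgue. x \<in> \<Omega> \<longrightarrow> \<bar>(u h x - A *v x) $ i\<bar> \<le> M) \<and>
    (\<forall>h i j. AE x in lebesgue. x \<in> \<Omega> \<longrightarrow> \<bar>(weak_grad \<Omega> (u h) x - A) $ i $ j\<bar> \<le> M) \<and>
    (\<forall>i. (\<lambda>h. LINT x:\<Omega>|lebesgue. \<bar>(u h x - A *v x) $ i\<bar>) \<longlonglongrightarrow> 0)"
proof -
  have Om: "\<Omega> \<in> sets borel" using \<Omega> by simp
  have lin: "has_weak_gradient \<Omega> (\<lambda>x. A *v x) (\<lambda>x. A)" by (rule linear_map_weak_gradient[OF \<Omega>(1)])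
  define H where "H h = weak_grad \<Omega> (u h)" for h
  \<comment> \<open>\<open>weakstar_W1inf\<close> refers to the chosen gradient of the linear map,
    which equals \<open>A\<close> only almost everywhere; it is carried along as \<open>H0\<close>
    and replaced by \<open>A\<close> at the end.\<close>
  define H0 where "H0 = weak_grad \<Omega> (\<lambda>x. A *v x)"
  have H0: "AE x in lebesgue. x \<in> \<Omega> \<longrightarrow> H0 x = A" "has_weak_gradient \<Omega> (\<lambda>x. A *v x) H0"
    unfolding H0_def by (rule weak_grad_AE_eq[OF \<Omega>(1) lin])+
  have H: "has_weak_gradient \<Omega> (u h) (H h)" "\<exists>B. AE x in lebesgue. x \<in> \<Omega> \<longrightarrow> norm (H h x) \<le> B"
    and ub: "\<exists>B. AE x in lebesgue. x \<in> \<Omega> \<longrightarrow> norm (u h x) \<le> B" for h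
  proof -
    obtain G where G: "G \<in> Linf \<Omega>" "has_weak_gradient \<Omega> (u h) G" and ul: "u h \<in> Linf \<Omega>"
      using u[of h] unfolding W1inf_def by blast
    show "has_weak_gradient \<Omega> (u h) (H h)" unfolding H_def by (rule weak_grad_AE_eq(2)[OF \<Omega>(1) G(2)])
    obtain B where "AE x in lebesgue. x \<in> \<Omega> \<longrightarrow> norm (G x) \<le> B" using G(1) unfolding Linf_def by blast
    then have "AE x in lebesgue. x \<in> \<Omega> \<longrightarrow> norm (H h x) \<le> B"
      using weak_grad_AE_eq(1)[OF \<Omega>(1) G(2)] unfolding H_def by eventually_elim auto
    then show "\<exists>B. AE x in lebesgue. x \<in> \<Omega> \<longrightarrow> norm (H h x) \<le> B" by blast
    show "\<exists>B. AE x in lebesgue. x \<in> \<Omega> \<longrightarrow> norm (u h x) \<le> B" using ul unfolding Linf_def by blast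
  qed
  note meas = locally_integrable_measurable[OF \<Omega>(1)]
  have um: "set_borel_measurable lebesgue \<Omega> (u h)" "set_borel_measurable lebesgue \<Omega> (H h)" for h
    using has_weak_gradientD(1,2)[OF H(1)] by (auto intro: meas)
  have u0m: "set_borel_measurable lebesgue \<Omega> (\<lambda>x. A *v x)" "set_borel_measurable lebesgue \<Omega> H0"
    using has_weak_gradientD(1,2)[OF H0(2)] by (auto intro: meas)
  have H0b: "\<exists>B. AE x in lebesgue. x \<in> \<Omega> \<longrightarrow> norm (H0 x) \<le> B"
    using H0(1) by (intro exI[of _ "norm A"]) (auto elim!: eventually_mono)
  have A0b: "\<exists>B. AE x in lebesgue. x \<in> \<Omega> \<longrightarrow> norm (A *v x) \<le> B"
    using AE_bounded_minus_linear[OF \<Omega>(2), of "\<lambda>x. 0" 0 A] by simp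
  define v where "v h x = u h x - A *v x" for h x
  define G where "G h x = H h x - H0 x" for h x
  have V: "has_weak_gradient \<Omega> (v h) (G h)" for h
    unfolding v_def[abs_def] G_def[abs_def] by (rule has_weak_gradient_diff[OF H(1) H0(2)])
  have vb: "\<exists>B. AE x in lebesgue. x \<in> \<Omega> \<longrightarrow> \<bar>v h x $ i\<bar> \<le> B" for h i
  proof -
    obtain B where "AE x in lebesgue. x \<in> \<Omega> \<longrightarrow> norm (v h x) \<le> B"
      using ub[of h] AE_bounded_minus_linear[OF \<Omega>(2), of "u h" _ A] unfolding v_def by blast
    then have "AE x in lebesgue. x \<in> \<Omega> \<longrightarrow> \<bar>v h x $ i\<bar> \<le> B"
      by eventually_elim (auto intro: order_trans[OF component_le_norm_cart])
    then show ?thesis by blast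
  qed
  have gb: "\<exists>B. AE x in lebesgue. x \<in> \<Omega> \<longrightarrow> \<bar>G h x $ i $ j\<bar> \<le> B" for h i j
  proof -
    obtain B where "AE x in lebesgue. x \<in> \<Omega> \<longrightarrow> norm (H h x) \<le> B" using H(2) by blast
    then have "AE x in lebesgue. x \<in> \<Omega> \<longrightarrow> \<bar>G h x $ i $ j\<bar> \<le> B + norm A"
      using H0(1)
    proof (eventually_elim, intro impI)
      fix x assume *: "x \<in> \<Omega> \<longrightarrow> norm (H h x) \<le> B" "x \<in> \<Omega> \<longrightarrow> H0 x = A" "x \<in> \<Omega>"
      have "\<bar>G h x $ i $ j\<bar> \<le> norm (G h x $ i)" by (rule component_le_norm_cart)
      also have "\<dots> \<le> norm (G h x)" by (rule Finite_Cartesian_Product.norm_nth_le)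
      also have "\<dots> \<le> B + norm A" using * norm_triangle_ineq4[of "H h x" A] by (simp add: G_def)
      finally show "\<bar>G h x $ i $ j\<bar> \<le> B + norm A" .
    qed
    then show ?thesis by blast
  qed
  note LV = has_weak_gradientD(1,2)[OF V]
  have "\<exists>z. bounded_rep \<Omega> (\<lambda>x. v h x $ i) z" for h i
    by (rule ex_bounded_rep[OF \<Omega> meas[OF locally_integrable_component[OF LV(1)]] vb])
  then obtain z where zz: "\<And>h i. bounded_rep \<Omega> (\<lambda>x. v h x $ i) (z h i)" by metis
  note z = bounded_repD[OF zz]
  have "\<exists>z. bounded_rep \<Omega> (\<lambda>x. G h x $ i $ j) z" for h i j
    by (rule ex_bounded_rep[OF \<Omega> meas[OF locally_integrable_component2[OF LV(2)]] gb])
  then obtain g where gg: "\<And>h i j. bounded_rep \<Omega> (\<lambda>x. G h x $ i $ j) (g h i j)" by metis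
  note g = bounded_repD[OF gg]
  note zm = z(5) g(5)
  have vm: "(\<lambda>x. indicator \<Omega> x * v h x $ i) \<in> borel_measurable lebesgue" "(\<lambda>x. indicator \<Omega> x * G h x $ i $ j) \<in> borel_measurable lebesgue" for h i j
    using meas[OF locally_integrable_component[OF LV(1)]] meas[OF locally_integrable_component2[OF LV(2)]] by (simp_all add: set_borel_measurable_def)
  have wz: "(\<lambda>h. LINT x|lborel. z h i x * f x) \<longlonglongrightarrow> 0" if f: "integrable lborel f" for f i
  proof -
    have fm: "f \<in> borel_measurable borel" using f by auto
    have "(\<lambda>h. LINT x:\<Omega>|lebesgue. ((u h x - A *v x) \<bullet> axis i 1) * f x) \<longlonglongrightarrow> 0"
      by (rule weakstar_Linf_tested[OF _ Om um(1) ub u0m(1) A0b f]) (use w in \<open>simp add: weakstar_W1inf_def\<close>)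
    moreover have "(LINT x:\<Omega>|lebesgue. ((u h x - A *v x) \<bullet> axis i 1) * f x) = (LINT x|lborel. z h i x * f x)" for h
      using set_integral_borel_rep[OF vm(1) zm(1) fm z(3)] by (simp add: v_def inner_axis)
    ultimately show ?thesis by simp
  qed
  have wg: "(\<lambda>h. LINT x|lborel. g h i j x * f x) \<longlonglongrightarrow> 0" if f: "integrable lborel f" for f i j
  proof -
    have fm: "f \<in> borel_measurable borel" using f by auto
    have "(\<lambda>h. LINT x:\<Omega>|lebesgue. ((H h x - H0 x) \<bullet> axis i (axis j 1)) * f x) \<longlonglongrightarrow> 0"
      by (rule weakstar_Linf_tested[OF _ Om um(2) H(2) u0m(2) H0b f]) (use w in \<open>simp add: weakstar_W1inf_def H_def H0_def\<close>)
    moreover have "(LINT x:\<Omega>|lebesgue. ((H h x - H0 x) \<bullet> axis i (axis j 1)) * f x) = (LINT x|lborel. g h i j x * f x)" for h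
      using set_integral_borel_rep[OF vm(2) zm(2) fm g(3)] by (simp add: G_def axis_inner_matrix)
    ultimately show ?thesis by simp
  qed
  have "\<exists>M. \<forall>h. AE x in lborel. \<bar>z h i x\<bar> \<le> M" for i
    by (rule uniform_boundedness_weakstar[OF \<Omega> z(1,2,4) wz])
  then obtain M1 where M1: "\<And>h i. AE x in lborel. \<bar>z h i x\<bar> \<le> M1 i" by metis
  have "\<exists>M. \<forall>h. AE x in lborel. \<bar>g h i j x\<bar> \<le> M" for i j
    by (rule uniform_boundedness_weakstar[OF \<Omega> g(1,2,4) wg])
  then obtain M2 where M2: "\<And>h i j. AE x in lborel. \<bar>g h i j x\<bar> \<le> M2 i j" by metis
  define M where "M = Max (range M1 \<union> range (\<lambda>(i, j). M2 i j))"
  have fin: "finite (range M1 \<union> range (\<lambda>(i, j). M2 i j))" by simp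
  have Mz: "AE x in lborel. \<bar>z h i x\<bar> \<le> M" for h i
  proof -
    have "M1 i \<le> M" unfolding M_def by (rule Max_ge[OF fin]) simp
    then show ?thesis using M1[of h i] by (auto elim!: eventually_mono)
  qed
  have Mg: "AE x in lborel. \<bar>g h i j x\<bar> \<le> M" for h i j
  proof -
    have "M2 i j \<le> M" unfolding M_def by (rule Max_ge[OF fin]) (auto intro!: image_eqI[of _ _ "(i, j)"])
    then show ?thesis using M2[of h i j] by (auto elim!: eventually_mono)
  qed
  have wp: "weak_pdiff \<Omega> j (z h i) (g h i j)" for h i j
    by (rule weak_pdiff_borel_rep[OF \<Omega>(1) V zm(1) z(3) zm(2) g(3)])
  have L1: "(\<lambda>h. LINT x|lborel. \<bar>z h i x\<bar>) \<longlonglongrightarrow> 0" for i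
    by (rule weakstar_bounded_gradient_L1[OF \<Omega> wp z(1) g(1) Mg Mz z(2) wz])
  have "(LINT x:\<Omega>|lebesgue. \<bar>v h x $ i\<bar> * 1) = (LINT x|lborel. \<bar>z h i x\<bar> * 1)" for h i
  proof (rule set_integral_borel_rep)
    have "(\<lambda>x. \<bar>indicator \<Omega> x * v h x $ i\<bar>) \<in> borel_measurable lebesgue" using vm(1) by (rule borel_measurable_abs)
    then show "(\<lambda>x. indicator \<Omega> x * \<bar>v h x $ i\<bar>) \<in> borel_measurable lebesgue" by (simp add: abs_mult)
    show "AE x in lborel. indicator \<Omega> x * \<bar>v h x $ i\<bar> = \<bar>z h i x\<bar>"
      using z(3)[of h i] by eventually_elim (auto split: split_indicator)
  qed (use zm in auto)
  then have L1': "(\<lambda>h. LINT x:\<Omega>|lebesgue. \<bar>v h x $ i\<bar>) \<longlonglongrightarrow> 0" for i using L1 by simp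
  have fin1: "AE x in lebesgue. x \<in> \<Omega> \<longrightarrow> \<bar>v h x $ i\<bar> \<le> M" for h i
    using AE_completion[OF z(3)[of h i]] AE_completion[OF Mz[of h i]] by eventually_elim auto
  have fin2: "AE x in lebesgue. x \<in> \<Omega> \<longrightarrow> \<bar>(H h x - A) $ i $ j\<bar> \<le> M" for h i j
    using AE_completion[OF g(3)[of h i j]] AE_completion[OF Mg[of h i j]] H0(1) by eventually_elim (auto simp: G_def)
  show ?thesis using L1' fin1 fin2 unfolding v_def H_def by blast
qed


subsection \<open>The homogenized set is contained in the zero set\<close>

lemma bounded_Lp:
  fixes u :: "'a::euclidean_space \<Rightarrow> 'b::euclidean_space"
  assumes \<Omega>: "open \<Omega>" "bounded \<Omega>" and u: "set_borel_measurable lebesgue \<Omega> u" "AE x in lebesgue. x \<in> \<Omega> \<longrightarrow> norm (u x) \<le> B" and p: "p > 0"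
  shows "u \<in> Lp \<Omega> p"
  unfolding Lp_def
proof (intro CollectI conjI u(1) bounded_set_integrable[OF _ \<Omega>])
  have "(\<lambda>x. norm (indicator \<Omega> x *\<^sub>R u x) powr p) \<in> borel_measurable lebesgue"
    using measurable_compose[OF u(1)[unfolded set_borel_measurable_def] borel_measurable_norm] by (rule powr_real_measurable) simp
  moreover have "norm (indicator \<Omega> x *\<^sub>R u x) powr p = indicator \<Omega> x *\<^sub>R (norm (u x) powr p)" for x
    by (auto split: split_indicator)
  ultimately show "set_borel_measurable lebesgue \<Omega> (\<lambda>x. norm (u x) powr p)" by (simp add: set_borel_measurable_def)
  show "AE x in lebesgue. x \<in> \<Omega> \<longrightarrow> \<bar>norm (u x) powr p\<bar> \<le> B powr p"
    using u(2) by eventually_elim (use p in \<open>auto intro!: powr_mono2\<close>)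
qed

lemma norm_matrix_le_sum: "norm (X :: real^'d^'s) \<le> (\<Sum>i\<in>UNIV. \<Sum>j\<in>UNIV. \<bar>X $ i $ j\<bar>)"
proof -
  have "norm X \<le> (\<Sum>i\<in>UNIV. norm (X $ i))" unfolding norm_vec_def by (rule L2_set_le_sum) simp
  also have "\<dots> \<le> (\<Sum>i\<in>UNIV. \<Sum>j\<in>UNIV. \<bar>X $ i $ j\<bar>)" by (intro sum_mono norm_le_l1_cart)
  finally show ?thesis .
qed

text \<open>Interpolation: \<open>norm v powr p\<close> is at most
  \<open>S powr (p - 1) * norm v\<close> when \<open>norm v\<close> is bounded by
  \<open>S\<close>.\<close>

lemma bounded_L1_imp_Lp_tendsto:
  fixes v :: "nat \<Rightarrow> 'a::euclidean_space \<Rightarrow> real^'s"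
  assumes i: "\<And>h i. set_integrable lebesgue \<Omega> (\<lambda>x. v h x $ i)" and b: "\<And>h i. AE x in lebesgue. x \<in> \<Omega> \<longrightarrow> \<bar>v h x $ i\<bar> \<le> M"
    and l: "\<And>i. (\<lambda>h. LINT x:\<Omega>|lebesgue. \<bar>v h x $ i\<bar>) \<longlonglongrightarrow> 0" and p: "p > 1"
  shows "(\<lambda>h. LINT x:\<Omega>|lebesgue. norm (v h x) powr p) \<longlonglongrightarrow> 0"
proof (rule tendsto_sandwich)
  define S where "S = real CARD('s) * max M 0"
  have S: "S \<ge> 0" by (simp add: S_def)
  show "\<forall>\<^sub>F h in sequentially. 0 \<le> (LINT x:\<Omega>|lebesgue. norm (v h x) powr p)"
    by (intro always_eventually allI) (auto simp: set_lebesgue_integral_def intro!: Bochner_Integration.integral_nonneg)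
  have ia: "set_integrable lebesgue \<Omega> (\<lambda>x. \<bar>v h x $ i\<bar>)" for h i using set_integrable_abs[OF i] .
  have "(LINT x:\<Omega>|lebesgue. norm (v h x) powr p) \<le> S powr (p - 1) * (\<Sum>i\<in>UNIV. LINT x:\<Omega>|lebesgue. \<bar>v h x $ i\<bar>)" for h
  proof -
    have ii: "integrable lebesgue (\<lambda>x. indicator \<Omega> x * \<bar>v h x $ i\<bar>)" for i using ia unfolding set_integrable_def by simp
    have "AE x in lebesgue. \<forall>i. x \<in> \<Omega> \<longrightarrow> \<bar>v h x $ i\<bar> \<le> M" by (intro AE_all_countable[THEN iffD2] allI b)
    then have ae: "AE x in lebesgue. indicator \<Omega> x *\<^sub>R norm (v h x) powr p \<le> S powr (p - 1) * (\<Sum>i\<in>UNIV. indicator \<Omega> x * \<bar>v h x $ i\<bar>)"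
    proof eventually_elim
      case (elim x)
      show ?case
      proof (cases "x \<in> \<Omega>")
        case True
        have n1: "norm (v h x) \<le> (\<Sum>i\<in>UNIV. \<bar>v h x $ i\<bar>)" by (rule norm_le_l1_cart)
        also have "\<dots> \<le> (\<Sum>i\<in>(UNIV::'s set). max M 0)" using elim True by (intro sum_mono) (auto simp: le_max_iff_disj)
        finally have n2: "norm (v h x) \<le> S" by (simp add: S_def)
        have "norm (v h x) powr p = norm (v h x) powr (p - 1) * norm (v h x)"
          using powr_mult_base[of "norm (v h x)" "p - 1"] by (simp add: mult.commute)
        also have "\<dots> \<le> S powr (p - 1) * (\<Sum>i\<in>UNIV. \<bar>v h x $ i\<bar>)"
          using n1 n2 p by (intro mult_mono powr_mono2) auto
        finally show ?thesis using True by simp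
      qed simp
    qed
    have "(LINT x:\<Omega>|lebesgue. norm (v h x) powr p) \<le> (LINT x|lebesgue. S powr (p - 1) * (\<Sum>i\<in>UNIV. indicator \<Omega> x * \<bar>v h x $ i\<bar>))"
      unfolding set_lebesgue_integral_def
    proof (rule integral_mono_AE'[OF _ ae])
      show "integrable lebesgue (\<lambda>x. S powr (p - 1) * (\<Sum>i\<in>UNIV. indicator \<Omega> x * \<bar>v h x $ i\<bar>))"
        by (intro integrable_mult_right Bochner_Integration.integrable_sum ii)
      show "AE x in lebesgue. 0 \<le> S powr (p - 1) * (\<Sum>i\<in>UNIV. indicator \<Omega> x * \<bar>v h x $ i\<bar>)"
        by (intro AE_I2 mult_nonneg_nonneg sum_nonneg) auto
    qed
    also have "\<dots> = S powr (p - 1) * (\<Sum>i\<in>UNIV. LINT x|lebesgue. indicator \<Omega> x * \<bar>v h x $ i\<bar>)"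
      by (simp only: integral_mult_right_zero Bochner_Integration.integral_sum[OF ii])
    also have "\<dots> = S powr (p - 1) * (\<Sum>i\<in>UNIV. LINT x:\<Omega>|lebesgue. \<bar>v h x $ i\<bar>)"
      by (simp only: set_lebesgue_integral_def real_scaleR_def)
    finally show ?thesis .
  qed
  then show "\<forall>\<^sub>F h in sequentially. (LINT x:\<Omega>|lebesgue. norm (v h x) powr p) \<le> S powr (p - 1) * (\<Sum>i\<in>UNIV. LINT x:\<Omega>|lebesgue. \<bar>v h x $ i\<bar>)"
    by (intro always_eventually allI)
  have "(\<lambda>h. \<Sum>i\<in>UNIV. LINT x:\<Omega>|lebesgue. \<bar>v h x $ i\<bar>) \<longlonglongrightarrow> (\<Sum>i\<in>(UNIV::'s set). 0)"
    by (intro tendsto_sum l)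
  then show "(\<lambda>h. S powr (p - 1) * (\<Sum>i\<in>UNIV. LINT x:\<Omega>|lebesgue. \<bar>v h x $ i\<bar>)) \<longlonglongrightarrow> 0"
    using tendsto_mult_right_zero by fastforce
qed simp

text \<open>The sets partition the unit cell, so one term survives at each point; this reduces the
  pointwise estimates of energies and distances to a single integrand.\<close>

lemma partition_sum:
  assumes P: "measurable_partition n P"
  obtains k where "k \<in> {1..n}" "frac_vec y \<in> P k" "\<And>g :: nat \<Rightarrow> real. (\<Sum>k\<in>{1..n}. indicator (P k) (frac_vec y) * g k) = g k"
proof -
  have "frac_vec y \<in> unit_cell" by (auto simp: frac_vec_def unit_cell_def frac_lt_1)
  then obtain k where k: "k \<in> {1..n}" "frac_vec y \<in> P k" using P unfolding measurable_partition_def by blast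
  have "(\<Sum>k\<in>{1..n}. indicator (P k) (frac_vec y) * g k) = g k" for g :: "nat \<Rightarrow> real"
  proof -
    have "indicator (P l) (frac_vec y) * g l = (if l = k then g k else 0)" if "l \<in> {1..n}" for l
    proof (cases "l = k")
      case False
      then have "P l \<inter> P k = {}" using P k(1) that unfolding measurable_partition_def disjoint_family_on_def by blast
      then show ?thesis using k(2) False by (auto simp: indicator_def)
    qed (use k in simp)
    then have "(\<Sum>k\<in>{1..n}. indicator (P k) (frac_vec y) * g k) = (\<Sum>l\<in>{1..n}. if l = k then g k else 0)"
      by (intro sum.cong) auto
    then show ?thesis using k(1) by simp
  qed
  with k that show thesis by blast
qed

text \<open>\<open>emeasure\<close> is 0 by default on non-measurable sets, so monotonicity and
  Markov estimates for these level sets require measurability. \<open>H\<close> is measurable on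
  \<open>\<Omega>\<close> only; multiplying it by the indicator of \<open>\<Omega>\<close> before
  taking distances changes nothing on the set.\<close>

lemma dist_level_set_measurable:
  fixes H :: "real^'d \<Rightarrow> real^'d^'s"
  assumes \<Omega>: "open \<Omega>" and P: "measurable_partition n P" and e: "\<epsilon> > 0" and H: "set_borel_measurable lebesgue \<Omega> H"
  shows "{x \<in> \<Omega>. \<bar>(\<Sum>k\<in>{1..n}. indicator (P k) (frac_vec (x /\<^sub>R \<epsilon>)) * infdist (H x) (\<AA> k)) - 0\<bar> > \<delta>} \<in> sets lebesgue" (is "?D \<in> _")
proof -
  have "?D = (\<Union>k\<in>{1..n}. {x. frac_vec (x /\<^sub>R \<epsilon>) \<in> P k} \<inter> \<Omega> \<inter> {x. infdist (indicator \<Omega> x *\<^sub>R H x) (\<AA> k) > \<delta>})"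
  proof (intro equalityI subsetI)
    fix x assume x: "x \<in> ?D"
    obtain k where k: "k \<in> {1..n}" "frac_vec (x /\<^sub>R \<epsilon>) \<in> P k" "\<And>g :: nat \<Rightarrow> real. (\<Sum>k\<in>{1..n}. indicator (P k) (frac_vec (x /\<^sub>R \<epsilon>)) * g k) = g k"
      using partition_sum[OF P, of "x /\<^sub>R \<epsilon>"] by blast
    then show "x \<in> (\<Union>k\<in>{1..n}. {x. frac_vec (x /\<^sub>R \<epsilon>) \<in> P k} \<inter> \<Omega> \<inter> {x. infdist (indicator \<Omega> x *\<^sub>R H x) (\<AA> k) > \<delta>})"
      using x by (auto simp: infdist_nonneg intro!: bexI[of _ k])
  next
    fix x assume "x \<in> (\<Union>k\<in>{1..n}. {x. frac_vec (x /\<^sub>R \<epsilon>) \<in> P k} \<inter> \<Omega> \<inter> {x. infdist (indicator \<Omega> x *\<^sub>R H x) (\<AA> k) > \<delta>})"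
    then obtain l where l: "l \<in> {1..n}" "frac_vec (x /\<^sub>R \<epsilon>) \<in> P l" "x \<in> \<Omega>" "infdist (H x) (\<AA> l) > \<delta>" by auto
    obtain k where k: "k \<in> {1..n}" "frac_vec (x /\<^sub>R \<epsilon>) \<in> P k" "\<And>g :: nat \<Rightarrow> real. (\<Sum>k\<in>{1..n}. indicator (P k) (frac_vec (x /\<^sub>R \<epsilon>)) * g k) = g k"
      using partition_sum[OF P, of "x /\<^sub>R \<epsilon>"] by blast
    have "k = l" using P k(1,2) l(1,2) unfolding measurable_partition_def disjoint_family_on_def by blast
    then show "x \<in> ?D" using l k(3) by (simp add: infdist_nonneg)
  qed
  moreover have "{x. frac_vec (x /\<^sub>R \<epsilon>) \<in> P k} \<in> sets lebesgue" if "k \<in> {1..n}" for k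
    using P that e unfolding measurable_partition_def by (intro frac_vec_preimage_lebesgue) auto
  moreover have "{x. infdist (indicator \<Omega> x *\<^sub>R H x) (\<AA> k) > \<delta>} \<in> sets lebesgue" for k
  proof -
    have "(\<lambda>y. infdist y (\<AA> k)) \<in> borel_measurable borel" by (intro borel_measurable_continuous_onI continuous_intros)
    from measurable_compose[OF H[unfolded set_borel_measurable_def] this]
    have m: "(\<lambda>x. infdist (indicator \<Omega> x *\<^sub>R H x) (\<AA> k)) \<in> borel_measurable lebesgue" .
    have "{x \<in> space lebesgue. \<delta> < infdist (indicator \<Omega> x *\<^sub>R H x) (\<AA> k)} \<in> sets lebesgue"
      using m by (intro borel_measurable_less) auto
    then show ?thesis by simp
  qed
  moreover have "\<Omega> \<in> sets lebesgue" using \<Omega> by simp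
  ultimately show ?thesis by (simp only:) (intro sets.finite_UN sets.Int finite_atLeastAtMost; assumption)
qed

lemma energy_linear:
  fixes A :: "real^'d^'s"
  assumes \<Omega>: "open \<Omega>" "bounded \<Omega>" and p: "p > 0"
  shows "(\<lambda>x. A *v x) \<in> Lp \<Omega> p" "energy \<Omega> p (\<lambda>x. f) (\<lambda>x. A *v x) = ennreal (f A) * emeasure lebesgue \<Omega>"
proof -
  have lin: "has_weak_gradient \<Omega> (\<lambda>x. A *v x) (\<lambda>x. A)" by (rule linear_map_weak_gradient[OF \<Omega>(1)])
  note meas = locally_integrable_measurable[OF \<Omega>(1)]
  obtain B where "AE x in lebesgue. x \<in> \<Omega> \<longrightarrow> norm (0 - A *v x) \<le> B"
    using AE_bounded_minus_linear[OF \<Omega>(2), of "\<lambda>x. 0" 0 A] by auto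
  then have B: "AE x in lebesgue. x \<in> \<Omega> \<longrightarrow> norm (A *v x) \<le> B" by simp
  show Lp: "(\<lambda>x. A *v x) \<in> Lp \<Omega> p"
    by (rule bounded_Lp[OF \<Omega> meas[OF has_weak_gradientD(1)[OF lin]] B p])
  have "(\<lambda>x. A) \<in> Lp \<Omega> p"
    by (rule bounded_Lp[OF \<Omega> meas[OF has_weak_gradientD(2)[OF lin]], where B="norm A"]) (use p in auto)
  then have W: "(\<lambda>x. A *v x) \<in> W1p \<Omega> p" using Lp lin unfolding W1p_def by blast
  have "(\<integral>\<^sup>+x\<in>\<Omega>. ennreal (f (weak_grad \<Omega> (\<lambda>x. A *v x) x)) \<partial>lebesgue) = (\<integral>\<^sup>+x\<in>\<Omega>. ennreal (f A) \<partial>lebesgue)"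
    by (intro nn_integral_cong_AE) (use weak_grad_AE_eq(1)[OF \<Omega>(1) lin] in \<open>eventually_elim, auto split: split_indicator\<close>)
  also have "\<dots> = ennreal (f A) * emeasure lebesgue \<Omega>" using \<Omega> by (intro nn_integral_cmult_indicator) auto
  finally show "energy \<Omega> p (\<lambda>x. f) (\<lambda>x. A *v x) = ennreal (f A) * emeasure lebesgue \<Omega>" using W by (simp add: energy_def)
qed

lemma W1inf_subset_W1p:
  assumes \<Omega>: "open \<Omega>" "bounded \<Omega>" and p: "p > 0" and u: "u \<in> W1inf \<Omega>"
  shows "u \<in> W1p \<Omega> p"
proof -
  obtain G where G: "G \<in> Linf \<Omega>" "has_weak_gradient \<Omega> u G" and ul: "u \<in> Linf \<Omega>"
    using u unfolding W1inf_def by blast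
  have "u \<in> Lp \<Omega> p" using ul bounded_Lp[OF \<Omega> _ _ p, of u] unfolding Linf_def by blast
  moreover have "G \<in> Lp \<Omega> p" using G(1) bounded_Lp[OF \<Omega> _ _ p, of G] unfolding Linf_def by blast
  ultimately show ?thesis using G(2) unfolding W1p_def by blast
qed

text \<open>Off the level set the gradient is within \<open>\<delta>\<close> of the active set and
  the density is at most \<open>\<kappa>\<close>; on it the gradient bound \<open>R\<close> still
  gives the density bound \<open>C\<close>.\<close>

lemma energy_le_level_set:
  fixes \<Omega> :: "(real^'d) set" and W :: "nat \<Rightarrow> real^'d^'s \<Rightarrow> real"
  assumes \<Omega>: "open \<Omega>" "bounded \<Omega>" and P: "measurable_partition n P" and e: "\<epsilon> > 0"
    and H: "set_borel_measurable lebesgue \<Omega> H" "AE x in lebesgue. x \<in> \<Omega> \<longrightarrow> norm (H x) \<le> R"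
    and small: "\<And>k \<Lambda>. k \<in> {1..n} \<Longrightarrow> norm \<Lambda> \<le> R \<Longrightarrow> infdist \<Lambda> (\<AA> k) \<le> \<delta> \<Longrightarrow> W k \<Lambda> \<le> \<kappa>"
    and C: "\<And>k \<Lambda>. k \<in> {1..n} \<Longrightarrow> norm \<Lambda> \<le> R \<Longrightarrow> W k \<Lambda> \<le> C" and k: "\<kappa> \<ge> 0" "C \<ge> 0"
  shows "(\<integral>\<^sup>+x\<in>\<Omega>. ennreal (\<Sum>k\<in>{1..n}. indicator (P k) (frac_vec (x /\<^sub>R \<epsilon>)) * W k (H x)) \<partial>lebesgue)
    \<le> ennreal \<kappa> * emeasure lebesgue \<Omega> + ennreal C * emeasure lebesgue {x \<in> \<Omega>. \<bar>(\<Sum>k\<in>{1..n}. indicator (P k) (frac_vec (x /\<^sub>R \<epsilon>)) * infdist (H x) (\<AA> k)) - 0\<bar> > \<delta>}"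
    (is "_ \<le> _ + _ * emeasure lebesgue ?D")
proof -
  have D: "?D \<in> sets lebesgue" by (rule dist_level_set_measurable[OF \<Omega>(1) P e H(1)])
  have Om: "\<Omega> \<in> sets lebesgue" using \<Omega> by auto
  have "(\<integral>\<^sup>+x\<in>\<Omega>. ennreal (\<Sum>k\<in>{1..n}. indicator (P k) (frac_vec (x /\<^sub>R \<epsilon>)) * W k (H x)) \<partial>lebesgue)
     \<le> (\<integral>\<^sup>+x. ennreal \<kappa> * indicator \<Omega> x + ennreal C * indicator ?D x \<partial>lebesgue)"
  proof (rule nn_integral_mono_AE)
    show "AE x in lebesgue. ennreal (\<Sum>k\<in>{1..n}. indicator (P k) (frac_vec (x /\<^sub>R \<epsilon>)) * W k (H x)) * indicator \<Omega> x \<le> ennreal \<kappa> * indicator \<Omega> x + ennreal C * indicator ?D x"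
      using H(2)
    proof eventually_elim
      case (elim x)
      show ?case
      proof (cases "x \<in> \<Omega>")
        case True
        obtain k where k: "k \<in> {1..n}" "frac_vec (x /\<^sub>R \<epsilon>) \<in> P k" "\<And>g :: nat \<Rightarrow> real. (\<Sum>k\<in>{1..n}. indicator (P k) (frac_vec (x /\<^sub>R \<epsilon>)) * g k) = g k"
          using partition_sum[OF P, of "x /\<^sub>R \<epsilon>"] by blast
        show ?thesis
        proof (cases "x \<in> ?D")
          case D: True
          have "ennreal (W k (H x)) \<le> ennreal C" using C[OF k(1)] elim True by (intro ennreal_leI) auto
          then show ?thesis using D True k(3) by (simp add: add_increasing)
        next
          case False
          then have "infdist (H x) (\<AA> k) \<le> \<delta>" using True k(3) by (simp add: infdist_nonneg)
          then have "ennreal (W k (H x)) \<le> ennreal \<kappa>" using small[OF k(1)] elim True by (intro ennreal_leI) auto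
          then show ?thesis using True k(3) by (simp add: add_increasing2)
        qed
      qed simp
    qed
  qed
  also have "\<dots> = ennreal \<kappa> * emeasure lebesgue \<Omega> + ennreal C * emeasure lebesgue ?D"
    using D Om by (simp add: nn_integral_add nn_integral_cmult)
  finally show ?thesis .
qed

lemma homogenized_set_imp_zero:
  fixes \<Omega> :: "(real^'d) set" and W :: "nat \<Rightarrow> real^'d^'s \<Rightarrow> real"
  assumes n: "1 \<le> n" and p: "1 < p" and \<Omega>: "open \<Omega>" "bounded \<Omega>" "\<Omega> \<noteq> {}"
    and W0: "\<And>k \<Lambda>. k \<in> {1..n} \<Longrightarrow> 0 \<le> W k \<Lambda>"
    and Wc: "\<And>k. k \<in> {1..n} \<Longrightarrow> continuous_on UNIV (W k)"
    and P: "measurable_partition n P"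
    and WZ: "\<And>k. k \<in> {1..n} \<Longrightarrow> W k -` {0} \<noteq> {}"
    and hom: "homogenized_integrand \<Omega> p (\<lambda>y \<Lambda>. \<Sum>k\<in>{1..n}. indicator (P k) y * W k \<Lambda>) Whom"
    and A: "A \<in> homogenized_set \<Omega> n (\<lambda>k. W k -` {0}) P"
  shows "Whom A = 0"
proof -
  \<comment> \<open>Membership in the homogenized set and Gamma-convergence both hold along every
    vanishing sequence; one sequence is enough for this inclusion.\<close>
  define \<epsilon> where "\<epsilon> h = inverse (real (Suc h))" for h
  have v\<epsilon>: "vanishing_positive \<epsilon>" unfolding vanishing_positive_def \<epsilon>_def using LIMSEQ_inverse_real_of_nat by auto
  then have e: "\<epsilon> h > 0" for h by (simp add: vanishing_positive_def)
  obtain u where u: "\<And>h. u h \<in> W1inf \<Omega>" "weakstar_W1inf \<Omega> u (\<lambda>x. A *v x)"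
    "converges_in_measure \<Omega> (\<lambda>h x. \<Sum>k\<in>{1..n}. indicator (P k) (frac_vec (x /\<^sub>R \<epsilon> h)) *
                  infdist (weak_grad \<Omega> (u h) x) (W k -` {0})) (\<lambda>x. 0)"
    using A v\<epsilon> unfolding homogenized_set_def by blast
  define H where "H h = weak_grad \<Omega> (u h)" for h
  obtain M where M: "\<And>h i. AE x in lebesgue. x \<in> \<Omega> \<longrightarrow> \<bar>(u h x - A *v x) $ i\<bar> \<le> M"
    "\<And>h i j. AE x in lebesgue. x \<in> \<Omega> \<longrightarrow> \<bar>(H h x - A) $ i $ j\<bar> \<le> M"
    "\<And>i. (\<lambda>h. LINT x:\<Omega>|lebesgue. \<bar>(u h x - A *v x) $ i\<bar>) \<longlonglongrightarrow> 0"
    using weakstar_W1inf_strong[OF \<Omega>(1,2) u(1,2)] unfolding H_def by blast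
  have wg: "has_weak_gradient \<Omega> (u h) (H h)" for h
    using u(1)[of h] weak_grad_AE_eq(2)[OF \<Omega>(1)] unfolding W1inf_def H_def by blast
  note meas = locally_integrable_measurable[OF \<Omega>(1)]
  have Hm: "set_borel_measurable lebesgue \<Omega> (H h)" for h by (rule meas[OF has_weak_gradientD(2)[OF wg]])
  define R where "R = norm A + (\<Sum>i\<in>(UNIV::'s set). \<Sum>j\<in>(UNIV::'d set). M)"
  have HR: "AE x in lebesgue. x \<in> \<Omega> \<longrightarrow> norm (H h x) \<le> R" for h
  proof -
    have "AE x in lebesgue. \<forall>i j. x \<in> \<Omega> \<longrightarrow> \<bar>(H h x - A) $ i $ j\<bar> \<le> M" by (intro AE_all_countable[THEN iffD2] allI M(2))
    then show ?thesis
    proof (eventually_elim, intro impI)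
      fix x assume *: "\<forall>i j. x \<in> \<Omega> \<longrightarrow> \<bar>(H h x - A) $ i $ j\<bar> \<le> M" and x: "x \<in> \<Omega>"
      have "norm (H h x) \<le> norm A + norm (H h x - A)" by (rule norm_triangle_sub)
      also have "norm (H h x - A) \<le> (\<Sum>i\<in>UNIV. \<Sum>j\<in>UNIV. \<bar>(H h x - A) $ i $ j\<bar>)" by (rule norm_matrix_le_sum)
      also have "\<dots> \<le> (\<Sum>i\<in>(UNIV::'s set). \<Sum>j\<in>(UNIV::'d set). M)" using * x by (intro sum_mono) blast
      finally show "norm (H h x) \<le> R" by (simp add: R_def)
    qed
  qed
  have "\<exists>C. \<forall>\<Lambda>. norm \<Lambda> \<le> R \<longrightarrow> W k \<Lambda> \<le> C" if "k \<in> {1..n}" for k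
  proof -
    have "compact (W k ` cball 0 R)" using Wc[OF that] by (intro compact_continuous_image) (auto intro: continuous_on_subset)
    then obtain b where "\<And>y. y \<in> W k ` cball 0 R \<Longrightarrow> norm y \<le> b" using compact_imp_bounded bounded_iff by metis
    then show ?thesis by (intro exI[of _ b]) (auto simp: abs_le_iff)
  qed
  then obtain c where c: "\<And>k \<Lambda>. k \<in> {1..n} \<Longrightarrow> norm \<Lambda> \<le> R \<Longrightarrow> W k \<Lambda> \<le> c k" by metis
  define C where "C = Max (insert 0 (c ` {1..n}))"
  have C0: "C \<ge> 0" unfolding C_def by (intro Max_ge) auto
  have C: "W k \<Lambda> \<le> C" if "k \<in> {1..n}" "norm \<Lambda> \<le> R" for k \<Lambda>
  proof -
    have "c k \<le> C" unfolding C_def using that by (intro Max_ge) auto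
    then show ?thesis using c[OF that] by linarith
  qed
  define E where "E h = energy \<Omega> p (\<lambda>x \<Lambda>. \<Sum>k\<in>{1..n}. indicator (P k) (frac_vec (x /\<^sub>R \<epsilon> h)) * W k \<Lambda>)" for h
  have u1p: "u h \<in> W1p \<Omega> p" for h using W1inf_subset_W1p[OF \<Omega>(1,2) _ u(1)] p by simp
  define Om where "Om = measure lebesgue \<Omega>"
  have Om: "emeasure lebesgue \<Omega> = ennreal Om" "Om > 0"
  proof -
    have "\<Omega> \<in> lmeasurable" using \<Omega> by (simp add: lmeasurable_open)
    then show "emeasure lebesgue \<Omega> = ennreal Om" unfolding Om_def by (rule emeasure_eq_measure2)
    have "measure lebesgue \<Omega> \<noteq> 0"
      using open_not_negligible[OF \<Omega>(1,3)] \<open>\<Omega> \<in> lmeasurable\<close> by (simp add: negligible_iff_measure)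
    then show "Om > 0" unfolding Om_def using measure_nonneg[of lebesgue \<Omega>] by linarith
  qed
  have lim0: "liminf (\<lambda>h. E h (u h)) \<le> 0 + ennreal t" if t: "t > 0" for t
  proof -
    \<comment> \<open>Half of \<open>t\<close> is spent off the level set, the other half on it,
      where the density is at most \<open>C\<close> and the measure is eventually below
      \<open>t / (2 * (C + 1))\<close>.\<close>
    define \<kappa> where "\<kappa> = t / (2 * Om)"
    have \<kappa>: "\<kappa> > 0" using t Om by (simp add: \<kappa>_def)
    have "\<exists>\<delta>>0. \<forall>\<Lambda>. norm \<Lambda> \<le> R \<longrightarrow> infdist \<Lambda> (W k -` {0}) \<le> \<delta> \<longrightarrow> W k \<Lambda> < \<kappa>" if "k \<in> {1..n}" for k
      by (rule small_near_zero_set[OF Wc[OF that] WZ[OF that] \<kappa>])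
    then obtain d where d: "\<And>k. k \<in> {1..n} \<Longrightarrow> d k > 0"
      "\<And>k \<Lambda>. k \<in> {1..n} \<Longrightarrow> norm \<Lambda> \<le> R \<Longrightarrow> infdist \<Lambda> (W k -` {0}) \<le> d k \<Longrightarrow> W k \<Lambda> < \<kappa>" by metis
    define \<delta> where "\<delta> = Min (d ` {1..n})"
    have \<delta>: "\<delta> > 0" using d(1) n by (simp add: \<delta>_def)
    have small: "W k \<Lambda> \<le> \<kappa>" if "k \<in> {1..n}" "norm \<Lambda> \<le> R" "infdist \<Lambda> (W k -` {0}) \<le> \<delta>" for k \<Lambda>
    proof -
      have "\<delta> \<le> d k" unfolding \<delta>_def using that(1) by (intro Min_le) auto
      then show ?thesis using d(2)[OF that(1,2)] that(3) by simp
    qed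
    define D where "D h = {x \<in> \<Omega>. \<bar>(\<Sum>k\<in>{1..n}. indicator (P k) (frac_vec (x /\<^sub>R \<epsilon> h)) * infdist (H h x) (W k -` {0})) - 0\<bar> > \<delta>}" for h
    have "(\<lambda>h. emeasure lebesgue (D h)) \<longlonglongrightarrow> 0"
      using u(3) \<delta> unfolding converges_in_measure_def D_def H_def by blast
    moreover have "ennreal (t / (2 * (C + 1))) > 0" using t C0 by simp
    ultimately have "\<forall>\<^sub>F h in sequentially. emeasure lebesgue (D h) < ennreal (t / (2 * (C + 1)))"
      by (rule order_tendstoD(2))
    then have "\<forall>\<^sub>F h in sequentially. E h (u h) \<le> ennreal t"
    proof eventually_elim
      case (elim h)
      have "E h (u h) \<le> ennreal \<kappa> * emeasure lebesgue \<Omega> + ennreal C * emeasure lebesgue (D h)"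
        unfolding E_def energy_def D_def H_def[symmetric] using u1p[of h] energy_le_level_set[OF \<Omega>(1,2) P e[of h] Hm[of h] HR[of h] small C _ C0] \<kappa> by simp
      also have "\<dots> \<le> ennreal \<kappa> * ennreal Om + ennreal C * ennreal (t / (2 * (C + 1)))"
        using elim Om by (intro add_mono mult_left_mono) auto
      also have "\<dots> = ennreal (\<kappa> * Om + C * (t / (2 * (C + 1))))"
        using \<kappa> Om C0 t by (simp only: ennreal_plus ennreal_mult mult_nonneg_nonneg less_imp_le divide_nonneg_nonneg add_nonneg_nonneg zero_le_one zero_le_numeral)
      also have "\<dots> \<le> ennreal t"
      proof (rule ennreal_leI)
        have "C * (t / (2 * (C + 1))) = (t/2) * (C / (C + 1))" by simp
        also have "\<dots> \<le> (t/2) * 1" using t C0 by (intro mult_left_mono) auto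
        finally have "C * (t / (2 * (C + 1))) \<le> t / 2" by simp
        moreover have "\<kappa> * Om = t / 2" using Om by (simp add: \<kappa>_def)
        ultimately show "\<kappa> * Om + C * (t / (2 * (C + 1))) \<le> t" by linarith
      qed
      finally show ?case .
    qed
    then have "limsup (\<lambda>h. E h (u h)) \<le> ennreal t" by (rule Limsup_bounded)
    then show ?thesis using Liminf_le_Limsup[of sequentially "\<lambda>h. E h (u h)"] by simp
  qed
  have "liminf (\<lambda>h. E h (u h)) \<le> 0" by (rule ennreal_le_epsilon) (rule lim0)
  moreover have "energy \<Omega> p (\<lambda>x. Whom) (\<lambda>x. A *v x) \<le> liminf (\<lambda>h. E h (u h))"
  proof -
    have "gamma_limit \<Omega> p E (energy \<Omega> p (\<lambda>x. Whom))"
      using hom v\<epsilon> unfolding homogenized_integrand_def E_def[abs_def] by blast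
    then have "energy \<Omega> p (\<lambda>x. Whom) (\<lambda>x. A *v x) \<le> Inf {liminf (\<lambda>h. E h (v h)) | v. (\<forall>h. v h \<in> Lp \<Omega> p) \<and> converges_Lp \<Omega> p v (\<lambda>x. A *v x)}"
      using energy_linear(1)[OF \<Omega>(1,2), of p A] p unfolding gamma_limit_def by simp
    also have "\<dots> \<le> liminf (\<lambda>h. E h (u h))"
    proof (rule Inf_lower, intro CollectI exI[of _ u] conjI refl allI)
      show "u h \<in> Lp \<Omega> p" for h using u1p unfolding W1p_def by blast
      show "converges_Lp \<Omega> p u (\<lambda>x. A *v x)" unfolding converges_Lp_def
      proof (rule bounded_L1_imp_Lp_tendsto[OF _ M(1,3) p])
        have "has_weak_gradient \<Omega> (\<lambda>x. u h x - A *v x) (\<lambda>x. H h x - A)" for h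
          by (rule has_weak_gradient_diff[OF wg linear_map_weak_gradient[OF \<Omega>(1)]])
        from meas[OF locally_integrable_component[OF has_weak_gradientD(1)[OF this]]]
        show "set_integrable lebesgue \<Omega> (\<lambda>x. (u h x - A *v x) $ i)" for h i
          by (rule bounded_set_integrable[OF _ \<Omega>(1,2) M(1)])
      qed
    qed
    finally show ?thesis .
  qed
  \<comment> \<open>The homogenized energy of the linear map is \<open>Whom A\<close> times the
    measure of the nonempty open set \<open>\<Omega>\<close>, which is positive.\<close>
  ultimately have "ennreal (Whom A) * ennreal Om = 0"
    using energy_linear(2)[OF \<Omega>(1,2), of p Whom A] p Om(1) by simp
  then have "ennreal (Whom A) = 0" using Om(2) by simp
  then show ?thesis using hom unfolding homogenized_integrand_def by (simp add: ennreal_eq_0_iff antisym)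
qed


subsection \<open>Lipschitz estimates off the level set of a maximal function\<close>

text \<open>The infimal convolution of \<open>f\<close> with \<open>L * dist\<close> extends it with
  the same Lipschitz constant. Clipping at \<open>\<tau>\<close> preserves both the constant and the
  values on \<open>S\<close>; the sup bound is what later gives uniform convergence.\<close>

lemma mcshane_bounded_extension:
  fixes f :: "'a::metric_space \<Rightarrow> real"
  assumes lip: "\<And>x y. x \<in> S \<Longrightarrow> y \<in> S \<Longrightarrow> \<bar>f x - f y\<bar> \<le> L * dist x y" and L: "L \<ge> 0"
    and b: "\<And>x. x \<in> S \<Longrightarrow> \<bar>f x\<bar> \<le> \<tau>" and \<tau>: "\<tau> \<ge> 0"
  shows "\<exists>w. (\<forall>x y. \<bar>w x - w y\<bar> \<le> L * dist x y) \<and> (\<forall>x. \<bar>w x\<bar> \<le> \<tau>) \<and> (\<forall>x\<in>S. w x = f x)"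
proof (cases "S = {}")
  case True
  then show ?thesis using L \<tau> by (intro exI[of _ "\<lambda>x. 0"]) auto
next
  case False
  define W where "W x = (INF y\<in>S. f y + L * dist x y)" for x
  have bdd: "bdd_below ((\<lambda>y. f y + L * dist x y) ` S)" for x
  proof (rule bdd_belowI2[of _ "-\<tau>"])
    fix y assume "y \<in> S"
    then have "- \<tau> \<le> f y" using b[of y] by linarith
    then show "- \<tau> \<le> f y + L * dist x y" using L by (simp add: add_increasing2)
  qed
  have le: "W x \<le> W y + L * dist x y" for x y
  proof -
    have "W x - L * dist x y \<le> f z + L * dist y z" if z: "z \<in> S" for z
    proof -
      have "W x \<le> f z + L * dist x z" unfolding W_def by (rule cINF_lower[OF bdd z])
      also have "L * dist x z \<le> L * (dist x y + dist y z)" by (intro mult_left_mono dist_triangle L)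
      finally show ?thesis by (simp add: distrib_left)
    qed
    then have "W x - L * dist x y \<le> W y" unfolding W_def[of y] by (intro cINF_greatest False)
    then show ?thesis by simp
  qed
  have eq: "W x = f x" if x: "x \<in> S" for x
  proof (rule antisym)
    show "W x \<le> f x" using cINF_lower[OF bdd x, of x] by (simp add: W_def)
    show "f x \<le> W x" unfolding W_def
    proof (rule cINF_greatest[OF False])
      fix y assume "y \<in> S" then show "f x \<le> f y + L * dist x y" using lip[OF x, of y] by simp
    qed
  qed
  define w where "w x = max (- \<tau>) (min \<tau> (W x))" for x
  have "\<bar>w x - w y\<bar> \<le> L * dist x y" for x y
  proof -
    have "\<bar>w x - w y\<bar> \<le> \<bar>W x - W y\<bar>" by (simp add: w_def)
    also have "\<dots> \<le> L * dist x y" using le[of x y] le[of y x] by (simp add: dist_commute abs_le_iff)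
    finally show ?thesis .
  qed
  moreover have "\<bar>w x\<bar> \<le> \<tau>" for x using \<tau> by (auto simp: w_def)
  moreover have "w x = f x" if "x \<in> S" for x using eq[OF that] b[OF that] by (auto simp: w_def)
  ultimately show ?thesis by blast
qed

lemma ball_borel_measurable [measurable]: "ball a r \<in> sets borel" by simp

text \<open>The set where the uncentred Hardy-Littlewood maximal function of \<open>g\<close>
  exceeds 1. Uncentred balls make it open as a union of balls, and they let a single ball be used
  for two points at once.\<close>

definition maximal_bad_set :: "('a::euclidean_space \<Rightarrow> real) \<Rightarrow> 'a set" where
  "maximal_bad_set g = (\<Union>(a, r)\<in>{(a, r). r > 0 \<and> (\<integral>\<^sup>+x\<in>ball a r. ennreal (g x) \<partial>lborel) > emeasure lborel (ball a r)}. ball a r)"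

lemma open_maximal_bad_set: "open (maximal_bad_set g)"
  unfolding maximal_bad_set_def by auto

lemma not_maximal_bad_setD:
  assumes "x \<notin> maximal_bad_set g" "x \<in> ball a r"
  shows "(\<integral>\<^sup>+x\<in>ball a r. ennreal (g x) \<partial>lborel) \<le> emeasure lborel (ball a r)"
proof -
  have "r > 0" using assms(2) le_less_trans[OF zero_le_dist, of a x r] by simp
  then have "(a, r) \<in> {(a, r). r > 0 \<and> (\<integral>\<^sup>+x\<in>ball a r. ennreal (g x) \<partial>lborel) > emeasure lborel (ball a r)}"
    if "\<not> ?thesis" using that by simp
  then show ?thesis using assms unfolding maximal_bad_set_def by blast
qed

text \<open>The weak type inequality for the maximal function: from the balls with large average a
  disjoint subfamily is selected whose fivefold enlargements cover all of them, whence the factor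
  \<open>5 ^ DIM('a)\<close>.\<close>

lemma emeasure_maximal_bad_set:
  fixes g :: "'a::euclidean_space \<Rightarrow> real"
  assumes g: "integrable lborel g" "\<And>x. g x \<ge> 0"
  shows "emeasure lborel (maximal_bad_set g) \<le> 5 ^ DIM('a) * (\<integral>\<^sup>+x. ennreal (g x) \<partial>lborel)"
proof -
  have [measurable]: "g \<in> borel_measurable borel" using g by auto
  define K where "K = {(a::'a, r). r > 0 \<and> (\<integral>\<^sup>+x\<in>ball a r. ennreal (g x) \<partial>lborel) > emeasure lborel (ball a r)}"
  define I where "I = (LINT x|lborel. g x)"
  have I: "(\<integral>\<^sup>+x. ennreal (g x) \<partial>lborel) = ennreal I" "I \<ge> 0"
    using g by (auto simp: I_def nn_integral_eq_integral)
  define c where "c = unit_ball_vol (real DIM('a))"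
  have c: "c > 0" by (simp add: c_def unit_ball_vol_pos)
  \<comment> \<open>The covering lemma needs bounded radii: the volume
    \<open>c * r ^ DIM('a)\<close> is below the total integral \<open>I\<close>, and for
    \<open>r > 1\<close> the power dominates \<open>r\<close>.\<close>
  have rb: "0 < snd i \<and> snd i \<le> max 1 (I / c)" if i: "i \<in> K" for i
  proof -
    obtain a r where ar: "i = (a, r)" by (cases i)
    have r: "r > 0" "emeasure lborel (ball a r) < (\<integral>\<^sup>+x\<in>ball a r. ennreal (g x) \<partial>lborel)" using i by (auto simp: K_def ar)
    note r(2)
    also have "(\<integral>\<^sup>+x\<in>ball a r. ennreal (g x) \<partial>lborel) \<le> (\<integral>\<^sup>+x. ennreal (g x) \<partial>lborel)"
      by (intro nn_integral_mono) (auto split: split_indicator)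
    finally have "ennreal (c * r ^ DIM('a)) < ennreal I" using r(1) I by (simp add: emeasure_ball c_def)
    then have lt: "c * r ^ DIM('a) < I" using c r(1) by (subst (asm) ennreal_less_iff) auto
    have "r \<le> max 1 (I / c)"
    proof (cases "r \<le> 1")
      case False
      then have "r ^ 1 \<le> r ^ DIM('a)" by (intro power_increasing) (auto simp: Suc_leI)
      then have "c * r \<le> c * r ^ DIM('a)" using c by (intro mult_left_mono) auto
      then have "c * r \<le> I" using lt by linarith
      then have "r \<le> I / c" using c by (simp add: field_simps)
      then show ?thesis by simp
    qed simp
    then show ?thesis using r ar by simp
  qed
  obtain C where C: "countable C" "C \<subseteq> K" "pairwise (\<lambda>i j. disjnt (cball (fst i) (snd i)) (cball (fst j) (snd j))) C"
    "\<And>i. i \<in> K \<Longrightarrow> \<exists>j. j \<in> C \<and> \<not> disjnt (cball (fst i) (snd i)) (cball (fst j) (snd j)) \<and> cball (fst i) (snd i) \<subseteq> ball (fst j) (5 * snd j)"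
    by (rule Vitali_covering_lemma_cballs_balls[of K snd "max 1 (I / c)" fst]) (rule rb, assumption, rule that, assumption+)
  define \<iota> where "\<iota> = to_nat_on C"
  have inj: "inj_on \<iota> C" unfolding \<iota>_def using C(1) by (rule inj_on_to_nat_on)
  define X where "X s m = (if m \<in> \<iota> ` C then ball (fst (the_inv_into C \<iota> m)) (s * snd (the_inv_into C \<iota> m)) else {})" for s m
  have X\<iota>: "X s (\<iota> j) = ball (fst j) (s * snd j)" if "j \<in> C" for s j
    using that by (simp add: X_def the_inv_into_f_f[OF inj])
  have Xm: "range (X s) \<subseteq> sets lborel" for s by (auto simp: X_def)
  have cov: "maximal_bad_set g \<subseteq> (\<Union>m. X 5 m)"
  proof
    fix x assume "x \<in> maximal_bad_set g"
    then obtain i where i: "i \<in> K" "x \<in> ball (fst i) (snd i)" unfolding maximal_bad_set_def K_def by auto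
    obtain j where j: "j \<in> C" "cball (fst i) (snd i) \<subseteq> ball (fst j) (5 * snd j)" using C(4)[OF i(1)] by blast
    have "x \<in> cball (fst i) (snd i)" using i(2) by simp
    then have "x \<in> X 5 (\<iota> j)" using j(2) unfolding X\<iota>[OF j(1)] by blast
    then show "x \<in> (\<Union>m. X 5 m)" by blast
  qed
  have scale: "emeasure lborel (X 5 m) = 5 ^ DIM('a) * emeasure lborel (X 1 m)" for m
  proof (cases "m \<in> \<iota> ` C")
    case True
    then obtain j where j: "j \<in> C" "m = \<iota> j" by blast
    have "snd j > 0" using rb C(2) j by blast
    then show ?thesis using c by (simp add: j X\<iota>[OF j(1)] emeasure_ball power_mult_distrib ennreal_mult'' ennreal_power[symmetric] mult_ac flip: ennreal_mult')
  qed (simp add: X_def)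
  have small: "emeasure lborel (X 1 m) \<le> (\<integral>\<^sup>+x\<in>X 1 m. ennreal (g x) \<partial>lborel)" for m
  proof (cases "m \<in> \<iota> ` C")
    case True
    then obtain j where j: "j \<in> C" "m = \<iota> j" by blast
    then have "j \<in> K" using C(2) by blast
    then show ?thesis unfolding j(2) X\<iota>[OF j(1)] by (cases j) (simp add: K_def less_imp_le)
  qed (simp add: X_def)
  have disj: "disjoint_family (X 1)"
  proof (unfold disjoint_family_on_def, intro ballI impI)
    fix m m' :: nat assume ne: "m \<noteq> m'"
    show "X 1 m \<inter> X 1 m' = {}"
    proof (cases "m \<in> \<iota> ` C \<and> m' \<in> \<iota> ` C")
      case True
      then obtain j j' where j: "j \<in> C" "m = \<iota> j" "j' \<in> C" "m' = \<iota> j'" by blast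
      then have "disjnt (cball (fst j) (snd j)) (cball (fst j') (snd j'))" using C(3) ne by (auto simp: pairwise_def)
      then have "ball (fst j) (snd j) \<inter> ball (fst j') (snd j') = {}" using ball_subset_cball unfolding disjnt_def by blast
      then show ?thesis using j by (simp add: X\<iota>)
    qed (auto simp: X_def)
  qed
  have "emeasure lborel (maximal_bad_set g) \<le> emeasure lborel (\<Union>m. X 5 m)"
    using Xm[of 5] cov by (intro emeasure_mono sets.countable_UN) auto
  also have "\<dots> \<le> (\<Sum>m. emeasure lborel (X 5 m))" by (rule emeasure_subadditive_countably[OF Xm])
  also have "\<dots> = 5 ^ DIM('a) * (\<Sum>m. emeasure lborel (X 1 m))" by (simp add: scale)
  also have "\<dots> \<le> 5 ^ DIM('a) * (\<Sum>m. \<integral>\<^sup>+x\<in>X 1 m. ennreal (g x) \<partial>lborel)"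
    by (intro mult_left_mono suminf_le small) auto
  \<comment> \<open>Reading the integrals as values of the measure with density \<open>g\<close>
    turns the sum over disjoint balls into one integral.\<close>
  also have "(\<Sum>m. \<integral>\<^sup>+x\<in>X 1 m. ennreal (g x) \<partial>lborel) = (\<Sum>m. emeasure (density lborel g) (X 1 m))"
    using Xm[of 1] by (intro suminf_cong emeasure_density[symmetric]) auto
  also have "\<dots> = emeasure (density lborel g) (\<Union>m. X 1 m)"
    using Xm[of 1] disj by (intro suminf_emeasure) auto
  also have "\<dots> = (\<integral>\<^sup>+x\<in>(\<Union>m. X 1 m). ennreal (g x) \<partial>lborel)"
    using Xm[of 1] by (intro emeasure_density sets.countable_UN) auto
  also have "\<dots> \<le> (\<integral>\<^sup>+x. ennreal (g x) \<partial>lborel)" by (intro nn_integral_mono) (auto split: split_indicator)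
  finally show ?thesis by (simp add: mult_left_mono)
qed

text \<open>Growth along the segment is compared with the primitive of \<open>k\<close>. The bound
  is stated in \<open>ennreal\<close> so that Tonelli can be applied to it.\<close>

lemma norm_diff_le_segment_integral:
  fixes f :: "'a::euclidean_space \<Rightarrow> 'b::euclidean_space"
  assumes f: "\<And>x. (f has_derivative f' x) (at x)" and h: "\<And>x v. norm (f' x v) \<le> h x * norm v" "continuous_on UNIV h"
  shows "ennreal (norm (f y - f x)) \<le> (\<integral>\<^sup>+t\<in>{0..1}. ennreal (h (x + t *\<^sub>R (y - x)) * norm (y - x)) \<partial>lborel)"
proof -
  define k where "k t = h (x + t *\<^sub>R (y - x)) * norm (y - x)" for t :: real
  have k: "continuous_on {0..1} k" unfolding k_def
    by (intro continuous_intros continuous_on_compose2[OF h(2)]) auto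
  have k0: "k t \<ge> 0" for t using norm_ge_zero[of "f' (x + t *\<^sub>R (y - x)) (y - x)"] h(1) order_trans unfolding k_def by blast
  define \<psi> where "\<psi> t = integral {0..t} k" for t
  have d\<psi>: "(\<psi> has_vector_derivative k t) (at t within {0..1})" if "t \<in> {0..1}" for t
    unfolding \<psi>_def by (rule integral_has_vector_derivative[OF k that])
  define \<phi> where "\<phi> t = f (x + t *\<^sub>R (y - x))" for t :: real
  have d\<phi>: "(\<phi> has_vector_derivative f' (x + t *\<^sub>R (y - x)) (y - x)) (at t within {0..1})" for t
  proof -
    have "(\<phi> has_derivative (\<lambda>s. f' (x + t *\<^sub>R (y - x)) (s *\<^sub>R (y - x)))) (at t within {0..1})"
      unfolding \<phi>_def by (rule has_derivative_compose[OF _ f]) (auto intro!: derivative_eq_intros)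
    moreover have "f' (x + t *\<^sub>R (y - x)) (s *\<^sub>R (y - x)) = s *\<^sub>R f' (x + t *\<^sub>R (y - x)) (y - x)" for s
      using has_derivative_linear[OF f] by (rule linear_cmul)
    ultimately show ?thesis by (simp add: has_vector_derivative_def)
  qed
  have "norm (\<phi> 1 - \<phi> 0) \<le> \<psi> 1 - \<psi> 0"
  proof (rule differentiable_bound_general)
    show "continuous_on {0..1} \<phi>" "continuous_on {0..1} \<psi>"
      by (auto simp: continuous_on_eq_continuous_within intro: has_vector_derivative_continuous[OF d\<phi>] has_vector_derivative_continuous[OF d\<psi>])
    fix t :: real assume t: "0 < t" "t < 1"
    show "(\<phi> has_vector_derivative f' (x + t *\<^sub>R (y - x)) (y - x)) (at t)" using d\<phi>[of t] at_within_Icc_at[OF t] by simp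
    show "(\<psi> has_vector_derivative k t) (at t)" using d\<psi>[of t] at_within_Icc_at[OF t] t by simp
    show "norm (f' (x + t *\<^sub>R (y - x)) (y - x)) \<le> k t" unfolding k_def by (rule h(1))
  qed simp
  also have "\<dots> = integral {0..1} k" by (simp add: \<psi>_def)
  finally have "ennreal (norm (f y - f x)) \<le> ennreal (integral {0..1} k)" by (intro ennreal_leI) (simp add: \<phi>_def)
  also have "\<dots> = (\<integral>\<^sup>+t. ennreal (indicator {0..1} t * k t) \<partial>lborel)"
    using k0 k by (intro nn_integral_has_integral_lebesgue[symmetric] integrable_integral integrable_continuous_real) auto
  also have "\<dots> = (\<integral>\<^sup>+t\<in>{0..1}. ennreal (k t) \<partial>lborel)" by (intro nn_integral_cong) (auto split: split_indicator)
  finally show ?thesis by (simp add: k_def)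
qed

text \<open>Integrate the segment estimate over \<open>y\<close> and exchange the order of
  integration. For fixed \<open>t\<close> the map from \<open>y\<close> to
  \<open>x + t *\<^sub>R (y - x)\<close> shrinks the ball to one of radius \<open>t * r\<close> that
  still contains \<open>x\<close>, so the assumed bound on averages of \<open>h\<close> applies to
  it; the Jacobian \<open>t ^ DIM('a)\<close> cancels against the volume ratio. The factor
  \<open>2 * r\<close> bounds \<open>norm (y - x)\<close>.\<close>

lemma ball_average_le:
  fixes f :: "'a::euclidean_space \<Rightarrow> 'b::euclidean_space"
  assumes f: "\<And>x. (f has_derivative f' x) (at x)" and h: "\<And>x v. norm (f' x v) \<le> h x * norm v" "continuous_on UNIV h"
    and x: "x \<in> ball a r" and K: "\<And>b s. x \<in> ball b s \<Longrightarrow> (\<integral>\<^sup>+z\<in>ball b s. ennreal (h z) \<partial>lborel) \<le> ennreal K * emeasure lborel (ball b s)" and K0: "K \<ge> 0"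
  shows "(\<integral>\<^sup>+y\<in>ball a r. ennreal (norm (f y - f x)) \<partial>lborel) \<le> ennreal (2 * r * K) * emeasure lborel (ball a r)"
proof -
  have r: "r > 0" using x le_less_trans[OF zero_le_dist, of a x r] by simp
  have hm[measurable]: "h \<in> borel_measurable borel" using h(2) by (rule borel_measurable_continuous_onI)
  have h0: "h z \<ge> 0" for z
  proof -
    obtain b :: 'a where "b \<in> Basis" using nonempty_Basis by blast
    then have "0 \<le> h z * 1" using order_trans[OF norm_ge_zero h(1)[of z b]] by simp
    then show ?thesis by simp
  qed
  define B where "B = ball a r"
  have [measurable]: "B \<in> sets borel" by (simp add: B_def)
  let ?k = "\<lambda>t y. ennreal (h (x + t *\<^sub>R (y - x)) * norm (y - x))"
  have inner: "(\<integral>\<^sup>+y\<in>ball a r. ennreal (h (x + t *\<^sub>R (y - x))) \<partial>lborel) \<le> ennreal K * emeasure lborel (ball a r)" if t: "t > 0" for t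
  proof -
    let ?B = "ball (x + t *\<^sub>R (a - x)) (t * r)"
    have "x - (x + t *\<^sub>R (a - x)) = t *\<^sub>R (x - a)" by (simp add: scaleR_diff_right)
    then have xB: "x \<in> ?B" using x t by (simp add: dist_norm norm_minus_commute)
    have ind: "indicator ?B ((x - t *\<^sub>R x) + t *\<^sub>R y) = (indicator (ball a r) y :: ennreal)" for y
    proof -
      have "x + t *\<^sub>R (a - x) - ((x - t *\<^sub>R x) + t *\<^sub>R y) = t *\<^sub>R (a - y)" by (simp add: scaleR_diff_right)
      then have "dist (x + t *\<^sub>R (a - x)) ((x - t *\<^sub>R x) + t *\<^sub>R y) = t * dist a y" using t by (simp add: dist_norm)
      then show ?thesis using t by (simp add: indicator_def)
    qed
    have mB: "(\<lambda>z. ennreal (h z) * indicator ?B z) \<in> borel_measurable borel" by measurable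
    define T where "T = ennreal (t ^ DIM('a))"
    have T: "T \<noteq> 0" "T \<noteq> \<infinity>" using t by (auto simp: T_def)
    have "T * (\<integral>\<^sup>+y\<in>ball a r. ennreal (h (x + t *\<^sub>R (y - x))) \<partial>lborel) = T * (\<integral>\<^sup>+y. ennreal (h ((x - t *\<^sub>R x) + t *\<^sub>R y)) * indicator ?B ((x - t *\<^sub>R x) + t *\<^sub>R y) \<partial>lborel)"
      unfolding ind by (simp add: algebra_simps)
    also have "\<dots> = (\<integral>\<^sup>+z\<in>?B. ennreal (h z) \<partial>lborel)"
      using nn_integral_lborel_affine[OF mB, of t "x - t *\<^sub>R x"] t by (simp add: T_def)
    also have "\<dots> \<le> ennreal K * emeasure lborel ?B" by (rule K[OF xB])
    also have "emeasure lborel ?B = T * emeasure lborel (ball a r)"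
      using t r by (simp add: emeasure_ball T_def power_mult_distrib mult_ac unit_ball_vol_nonneg flip: ennreal_mult')
    finally have "T * (\<integral>\<^sup>+y\<in>ball a r. ennreal (h (x + t *\<^sub>R (y - x))) \<partial>lborel) \<le> T * (ennreal K * emeasure lborel (ball a r))"
      by (simp add: mult_ac)
    then show ?thesis using T by (simp add: ennreal_mult_le_mult_iff)
  qed
  have "(\<integral>\<^sup>+y\<in>ball a r. ennreal (norm (f y - f x)) \<partial>lborel) \<le> (\<integral>\<^sup>+y\<in>ball a r. (\<integral>\<^sup>+t\<in>{0..1}. ?k t y \<partial>lborel) \<partial>lborel)"
    by (intro nn_integral_mono mult_right_mono norm_diff_le_segment_integral[OF f h]) auto
  also have "\<dots> = (\<integral>\<^sup>+y. (\<integral>\<^sup>+t. ?k t y * indicator {0..1} t * indicator (ball a r) y \<partial>lborel) \<partial>lborel)"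
    by (intro nn_integral_cong nn_integral_multc[symmetric]) measurable
  also have "\<dots> = (\<integral>\<^sup>+t. (\<integral>\<^sup>+y. ?k t y * indicator {0..1} t * indicator (ball a r) y \<partial>lborel) \<partial>lborel)"
    unfolding B_def[symmetric] by (rule lborel_pair.Fubini') measurable
  also have "\<dots> \<le> (\<integral>\<^sup>+(t::real). ennreal (2 * r) * (ennreal K * emeasure lborel (ball a r)) * indicator {0..1} t \<partial>lborel)"
  proof (rule nn_integral_mono_AE)
    \<comment> \<open>At \<open>t = 0\<close> the ball degenerates to a point; this single value is
      null.\<close>
    have "AE t in lborel. t \<noteq> (0::real)" by (rule AE_lborel_singleton)
    then show "AE t in lborel. (\<integral>\<^sup>+y. ?k t y * indicator {0..1} t * indicator (ball a r) y \<partial>lborel) \<le> ennreal (2 * r) * (ennreal K * emeasure lborel (ball a r)) * indicator {0..1} t"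
    proof eventually_elim
      case (elim t)
      show ?case
      proof (cases "t \<in> {0..1}")
        case True
        then have t: "t > 0" using elim by auto
        have "(\<integral>\<^sup>+y. ?k t y * indicator {0..1} t * indicator (ball a r) y \<partial>lborel) \<le> (\<integral>\<^sup>+y. ennreal (2 * r) * (ennreal (h (x + t *\<^sub>R (y - x))) * indicator (ball a r) y) \<partial>lborel)"
        proof (rule nn_integral_mono)
          fix y
          show "?k t y * indicator {0..1} t * indicator (ball a r) y \<le> ennreal (2 * r) * (ennreal (h (x + t *\<^sub>R (y - x))) * indicator (ball a r) y)"
          proof (cases "y \<in> ball a r")
            case y: True
            have "norm (y - x) \<le> 2 * r" using dist_triangle2[of y x a] x y by (simp add: dist_norm[symmetric] dist_commute)
            then have "h (x + t *\<^sub>R (y - x)) * norm (y - x) \<le> 2 * r * h (x + t *\<^sub>R (y - x))"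
              using h0 mult_left_mono[of "norm (y - x)" "2 * r" "h (x + t *\<^sub>R (y - x))"] by (simp add: mult_ac)
            then have "?k t y \<le> ennreal (2 * r * h (x + t *\<^sub>R (y - x)))" by (rule ennreal_leI)
            then show ?thesis using y True r h0 by (simp add: ennreal_mult)
          qed simp
        qed
        also have "\<dots> = ennreal (2 * r) * (\<integral>\<^sup>+y\<in>ball a r. ennreal (h (x + t *\<^sub>R (y - x))) \<partial>lborel)"
          by (rule nn_integral_cmult) measurable
        also have "\<dots> \<le> ennreal (2 * r) * (ennreal K * emeasure lborel (ball a r))" by (intro mult_left_mono inner t) auto
        finally show ?thesis using True by simp
      qed simp
    qed
  qed
  also have "\<dots> = ennreal (2 * r) * (ennreal K * emeasure lborel (ball a r))"
    by (subst nn_integral_cmult_indicator) auto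
  finally show ?thesis using r K0 by (simp add: ennreal_mult mult_ac)
qed

text \<open>Over a ball that meets the complement of the bad set, the average of \<open>h\<close> is
  at most \<open>R\<close> plus the average of the excess \<open>g\<close>, hence at most
  \<open>R + 1\<close>. The ball of radius \<open>norm (x - y)\<close> about the midpoint contains
  both points, and averaging the triangle inequality through \<open>z\<close> over it costs
  \<open>2 * r * (R + 1)\<close> per point; this explains the factor 4.\<close>

lemma lipschitz_off_bad_set:
  fixes f :: "'a::euclidean_space \<Rightarrow> 'b::euclidean_space"
  assumes f: "\<And>x. (f has_derivative f' x) (at x)" and h: "\<And>x v. norm (f' x v) \<le> h x * norm v" "continuous_on UNIV h"
    and g: "g = (\<lambda>x. max 0 (h x - R))" and R: "R \<ge> 0"
    and xy: "x \<notin> maximal_bad_set g" "y \<notin> maximal_bad_set g"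
  shows "norm (f x - f y) \<le> 4 * (R + 1) * norm (x - y)"
proof (cases "x = y")
  case False
  have hm[measurable]: "h \<in> borel_measurable borel" using h(2) by (rule borel_measurable_continuous_onI)
  have gm[measurable]: "g \<in> borel_measurable borel" unfolding g by measurable
  have K: "(\<integral>\<^sup>+z\<in>ball b s. ennreal (h z) \<partial>lborel) \<le> ennreal (R + 1) * emeasure lborel (ball b s)"
    if "u \<notin> maximal_bad_set g" "u \<in> ball b s" for u b s
  proof -
    have "(\<integral>\<^sup>+z\<in>ball b s. ennreal (h z) \<partial>lborel) \<le> (\<integral>\<^sup>+z. ennreal R * indicator (ball b s) z + ennreal (g z) * indicator (ball b s) z \<partial>lborel)"
    proof (rule nn_integral_mono)
      fix z
      have "ennreal (h z) \<le> ennreal (R + g z)" unfolding g by (intro ennreal_leI) auto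
      also have "\<dots> = ennreal R + ennreal (g z)" using R by (intro ennreal_plus) (auto simp: g)
      finally show "ennreal (h z) * indicator (ball b s) z \<le> ennreal R * indicator (ball b s) z + ennreal (g z) * indicator (ball b s) z"
        by (auto split: split_indicator)
    qed
    also have "\<dots> = ennreal R * emeasure lborel (ball b s) + (\<integral>\<^sup>+z\<in>ball b s. ennreal (g z) \<partial>lborel)"
      by (subst nn_integral_add) (auto simp: nn_integral_cmult_indicator)
    also have "\<dots> \<le> ennreal R * emeasure lborel (ball b s) + emeasure lborel (ball b s)"
      by (intro add_left_mono not_maximal_bad_setD[OF that])
    also have "\<dots> = ennreal (R + 1) * emeasure lborel (ball b s)" using R by (simp add: distrib_right)
    finally show ?thesis .
  qed
  define r where "r = norm (x - y)"
  define a where "a = midpoint x y"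
  have r: "r > 0" using False by (simp add: r_def)
  have "dist a x = r / 2" "dist a y = r / 2" using dist_midpoint(3,4)[of x y] unfolding a_def r_def dist_norm by auto
  then have inb: "x \<in> ball a r" "y \<in> ball a r" using r by simp_all
  have fc: "continuous_on UNIV f" using f by (auto simp: continuous_on_eq_continuous_at intro: has_derivative_continuous)
  have [measurable]: "f \<in> borel_measurable borel" using fc by (rule borel_measurable_continuous_onI)
  note av = ball_average_le[OF f h inb(1) K[OF xy(1)]] ball_average_le[OF f h inb(2) K[OF xy(2)]]
  define V where "V = unit_ball_vol (real DIM('a)) * r ^ DIM('a)"
  have V: "V > 0" "emeasure lborel (ball a r) = ennreal V" using r by (auto simp: V_def emeasure_ball unit_ball_vol_pos)
  have "ennreal (norm (f x - f y)) * emeasure lborel (ball a r) = (\<integral>\<^sup>+z\<in>ball a r. ennreal (norm (f x - f y)) \<partial>lborel)"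
    by (simp add: nn_integral_cmult_indicator)
  also have "\<dots> \<le> (\<integral>\<^sup>+z. ennreal (norm (f z - f x)) * indicator (ball a r) z + ennreal (norm (f z - f y)) * indicator (ball a r) z \<partial>lborel)"
  proof (rule nn_integral_mono)
    fix z
    have "norm (f x - f y) \<le> norm (f z - f x) + norm (f z - f y)"
      using norm_triangle_ineq4[of "f z - f y" "f z - f x"] by simp
    then have "ennreal (norm (f x - f y)) \<le> ennreal (norm (f z - f x) + norm (f z - f y))" by (rule ennreal_leI)
    then have "ennreal (norm (f x - f y)) \<le> ennreal (norm (f z - f x)) + ennreal (norm (f z - f y))"
      by (simp only: ennreal_plus norm_ge_zero)
    then show "ennreal (norm (f x - f y)) * indicator (ball a r) z \<le> ennreal (norm (f z - f x)) * indicator (ball a r) z + ennreal (norm (f z - f y)) * indicator (ball a r) z"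
      by (auto split: split_indicator)
  qed
  also have "\<dots> = (\<integral>\<^sup>+z\<in>ball a r. ennreal (norm (f z - f x)) \<partial>lborel) + (\<integral>\<^sup>+z\<in>ball a r. ennreal (norm (f z - f y)) \<partial>lborel)"
    by (rule nn_integral_add) measurable
  also have "\<dots> \<le> ennreal (2 * r * (R + 1)) * emeasure lborel (ball a r) + ennreal (2 * r * (R + 1)) * emeasure lborel (ball a r)"
    using R by (intro add_mono av) auto
  finally have "ennreal (norm (f x - f y) * V) \<le> ennreal (2 * r * (R + 1) * V + 2 * r * (R + 1) * V)"
  proof -
    have nn: "0 \<le> 2 * r * (R + 1)" "0 \<le> 2 * r * (R + 1) * V" "0 \<le> V" using V r R by auto
    show "ennreal (norm (f x - f y)) * emeasure lborel (ball a r) \<le> ennreal (2 * r * (R + 1)) * emeasure lborel (ball a r) + ennreal (2 * r * (R + 1)) * emeasure lborel (ball a r)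
      \<Longrightarrow> ennreal (norm (f x - f y) * V) \<le> ennreal (2 * r * (R + 1) * V + 2 * r * (R + 1) * V)"
      unfolding V(2) by (simp only: ennreal_mult[OF norm_ge_zero nn(3)] ennreal_plus[OF nn(2) nn(2)] ennreal_mult[OF nn(1) nn(3)])
  qed
  then have "norm (f x - f y) * V \<le> 2 * r * (R + 1) * V + 2 * r * (R + 1) * V"
    using V r R by (subst (asm) ennreal_le_iff) auto
  then have "norm (f x - f y) * V \<le> (4 * (R + 1) * r) * V" by (simp add: algebra_simps)
  then show ?thesis using V unfolding r_def by (rule_tac mult_right_le_imp_le) auto
qed simp


subsection \<open>Truncation\<close>

lemma mollifier_derivative_support:
  assumes "mollifier \<delta> \<eta>" "frechet_derivative \<eta> (at x) v \<noteq> 0"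
  shows "norm x \<le> \<delta>"
proof (rule ccontr)
  assume "\<not> norm x \<le> \<delta>"
  have "((\<lambda>x. 0) has_derivative (\<lambda>v. 0)) (at x)" by simp
  then have "(\<eta> has_derivative (\<lambda>v. 0)) (at x)"
    by (rule has_derivative_transform_within_open[where s="- cball 0 \<delta>"])
       (use \<open>\<not> norm x \<le> \<delta>\<close> mollifierD(3)[OF assms(1)] in \<open>force+\<close>)
  from fun_cong[OF frechet_derivative_at[OF this], of v] assms(2) show False by simp
qed

lemma smooth_weak_pdiff:
  fixes f :: "real^'d \<Rightarrow> real"
  assumes "\<And>k. Ck k f"
  shows "weak_pdiff \<Omega> j f (pdiff j f)"
  unfolding weak_pdiff_def using integration_by_parts_test[OF assms] by blast

lemma smooth_lipschitz:
  fixes f :: "real^'d \<Rightarrow> real"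
  assumes f: "\<And>k. Ck k f" and B: "\<And>j x. \<bar>pdiff j f x\<bar> \<le> B"
  shows "\<bar>f x - f y\<bar> \<le> (real CARD('d) * B) * norm (x - y)"
proof -
  have "norm (f x - f y) \<le> (real CARD('d) * B) * norm (x - y)"
  proof (rule differentiable_bound[where S=UNIV and f'="\<lambda>x. frechet_derivative f (at x)"])
    show "(f has_derivative frechet_derivative f (at u)) (at u within UNIV)" for u using smooth_has_derivative[OF f] by simp
    show "onorm (frechet_derivative f (at u)) \<le> real CARD('d) * B" for u
      by (rule onorm_le) (simp add: linear_bound_pdiff[OF has_derivative_linear[OF smooth_has_derivative[OF f]] B])
  qed auto
  then show ?thesis by simp
qed

text \<open>
  Here \<open>u\<close> is a mollification of the McShane extension of \<open>f\<close> from \<open>G\<close>. The difference of \<open>f\<close> and its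
  extension vanishes on \<open>G\<close> and is Lipschitz, so at points of \<open>G\<close> the derivative of its mollification
  is an average of the indicator of the complement of \<open>G\<close>, up to a factor that does not depend on
  the mollification radius. Integrated over \<open>G\<close>, this average is small by the continuity of
  translations in \<open>L\<^sup>1\<close>.
\<close>

lemma lipschitz_replacement:
  "\<exists>C>0. \<forall>(f :: real^'d \<Rightarrow> real) G \<Omega> L \<tau> B e.
     (\<forall>k. Ck k f) \<longrightarrow> integrable lborel f \<longrightarrow> (\<forall>j. integrable lborel (pdiff j f)) \<longrightarrow> (\<forall>j x. \<bar>pdiff j f x\<bar> \<le> B) \<longrightarrow>
     closed G \<longrightarrow> emeasure lborel (- G) < \<infinity> \<longrightarrow> bounded \<Omega> \<longrightarrow> \<Omega> \<in> sets borel \<longrightarrow> L \<ge> 0 \<longrightarrow> \<tau> \<ge> 0 \<longrightarrow> e > 0 \<longrightarrow>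
     (\<forall>x\<in>G. \<forall>y\<in>G. \<bar>f x - f y\<bar> \<le> L * dist x y) \<longrightarrow> (\<forall>x\<in>G. \<bar>f x\<bar> \<le> \<tau>) \<longrightarrow>
     (\<exists>u. (\<forall>k. Ck k u) \<and> (\<forall>x. \<bar>u x\<bar> \<le> \<tau>) \<and> (\<forall>x\<in>\<Omega>. \<forall>j. \<bar>pdiff j u x\<bar> \<le> C * L) \<and>
       (\<forall>j. (\<integral>\<^sup>+x\<in>G \<inter> \<Omega>. ennreal \<bar>pdiff j u x - pdiff j f x\<bar> \<partial>lborel) \<le> ennreal e))"
proof -
  obtain C where C: "C > 0" "\<And>\<delta>. \<delta> > 0 \<Longrightarrow> \<exists>\<eta> :: real^'d \<Rightarrow> real. mollifier \<delta> \<eta> \<and>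
     (\<forall>b\<in>Basis. (LINT x|lborel. \<bar>frechet_derivative \<eta> (at x) b\<bar>) \<le> C / \<delta>)" using ex_mollifier by blast
  show ?thesis
  proof (intro exI[of _ C] conjI C(1) allI impI)
    fix f :: "real^'d \<Rightarrow> real" and G \<Omega> :: "(real^'d) set" and L \<tau> B e :: real
    assume f: "\<forall>k. Ck k f" and fi: "integrable lborel f" and Dfi: "\<forall>j. integrable lborel (pdiff j f)" and B: "\<forall>j x. \<bar>pdiff j f x\<bar> \<le> B"
      and G: "closed G" "emeasure lborel (- G) < \<infinity>" and \<Omega>: "bounded \<Omega>" "\<Omega> \<in> sets borel" and L: "L \<ge> 0" and \<tau>: "\<tau> \<ge> 0" and e: "e > 0"
      and lip: "\<forall>x\<in>G. \<forall>y\<in>G. \<bar>f x - f y\<bar> \<le> L * dist x y" and b: "\<forall>x\<in>G. \<bar>f x\<bar> \<le> \<tau>"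
    have fk: "Ck k f" for k using f by blast
    have Gm[measurable]: "G \<in> sets borel" using G(1) by simp
    have Om[measurable]: "\<Omega> \<in> sets borel" by (rule \<Omega>(2))
    have fm[measurable]: "f \<in> borel_measurable borel" using fi by auto
    obtain w where w: "\<And>x y. \<bar>w x - w y\<bar> \<le> L * dist x y" "\<And>x. \<bar>w x\<bar> \<le> \<tau>" "\<And>x. x \<in> G \<Longrightarrow> w x = f x"
      using mcshane_bounded_extension[of G f L \<tau>] lip b L \<tau> by blast
    have "continuous_on UNIV w"
    proof (rule lipschitz_on_continuous_on)
      show "L-lipschitz_on UNIV w" using w(1) L by (auto simp: lipschitz_on_def dist_real_def)
    qed
    then have wm[measurable]: "w \<in> borel_measurable borel" by (rule borel_measurable_continuous_onI)
    obtain \<rho> where \<rho>: "\<And>x. x \<in> \<Omega> \<Longrightarrow> norm x < \<rho>" using \<Omega>(1) unfolding bounded_pos_less by blast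
    \<comment> \<open>\<open>w\<close> need not be integrable. Cutting it off one unit beyond
      \<open>\<Omega>\<close> does not affect the derivatives of its mollification on
      \<open>\<Omega>\<close>, since the mollification radius is at most 1.\<close>
    define BB where "BB = ball (0::real^'d) (\<rho> + 1)"
    have BBm[measurable]: "BB \<in> sets borel" by (simp add: BB_def)
    define v where "v x = w x * indicator BB x" for x
    have vm[measurable]: "v \<in> borel_measurable borel" unfolding v_def by measurable
    have iBB: "integrable lborel (indicator BB :: real^'d \<Rightarrow> real)"
      unfolding BB_def using emeasure_bounded_finite[OF bounded_ball] by (intro integrable_real_indicator) auto
    have vi: "integrable lborel v"
    proof (rule Bochner_Integration.integrable_bound[where f="\<lambda>x. \<tau> * indicator BB x"])
      show "AE x in lborel. norm (v x) \<le> norm (\<tau> * indicator BB x)"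
        using w(2) \<tau> by (intro AE_I2) (auto simp: v_def abs_mult split: split_indicator)
    qed (use iBB in auto)
    define U where "U = - G"
    have Um[measurable]: "U \<in> sets borel" unfolding U_def by measurable
    have iU: "integrable lborel (indicator U :: real^'d \<Rightarrow> real)" using G(2) by (intro integrable_real_indicator) (auto simp: U_def)
    have B0: "B \<ge> 0" using B abs_ge_zero order_trans by blast
    \<comment> \<open>The Lipschitz constant of \<open>f\<close> on the whole space may be huge; it
      enters only the error, and \<open>e'\<close> and the mollification radius are chosen after
      it.\<close>
    define Lf where "Lf = real CARD('d) * B"
    have Lf: "Lf \<ge> 0" "\<And>x y. \<bar>f x - f y\<bar> \<le> Lf * norm (x - y)" using B0 smooth_lipschitz[OF fk] B by (auto simp: Lf_def)
    define M where "M = (L + Lf) * C"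
    have M: "M \<ge> 0" using L Lf(1) C by (simp add: M_def)
    define e' where "e' = e / (M + 1)"
    have e': "e' > 0" "M * e' + e' \<le> e"
    proof -
      show "e' > 0" unfolding e'_def by (rule divide_pos_pos) (use e M in linarith)+
      have "M * e' + e' = (M + 1) * e'" by (rule distrib_right[of M 1, simplified, symmetric])
      also have "(M + 1) * e' = e" unfolding e'_def using M by (intro nonzero_mult_div_cancel_left[of "M + 1" e, simplified times_divide_eq_right[symmetric]]) linarith
      finally show "M * e' + e' \<le> e" by (rule eq_refl)
    qed
    obtain d1 where d1': "d1 > 0" "\<forall>y. norm y < d1 \<longrightarrow> (\<integral>\<^sup>+x. ennreal \<bar>indicator U (x - y) - indicator U x\<bar> \<partial>lborel) \<le> ennreal e'"
      using nn_integral_L1_translation[OF iU e'(1)] by (elim exE conjE)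
    note d1 = d1'(1) d1'(2)[rule_format]
    have "\<exists>d>0. \<forall>y. norm y < d \<longrightarrow> (\<integral>\<^sup>+x. ennreal \<bar>pdiff j f (x - y) - pdiff j f x\<bar> \<partial>lborel) \<le> ennreal e'" for j
      by (rule nn_integral_L1_translation[OF Dfi[rule_format] e'(1)])
    then have "\<forall>j. \<exists>d>0. \<forall>y. norm y < d \<longrightarrow> (\<integral>\<^sup>+x. ennreal \<bar>pdiff j f (x - y) - pdiff j f x\<bar> \<partial>lborel) \<le> ennreal e'" by (rule allI)
    from choice[OF this] obtain d2 where d2': "\<forall>j. d2 j > 0 \<and> (\<forall>y. norm y < d2 j \<longrightarrow> (\<integral>\<^sup>+x. ennreal \<bar>pdiff j f (x - y) - pdiff j f x\<bar> \<partial>lborel) \<le> ennreal e')" by (elim exE)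
    note d2 = d2'[rule_format, THEN conjunct1] d2'[rule_format, THEN conjunct2, rule_format]
    define \<delta> where "\<delta> = min (min (d1/2) 1) (Min (range d2))"
    have "Min (range d2) > 0" using d2(1) by auto
    then have \<delta>: "\<delta> > 0" "\<delta> < d1" "\<delta> \<le> 1" "\<And>j. \<delta> \<le> d2 j" using d1 by (auto simp: \<delta>_def min_le_iff_disj)
    obtain \<eta> :: "real^'d \<Rightarrow> real" where \<eta>: "mollifier \<delta> \<eta>" "\<And>j. (LINT x|lborel. \<bar>pdiff j \<eta> x\<bar>) \<le> C / \<delta>"
      using C(2)[OF \<delta>(1)] axis_in_Basis_iff by (metis Basis_real_def singletonI)
    note MM = mollifierD[OF \<eta>(1)]
    have TD: "test_function UNIV (pdiff j \<eta>)" for j by (rule test_function_frechet_derivative[OF MM(1)])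
    have TDm[measurable]: "pdiff j \<eta> \<in> borel_measurable borel" for j by (rule test_function_borel[OF TD])
    note TDi = test_function_integrable[OF TD]
    have D0: "(LINT y|lborel. pdiff j \<eta> y) = 0" for j by (rule integral_test_function_derivative[OF MM(1)])
    define u where "u = conv \<eta> v"
    have uk: "Ck k u" for k unfolding u_def by (rule Ck_conv[OF vi MM(1)])
    have u\<tau>: "\<bar>u x\<bar> \<le> \<tau>" for x
      unfolding u_def by (rule conv_bounded[OF \<eta>(1) vi]) (use w(2) \<tau> in \<open>auto simp: v_def abs_mult split: split_indicator\<close>)
    have vw: "pdiff j \<eta> y * v (x - y) = pdiff j \<eta> y * w (x - y)" if x: "x \<in> \<Omega>" for x y j
    proof (cases "pdiff j \<eta> y = 0")
      case False
      then have "norm y \<le> 1" using mollifier_derivative_support[OF \<eta>(1) False] \<delta>(3) by simp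
      then have "norm (x - y) < \<rho> + 1" using \<rho>[OF x] norm_triangle_ineq4[of x y] by linarith
      then show ?thesis by (simp add: v_def BB_def)
    qed simp
    have Du: "pdiff j u x = (LINT y|lborel. pdiff j \<eta> y * w (x - y))" "integrable lborel (\<lambda>y. pdiff j \<eta> y * w (x - y))" if x: "x \<in> \<Omega>" for x j
    proof -
      have "pdiff j u x = (LINT y|lborel. pdiff j \<eta> y * v (x - y))"
        unfolding u_def conv_frechet_derivative[OF MM(1) vi] by (rule conv_commute(1)[OF TD vi])
      then show "pdiff j u x = (LINT y|lborel. pdiff j \<eta> y * w (x - y))" by (simp add: vw[OF x])
      show "integrable lborel (\<lambda>y. pdiff j \<eta> y * w (x - y))" using conv_commute(2)[OF TD vi, of j x] by (simp add: vw[OF x])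
    qed
    have Dub: "\<bar>pdiff j u x\<bar> \<le> C * L" if x: "x \<in> \<Omega>" for x j
    proof -
      have i: "integrable lborel (\<lambda>y. pdiff j \<eta> y * (w (x - y) - w x))"
        unfolding right_diff_distrib using Du(2)[OF x] TDi by (intro Bochner_Integration.integrable_diff integrable_mult_left) auto
      \<comment> \<open>The derivative of the kernel integrates to zero, so the constant
        \<open>w x\<close> can be subtracted; the mass \<open>C / \<delta>\<close> then meets an
        oscillation of at most \<open>L * \<delta>\<close>.\<close>
      have "pdiff j u x = (LINT y|lborel. pdiff j \<eta> y * (w (x - y) - w x))"
        using Du[OF x] TDi D0 by (simp add: right_diff_distrib)
      then have "\<bar>pdiff j u x\<bar> \<le> (LINT y|lborel. norm (pdiff j \<eta> y * (w (x - y) - w x)))"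
        by (simp only: real_norm_def[symmetric] integral_norm_bound)
      also have "\<dots> \<le> (LINT y|lborel. \<bar>pdiff j \<eta> y\<bar> * (L * \<delta>))"
      proof (rule integral_mono)
        show "norm (pdiff j \<eta> y * (w (x - y) - w x)) \<le> \<bar>pdiff j \<eta> y\<bar> * (L * \<delta>)" for y
        proof (cases "pdiff j \<eta> y = 0")
          case False
          then have "norm y \<le> \<delta>" by (rule mollifier_derivative_support[OF \<eta>(1)])
          then have "L * dist (x - y) x \<le> L * \<delta>" using L by (intro mult_left_mono) (auto simp: dist_norm)
          then have "\<bar>w (x - y) - w x\<bar> \<le> L * \<delta>" using w(1)[of "x - y" x] by linarith
          then show ?thesis by (simp add: abs_mult mult_left_mono)
        qed simp
      qed (use i TDi in auto)
      also have "\<dots> = (LINT y|lborel. \<bar>pdiff j \<eta> y\<bar>) * (L * \<delta>)" by simp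
      also have "\<dots> \<le> (C / \<delta>) * (L * \<delta>)" using L \<delta> by (intro mult_right_mono \<eta>(2)) auto
      finally show ?thesis using \<delta> by simp
    qed
    have Dx: "ennreal \<bar>pdiff j u x - pdiff j f x\<bar> \<le> ennreal ((L + Lf) * \<delta>) * (\<integral>\<^sup>+y. ennreal \<bar>pdiff j \<eta> y\<bar> * ennreal (indicator U (x - y)) \<partial>lborel) + ennreal \<bar>conv \<eta> (pdiff j f) x - pdiff j f x\<bar>"
      if x: "x \<in> G" "x \<in> \<Omega>" for x j
    proof -
      \<comment> \<open>The mollified derivative of \<open>f\<close> is rewritten with the
        derivative on the kernel, so that it can be subtracted from the derivative of
        \<open>u\<close> under one integral.\<close>
      have cf: "conv \<eta> (pdiff j f) x = (LINT y|lborel. pdiff j \<eta> y * f (x - y))"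
      proof -
        have "conv \<eta> (pdiff j f) x = pdiff j (conv \<eta> f) x"
          by (rule pdiff_conv_weak[OF smooth_weak_pdiff[OF fk] fi \<eta>(1), symmetric, where \<Omega>=UNIV]) simp
        also have "\<dots> = (LINT y|lborel. pdiff j \<eta> y * f (x - y))"
          unfolding conv_frechet_derivative[OF MM(1) fi] by (rule conv_commute(1)[OF TD fi])
        finally show ?thesis .
      qed
      have i1: "integrable lborel (\<lambda>y. pdiff j \<eta> y * f (x - y))" by (rule conv_commute(2)[OF TD fi])
      have i: "integrable lborel (\<lambda>y. pdiff j \<eta> y * (w (x - y) - f (x - y)))"
        unfolding right_diff_distrib using Du(2)[OF x(2)] i1 by (rule Bochner_Integration.integrable_diff)
      have eq: "pdiff j u x - conv \<eta> (pdiff j f) x = (LINT y|lborel. pdiff j \<eta> y * (w (x - y) - f (x - y)))"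
        unfolding Du(1)[OF x(2)] cf using Du(2)[OF x(2)] i1 by (simp add: right_diff_distrib)
      have "ennreal (norm (pdiff j u x - conv \<eta> (pdiff j f) x)) \<le> (\<integral>\<^sup>+y. ennreal (norm (pdiff j \<eta> y * (w (x - y) - f (x - y)))) \<partial>lborel)"
        unfolding eq using i by (rule integral_norm_bound_ennreal)
      also have "\<dots> \<le> (\<integral>\<^sup>+y. ennreal ((L + Lf) * \<delta>) * (ennreal \<bar>pdiff j \<eta> y\<bar> * ennreal (indicator U (x - y))) \<partial>lborel)"
      proof (rule nn_integral_mono)
        fix y
        have "\<bar>pdiff j \<eta> y * (w (x - y) - f (x - y))\<bar> \<le> ((L + Lf) * \<delta>) * (\<bar>pdiff j \<eta> y\<bar> * indicator U (x - y))"
        proof (cases "pdiff j \<eta> y = 0 \<or> x - y \<in> G")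
          case True
          then show ?thesis using w(3)[of "x - y"] L Lf(1) \<delta>(1) by auto
        next
          case False
          then have y: "norm y \<le> \<delta>" using mollifier_derivative_support[OF \<eta>(1)] by blast
          \<comment> \<open>Passing through the common value \<open>w x = f x\<close> at the point
            \<open>x\<close> of \<open>G\<close> makes the difference of order
            \<open>\<delta>\<close>, which compensates the mass \<open>C / \<delta>\<close>.\<close>
          have "\<bar>w (x - y) - f (x - y)\<bar> \<le> \<bar>w (x - y) - w x\<bar> + \<bar>f (x - y) - f x\<bar>" using w(3)[OF x(1)] by linarith
          also have "\<dots> \<le> L * norm y + Lf * norm y" using w(1)[of "x - y" x] Lf(2)[of "x - y" x] by (intro add_mono) (auto simp: dist_norm)
          also have "\<dots> = (L + Lf) * norm y" by (simp add: distrib_right)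
          also have "\<dots> \<le> (L + Lf) * \<delta>" using y L Lf(1) by (intro mult_left_mono) auto
          finally have "\<bar>pdiff j \<eta> y\<bar> * \<bar>w (x - y) - f (x - y)\<bar> \<le> \<bar>pdiff j \<eta> y\<bar> * ((L + Lf) * \<delta>)" by (intro mult_left_mono) auto
          then show ?thesis using False by (simp add: U_def abs_mult mult_ac)
        qed
        then have "ennreal (norm (pdiff j \<eta> y * (w (x - y) - f (x - y)))) \<le> ennreal (((L + Lf) * \<delta>) * (\<bar>pdiff j \<eta> y\<bar> * indicator U (x - y)))" by (intro ennreal_leI) simp
        also have "\<dots> = ennreal ((L + Lf) * \<delta>) * (ennreal \<bar>pdiff j \<eta> y\<bar> * ennreal (indicator U (x - y)))"
          using L Lf(1) \<delta>(1) by (simp add: ennreal_mult)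
        finally show "ennreal (norm (pdiff j \<eta> y * (w (x - y) - f (x - y)))) \<le> ennreal ((L + Lf) * \<delta>) * (ennreal \<bar>pdiff j \<eta> y\<bar> * ennreal (indicator U (x - y)))" .
      qed
      also have "\<dots> = ennreal ((L + Lf) * \<delta>) * (\<integral>\<^sup>+y. ennreal \<bar>pdiff j \<eta> y\<bar> * ennreal (indicator U (x - y)) \<partial>lborel)"
        by (rule nn_integral_cmult) measurable
      finally have 1: "ennreal (norm (pdiff j u x - conv \<eta> (pdiff j f) x)) \<le> ennreal ((L + Lf) * \<delta>) * (\<integral>\<^sup>+y. ennreal \<bar>pdiff j \<eta> y\<bar> * ennreal (indicator U (x - y)) \<partial>lborel)" .
      have "ennreal \<bar>pdiff j u x - pdiff j f x\<bar> \<le> ennreal (norm (pdiff j u x - conv \<eta> (pdiff j f) x) + \<bar>conv \<eta> (pdiff j f) x - pdiff j f x\<bar>)"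
        by (intro ennreal_leI) auto
      also have "\<dots> = ennreal (norm (pdiff j u x - conv \<eta> (pdiff j f) x)) + ennreal \<bar>conv \<eta> (pdiff j f) x - pdiff j f x\<bar>"
        by (intro ennreal_plus) auto
      also have "\<dots> \<le> ennreal ((L + Lf) * \<delta>) * (\<integral>\<^sup>+y. ennreal \<bar>pdiff j \<eta> y\<bar> * ennreal (indicator U (x - y)) \<partial>lborel) + ennreal \<bar>conv \<eta> (pdiff j f) x - pdiff j f x\<bar>"
        by (intro add_right_mono 1)
      finally show ?thesis .
    qed
    have L1: "(\<integral>\<^sup>+x\<in>G \<inter> \<Omega>. ennreal \<bar>pdiff j u x - pdiff j f x\<bar> \<partial>lborel) \<le> ennreal e" for j
    proof -
      define k where "k x = (\<integral>\<^sup>+y. ennreal \<bar>pdiff j \<eta> y\<bar> * ennreal (indicator U (x - y)) \<partial>lborel)" for x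
      have km[measurable]: "k \<in> borel_measurable lborel" unfolding k_def by measurable
      have cm[measurable]: "conv \<eta> (pdiff j f) \<in> borel_measurable borel"
        using Ck_conv[OF Dfi[rule_format, of j] MM(1), of 0] by (auto intro: borel_measurable_continuous_onI)
      have pm[measurable]: "pdiff j f \<in> borel_measurable borel" using Dfi[rule_format, of j] by auto
      have kb: "(\<integral>\<^sup>+x\<in>G. k x \<partial>lborel) \<le> ennreal (LINT y|lborel. \<bar>pdiff j \<eta> y\<bar>) * ennreal e'"
        unfolding k_def
      proof (rule kernel_L1_bound[OF TDi _ Gm])
        show "(\<lambda>(x, y). ennreal (indicator U (x - y))) \<in> borel_measurable (lborel \<Otimes>\<^sub>M lborel)" by measurable
        fix y assume "pdiff j \<eta> y \<noteq> 0"
        then have "norm y < d1" using mollifier_derivative_support[OF \<eta>(1)] \<delta>(2) by fastforce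
        \<comment> \<open>On \<open>G\<close> the indicator of \<open>U\<close> vanishes, so the
          integrand is a translation difference of that indicator.\<close>
        have "(\<integral>\<^sup>+x\<in>G. ennreal (indicator U (x - y)) \<partial>lborel) \<le> (\<integral>\<^sup>+x. ennreal \<bar>indicator U (x - y) - indicator U x\<bar> \<partial>lborel)"
          by (intro nn_integral_mono) (auto simp: U_def split: split_indicator)
        also have "\<dots> \<le> ennreal e'" by (rule d1(2)) fact
        finally show "(\<integral>\<^sup>+x\<in>G. ennreal (indicator U (x - y)) \<partial>lborel) \<le> ennreal e'" .
      qed
      have cb: "(\<integral>\<^sup>+x\<in>UNIV. ennreal \<bar>conv \<eta> (pdiff j f) x - pdiff j f x\<bar> \<partial>lborel) \<le> ennreal e'"
      proof (rule conv_L1_diff[OF \<eta>(1) Dfi[rule_format]])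
        fix y :: "real^'d" assume "norm y < \<delta>"
        then have "norm y < d2 j" using \<delta>(4)[of j] by simp
        then show "(\<integral>\<^sup>+x\<in>UNIV. ennreal \<bar>pdiff j f (x - y) - pdiff j f x\<bar> \<partial>lborel) \<le> ennreal e'" using d2(2) by simp
      qed simp
      have "(\<integral>\<^sup>+x\<in>G \<inter> \<Omega>. ennreal \<bar>pdiff j u x - pdiff j f x\<bar> \<partial>lborel) \<le> (\<integral>\<^sup>+x. ennreal ((L + Lf) * \<delta>) * (k x * indicator G x) + ennreal \<bar>conv \<eta> (pdiff j f) x - pdiff j f x\<bar> \<partial>lborel)"
      proof (rule nn_integral_mono)
        fix x show "ennreal \<bar>pdiff j u x - pdiff j f x\<bar> * indicator (G \<inter> \<Omega>) x \<le> ennreal ((L + Lf) * \<delta>) * (k x * indicator G x) + ennreal \<bar>conv \<eta> (pdiff j f) x - pdiff j f x\<bar>"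
          using Dx[of x j] by (auto simp: k_def split: split_indicator)
      qed
      also have "\<dots> = ennreal ((L + Lf) * \<delta>) * (\<integral>\<^sup>+x\<in>G. k x \<partial>lborel) + (\<integral>\<^sup>+x. ennreal \<bar>conv \<eta> (pdiff j f) x - pdiff j f x\<bar> \<partial>lborel)"
        by (subst nn_integral_add) (auto simp: nn_integral_cmult)
      also have "\<dots> \<le> ennreal ((L + Lf) * \<delta>) * (ennreal (C / \<delta>) * ennreal e') + ennreal e'"
      proof (intro add_mono mult_left_mono)
        show "(\<integral>\<^sup>+x\<in>G. k x \<partial>lborel) \<le> ennreal (C / \<delta>) * ennreal e'"
          using kb by (rule order_trans) (intro mult_right_mono ennreal_leI \<eta>(2), simp)
      qed (use cb in auto)
      also have "\<dots> = ennreal (((L + Lf) * \<delta>) * ((C / \<delta>) * e') + e')"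
      proof -
        have a: "0 \<le> (L + Lf) * \<delta>" "0 \<le> C / \<delta>" "0 \<le> e'" using L Lf(1) \<delta>(1) C(1) e'(1) by auto
        show ?thesis
          by (simp only: ennreal_plus[OF mult_nonneg_nonneg[OF a(1) mult_nonneg_nonneg[OF a(2,3)]] a(3)]
            ennreal_mult[OF a(1) mult_nonneg_nonneg[OF a(2,3)]] ennreal_mult[OF a(2,3)])
      qed
      also have "((L + Lf) * \<delta>) * ((C / \<delta>) * e') + e' = M * e' + e'" using \<delta>(1) by (simp add: M_def)
      also have "ennreal (M * e' + e') \<le> ennreal e" by (rule ennreal_leI[OF e'(2)])
      finally show ?thesis .
    qed
    show "\<exists>u. (\<forall>k. Ck k u) \<and> (\<forall>x. \<bar>u x\<bar> \<le> \<tau>) \<and> (\<forall>x\<in>\<Omega>. \<forall>j. \<bar>pdiff j u x\<bar> \<le> C * L) \<and>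
       (\<forall>j. (\<integral>\<^sup>+x\<in>G \<inter> \<Omega>. ennreal \<bar>pdiff j u x - pdiff j f x\<bar> \<partial>lborel) \<le> ennreal e)"
      using uk u\<tau> Dub L1 by blast
  qed
qed


section \<open>Measure estimates and the truncation of vector-valued maps with small excess\<close>

lemma emeasure_le_Markov:
  fixes F :: "'a \<Rightarrow> real"
  assumes F: "F \<in> borel_measurable M" "(\<integral>\<^sup>+x. ennreal (F x) \<partial>M) \<le> ennreal b" and A: "A \<in> sets M" "\<And>x. x \<in> A \<Longrightarrow> t \<le> F x" and t: "t > 0"
  shows "emeasure M A \<le> ennreal (b / t)"
proof -
  have "emeasure M A = (\<integral>\<^sup>+x. indicator A x \<partial>M)" using A by simp
  also have "\<dots> \<le> (\<integral>\<^sup>+x. ennreal (1 / t) * ennreal (F x) \<partial>M)"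
  proof (rule nn_integral_mono)
    fix x show "indicator A x \<le> ennreal (1 / t) * ennreal (F x)"
    proof (cases "x \<in> A")
      case True
      have "1 \<le> 1 / t * F x" using A(2)[OF True] t by simp
      then have "ennreal 1 \<le> ennreal (1 / t * F x)" by (rule ennreal_leI)
      then show ?thesis using True t A(2)[OF True] by (subst (asm) ennreal_mult) auto
    qed simp
  qed
  also have "\<dots> = ennreal (1 / t) * (\<integral>\<^sup>+x. ennreal (F x) \<partial>M)" using F by (intro nn_integral_cmult) auto
  also have "\<dots> \<le> ennreal (1 / t) * ennreal b" by (intro mult_left_mono F) auto
  also have "\<dots> = ennreal (b / t)" using t by (subst ennreal_mult'[symmetric]) auto
  finally show ?thesis .
qed

lemma emeasure_UN_le_const:
  fixes A :: "'i::finite \<Rightarrow> 'a set"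
  assumes A: "\<And>i. A i \<in> sets M" "\<And>i. emeasure M (A i) \<le> ennreal b" and b: "b \<ge> 0"
  shows "emeasure M (\<Union>i. A i) \<le> ennreal (real CARD('i) * b)"
proof -
  have "emeasure M (\<Union>i. A i) \<le> (\<Sum>i\<in>UNIV. emeasure M (A i))"
    by (rule emeasure_subadditive_finite) (use A in auto)
  also have "\<dots> \<le> (\<Sum>i\<in>(UNIV::'i set). ennreal b)" by (intro sum_mono A)
  also have "\<dots> = ennreal (real CARD('i) * b)" using b by (simp add: ennreal_mult ennreal_of_nat_eq_real_of_nat)
  finally show ?thesis .
qed

lemma norm_matrix_vector_le: "norm ((M :: real^'d^'s) *v v) \<le> norm M * norm v"
proof -
  have "norm (M *v v) = L2_set (\<lambda>i. norm ((M *v v) $ i)) UNIV" by (simp add: norm_vec_def)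
  also have "\<dots> \<le> L2_set (\<lambda>i. norm v * norm (M $ i)) UNIV"
    by (intro L2_set_mono) (auto simp: matrix_vector_mul_component mult.commute[of "norm v"] Cauchy_Schwarz_ineq2)
  also have "\<dots> = norm v * L2_set (\<lambda>i. norm (M $ i)) UNIV" by (rule L2_set_right_distrib[symmetric]) simp
  finally show ?thesis by (simp add: norm_vec_def mult.commute)
qed

lemma vector_has_derivative_pdiff:
  fixes f :: "'s::finite \<Rightarrow> real^'d \<Rightarrow> real"
  assumes f: "\<And>i k. Ck k (f i)"
  shows "((\<lambda>x. \<chi> i. f i x) has_derivative (\<lambda>v. (\<chi> i j. pdiff j (f i) x) *v v)) (at x)"
proof -
  have "((\<lambda>x. \<Sum>i\<in>UNIV. f i x *\<^sub>R axis i (1::real)) has_derivative (\<lambda>v. \<Sum>i\<in>UNIV. frechet_derivative (f i) (at x) v *\<^sub>R axis i 1)) (at x)"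
    by (intro has_derivative_sum has_derivative_scaleR_left smooth_has_derivative f)
  moreover have "(\<Sum>i\<in>UNIV. f i x *\<^sub>R axis i (1::real)) = (\<chi> i. f i x)" for x
    using basis_expansion[of "\<chi> i. f i x"] by (simp add: scalar_mult_eq_scaleR)
  moreover have "(\<Sum>i\<in>UNIV. frechet_derivative (f i) (at x) v *\<^sub>R axis i 1) = (\<chi> i j. pdiff j (f i) x) *v v" for v
  proof -
    have "frechet_derivative (f i) (at x) v = (\<Sum>j\<in>UNIV. pdiff j (f i) x * v $ j)" for i
    proof -
      have lin: "linear (frechet_derivative (f i) (at x))" by (rule has_derivative_linear[OF smooth_has_derivative[OF f]])
      have "frechet_derivative (f i) (at x) v = frechet_derivative (f i) (at x) (\<Sum>j\<in>UNIV. (v $ j) *\<^sub>R axis j 1)"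
        using basis_expansion[of v] by (simp add: scalar_mult_eq_scaleR)
      also have "\<dots> = (\<Sum>j\<in>UNIV. v $ j * pdiff j (f i) x)" by (simp add: linear_sum[OF lin] linear_cmul[OF lin])
      finally show ?thesis by (simp add: mult.commute)
    qed
    then have "(\<chi> i j. pdiff j (f i) x) *v v = (\<chi> i. frechet_derivative (f i) (at x) v)" by (simp add: matrix_vector_mult_def vec_eq_iff)
    then show ?thesis using basis_expansion[of "\<chi> i. frechet_derivative (f i) (at x) v"] by (simp add: scalar_mult_eq_scaleR)
  qed
  ultimately show ?thesis by simp
qed

text \<open>Mollification makes the maximal function estimate applicable at the price of an error
  \<open>e\<close>. The good set leaves out the bad set of the maximal function, of measure about
  \<open>5 ^ CARD('d) * m\<close> at most, and for each component the points of modulus above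
  \<open>\<tau>\<close>, of measure about \<open>m / \<tau>\<close> at most by Markov.\<close>

lemma smooth_approximation_good_set:
  fixes \<zeta> :: "'s::finite \<Rightarrow> real^'d \<Rightarrow> real" and H :: "'s \<Rightarrow> 'd \<Rightarrow> real^'d \<Rightarrow> real"
  assumes \<zeta>: "\<And>i. integrable lborel (\<zeta> i)" and H: "\<And>i j. integrable lborel (H i j)" and w: "\<And>i j. weak_pdiff UNIV j (\<zeta> i) (H i j)"
    and R: "R \<ge> 0" and \<tau>: "\<tau> > 0" and e: "e > 0" and m: "m \<ge> 0"
    and m1: "(\<integral>\<^sup>+x. ennreal (max 0 (norm (\<chi> i j. H i j x) - R)) \<partial>lborel) \<le> ennreal m" and m2: "\<And>i. (LINT x|lborel. \<bar>\<zeta> i x\<bar>) \<le> m"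
  shows "\<exists>f G. (\<forall>i k. Ck k (f i)) \<and> (\<forall>i. integrable lborel (f i)) \<and> (\<forall>i j. integrable lborel (pdiff j (f i))) \<and> (\<forall>i. \<exists>B. \<forall>j x. \<bar>pdiff j (f i) x\<bar> \<le> B) \<and>
    closed G \<and> emeasure lborel (- G) \<le> ennreal (5 ^ CARD('d) * m + real CARD('s) * m / \<tau> + e) \<and>
    (\<forall>i. \<forall>x\<in>G. \<forall>y\<in>G. \<bar>f i x - f i y\<bar> \<le> (4 * (R + 1)) * dist x y) \<and> (\<forall>i. \<forall>x\<in>G. \<bar>f i x\<bar> \<le> \<tau>) \<and>
    (\<forall>i j. (LINT x|lborel. \<bar>pdiff j (f i) x - H i j x\<bar>) \<le> e)"
proof -
  \<comment> \<open>\<open>N * e1\<close> is what the mollification errors add to the measure of the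
    complement of \<open>G\<close>: an excess error \<open>e1\<close> for each matrix entry,
    multiplied by the covering constant, and \<open>e1 / \<tau>\<close> for each component.\<close>
  define N where "N = 5 ^ CARD('d) * (real CARD('s) * real CARD('d)) + real CARD('s) / \<tau>"
  have N: "N > 0" using \<tau> unfolding N_def by (intro add_pos_pos mult_pos_pos divide_pos_pos) auto
  define e1 where "e1 = e / (N + 1)"
  have "N + 1 > 0" using N by simp
  then have e1: "e1 > 0" unfolding e1_def using e by (intro divide_pos_pos)
  have "(N + 1) * e1 = e" unfolding e1_def using \<open>N + 1 > 0\<close> by (simp add: divide_simps)
  then have e1': "N * e1 + e1 = e" by (simp add: distrib_right)
  have "N * e1 > 0" using N e1 by simp
  then have e1e: "e1 \<le> e" "N * e1 \<le> e" using e1 e1' by linarith+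
  have "\<exists>d>0. \<forall>\<delta> \<eta>. \<delta> \<le> d \<longrightarrow> mollifier \<delta> \<eta> \<longrightarrow> integrable lborel (conv \<eta> (\<zeta> i)) \<and> (LINT x|lborel. \<bar>conv \<eta> (\<zeta> i) x - \<zeta> i x\<bar>) \<le> e1" for i
    by (rule conv_L1_tendsto[OF \<zeta> e1])
  then have "\<forall>i. \<exists>d>0. \<forall>\<delta> \<eta>. \<delta> \<le> d \<longrightarrow> mollifier \<delta> \<eta> \<longrightarrow> integrable lborel (conv \<eta> (\<zeta> i)) \<and> (LINT x|lborel. \<bar>conv \<eta> (\<zeta> i) x - \<zeta> i x\<bar>) \<le> e1" by (rule allI)
  from choice[OF this] obtain d1 where d1: "\<forall>i. d1 i > 0 \<and> (\<forall>\<delta> \<eta>. \<delta> \<le> d1 i \<longrightarrow> mollifier \<delta> \<eta> \<longrightarrow> integrable lborel (conv \<eta> (\<zeta> i)) \<and> (LINT x|lborel. \<bar>conv \<eta> (\<zeta> i) x - \<zeta> i x\<bar>) \<le> e1)"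
    by (elim exE)
  have "\<exists>d>0. \<forall>\<delta> \<eta>. \<delta> \<le> d \<longrightarrow> mollifier \<delta> \<eta> \<longrightarrow> integrable lborel (conv \<eta> (H (fst q) (snd q))) \<and> (LINT x|lborel. \<bar>conv \<eta> (H (fst q) (snd q)) x - H (fst q) (snd q) x\<bar>) \<le> e1" for q
    by (rule conv_L1_tendsto[OF H e1])
  then have "\<forall>q. \<exists>d>0. \<forall>\<delta> \<eta>. \<delta> \<le> d \<longrightarrow> mollifier \<delta> \<eta> \<longrightarrow> integrable lborel (conv \<eta> (H (fst q) (snd q))) \<and> (LINT x|lborel. \<bar>conv \<eta> (H (fst q) (snd q)) x - H (fst q) (snd q) x\<bar>) \<le> e1" by (rule allI)
  from choice[OF this] obtain d2 where d2: "\<forall>q. d2 q > 0 \<and> (\<forall>\<delta> \<eta>. \<delta> \<le> d2 q \<longrightarrow> mollifier \<delta> \<eta> \<longrightarrow> integrable lborel (conv \<eta> (H (fst q) (snd q))) \<and> (LINT x|lborel. \<bar>conv \<eta> (H (fst q) (snd q)) x - H (fst q) (snd q) x\<bar>) \<le> e1)"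
    by (elim exE)
  define \<delta> where "\<delta> = min (Min (range d1)) (Min (range d2))"
  have "Min (range d1) > 0" "Min (range d2) > 0" using d1 d2 by auto
  then have \<delta>: "\<delta> > 0" "\<And>i. \<delta> \<le> d1 i" "\<And>q. \<delta> \<le> d2 q" by (auto simp: \<delta>_def min_le_iff_disj)
  obtain \<eta> :: "real^'d \<Rightarrow> real" where \<eta>: "mollifier \<delta> \<eta>" using ex_mollifier \<delta>(1) by metis
  note MM = mollifierD[OF \<eta>]
  define f where "f i = conv \<eta> (\<zeta> i)" for i
  have fk: "Ck k (f i)" for i k unfolding f_def by (rule Ck_conv[OF \<zeta> MM(1)])
  have fi: "integrable lborel (f i)" "(LINT x|lborel. \<bar>f i x - \<zeta> i x\<bar>) \<le> e1" for i
    using d1 \<delta>(2) \<eta> unfolding f_def by blast+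
  have Df: "pdiff j (f i) = conv \<eta> (H i j)" for i j
    unfolding f_def by (rule ext) (rule pdiff_conv_weak[OF w \<zeta> \<eta>], simp)
  note Dfx = fun_cong[OF Df]
  have Hi: "integrable lborel (conv \<eta> (H i j))" "(LINT x|lborel. \<bar>conv \<eta> (H i j) x - H i j x\<bar>) \<le> e1" for i j
    using d2[rule_format, of "(i, j)", THEN conjunct2, rule_format, OF \<delta>(3) \<eta>] by simp_all
  have Dfm[measurable]: "conv \<eta> (H i j) \<in> borel_measurable borel" for i j using Hi(1)[of i j] by auto
  have Hm[measurable]: "H i j \<in> borel_measurable borel" for i j using H[of i j] by auto
  have fm[measurable]: "f i \<in> borel_measurable borel" for i using fi(1)[of i] by auto
  \<comment> \<open>The bound depends on the mollifier and may be very large; only its existence is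
    used, as a Lipschitz constant in the error term of the replacement.\<close>
  have DB: "\<exists>B. \<forall>j x. \<bar>pdiff j (f i) x\<bar> \<le> B" for i
  proof -
    obtain S where S: "S > 0" "\<And>x. \<bar>\<eta> x\<bar> \<le> S" using test_function_bounded[OF MM(1)] by blast
    define B where "B = (\<Sum>j\<in>UNIV. S * (LINT y|lborel. \<bar>H i j y\<bar>))"
    have "\<bar>pdiff j (f i) x\<bar> \<le> B" for j x
    proof -
      have "\<bar>conv \<eta> (H i j) x\<bar> \<le> (LINT y|lborel. norm (\<eta> (x - y) * H i j y))"
        unfolding conv_def real_norm_def[symmetric] by (rule integral_norm_bound)
      also have "\<dots> \<le> (LINT y|lborel. S * \<bar>H i j y\<bar>)"
        using S by (intro integral_mono integrable_norm integrable_mult_right integrable_abs conv_integrable MM(1) H)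
          (auto simp: abs_mult intro!: mult_right_mono)
      also have "\<dots> = S * (LINT y|lborel. \<bar>H i j y\<bar>)" by simp
      also have "\<dots> \<le> B" unfolding B_def using S(1) by (intro member_le_sum) auto
      finally show ?thesis by (simp add: Dfx)
    qed
    then show ?thesis by blast
  qed
  define M where "M x = (\<chi> i j. pdiff j (f i) x)" for x
  define h where "h x = norm (M x)" for x
  define g where "g = (\<lambda>x. max 0 (h x - R))"
  have pc: "continuous_on UNIV (pdiff j (f i))" for i j using smooth_frechet_derivative[OF fk, of 0 i] by simp
  have hc: "continuous_on UNIV h" unfolding h_def M_def by (intro continuous_on_norm continuous_on_vec_lambda pc)
  then have [measurable]: "h \<in> borel_measurable borel" by (rule borel_measurable_continuous_onI)
  define q where "q x = (\<Sum>i\<in>UNIV. \<Sum>j\<in>UNIV. \<bar>conv \<eta> (H i j) x - H i j x\<bar>)" for x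
  have qi: "integrable lborel q" unfolding q_def using Hi(1) H by (intro Bochner_Integration.integrable_sum integrable_abs Bochner_Integration.integrable_diff)
  have qb: "(LINT x|lborel. q x) \<le> real CARD('s) * real CARD('d) * e1"
  proof -
    have "(LINT x|lborel. q x) = (\<Sum>i\<in>UNIV. \<Sum>j\<in>UNIV. LINT x|lborel. \<bar>conv \<eta> (H i j) x - H i j x\<bar>)"
      unfolding q_def using Hi(1) H by (subst Bochner_Integration.integral_sum, intro Bochner_Integration.integrable_sum integrable_abs Bochner_Integration.integrable_diff)
        (auto intro!: sum.cong Bochner_Integration.integral_sum)
    also have "\<dots> \<le> (\<Sum>i\<in>(UNIV::'s set). \<Sum>j\<in>(UNIV::'d set). e1)" by (intro sum_mono Hi)
    finally show ?thesis by simp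
  qed
  have hle: "h x \<le> norm (\<chi> i j. H i j x) + q x" for x
  proof -
    have "h x \<le> norm (\<chi> i j. H i j x) + norm (M x - (\<chi> i j. H i j x))" unfolding h_def by (rule norm_triangle_sub)
    also have "norm (M x - (\<chi> i j. H i j x)) \<le> q x" unfolding q_def M_def using norm_matrix_le_sum[of "(\<chi> i j. pdiff j (f i) x) - (\<chi> i j. H i j x)"] by (simp add: Dfx)
    finally show ?thesis by simp
  qed
  have q0: "q x \<ge> 0" for x unfolding q_def by (intro sum_nonneg) auto
  have gb: "(\<integral>\<^sup>+x. ennreal (g x) \<partial>lborel) \<le> ennreal (m + real CARD('s) * real CARD('d) * e1)"
  proof -
    have Nm: "(\<lambda>x. max 0 (norm (\<chi> i j. H i j x) - R)) \<in> borel_measurable borel"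
    proof -
      have "(\<lambda>x. norm (\<chi> i j. H i j x)) = (\<lambda>x. sqrt (\<Sum>i\<in>UNIV. (sqrt (\<Sum>j\<in>UNIV. (H i j x)\<^sup>2))\<^sup>2))"
        by (simp add: norm_vec_def L2_set_def)
      then have "(\<lambda>x. norm (\<chi> i j. H i j x)) \<in> borel_measurable borel" by simp
      then show ?thesis by simp
    qed
    have "(\<integral>\<^sup>+x. ennreal (g x) \<partial>lborel) \<le> (\<integral>\<^sup>+x. ennreal (max 0 (norm (\<chi> i j. H i j x) - R)) + ennreal (q x) \<partial>lborel)"
    proof (rule nn_integral_mono)
      fix x
      have "ennreal (g x) \<le> ennreal (max 0 (norm (\<chi> i j. H i j x) - R) + q x)"
        using hle[of x] q0[of x] unfolding g_def by (intro ennreal_leI) auto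
      then show "ennreal (g x) \<le> ennreal (max 0 (norm (\<chi> i j. H i j x) - R)) + ennreal (q x)" using q0 by simp
    qed
    also have "\<dots> = (\<integral>\<^sup>+x. ennreal (max 0 (norm (\<chi> i j. H i j x) - R)) \<partial>lborel) + (\<integral>\<^sup>+x. ennreal (q x) \<partial>lborel)"
      using Nm qi by (intro nn_integral_add) auto
    also have "\<dots> \<le> ennreal m + ennreal (real CARD('s) * real CARD('d) * e1)"
      using m1 qi q0 qb by (intro add_mono) (auto simp: nn_integral_eq_integral intro: ennreal_leI)
    also have "\<dots> = ennreal (m + real CARD('s) * real CARD('d) * e1)" using m e1 by (intro ennreal_plus[symmetric]) auto
    finally show ?thesis .
  qed
  have gm[measurable]: "g \<in> borel_measurable borel" unfolding g_def by measurable
  have g0: "g x \<ge> 0" for x by (simp add: g_def)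
  have gi: "integrable lborel g"
    unfolding integrable_iff_bounded using gb g0 by (auto intro: le_less_trans)
  define G where "G = - maximal_bad_set g \<inter> (\<Inter>i. {x. \<bar>f i x\<bar> \<le> \<tau>})"
  have fc: "continuous_on UNIV (f i)" for i using fk[of 0 i] by simp
  have Gc: "closed G" unfolding G_def
    by (intro closed_Int closed_INT ballI closed_Collect_le continuous_intros fc) (use open_maximal_bad_set in auto)
  have Gm: "emeasure lborel (- G) \<le> ennreal (5 ^ CARD('d) * m + real CARD('s) * m / \<tau> + e)"
  proof -
    have bad: "emeasure lborel (maximal_bad_set g) \<le> ennreal (5 ^ CARD('d) * (m + real CARD('s) * real CARD('d) * e1))"
    proof -
      have "emeasure lborel (maximal_bad_set g) \<le> 5 ^ DIM(real^'d) * (\<integral>\<^sup>+x. ennreal (g x) \<partial>lborel)"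
        by (rule emeasure_maximal_bad_set[OF gi g0])
      also have "\<dots> \<le> ennreal (5 ^ CARD('d)) * ennreal (m + real CARD('s) * real CARD('d) * e1)"
        using gb by (intro mult_mono) (auto simp: ennreal_power[symmetric])
      also have "\<dots> = ennreal (5 ^ CARD('d) * (m + real CARD('s) * real CARD('d) * e1))" using m e1 by (intro ennreal_mult[symmetric]) auto
      finally show ?thesis .
    qed
    have big: "emeasure lborel {x. \<bar>f i x\<bar> > \<tau>} \<le> ennreal ((m + e1) / \<tau>)" for i
    proof (rule emeasure_le_Markov[where F="\<lambda>x. \<bar>f i x\<bar>"])
      have "(LINT x|lborel. \<bar>f i x\<bar>) \<le> (LINT x|lborel. \<bar>\<zeta> i x\<bar> + \<bar>f i x - \<zeta> i x\<bar>)"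
        using fi(1) \<zeta> by (intro integral_mono) auto
      also have "\<dots> \<le> m + e1" using fi \<zeta> m2[of i] by (simp add: add_mono)
      finally show "(\<integral>\<^sup>+x. ennreal \<bar>f i x\<bar> \<partial>lborel) \<le> ennreal (m + e1)"
        using fi(1) by (subst nn_integral_eq_integral) (auto intro: ennreal_leI)
    qed (use \<tau> in auto)
    have "- G \<subseteq> maximal_bad_set g \<union> (\<Union>i. {x. \<bar>f i x\<bar> > \<tau>})" by (auto simp: G_def not_le)
    then have "emeasure lborel (- G) \<le> emeasure lborel (maximal_bad_set g \<union> (\<Union>i. {x. \<bar>f i x\<bar> > \<tau>}))"
      using open_maximal_bad_set[of g] by (intro emeasure_mono) auto
    also have "\<dots> \<le> emeasure lborel (maximal_bad_set g) + emeasure lborel (\<Union>i. {x. \<bar>f i x\<bar> > \<tau>})"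
      using open_maximal_bad_set[of g] by (intro emeasure_subadditive) auto
    also have "\<dots> \<le> ennreal (5 ^ CARD('d) * (m + real CARD('s) * real CARD('d) * e1)) + ennreal (real CARD('s) * ((m + e1) / \<tau>))"
      using m e1 \<tau> by (intro add_mono bad emeasure_UN_le_const big) auto
    also have "\<dots> = ennreal (5 ^ CARD('d) * (m + real CARD('s) * real CARD('d) * e1) + real CARD('s) * ((m + e1) / \<tau>))"
      using m e1 \<tau> by (intro ennreal_plus[symmetric]) auto
    also have "5 ^ CARD('d) * (m + real CARD('s) * real CARD('d) * e1) + real CARD('s) * ((m + e1) / \<tau>) = 5 ^ CARD('d) * m + real CARD('s) * m / \<tau> + N * e1"
      by (simp add: N_def algebra_simps add_divide_distrib)
    also have "ennreal \<dots> \<le> ennreal (5 ^ CARD('d) * m + real CARD('s) * m / \<tau> + e)" using e1e by (intro ennreal_leI) auto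
    finally show ?thesis .
  qed
  \<comment> \<open>The excess is that of the full gradient norm, so the vector-valued estimate
    holds on one set for all components and each of them inherits it.\<close>
  have lip: "\<bar>f i x - f i y\<bar> \<le> (4 * (R + 1)) * dist x y" if "x \<in> G" "y \<in> G" for i x y
  proof -
    have "\<bar>f i x - f i y\<bar> \<le> norm ((\<chi> i. f i x) - (\<chi> i. f i y))"
      using component_le_norm_cart[of "(\<chi> i. f i x) - (\<chi> i. f i y)" i] by simp
    also have "\<dots> \<le> 4 * (R + 1) * norm (x - y)"
    proof (rule lipschitz_off_bad_set[where h=h, OF vector_has_derivative_pdiff[OF fk] _ hc g_def R])
      show "norm ((\<chi> i j. pdiff j (f i) x) *v v) \<le> h x * norm v" for x v
        unfolding h_def M_def by (rule norm_matrix_vector_le)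
    qed (use that in \<open>auto simp: G_def\<close>)
    finally show ?thesis by (simp add: dist_norm)
  qed
  have "\<bar>f i x\<bar> \<le> \<tau>" if "x \<in> G" for i x using that by (auto simp: G_def)
  moreover have "(LINT x|lborel. \<bar>pdiff j (f i) x - H i j x\<bar>) \<le> e" for i j using Hi(2)[of i j] e1e by (simp add: Dfx)
  moreover have "integrable lborel (pdiff j (f i))" for i j using Hi(1) by (simp add: Df)
  ultimately show ?thesis using fk fi(1) DB Gc Gm lip by (intro exI[of _ f] exI[of _ G]) blast
qed


text \<open>\<open>C\<close> precedes all other quantifiers: the gradient bound depends on the
  dimension and on \<open>R\<close>, not on \<open>\<tau>\<close>, \<open>e\<close>,
  \<open>m\<close> or \<open>\<theta>\<close>. On the good set the gradient differs from
  \<open>H\<close> by two errors that are small in \<open>L^1\<close>, so the difference is large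
  only on small sets.\<close>

lemma lipschitz_truncation:
  "\<exists>C>0. \<forall>(\<zeta> :: 's::finite \<Rightarrow> real^'d \<Rightarrow> real) (H :: 's \<Rightarrow> 'd \<Rightarrow> real^'d \<Rightarrow> real) \<Omega> R \<tau> e m \<theta>.
     (\<forall>i. integrable lborel (\<zeta> i)) \<longrightarrow> (\<forall>i j. integrable lborel (H i j)) \<longrightarrow> (\<forall>i j. weak_pdiff UNIV j (\<zeta> i) (H i j)) \<longrightarrow>
     bounded \<Omega> \<longrightarrow> \<Omega> \<in> sets borel \<longrightarrow> R \<ge> 0 \<longrightarrow> \<tau> > 0 \<longrightarrow> e > 0 \<longrightarrow> m \<ge> 0 \<longrightarrow> \<theta> > 0 \<longrightarrow>
     (\<integral>\<^sup>+x. ennreal (max 0 (norm (\<chi> i j. H i j x) - R)) \<partial>lborel) \<le> ennreal m \<longrightarrow> (\<forall>i. (LINT x|lborel. \<bar>\<zeta> i x\<bar>) \<le> m) \<longrightarrow>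
     (\<exists>u. (\<forall>i k. Ck k (u i)) \<and> (\<forall>i x. \<bar>u i x\<bar> \<le> \<tau>) \<and> (\<forall>x\<in>\<Omega>. \<forall>i j. \<bar>pdiff j (u i) x\<bar> \<le> C * (R + 1)) \<and>
       emeasure lborel {x \<in> \<Omega>. \<exists>i j. \<bar>pdiff j (u i) x - H i j x\<bar> > \<theta>} \<le> ennreal (5 ^ CARD('d) * m + real CARD('s) * m / \<tau> + e))"
proof -
  obtain C where C: "C > 0" and rep: "\<forall>(f :: real^'d \<Rightarrow> real) G \<Omega> L \<tau> B e.
     (\<forall>k. Ck k f) \<longrightarrow> integrable lborel f \<longrightarrow> (\<forall>j. integrable lborel (pdiff j f)) \<longrightarrow> (\<forall>j x. \<bar>pdiff j f x\<bar> \<le> B) \<longrightarrow>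
     closed G \<longrightarrow> emeasure lborel (- G) < \<infinity> \<longrightarrow> bounded \<Omega> \<longrightarrow> \<Omega> \<in> sets borel \<longrightarrow> L \<ge> 0 \<longrightarrow> \<tau> \<ge> 0 \<longrightarrow> e > 0 \<longrightarrow>
     (\<forall>x\<in>G. \<forall>y\<in>G. \<bar>f x - f y\<bar> \<le> L * dist x y) \<longrightarrow> (\<forall>x\<in>G. \<bar>f x\<bar> \<le> \<tau>) \<longrightarrow>
     (\<exists>u. (\<forall>k. Ck k u) \<and> (\<forall>x. \<bar>u x\<bar> \<le> \<tau>) \<and> (\<forall>x\<in>\<Omega>. \<forall>j. \<bar>pdiff j u x\<bar> \<le> C * L) \<and>
       (\<forall>j. (\<integral>\<^sup>+x\<in>G \<inter> \<Omega>. ennreal \<bar>pdiff j u x - pdiff j f x\<bar> \<partial>lborel) \<le> ennreal e))"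
    using lipschitz_replacement[where 'd='d] by (elim exE conjE)
  show ?thesis
  proof (intro exI[of _ "4 * C"] conjI allI impI)
    show "4 * C > 0" using C by simp
    fix \<zeta> :: "'s \<Rightarrow> real^'d \<Rightarrow> real" and H :: "'s \<Rightarrow> 'd \<Rightarrow> real^'d \<Rightarrow> real" and \<Omega> :: "(real^'d) set" and R \<tau> e m \<theta> :: real
    assume \<zeta>: "\<forall>i. integrable lborel (\<zeta> i)" and H: "\<forall>i j. integrable lborel (H i j)" and w: "\<forall>i j. weak_pdiff UNIV j (\<zeta> i) (H i j)"
      and \<Omega>: "bounded \<Omega>" "\<Omega> \<in> sets borel" and R: "R \<ge> 0" and \<tau>: "\<tau> > 0" and e: "e > 0" and m: "m \<ge> 0" and \<theta>: "\<theta> > 0"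
      and m1: "(\<integral>\<^sup>+x. ennreal (max 0 (norm (\<chi> i j. H i j x) - R)) \<partial>lborel) \<le> ennreal m" and m2: "\<forall>i. (LINT x|lborel. \<bar>\<zeta> i x\<bar>) \<le> m"
    note [measurable] = \<Omega>(2)
    define N where "N = real CARD('s) * real CARD('d)"
    have N: "N > 0" by (simp add: N_def)
    \<comment> \<open>Budget: the complement of \<open>G\<close> costs one \<open>e1\<close>; the
      \<open>N\<close> sets \<open>S1\<close> and the \<open>N\<close> sets \<open>S2\<close> cost
      \<open>2 * e1 / \<theta>\<close> each by Markov at height \<open>\<theta> / 2\<close>.\<close>
    define e1 where "e1 = e / (1 + 4 * N / \<theta>)"
    have pos: "1 + 4 * N / \<theta> > 0" using N \<theta> by (intro add_pos_pos divide_pos_pos) auto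
    then have e1: "e1 > 0" unfolding e1_def using e by (intro divide_pos_pos)
    have "(1 + 4 * N / \<theta>) * e1 = e" unfolding e1_def using pos by (intro nonzero_mult_div_cancel_left[of _ e, simplified times_divide_eq_right[symmetric]]) linarith
    then have e1e: "e1 + 4 * N / \<theta> * e1 = e" by (simp add: distrib_right)
    define X where "X = 5 ^ CARD('d) * m + real CARD('s) * m / \<tau>"
    have X: "X \<ge> 0" using m \<tau> by (simp add: X_def)
    obtain f G where f: "\<forall>i k. Ck k (f i)" "\<forall>i. integrable lborel (f i)" "\<forall>i j. integrable lborel (pdiff j (f i))" "\<forall>i. \<exists>B. \<forall>j x. \<bar>pdiff j (f i) x\<bar> \<le> B"
      and G: "closed G" "emeasure lborel (- G) \<le> ennreal (X + e1)"
      and lip: "\<forall>i. \<forall>x\<in>G. \<forall>y\<in>G. \<bar>f i x - f i y\<bar> \<le> (4 * (R + 1)) * dist x y" "\<forall>i. \<forall>x\<in>G. \<bar>f i x\<bar> \<le> \<tau>"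
      and fH: "\<forall>i j. (LINT x|lborel. \<bar>pdiff j (f i) x - H i j x\<bar>) \<le> e1"
      using smooth_approximation_good_set[OF \<zeta>[rule_format] H[rule_format] w[rule_format] R \<tau> e1 m m1 m2[rule_format]] unfolding X_def by (elim exE conjE) 
    have Gf: "emeasure lborel (- G) < \<infinity>" using G(2) by (rule le_less_trans) simp
    have [measurable]: "G \<in> sets borel" using G(1) by simp
    have "\<exists>u. (\<forall>k. Ck k u) \<and> (\<forall>x. \<bar>u x\<bar> \<le> \<tau>) \<and> (\<forall>x\<in>\<Omega>. \<forall>j. \<bar>pdiff j u x\<bar> \<le> C * (4 * (R + 1))) \<and>
       (\<forall>j. (\<integral>\<^sup>+x\<in>G \<inter> \<Omega>. ennreal \<bar>pdiff j u x - pdiff j (f i) x\<bar> \<partial>lborel) \<le> ennreal e1)" for i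
    proof -
      obtain B where B: "\<forall>j x. \<bar>pdiff j (f i) x\<bar> \<le> B" using f(4) by blast
      show ?thesis
        by (rule rep[rule_format, where B=B])
           (use f(1,2,3) B G(1) Gf \<Omega> e1 lip R \<tau> in \<open>simp_all\<close>)
    qed
    then have "\<forall>i. \<exists>u. (\<forall>k. Ck k u) \<and> (\<forall>x. \<bar>u x\<bar> \<le> \<tau>) \<and> (\<forall>x\<in>\<Omega>. \<forall>j. \<bar>pdiff j u x\<bar> \<le> C * (4 * (R + 1))) \<and>
       (\<forall>j. (\<integral>\<^sup>+x\<in>G \<inter> \<Omega>. ennreal \<bar>pdiff j u x - pdiff j (f i) x\<bar> \<partial>lborel) \<le> ennreal e1)" by (rule allI)
    from choice[OF this] obtain u where "\<forall>i. (\<forall>k. Ck k (u i)) \<and> (\<forall>x. \<bar>u i x\<bar> \<le> \<tau>) \<and> (\<forall>x\<in>\<Omega>. \<forall>j. \<bar>pdiff j (u i) x\<bar> \<le> C * (4 * (R + 1))) \<and>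
       (\<forall>j. (\<integral>\<^sup>+x\<in>G \<inter> \<Omega>. ennreal \<bar>pdiff j (u i) x - pdiff j (f i) x\<bar> \<partial>lborel) \<le> ennreal e1)" by (elim exE)
    then have u: "\<And>i k. Ck k (u i)" "\<And>i x. \<bar>u i x\<bar> \<le> \<tau>" "\<And>i j x. x \<in> \<Omega> \<Longrightarrow> \<bar>pdiff j (u i) x\<bar> \<le> C * (4 * (R + 1))"
      "\<And>i j. (\<integral>\<^sup>+x\<in>G \<inter> \<Omega>. ennreal \<bar>pdiff j (u i) x - pdiff j (f i) x\<bar> \<partial>lborel) \<le> ennreal e1" by simp_all
    have pm[measurable]: "pdiff j (u i) \<in> borel_measurable borel" for i j
      using smooth_frechet_derivative[OF u(1), of 0 i] by (simp add: borel_measurable_continuous_onI)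
    have fm[measurable]: "pdiff j (f i) \<in> borel_measurable borel" for i j using borel_measurable_integrable[OF f(3)[rule_format, of i j]] by simp
    have Hm[measurable]: "H i j \<in> borel_measurable borel" for i j using borel_measurable_integrable[OF H[rule_format, of i j]] by simp
    define S1 where "S1 q = {x \<in> G \<inter> \<Omega>. \<bar>pdiff (snd q) (u (fst q)) x - pdiff (snd q) (f (fst q)) x\<bar> \<ge> \<theta> / 2}" for q :: "'s \<times> 'd"
    define S2 where "S2 q = {x. \<bar>pdiff (snd q) (f (fst q)) x - H (fst q) (snd q) x\<bar> \<ge> \<theta> / 2}" for q :: "'s \<times> 'd"
    have S1m: "S1 q \<in> sets lborel" for q unfolding S1_def by measurable
    have S2m: "S2 q \<in> sets lborel" for q unfolding S2_def by measurable
    have b1: "emeasure lborel (S1 q) \<le> ennreal (e1 / (\<theta> / 2))" for q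
    proof (rule emeasure_le_Markov[where F="\<lambda>x. \<bar>pdiff (snd q) (u (fst q)) x - pdiff (snd q) (f (fst q)) x\<bar> * indicator (G \<inter> \<Omega>) x"])
      have "(\<integral>\<^sup>+x. ennreal (\<bar>pdiff (snd q) (u (fst q)) x - pdiff (snd q) (f (fst q)) x\<bar> * indicator (G \<inter> \<Omega>) x) \<partial>lborel)
        = (\<integral>\<^sup>+x\<in>G \<inter> \<Omega>. ennreal \<bar>pdiff (snd q) (u (fst q)) x - pdiff (snd q) (f (fst q)) x\<bar> \<partial>lborel)"
        by (intro nn_integral_cong) (auto split: split_indicator)
      then show "(\<integral>\<^sup>+x. ennreal (\<bar>pdiff (snd q) (u (fst q)) x - pdiff (snd q) (f (fst q)) x\<bar> * indicator (G \<inter> \<Omega>) x) \<partial>lborel) \<le> ennreal e1"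
        using u(4) by simp
      show "\<theta> / 2 > 0" using \<theta> by simp
      show "(\<lambda>x. \<bar>pdiff (snd q) (u (fst q)) x - pdiff (snd q) (f (fst q)) x\<bar> * indicator (G \<inter> \<Omega>) x) \<in> borel_measurable lborel" by measurable
    qed (use S1m in \<open>auto simp: S1_def\<close>)
    have b2: "emeasure lborel (S2 q) \<le> ennreal (e1 / (\<theta> / 2))" for q
    proof (rule emeasure_le_Markov[where F="\<lambda>x. \<bar>pdiff (snd q) (f (fst q)) x - H (fst q) (snd q) x\<bar>"])
      have "integrable lborel (\<lambda>x. \<bar>pdiff (snd q) (f (fst q)) x - H (fst q) (snd q) x\<bar>)" using f(3) H by auto
      then show "(\<integral>\<^sup>+x. ennreal \<bar>pdiff (snd q) (f (fst q)) x - H (fst q) (snd q) x\<bar> \<partial>lborel) \<le> ennreal e1"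
        using fH by (subst nn_integral_eq_integral) (auto intro: ennreal_leI)
      show "\<theta> / 2 > 0" using \<theta> by simp
      show "(\<lambda>x. \<bar>pdiff (snd q) (f (fst q)) x - H (fst q) (snd q) x\<bar>) \<in> borel_measurable lborel" by measurable
    qed (use S2m in \<open>auto simp: S2_def\<close>)
    have sub: "{x \<in> \<Omega>. \<exists>i j. \<bar>pdiff j (u i) x - H i j x\<bar> > \<theta>} \<subseteq> - G \<union> ((\<Union>q. S1 q) \<union> (\<Union>q. S2 q))"
    proof
      fix x assume "x \<in> {x \<in> \<Omega>. \<exists>i j. \<bar>pdiff j (u i) x - H i j x\<bar> > \<theta>}"
      then obtain i j where x: "x \<in> \<Omega>" "\<bar>pdiff j (u i) x - H i j x\<bar> > \<theta>" by blast
      have "x \<in> - G \<or> x \<in> S1 (i, j) \<or> x \<in> S2 (i, j)"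
      proof (cases "x \<in> G")
        case True
        have "\<bar>pdiff j (u i) x - pdiff j (f i) x\<bar> \<ge> \<theta> / 2 \<or> \<bar>pdiff j (f i) x - H i j x\<bar> \<ge> \<theta> / 2" using x(2) by linarith
        then show ?thesis using x(1) True by (auto simp: S1_def S2_def)
      qed simp
      then show "x \<in> - G \<union> ((\<Union>q. S1 q) \<union> (\<Union>q. S2 q))" by blast
    qed
    have U1: "(\<Union>q. S1 q) \<in> sets lborel" "(\<Union>q. S2 q) \<in> sets lborel" using S1m S2m by auto
    have "emeasure lborel {x \<in> \<Omega>. \<exists>i j. \<bar>pdiff j (u i) x - H i j x\<bar> > \<theta>} \<le> emeasure lborel (- G \<union> ((\<Union>q. S1 q) \<union> (\<Union>q. S2 q)))"
      using sub G(1) U1 by (intro emeasure_mono) auto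
    also have "\<dots> \<le> emeasure lborel (- G) + (emeasure lborel (\<Union>q. S1 q) + emeasure lborel (\<Union>q. S2 q))"
      using G(1) U1 by (intro order_trans[OF emeasure_subadditive] add_left_mono emeasure_subadditive) auto
    also have "\<dots> \<le> ennreal (X + e1) + (ennreal (real CARD('s \<times> 'd) * (e1 / (\<theta> / 2))) + ennreal (real CARD('s \<times> 'd) * (e1 / (\<theta> / 2))))"
      using e1 \<theta> by (intro add_mono G(2) emeasure_UN_le_const S1m S2m b1 b2) auto
    also have "\<dots> = ennreal (X + e1 + (real CARD('s \<times> 'd) * (e1 / (\<theta> / 2)) + real CARD('s \<times> 'd) * (e1 / (\<theta> / 2))))"
    proof -
      have a: "0 \<le> X + e1" "0 \<le> real CARD('s \<times> 'd) * (e1 / (\<theta> / 2))" using X e1 \<theta> by auto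
      show ?thesis by (simp only: ennreal_plus[OF a(1) add_nonneg_nonneg[OF a(2) a(2)]] ennreal_plus[OF a(2) a(2)])
    qed
    also have "X + e1 + (real CARD('s \<times> 'd) * (e1 / (\<theta> / 2)) + real CARD('s \<times> 'd) * (e1 / (\<theta> / 2))) = X + (e1 + 4 * N / \<theta> * e1)"
      by (simp add: N_def)
    also have "\<dots> = X + e" by (simp only: e1e)
    finally have "emeasure lborel {x \<in> \<Omega>. \<exists>i j. \<bar>pdiff j (u i) x - H i j x\<bar> > \<theta>} \<le> ennreal (5 ^ CARD('d) * m + real CARD('s) * m / \<tau> + e)" by (simp add: X_def)
    moreover have "\<forall>x\<in>\<Omega>. \<forall>i j. \<bar>pdiff j (u i) x\<bar> \<le> 4 * C * (R + 1)" using u(3) by (simp add: mult_ac)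
    ultimately show "\<exists>u. (\<forall>i k. Ck k (u i)) \<and> (\<forall>i x. \<bar>u i x\<bar> \<le> \<tau>) \<and> (\<forall>x\<in>\<Omega>. \<forall>i j. \<bar>pdiff j (u i) x\<bar> \<le> 4 * C * (R + 1)) \<and>
       emeasure lborel {x \<in> \<Omega>. \<exists>i j. \<bar>pdiff j (u i) x - H i j x\<bar> > \<theta>} \<le> ennreal (5 ^ CARD('d) * m + real CARD('s) * m / \<tau> + e)"
      using u(1,2) by (intro exI[of _ u]) blast
  qed
qed


subsection \<open>Improving low-energy maps to Lipschitz maps\<close>

lemma compact_inner_approximation:
  fixes \<Omega> :: "'a::euclidean_space set"
  assumes \<Omega>: "open \<Omega>" "bounded \<Omega>" and e: "e > 0"
  shows "\<exists>K. compact K \<and> K \<subseteq> \<Omega> \<and> emeasure lborel (\<Omega> - K) \<le> ennreal e"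
proof -
  have Om[measurable]: "\<Omega> \<in> sets borel" using \<Omega> by simp
  have Omf: "\<Omega> \<in> fmeasurable lborel" using emeasure_bounded_finite[OF \<Omega>(2)] Om by (simp add: fmeasurable_def)
  obtain C :: "nat \<Rightarrow> 'a set" where C: "\<And>n. compact (C n)" "\<And>n. C n \<subseteq> \<Omega>" "\<And>n. C n \<subseteq> interior (C (Suc n))" "(\<Union>n. C n) = \<Omega>"
    using open_Union_compact_subsets[OF \<Omega>(1)] by metis
  have Cm: "C n \<in> sets borel" for n using C(1) by (simp add: compact_imp_closed)
  have inc: "incseq C" using C(3) interior_subset by (intro incseq_SucI) blast
  have "(\<lambda>n. measure lborel (C n)) \<longlonglongrightarrow> measure lborel (\<Union>n. C n)"
    using Cm inc Omf C(4) by (intro Lim_measure_incseq) (auto simp: fmeasurable_def)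
  then have "(\<lambda>n. measure lborel (C n)) \<longlonglongrightarrow> measure lborel \<Omega>" by (simp only: C(4))
  from LIMSEQ_D[OF this e] obtain n where "norm (measure lborel (C n) - measure lborel \<Omega>) < e" by blast
  moreover have Cf: "C n \<in> fmeasurable lborel" using emeasure_bounded_finite[OF compact_imp_bounded[OF C(1)]] Cm by (simp add: fmeasurable_def)
  ultimately have "measure lborel (\<Omega> - C n) < e"
    using measurable_measure_Diff[OF Omf _ C(2)] Cm[of n] by simp
  then have "emeasure lborel (\<Omega> - C n) \<le> ennreal e"
    using fmeasurable.Diff[OF Omf Cf] by (simp add: emeasure_eq_measure2 ennreal_leI)
  then show ?thesis using C by blast
qed

lemma Lp_imp_integrable:
  fixes u :: "'a::euclidean_space \<Rightarrow> 'b::euclidean_space"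
  assumes \<Omega>: "open \<Omega>" "bounded \<Omega>" and u: "u \<in> Lp \<Omega> p" and p: "p \<ge> 1"
  shows "set_integrable lebesgue \<Omega> u"
  unfolding set_integrable_def
proof (rule Bochner_Integration.integrable_bound[where f="\<lambda>x. indicator \<Omega> x + indicator \<Omega> x *\<^sub>R norm (u x) powr p"])
  have "\<Omega> \<in> lmeasurable" using \<Omega> by (simp add: lmeasurable_open)
  then have "integrable lebesgue (indicator \<Omega> :: 'a \<Rightarrow> real)" by (auto simp: fmeasurable_def intro!: integrable_real_indicator)
  then show "integrable lebesgue (\<lambda>x. indicator \<Omega> x + indicator \<Omega> x *\<^sub>R norm (u x) powr p)"
    using u unfolding Lp_def set_integrable_def by (intro Bochner_Integration.integrable_add) auto
  show "(\<lambda>x. indicator \<Omega> x *\<^sub>R u x) \<in> borel_measurable lebesgue" using u by (simp add: Lp_def set_borel_measurable_def)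
  have "norm (u x) \<le> 1 + norm (u x) powr p" for x
  proof (cases "norm (u x) \<le> 1")
    case False
    then have "norm (u x) powr 1 \<le> norm (u x) powr p" using p by (intro powr_mono) auto
    then show ?thesis by simp
  qed (simp add: add_increasing2)
  then show "AE x in lebesgue. norm (indicator \<Omega> x *\<^sub>R u x) \<le> norm (indicator \<Omega> x + indicator \<Omega> x *\<^sub>R norm (u x) powr p)"
    by (intro AE_I2) (auto split: split_indicator)
qed

lemma Lp_diff:
  fixes u v :: "'a::euclidean_space \<Rightarrow> 'b::euclidean_space"
  assumes u: "u \<in> Lp \<Omega> p" and v: "v \<in> Lp \<Omega> p" and p: "p > 0"
  shows "(\<lambda>x. u x - v x) \<in> Lp \<Omega> p"
proof -
  have m: "(\<lambda>x. indicator \<Omega> x *\<^sub>R u x - indicator \<Omega> x *\<^sub>R v x) \<in> borel_measurable lebesgue"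
    using u v by (intro borel_measurable_diff) (auto simp: Lp_def set_borel_measurable_def)
  then have sm: "set_borel_measurable lebesgue \<Omega> (\<lambda>x. u x - v x)" by (simp add: set_borel_measurable_def scaleR_diff_right)
  have "integrable lebesgue (\<lambda>x. indicator \<Omega> x *\<^sub>R norm (u x - v x) powr p)"
  proof (rule Bochner_Integration.integrable_bound[where f="\<lambda>x. 2 powr p * (indicator \<Omega> x *\<^sub>R norm (u x) powr p + indicator \<Omega> x *\<^sub>R norm (v x) powr p)"])
    show "integrable lebesgue (\<lambda>x. 2 powr p * (indicator \<Omega> x *\<^sub>R norm (u x) powr p + indicator \<Omega> x *\<^sub>R norm (v x) powr p))"
      using u v unfolding Lp_def set_integrable_def by auto
    have "(\<lambda>x. norm (indicator \<Omega> x *\<^sub>R u x - indicator \<Omega> x *\<^sub>R v x) powr p) \<in> borel_measurable lebesgue"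
      using measurable_compose[OF m borel_measurable_norm] by (rule powr_real_measurable) simp
    moreover have "norm (indicator \<Omega> x *\<^sub>R u x - indicator \<Omega> x *\<^sub>R v x) powr p = indicator \<Omega> x *\<^sub>R norm (u x - v x) powr p" for x
      by (auto split: split_indicator)
    ultimately show "(\<lambda>x. indicator \<Omega> x *\<^sub>R norm (u x - v x) powr p) \<in> borel_measurable lebesgue" by simp
    have "norm (u x - v x) powr p \<le> 2 powr p * (norm (u x) powr p + norm (v x) powr p)" for x
    proof -
      let ?M = "max (norm (u x)) (norm (v x))"
      have "norm (u x - v x) \<le> 2 * ?M" using norm_triangle_ineq4[of "u x" "v x"] by linarith
      then have "norm (u x - v x) powr p \<le> (2 * ?M) powr p" using p by (intro powr_mono2) auto
      also have "\<dots> = 2 powr p * ?M powr p" by (simp add: powr_mult)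
      also have "?M powr p \<le> norm (u x) powr p + norm (v x) powr p" by (auto simp: max_def)
      finally show ?thesis by simp
    qed
    then show "AE x in lebesgue. norm (indicator \<Omega> x *\<^sub>R norm (u x - v x) powr p)
       \<le> norm (2 powr p * (indicator \<Omega> x *\<^sub>R norm (u x) powr p + indicator \<Omega> x *\<^sub>R norm (v x) powr p))"
      by (intro AE_I2) (auto split: split_indicator)
  qed
  with sm show ?thesis by (simp add: Lp_def set_integrable_def)
qed

text \<open>Pointwise, a nonnegative number is at most \<open>t\<close> or at most
  \<open>t powr (1 - p)\<close> times its \<open>p\<close>-th power. The free parameter
  \<open>t\<close> makes the \<open>L^1\<close> norm small once \<open>\<kappa>\<close> is small
  enough for that \<open>t\<close>.\<close>

lemma L1_le_Lp:
  fixes u :: "'a::euclidean_space \<Rightarrow> real^'s"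
  assumes \<Omega>: "open \<Omega>" "bounded \<Omega>" and u: "u \<in> Lp \<Omega> p" and p: "p > 1" and t: "t > 0" and k: "(LINT x:\<Omega>|lebesgue. norm (u x) powr p) \<le> \<kappa>"
  shows "(LINT x:\<Omega>|lebesgue. \<bar>u x $ i\<bar>) \<le> t * measure lebesgue \<Omega> + t powr (1 - p) * \<kappa>"
proof -
  have lm: "\<Omega> \<in> lmeasurable" using \<Omega> by (simp add: lmeasurable_open)
  then have i1: "integrable lebesgue (indicator \<Omega> :: 'a \<Rightarrow> real)" by (auto simp: fmeasurable_def intro!: integrable_real_indicator)
  have i2: "integrable lebesgue (\<lambda>x. indicator \<Omega> x *\<^sub>R norm (u x) powr p)" using u by (simp add: Lp_def set_integrable_def)
  have pt: "\<bar>u x $ i\<bar> \<le> t + t powr (1 - p) * norm (u x) powr p" for x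
  proof -
    have c: "\<bar>u x $ i\<bar> \<le> norm (u x)" by (rule component_le_norm_cart)
    show ?thesis
    proof (cases "norm (u x) \<le> t")
      case True
      then show ?thesis using c by (simp add: add_increasing2)
    next
      case False
      have "norm (u x) = norm (u x) powr (1 - p) * norm (u x) powr p" using False t by (simp flip: powr_add)
      also have "\<dots> \<le> t powr (1 - p) * norm (u x) powr p" using False t p by (intro mult_right_mono powr_mono2') auto
      finally show ?thesis using c t by linarith
    qed
  qed
  have "(LINT x:\<Omega>|lebesgue. \<bar>u x $ i\<bar>) \<le> (LINT x|lebesgue. t * indicator \<Omega> x + t powr (1 - p) * (indicator \<Omega> x *\<^sub>R norm (u x) powr p))"
    unfolding set_lebesgue_integral_def
  proof (rule integral_mono_AE')
    show "AE x in lebesgue. indicator \<Omega> x *\<^sub>R \<bar>u x $ i\<bar> \<le> t * indicator \<Omega> x + t powr (1 - p) * (indicator \<Omega> x *\<^sub>R norm (u x) powr p)"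
      using pt by (intro AE_I2) (auto split: split_indicator)
    show "AE x in lebesgue. 0 \<le> t * indicator \<Omega> x + t powr (1 - p) * (indicator \<Omega> x *\<^sub>R norm (u x) powr p)"
      using t by (intro AE_I2) auto
  qed (use i1 i2 in auto)
  also have "\<dots> = t * measure lebesgue \<Omega> + t powr (1 - p) * (LINT x:\<Omega>|lebesgue. norm (u x) powr p)"
    using i1 i2 by (simp add: set_lebesgue_integral_def)
  also have "\<dots> \<le> t * measure lebesgue \<Omega> + t powr (1 - p) * \<kappa>" using k by (intro add_left_mono mult_left_mono) auto
  finally show ?thesis .
qed

lemma test_times_integrable:
  fixes f \<phi> :: "'a::euclidean_space \<Rightarrow> real"
  assumes "test_function \<Omega> \<phi>" "integrable lborel f"
  shows "integrable lborel (\<lambda>x. \<phi> x * f x)"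
proof -
  obtain B where B: "B > 0" "\<And>x. \<bar>\<phi> x\<bar> \<le> B" using test_function_bounded[OF assms(1)] by blast
  have [measurable]: "\<phi> \<in> borel_measurable borel" using test_function_borel[OF assms(1)] .
  have [measurable]: "f \<in> borel_measurable borel" using assms(2) by auto
  show ?thesis
  proof (rule Bochner_Integration.integrable_bound[where f="\<lambda>y. B * f y"])
    show "AE y in lborel. norm (\<phi> y * f y) \<le> norm (B * f y)"
      using B by (intro AE_I2) (auto simp: abs_mult intro!: mult_right_mono)
  qed (use assms in auto)
qed

text \<open>The product rule combined with extension by zero: the conclusion holds on the whole
  space. It takes the place of a Sobolev extension, for which the boundary may be too rough; the
  price is the term with the derivative of \<open>\<phi>\<close>, which is small when
  \<open>z\<close> is small in \<open>L^1\<close>.\<close>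

lemma weak_pdiff_cutoff:
  fixes z g :: "real^'d \<Rightarrow> real"
  assumes w: "weak_pdiff \<Omega> j z g" and z: "integrable lborel z" and g: "integrable lborel g" and \<phi>: "test_function \<Omega> \<phi>"
  shows "weak_pdiff UNIV j (\<lambda>x. \<phi> x * z x) (\<lambda>x. \<phi> x * g x + pdiff j \<phi> x * z x)"
  unfolding weak_pdiff_def
proof (intro allI impI)
  fix \<psi> :: "real^'d \<Rightarrow> real" assume \<psi>: "test_function UNIV \<psi>"
  have T: "test_function \<Omega> (\<lambda>x. \<phi> x * \<psi> x)" by (rule test_function_mult[OF \<phi> test_functionD(1)[OF \<psi>]])
  have D: "pdiff j (\<lambda>x. \<phi> x * \<psi> x) x = \<phi> x * pdiff j \<psi> x + pdiff j \<phi> x * \<psi> x" for x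
    using fun_cong[OF frechet_derivative_at[OF has_derivative_mult[OF test_functionD(5)[OF \<phi>, of x] test_functionD(5)[OF \<psi>, of x]]], of "axis j 1"] by simp
  note TD = test_function_frechet_derivative
  have I: "integrable lborel (\<lambda>x. \<phi> x * pdiff j \<psi> x * z x)" "integrable lborel (\<lambda>x. pdiff j \<phi> x * \<psi> x * z x)" "integrable lborel (\<lambda>x. \<phi> x * \<psi> x * g x)"
    by (rule test_times_integrable[OF test_function_mult[OF \<phi> test_functionD(1)[OF TD[OF \<psi>]]] z],
        rule test_times_integrable[OF test_function_mult[OF TD[OF \<phi>] test_functionD(1)[OF \<psi>]] z],
        rule test_times_integrable[OF T g])
  have "(LINT x|lborel. z x * (\<phi> x * pdiff j \<psi> x + pdiff j \<phi> x * \<psi> x)) = - (LINT x|lborel. g x * (\<phi> x * \<psi> x))"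
    using w T unfolding weak_pdiff_def by (metis (no_types, lifting) D Bochner_Integration.integral_cong)
  moreover have "(LINT x|lborel. z x * (\<phi> x * pdiff j \<psi> x + pdiff j \<phi> x * \<psi> x)) = (LINT x|lborel. \<phi> x * pdiff j \<psi> x * z x) + (LINT x|lborel. pdiff j \<phi> x * \<psi> x * z x)"
    using I(1,2) by (simp add: distrib_left mult_ac)
  moreover have "(LINT x|lborel. (\<phi> x * g x + pdiff j \<phi> x * z x) * \<psi> x) = (LINT x|lborel. \<phi> x * \<psi> x * g x) + (LINT x|lborel. pdiff j \<phi> x * \<psi> x * z x)"
    using I(2,3) by (simp add: distrib_left distrib_right mult_ac)
  ultimately show "(LINT x|lborel. \<phi> x * z x * pdiff j \<psi> x) = - (LINT x|lborel. (\<phi> x * g x + pdiff j \<phi> x * z x) * \<psi> x)"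
    by (simp add: mult_ac)
qed

text \<open>The value 1 is a maximum of \<open>\<phi>\<close>, so the derivative vanishes there,
  even at boundary points of the plateau.\<close>

lemma cutoff_pdiff_zero:
  fixes \<phi> :: "real^'d \<Rightarrow> real"
  assumes "test_function \<Omega> \<phi>" "\<And>y. \<phi> y \<le> 1" "\<phi> x = 1"
  shows "pdiff j \<phi> x = 0"
proof -
  have "frechet_derivative \<phi> (at x) = (\<lambda>v. 0)"
    by (rule differential_zero_maxmin[of x UNIV \<phi>]) (use assms test_functionD(5)[OF assms(1)] in auto)
  then show ?thesis by simp
qed


definition integrable_rep :: "'a::euclidean_space set \<Rightarrow> ('a \<Rightarrow> real) \<Rightarrow> ('a \<Rightarrow> real) \<Rightarrow> bool" where
  "integrable_rep \<Omega> v z \<longleftrightarrow> integrable lborel z \<and> (\<forall>x. x \<notin> \<Omega> \<longrightarrow> z x = 0) \<and> (AE x in lborel. indicator \<Omega> x * v x = z x)"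

lemma integrable_repD:
  assumes "integrable_rep \<Omega> v z"
  shows "integrable lborel z" "x \<notin> \<Omega> \<Longrightarrow> z x = 0" "AE x in lborel. indicator \<Omega> x * v x = z x"
  using assms by (auto simp: integrable_rep_def)

lemma ex_integrable_rep:
  assumes "set_integrable lebesgue \<Omega> v" "\<Omega> \<in> sets borel"
  shows "\<exists>z. integrable_rep \<Omega> v z"
proof -
  obtain z where "integrable lborel z" "\<And>x. x \<notin> \<Omega> \<Longrightarrow> z x = 0" "AE x in lborel. indicator \<Omega> x * v x = z x"
    by (rule lebesgue_integrable_borel_rep[OF assms], rule that, assumption+)
  then show ?thesis by (intro exI[of _ z]) (simp add: integrable_rep_def)
qed

text \<open>Markov's inequality for the energy density: on the level set the active integrand is at
  least \<open>c\<close>.\<close>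

lemma dist_level_set_le:
  fixes \<Omega> :: "(real^'d) set" and W :: "nat \<Rightarrow> real^'d^'s \<Rightarrow> real"
  assumes \<Omega>: "open \<Omega>" and P: "measurable_partition n P" and e: "\<epsilon> > 0" and H: "set_borel_measurable lebesgue \<Omega> H"
    and b: "(\<integral>\<^sup>+x\<in>\<Omega>. ennreal (\<Sum>k\<in>{1..n}. indicator (P k) (frac_vec (x /\<^sub>R \<epsilon>)) * W k (H x)) \<partial>lebesgue) \<le> ennreal \<kappa>"
    and low: "\<And>k \<Lambda>. k \<in> {1..n} \<Longrightarrow> infdist \<Lambda> (\<AA> k) \<ge> \<theta> \<Longrightarrow> c \<le> W k \<Lambda>" and c: "c > 0"
  shows "emeasure lebesgue {x \<in> \<Omega>. \<bar>(\<Sum>k\<in>{1..n}. indicator (P k) (frac_vec (x /\<^sub>R \<epsilon>)) * infdist (H x) (\<AA> k)) - 0\<bar> > \<theta>} \<le> ennreal (\<kappa> / c)" (is "emeasure _ ?D \<le> _")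
proof -
  have D: "?D \<in> sets lebesgue" by (rule dist_level_set_measurable[OF \<Omega> P e H])
  have "ennreal c * emeasure lebesgue ?D = (\<integral>\<^sup>+x. ennreal c * indicator ?D x \<partial>lebesgue)" using D by (simp add: nn_integral_cmult_indicator)
  also have "\<dots> \<le> (\<integral>\<^sup>+x\<in>\<Omega>. ennreal (\<Sum>k\<in>{1..n}. indicator (P k) (frac_vec (x /\<^sub>R \<epsilon>)) * W k (H x)) \<partial>lebesgue)"
  proof (rule nn_integral_mono)
    fix x
    show "ennreal c * indicator ?D x \<le> ennreal (\<Sum>k\<in>{1..n}. indicator (P k) (frac_vec (x /\<^sub>R \<epsilon>)) * W k (H x)) * indicator \<Omega> x"
    proof (cases "x \<in> ?D")
      case True
      obtain k where k: "k \<in> {1..n}" "frac_vec (x /\<^sub>R \<epsilon>) \<in> P k" "\<And>g :: nat \<Rightarrow> real. (\<Sum>k\<in>{1..n}. indicator (P k) (frac_vec (x /\<^sub>R \<epsilon>)) * g k) = g k"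
        using partition_sum[OF P, of "x /\<^sub>R \<epsilon>"] by blast
      have "infdist (H x) (\<AA> k) \<ge> \<theta>" using True k(3) by (simp add: infdist_nonneg)
      then have "ennreal c \<le> ennreal (W k (H x))" by (intro ennreal_leI low k(1))
      then show ?thesis using True k(3) by simp
    qed simp
  qed
  also have "\<dots> \<le> ennreal \<kappa>" by (rule b)
  finally have "ennreal (1 / c) * (ennreal c * emeasure lebesgue ?D) \<le> ennreal (1 / c) * ennreal \<kappa>" by (rule mult_left_mono) simp
  moreover have "ennreal (1 / c) * ennreal c = 1" using c by (simp flip: ennreal_mult')
  ultimately have "emeasure lebesgue ?D \<le> ennreal (1 / c) * ennreal \<kappa>" by (simp add: mult.assoc[symmetric])
  also have "\<dots> = ennreal (\<kappa> / c)" using c by (simp flip: ennreal_mult')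
  finally show ?thesis .
qed

text \<open>Where \<open>norm (H x)\<close> reaches \<open>R0\<close> the active density dominates
  \<open>c * norm (H x)\<close>, hence \<open>c * F x\<close>; elsewhere \<open>F\<close> is zero
  almost everywhere. \<open>F\<close> is a Borel stand-in for the excess, so that its integral can
  be taken in \<open>lborel\<close>.\<close>

lemma low_energy_excess:
  fixes \<Omega> :: "(real^'d) set" and W :: "nat \<Rightarrow> real^'d^'s \<Rightarrow> real"
  assumes P: "measurable_partition n P"
    and F: "F \<in> borel_measurable lborel" "\<And>x. F x \<ge> 0" "\<And>x. x \<notin> \<Omega> \<Longrightarrow> F x = 0" "AE x in lebesgue. x \<in> \<Omega> \<longrightarrow> F x \<le> max 0 (norm (H x) - R0)"
    and b: "(\<integral>\<^sup>+x\<in>\<Omega>. ennreal (\<Sum>k\<in>{1..n}. indicator (P k) (frac_vec (x /\<^sub>R \<epsilon>)) * W k (H x)) \<partial>lebesgue) \<le> ennreal \<kappa>"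
    and low: "\<And>k \<Lambda>. k \<in> {1..n} \<Longrightarrow> norm \<Lambda> \<ge> R0 \<Longrightarrow> c * norm \<Lambda> \<le> W k \<Lambda>" and c: "c > 0" and R0: "R0 \<ge> 0"
  shows "(\<integral>\<^sup>+x. ennreal (F x) \<partial>lborel) \<le> ennreal (\<kappa> / c)"
proof -
  have "ennreal c * (\<integral>\<^sup>+x. ennreal (F x) \<partial>lborel) = (\<integral>\<^sup>+x. ennreal c * ennreal (F x) \<partial>lborel)" using F by (intro nn_integral_cmult[symmetric]) auto
  also have "\<dots> = (\<integral>\<^sup>+x. ennreal c * ennreal (F x) \<partial>lebesgue)" by (rule nn_integral_completion[symmetric])
  also have "\<dots> \<le> (\<integral>\<^sup>+x\<in>\<Omega>. ennreal (\<Sum>k\<in>{1..n}. indicator (P k) (frac_vec (x /\<^sub>R \<epsilon>)) * W k (H x)) \<partial>lebesgue)"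
  proof (rule nn_integral_mono_AE)
    show "AE x in lebesgue. ennreal c * ennreal (F x) \<le> ennreal (\<Sum>k\<in>{1..n}. indicator (P k) (frac_vec (x /\<^sub>R \<epsilon>)) * W k (H x)) * indicator \<Omega> x"
      using F(4)
    proof eventually_elim
      case (elim x)
      show ?case
      proof (cases "x \<in> \<Omega> \<and> norm (H x) \<ge> R0")
        case True
        obtain k where k: "k \<in> {1..n}" "frac_vec (x /\<^sub>R \<epsilon>) \<in> P k" "\<And>g :: nat \<Rightarrow> real. (\<Sum>k\<in>{1..n}. indicator (P k) (frac_vec (x /\<^sub>R \<epsilon>)) * g k) = g k"
          using partition_sum[OF P, of "x /\<^sub>R \<epsilon>"] by blast
        have "F x \<le> norm (H x)" using elim True R0 by (auto simp: max_def split: if_splits)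
        then have "c * F x \<le> c * norm (H x)" using c by simp
        also have "\<dots> \<le> W k (H x)" using True by (intro low k(1)) auto
        finally have "ennreal (c * F x) \<le> ennreal (W k (H x))" by (rule ennreal_leI)
        then show ?thesis using True k(3) c F(2)[of x] by (simp add: ennreal_mult)
      next
        case False
        then have "F x = 0" using elim F(2)[of x] F(3)[of x] by (cases "x \<in> \<Omega>") (auto simp: max_def)
        then show ?thesis by simp
      qed
    qed
  qed
  also have "\<dots> \<le> ennreal \<kappa>" by (rule b)
  finally have "ennreal (1 / c) * (ennreal c * (\<integral>\<^sup>+x. ennreal (F x) \<partial>lborel)) \<le> ennreal (1 / c) * ennreal \<kappa>" by (rule mult_left_mono) simp
  moreover have "ennreal (1 / c) * ennreal c = 1" using c by (simp flip: ennreal_mult')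
  ultimately have "(\<integral>\<^sup>+x. ennreal (F x) \<partial>lborel) \<le> ennreal (1 / c) * ennreal \<kappa>" by (simp add: mult.assoc[symmetric])
  also have "\<dots> = ennreal (\<kappa> / c)" using c by (simp flip: ennreal_mult')
  finally show ?thesis .
qed

text \<open>The order of the quantifiers carries the result: the gradient bound \<open>C\<close>
  comes before the accuracy \<open>\<theta>\<close>, so a diagonal sequence stays bounded, and the
  energy threshold \<open>\<kappa>\<close> comes before \<open>\<epsilon>\<close> and
  \<open>v\<close>, so it applies along a whole sequence of low-energy maps. Truncation is performed
  on \<open>v x - A *v x\<close> times a cutoff, and the linear map is added back.\<close>

lemma low_energy_lipschitz_approximation:
  fixes \<Omega> :: "(real^'d) set" and W :: "nat \<Rightarrow> real^'d^'s \<Rightarrow> real" and A :: "real^'d^'s"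
  assumes n: "1 \<le> n" and p: "1 < p" and \<Omega>: "open \<Omega>" "bounded \<Omega>"
    and W0: "\<And>k \<Lambda>. k \<in> {1..n} \<Longrightarrow> 0 \<le> W k \<Lambda>"
    and Wc: "\<And>k. k \<in> {1..n} \<Longrightarrow> continuous_on UNIV (W k)"
    and P: "measurable_partition n P"
    and Wg: "\<And>k. k \<in> {1..n} \<Longrightarrow> coercive_growth p (W k)"
    and WZ: "\<And>k. k \<in> {1..n} \<Longrightarrow> W k -` {0} \<noteq> {}"
  shows "\<exists>C. \<forall>\<theta>>0. \<exists>\<kappa>>0. \<forall>\<epsilon>>0. \<forall>v\<in>W1p \<Omega> p.
    (\<integral>\<^sup>+x\<in>\<Omega>. ennreal (\<Sum>k\<in>{1..n}. indicator (P k) (frac_vec (x /\<^sub>R \<epsilon>)) * W k (weak_grad \<Omega> v x)) \<partial>lebesgue) \<le> ennreal \<kappa> \<longrightarrow>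
    (LINT x:\<Omega>|lebesgue. norm (v x - A *v x) powr p) \<le> \<kappa> \<longrightarrow>
    (\<exists>u :: real^'d \<Rightarrow> real^'s. (\<forall>i k. Ck k (\<lambda>x. u x $ i)) \<and> (\<forall>x i. \<bar>(u x - A *v x) $ i\<bar> \<le> \<theta>) \<and>
      (\<forall>x\<in>\<Omega>. \<forall>i j. \<bar>pdiff j (\<lambda>x. u x $ i) x - A $ i $ j\<bar> \<le> C) \<and>
      emeasure lebesgue {x \<in> \<Omega>. \<bar>(\<Sum>k\<in>{1..n}. indicator (P k) (frac_vec (x /\<^sub>R \<epsilon>)) * infdist (\<chi> i j. pdiff j (\<lambda>x. u x $ i) x) (W k -` {0})) - 0\<bar> > \<theta>} \<le> ennreal \<theta>)"
proof -
  obtain C where C: "C > 0" and trunc: "\<forall>(\<zeta> :: 's::finite \<Rightarrow> real^'d \<Rightarrow> real) (H :: 's \<Rightarrow> 'd \<Rightarrow> real^'d \<Rightarrow> real) \<Omega> R \<tau> e m \<theta>.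
     (\<forall>i. integrable lborel (\<zeta> i)) \<longrightarrow> (\<forall>i j. integrable lborel (H i j)) \<longrightarrow> (\<forall>i j. weak_pdiff UNIV j (\<zeta> i) (H i j)) \<longrightarrow>
     bounded \<Omega> \<longrightarrow> \<Omega> \<in> sets borel \<longrightarrow> R \<ge> 0 \<longrightarrow> \<tau> > 0 \<longrightarrow> e > 0 \<longrightarrow> m \<ge> 0 \<longrightarrow> \<theta> > 0 \<longrightarrow>
     (\<integral>\<^sup>+x. ennreal (max 0 (norm (\<chi> i j. H i j x) - R)) \<partial>lborel) \<le> ennreal m \<longrightarrow> (\<forall>i. (LINT x|lborel. \<bar>\<zeta> i x\<bar>) \<le> m) \<longrightarrow>
     (\<exists>u. (\<forall>i k. Ck k (u i)) \<and> (\<forall>i x. \<bar>u i x\<bar> \<le> \<tau>) \<and> (\<forall>x\<in>\<Omega>. \<forall>i j. \<bar>pdiff j (u i) x\<bar> \<le> C * (R + 1)) \<and>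
       emeasure lborel {x \<in> \<Omega>. \<exists>i j. \<bar>pdiff j (u i) x - H i j x\<bar> > \<theta>} \<le> ennreal (5 ^ CARD('d) * m + real CARD('s) * m / \<tau> + e))"
    using lipschitz_truncation[where 'd='d and 's='s] by (elim exE conjE)
  have Om[measurable]: "\<Omega> \<in> sets borel" using \<Omega> by simp
  have "\<exists>c R. c > 0 \<and> R \<ge> 1 \<and> (\<forall>x. norm x \<ge> R \<longrightarrow> c * norm x \<le> W k x)" if "k \<in> {1..n}" for k
    by (rule coercive_growth_lower[OF Wg[OF that] p])
  then obtain cc RR where cR: "\<And>k. k \<in> {1..n} \<Longrightarrow> cc k > 0" "\<And>k. k \<in> {1..n} \<Longrightarrow> RR k \<ge> 1" "\<And>k \<Lambda>. k \<in> {1..n} \<Longrightarrow> norm \<Lambda> \<ge> RR k \<Longrightarrow> cc k * norm \<Lambda> \<le> W k \<Lambda>"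
    by metis
  define c where "c = Min (cc ` {1..n})"
  define R0 where "R0 = Max (insert 1 (RR ` {1..n}))"
  have c: "c > 0" using cR(1) n by (simp add: c_def)
  have R0: "R0 \<ge> 1" unfolding R0_def by (intro Max_ge) auto
  have low: "c * norm \<Lambda> \<le> W k \<Lambda>" if "k \<in> {1..n}" "norm \<Lambda> \<ge> R0" for k \<Lambda>
  proof -
    have "c \<le> cc k" unfolding c_def using that(1) by (intro Min_le) auto
    moreover have "RR k \<le> R0" unfolding R0_def using that(1) by (intro Max_ge) auto
    ultimately have "c * norm \<Lambda> \<le> cc k * norm \<Lambda>" "norm \<Lambda> \<ge> RR k" using that(2) by (auto intro: mult_right_mono)
    then show ?thesis using cR(3)[OF that(1), of \<Lambda>] by linarith
  qed
  \<comment> \<open>The gradient to be truncated is \<open>G - A\<close>; enlarging the radius by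
    \<open>norm A\<close> bounds its excess by that of \<open>G\<close> over
    \<open>R0\<close>.\<close>
  define R where "R = R0 + norm A"
  have R: "R \<ge> 0" using R0 by (simp add: R_def)
  show ?thesis
  proof (rule exI[of _ "C * (R + 1)"], intro allI impI)
    fix \<theta> :: real assume \<theta>: "\<theta> > 0"
    have th2: "\<theta> / 2 > 0" using \<theta> by simp
    have "\<exists>c>0. \<forall>x. infdist x (W k -` {0}) \<ge> \<theta> / 2 \<longrightarrow> c \<le> W k x" if "k \<in> {1..n}" for k
      by (rule bounded_below_off_zero_set[OF Wc[OF that] W0[OF that] WZ[OF that] Wg[OF that] p th2])
    then obtain b where b: "\<And>k. k \<in> {1..n} \<Longrightarrow> b k > 0" "\<And>k \<Lambda>. k \<in> {1..n} \<Longrightarrow> infdist \<Lambda> (W k -` {0}) \<ge> \<theta> / 2 \<Longrightarrow> b k \<le> W k \<Lambda>" by metis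
    define c\<theta> where "c\<theta> = Min (b ` {1..n})"
    have c\<theta>: "c\<theta> > 0" using b(1) n by (simp add: c\<theta>_def)
    have low\<theta>: "c\<theta> \<le> W k \<Lambda>" if "k \<in> {1..n}" "infdist \<Lambda> (W k -` {0}) \<ge> \<theta> / 2" for k \<Lambda>
    proof -
      have "c\<theta> \<le> b k" unfolding c\<theta>_def using that(1) by (intro Min_le) auto
      then show ?thesis using b(2)[OF that] by linarith
    qed
    \<comment> \<open>The measure \<open>\<theta>\<close> is split in four: the layer outside
      \<open>K\<close>, the part \<open>T * m\<close> of the truncation bound, its error term, and
      the set where the gradient of \<open>v\<close> is far from the zero sets.\<close>
    have th4: "\<theta> / 4 > 0" using \<theta> by simp
    obtain K where K: "compact K" "K \<subseteq> \<Omega>" "emeasure lborel (\<Omega> - K) \<le> ennreal (\<theta> / 4)"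
      using compact_inner_approximation[OF \<Omega> th4] by blast
    obtain \<phi> :: "real^'d \<Rightarrow> real" where \<phi>: "test_function \<Omega> \<phi>" "\<forall>x. 0 \<le> \<phi> x \<and> \<phi> x \<le> 1" "\<forall>x\<in>K. \<phi> x = 1"
      using ex_cutoff[OF \<Omega>(1) K(1,2)] by blast
    obtain B1 where B1: "B1 > 0" "\<And>x v. \<bar>frechet_derivative \<phi> (at x) v\<bar> \<le> B1 * norm v" using test_function_deriv_bound[OF \<phi>(1)] by blast
    have B1': "\<bar>pdiff j \<phi> x\<bar> \<le> B1" for j x using B1(2)[of x "axis j 1"] by (simp add: norm_axis_1)
    \<comment> \<open>Coefficient of \<open>m\<close> in the measure bound of the truncation at
      height \<open>\<tau> = \<theta>\<close>.\<close>
    define T where "T = 5 ^ CARD('d) + real CARD('s) / \<theta>"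
    have T: "T > 0" using \<theta> unfolding T_def by (intro add_pos_pos divide_pos_pos) auto
    define Y where "Y = \<theta> / 4 / T"
    have Y: "Y > 0" using T \<theta> by (simp add: Y_def)
    \<comment> \<open>The derivative of the cutoff contributes
      \<open>CARD('d) * B1 * CARD('s)\<close> times the \<open>L^1\<close> bound of the components;
      the summand 1 makes \<open>Q\<close> at least 1, so that \<open>m\<close> also bounds the
      components themselves.\<close>
    define Q where "Q = real CARD('d) * B1 * real CARD('s) + 1"
    have Q: "Q > 0" using B1(1) by (simp add: Q_def add_pos_nonneg)
    define mO where "mO = measure lebesgue \<Omega>"
    have mO: "mO \<ge> 0" by (simp add: mO_def)
    \<comment> \<open>\<open>t\<close> is fixed first, to make \<open>Q * t * mO\<close> at most
      \<open>Y / 2\<close>; only then is \<open>\<kappa>\<close> chosen so small that the remaining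
      terms, \<open>D * \<kappa>\<close>, fit into the other half of \<open>Y\<close>.\<close>
    define t where "t = Y / (2 * Q * (mO + 1))"
    have t: "t > 0" using Y Q mO unfolding t_def by (intro divide_pos_pos mult_pos_pos) auto
    define D where "D = 1 / c + Q * t powr (1 - p)"
    have D: "D > 0" using c Q t unfolding D_def by (intro add_pos_nonneg) auto
    define \<kappa> where "\<kappa> = min (c\<theta> * (\<theta> / 4)) (Y / 2 / D)"
    have \<kappa>: "\<kappa> > 0" using c\<theta> \<theta> Y D by (simp add: \<kappa>_def)
    define m where "m = \<kappa> / c + Q * (t * mO + t powr (1 - p) * \<kappa>)"
    have m0: "m \<ge> 0" using \<kappa> c Q t mO unfolding m_def by (intro add_nonneg_nonneg mult_nonneg_nonneg divide_nonneg_nonneg) auto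
    have "m \<le> Y"
    proof -
      have "m = D * \<kappa> + Q * t * mO" by (simp add: m_def D_def algebra_simps)
      moreover have "D * \<kappa> \<le> D * (Y / 2 / D)" using D by (intro mult_left_mono) (auto simp: \<kappa>_def)
      moreover have "D * (Y / 2 / D) = Y / 2" using D by simp
      moreover have "Q * t * mO \<le> Q * t * (mO + 1)" using Q t by (intro mult_left_mono) auto
      moreover have "Q * t * (mO + 1) = Y / 2" using Q mO by (simp add: t_def divide_simps)
      ultimately show ?thesis by linarith
    qed
    then have mT: "T * m \<le> \<theta> / 4" using T by (simp add: Y_def field_simps)
    show "\<exists>\<kappa>>0. \<forall>\<epsilon>>0. \<forall>v\<in>W1p \<Omega> p.
    (\<integral>\<^sup>+x\<in>\<Omega>. ennreal (\<Sum>k\<in>{1..n}. indicator (P k) (frac_vec (x /\<^sub>R \<epsilon>)) * W k (weak_grad \<Omega> v x)) \<partial>lebesgue) \<le> ennreal \<kappa> \<longrightarrow>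
    (LINT x:\<Omega>|lebesgue. norm (v x - A *v x) powr p) \<le> \<kappa> \<longrightarrow>
    (\<exists>u :: real^'d \<Rightarrow> real^'s. (\<forall>i k. Ck k (\<lambda>x. u x $ i)) \<and> (\<forall>x i. \<bar>(u x - A *v x) $ i\<bar> \<le> \<theta>) \<and>
      (\<forall>x\<in>\<Omega>. \<forall>i j. \<bar>pdiff j (\<lambda>x. u x $ i) x - A $ i $ j\<bar> \<le> C * (R + 1)) \<and>
      emeasure lebesgue {x \<in> \<Omega>. \<bar>(\<Sum>k\<in>{1..n}. indicator (P k) (frac_vec (x /\<^sub>R \<epsilon>)) * infdist (\<chi> i j. pdiff j (\<lambda>x. u x $ i) x) (W k -` {0})) - 0\<bar> > \<theta>} \<le> ennreal \<theta>)"
    proof (intro exI[of _ \<kappa>] conjI \<kappa> allI ballI impI)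
      fix \<epsilon> :: real and v :: "real^'d \<Rightarrow> real^'s"
      assume \<epsilon>: "\<epsilon> > 0" and v: "v \<in> W1p \<Omega> p"
        and en: "(\<integral>\<^sup>+x\<in>\<Omega>. ennreal (\<Sum>k\<in>{1..n}. indicator (P k) (frac_vec (x /\<^sub>R \<epsilon>)) * W k (weak_grad \<Omega> v x)) \<partial>lebesgue) \<le> ennreal \<kappa>"
        and Lpv: "(LINT x:\<Omega>|lebesgue. norm (v x - A *v x) powr p) \<le> \<kappa>"
      define G where "G = weak_grad \<Omega> v"
      obtain G' where G': "G' \<in> Lp \<Omega> p" "has_weak_gradient \<Omega> v G'" and vLp: "v \<in> Lp \<Omega> p" using v unfolding W1p_def by blast
      have Gv: "has_weak_gradient \<Omega> v G" and GG': "AE x in lebesgue. x \<in> \<Omega> \<longrightarrow> G x = G' x"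
        unfolding G_def using weak_grad_AE_eq[OF \<Omega>(1) G'(2)] by auto
      have p1: "p \<ge> 1" "p > 0" using p by auto
      have ALp: "(\<lambda>x. A *v x) \<in> Lp \<Omega> p" by (rule energy_linear(1)[OF \<Omega> p1(2)])
      have dLp: "(\<lambda>x. v x - A *v x) \<in> Lp \<Omega> p" by (rule Lp_diff[OF vLp ALp p1(2)])
      have cLp: "(\<lambda>x::real^'d. A) \<in> Lp \<Omega> p"
      proof (rule bounded_Lp[OF \<Omega> _ _ p1(2)])
        show "set_borel_measurable lebesgue \<Omega> (\<lambda>x::real^'d. A)" by (rule locally_integrable_measurable[OF \<Omega>(1) has_weak_gradientD(2)[OF linear_map_weak_gradient[OF \<Omega>(1)]]])
        show "AE x in lebesgue. x \<in> \<Omega> \<longrightarrow> norm A \<le> norm A" by simp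
      qed
      have V: "has_weak_gradient \<Omega> (\<lambda>x. v x - A *v x) (\<lambda>x. G x - A)"
        by (rule has_weak_gradient_diff[OF Gv linear_map_weak_gradient[OF \<Omega>(1)]])
      note LV = has_weak_gradientD(1,2)[OF V]
      have Gm: "set_borel_measurable lebesgue \<Omega> G" by (rule locally_integrable_measurable[OF \<Omega>(1) has_weak_gradientD(2)[OF Gv]])
      have si1: "set_integrable lebesgue \<Omega> (\<lambda>x. (v x - A *v x) $ i)" for i
      proof -
        have "integrable lebesgue (\<lambda>x. indicator \<Omega> x *\<^sub>R (v x - A *v x))"
          using Lp_imp_integrable[OF \<Omega> dLp p1(1)] by (simp add: set_integrable_def)
        from integrable_bounded_linear[OF bounded_linear_vec_nth this, of i] show ?thesis by (simp add: set_integrable_def)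
      qed
      have si2: "set_integrable lebesgue \<Omega> (\<lambda>x. (G x - A) $ i $ j)" for i j
      proof -
        have "integrable lebesgue (\<lambda>x. indicator \<Omega> x *\<^sub>R (G' x - A))"
          using Lp_imp_integrable[OF \<Omega> Lp_diff[OF G'(1) cLp p1(2)] p1(1)] by (simp add: set_integrable_def)
        from integrable_bounded_linear[OF bounded_linear_vec_nth integrable_bounded_linear[OF bounded_linear_vec_nth this, of i], of j]
        have i0: "integrable lebesgue (\<lambda>x. indicator \<Omega> x * (G' x - A) $ i $ j)" by simp
        have "integrable lebesgue (\<lambda>x. indicator \<Omega> x * (G x - A) $ i $ j)"
        proof (rule integrable_cong_AE_imp[OF i0])
          show "(\<lambda>x. indicator \<Omega> x * (G x - A) $ i $ j) \<in> borel_measurable lebesgue"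
            using locally_integrable_measurable[OF \<Omega>(1) locally_integrable_component2[OF LV(2)], of i j] by (simp add: set_borel_measurable_def)
          show "AE x in lebesgue. indicator \<Omega> x * (G' x - A) $ i $ j = indicator \<Omega> x * (G x - A) $ i $ j"
            using GG' by eventually_elim (auto split: split_indicator)
        qed
        then show ?thesis by (simp add: set_integrable_def)
      qed
      define z where "z i = (SOME z. integrable_rep \<Omega> (\<lambda>x. (v x - A *v x) $ i) z)" for i
      have zz: "integrable_rep \<Omega> (\<lambda>x. (v x - A *v x) $ i) (z i)" for i
        unfolding z_def by (rule someI_ex[OF ex_integrable_rep[OF si1 Om]])
      note z = integrable_repD[OF zz]
      define g where "g i j = (SOME z. integrable_rep \<Omega> (\<lambda>x. (G x - A) $ i $ j) z)" for i j
      have gg: "integrable_rep \<Omega> (\<lambda>x. (G x - A) $ i $ j) (g i j)" for i j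
        unfolding g_def by (rule someI_ex[OF ex_integrable_rep[OF si2 Om]])
      note g = integrable_repD[OF gg]
      have zm[measurable]: "z i \<in> borel_measurable borel" for i using z(1)[of i] by auto
      have gm[measurable]: "g i j \<in> borel_measurable borel" for i j using g(1)[of i j] by auto
      have wp: "weak_pdiff \<Omega> j (z i) (g i j)" for i j
        by (rule weak_pdiff_borel_rep[OF \<Omega>(1) V zm z(3) gm g(3)])
      have zL1: "(LINT x|lborel. \<bar>z i x\<bar>) \<le> t * mO + t powr (1 - p) * \<kappa>" for i
      proof -
        have "(LINT x:\<Omega>|lebesgue. \<bar>(v x - A *v x) $ i\<bar> * 1) = (LINT x|lborel. \<bar>z i x\<bar> * 1)"
        proof (rule set_integral_borel_rep)
          have "(\<lambda>x. indicator \<Omega> x * (v x - A *v x) $ i) \<in> borel_measurable lebesgue" using si1[of i] by (auto simp: set_integrable_def)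
          then have "(\<lambda>x. \<bar>indicator \<Omega> x * (v x - A *v x) $ i\<bar>) \<in> borel_measurable lebesgue" by (rule borel_measurable_abs)
          then show "(\<lambda>x. indicator \<Omega> x * \<bar>(v x - A *v x) $ i\<bar>) \<in> borel_measurable lebesgue" by (simp add: abs_mult)
          show "AE x in lborel. indicator \<Omega> x * \<bar>(v x - A *v x) $ i\<bar> = \<bar>z i x\<bar>"
            using z(3)[of i] by eventually_elim (auto split: split_indicator)
        qed auto
        then show ?thesis using L1_le_Lp[OF \<Omega> dLp p t Lpv, of i] by (simp add: mO_def)
      qed
      define \<zeta> where "\<zeta> i x = \<phi> x * z i x" for i x
      define H where "H i j x = \<phi> x * g i j x + pdiff j \<phi> x * z i x" for i j x
      have \<zeta>i: "integrable lborel (\<zeta> i)" for i unfolding \<zeta>_def by (rule test_times_integrable[OF \<phi>(1) z(1)])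
      have Hi: "integrable lborel (H i j)" for i j unfolding H_def
        by (intro Bochner_Integration.integrable_add test_times_integrable[OF \<phi>(1) g(1)] test_times_integrable[OF test_function_frechet_derivative[OF \<phi>(1)] z(1)])
      have Hw: "weak_pdiff UNIV j (\<zeta> i) (H i j)" for i j unfolding \<zeta>_def[abs_def] H_def[abs_def]
        by (rule weak_pdiff_cutoff[OF wp z(1) g(1) \<phi>(1)])
      define Z where "Z x = real CARD('d) * B1 * (\<Sum>i\<in>UNIV. \<bar>z i x\<bar>)" for x
      have Zi: "integrable lborel Z" unfolding Z_def using z(1) by (intro integrable_mult_right Bochner_Integration.integrable_sum integrable_abs)
      have Z0: "Z x \<ge> 0" for x unfolding Z_def using B1(1) by (intro mult_nonneg_nonneg sum_nonneg) auto
      have ZL: "(LINT x|lborel. Z x) \<le> (real CARD('d) * B1 * real CARD('s)) * (t * mO + t powr (1 - p) * \<kappa>)"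
      proof -
        have "(LINT x|lborel. Z x) = real CARD('d) * B1 * (\<Sum>i\<in>UNIV. LINT x|lborel. \<bar>z i x\<bar>)"
          unfolding Z_def using z(1) by (simp add: Bochner_Integration.integral_sum)
        also have "\<dots> \<le> real CARD('d) * B1 * (\<Sum>i\<in>(UNIV::'s set). t * mO + t powr (1 - p) * \<kappa>)"
          using B1(1) by (intro mult_left_mono sum_mono zL1) auto
        finally show ?thesis by (simp add: mult_ac)
      qed
      define F where "F x = max 0 (norm (\<chi> i j. g i j x) - R)" for x
      have Fm: "F \<in> borel_measurable lborel"
      proof -
        have "(\<lambda>x. norm (\<chi> i j. g i j x)) = (\<lambda>x. sqrt (\<Sum>i\<in>UNIV. (sqrt (\<Sum>j\<in>UNIV. (g i j x)\<^sup>2))\<^sup>2))"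
          by (simp add: norm_vec_def L2_set_def)
        then have "(\<lambda>x. norm (\<chi> i j. g i j x)) \<in> borel_measurable borel" by simp
        then show ?thesis unfolding F_def by simp
      qed
      have gAE: "AE x in lebesgue. x \<in> \<Omega> \<longrightarrow> (\<chi> i j. g i j x) = G x - A"
      proof -
        have "AE x in lborel. \<forall>i j. indicator \<Omega> x * (G x - A) $ i $ j = g i j x" by (intro AE_all_countable[THEN iffD2] allI g(3))
        from AE_completion[OF this] show ?thesis by eventually_elim (auto simp: vec_eq_iff)
      qed
      have Fb: "(\<integral>\<^sup>+x. ennreal (F x) \<partial>lborel) \<le> ennreal (\<kappa> / c)"
      proof (rule low_energy_excess[OF P Fm _ _ _ en low c])
        show "F x \<ge> 0" for x by (simp add: F_def)
        show "F x = 0" if "x \<notin> \<Omega>" for x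
        proof -
          have "(\<chi> i j. g i j x) = 0" using g(2)[OF that] by (simp add: vec_eq_iff)
          then show ?thesis using R by (simp add: F_def)
        qed
        show "AE x in lebesgue. x \<in> \<Omega> \<longrightarrow> F x \<le> max 0 (norm (weak_grad \<Omega> v x) - R0)"
          using gAE
        proof (eventually_elim, intro impI)
          fix x assume *: "x \<in> \<Omega> \<longrightarrow> (\<chi> i j. g i j x) = G x - A" "x \<in> \<Omega>"
          have "norm (G x - A) \<le> norm (G x) + norm A" by (rule norm_triangle_ineq4)
          then show "F x \<le> max 0 (norm (weak_grad \<Omega> v x) - R0)" using * by (auto simp: F_def R_def G_def max_def)
        qed
        show "R0 \<ge> 0" using R0 by simp
      qed
      \<comment> \<open>The cutoff is at most 1, so it cannot increase the excess of
        \<open>g\<close>; the term with its derivative is bounded by \<open>Z\<close>.\<close>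
      have NH: "max 0 (norm (\<chi> i j. H i j x) - R) \<le> F x + Z x" for x
      proof -
        have eq: "(\<chi> i j. H i j x) = \<phi> x *\<^sub>R (\<chi> i j. g i j x) + (\<chi> i j. pdiff j \<phi> x * z i x)" by (simp add: vec_eq_iff H_def)
        have "norm (\<chi> i j. pdiff j \<phi> x * z i x) \<le> (\<Sum>i\<in>(UNIV::'s set). \<Sum>j\<in>(UNIV::'d set). \<bar>pdiff j \<phi> x * z i x\<bar>)"
          using norm_matrix_le_sum[of "\<chi> i j. pdiff j \<phi> x * z i x"] by simp
        also have "\<dots> \<le> (\<Sum>i\<in>(UNIV::'s set). \<Sum>j\<in>(UNIV::'d set). B1 * \<bar>z i x\<bar>)"
          unfolding abs_mult by (intro sum_mono mult_right_mono B1') auto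
        also have "\<dots> = Z x" by (simp add: Z_def sum_distrib_left mult_ac)
        finally have 1: "norm (\<chi> i j. pdiff j \<phi> x * z i x) \<le> Z x" .
        have "norm (\<phi> x *\<^sub>R (\<chi> i j. g i j x)) \<le> 1 * norm (\<chi> i j. g i j x)"
          unfolding norm_scaleR using \<phi>(2) by (intro mult_right_mono) auto
        then have "norm (\<chi> i j. H i j x) \<le> norm (\<chi> i j. g i j x) + Z x"
          unfolding eq using 1 by (intro order_trans[OF norm_triangle_ineq] add_mono) auto
        then show ?thesis using Z0[of x] by (auto simp: F_def)
      qed
      have m1: "(\<integral>\<^sup>+x. ennreal (max 0 (norm (\<chi> i j. H i j x) - R)) \<partial>lborel) \<le> ennreal m"
      proof -
        have "(\<integral>\<^sup>+x. ennreal (max 0 (norm (\<chi> i j. H i j x) - R)) \<partial>lborel) \<le> (\<integral>\<^sup>+x. ennreal (F x) + ennreal (Z x) \<partial>lborel)"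
          using NH Z0 by (intro nn_integral_mono) (subst ennreal_plus[symmetric], auto intro: ennreal_leI simp: F_def simp del: ennreal_plus)
        also have "\<dots> = (\<integral>\<^sup>+x. ennreal (F x) \<partial>lborel) + (\<integral>\<^sup>+x. ennreal (Z x) \<partial>lborel)"
          using Fm Zi by (intro nn_integral_add) auto
        also have "\<dots> \<le> ennreal (\<kappa> / c) + ennreal ((real CARD('d) * B1 * real CARD('s)) * (t * mO + t powr (1 - p) * \<kappa>))"
          using Zi Z0 ZL by (intro add_mono Fb) (auto simp: nn_integral_eq_integral intro: ennreal_leI)
        also have "\<dots> = ennreal (\<kappa> / c + (real CARD('d) * B1 * real CARD('s)) * (t * mO + t powr (1 - p) * \<kappa>))"
          using \<kappa> c B1(1) t mO by (intro ennreal_plus[symmetric]) (auto intro!: add_nonneg_nonneg mult_nonneg_nonneg)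
        also have "\<dots> \<le> ennreal m"
          unfolding m_def Q_def using t mO \<kappa> by (intro ennreal_leI add_left_mono mult_right_mono add_nonneg_nonneg mult_nonneg_nonneg) auto
        finally show ?thesis .
      qed
      have m2: "(LINT x|lborel. \<bar>\<zeta> i x\<bar>) \<le> m" for i
      proof -
        have "(LINT x|lborel. \<bar>\<zeta> i x\<bar>) \<le> (LINT x|lborel. \<bar>z i x\<bar>)"
        proof (intro integral_mono integrable_abs \<zeta>i z(1))
          show "\<bar>\<zeta> i x\<bar> \<le> \<bar>z i x\<bar>" for x using \<phi>(2) mult_right_mono[of "\<bar>\<phi> x\<bar>" 1 "\<bar>z i x\<bar>"] by (simp add: \<zeta>_def abs_mult)
        qed
        also have "\<dots> \<le> t * mO + t powr (1 - p) * \<kappa>" by (rule zL1)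
        also have "\<dots> \<le> Q * (t * mO + t powr (1 - p) * \<kappa>)"
        proof -
          have "Q \<ge> 1" unfolding Q_def using B1(1) by simp
          then show ?thesis using t mO \<kappa> mult_right_mono[of 1 Q "t * mO + t powr (1 - p) * \<kappa>"] by simp
        qed
        also have "\<dots> \<le> m" using \<kappa> c by (simp add: m_def)
        finally show ?thesis .
      qed
      define SD where "SD = real CARD('s) * real CARD('d)"
      have SD: "SD > 0" by (simp add: SD_def)
      \<comment> \<open>Entries differing by at most \<open>\<theta>'\<close> give matrices at
        distance at most \<open>\<theta> / 2\<close>; the other half of \<open>\<theta>\<close> is
        the distance of \<open>G x\<close> from the zero set.\<close>
      define \<theta>' where "\<theta>' = \<theta> / (2 * SD)"
      have \<theta>': "\<theta>' > 0" using \<theta> SD by (simp add: \<theta>'_def)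
      have "\<exists>u. (\<forall>i k. Ck k (u i)) \<and> (\<forall>i x. \<bar>u i x\<bar> \<le> \<theta>) \<and> (\<forall>x\<in>\<Omega>. \<forall>i j. \<bar>pdiff j (u i) x\<bar> \<le> C * (R + 1)) \<and>
       emeasure lborel {x \<in> \<Omega>. \<exists>i j. \<bar>pdiff j (u i) x - H i j x\<bar> > \<theta>'} \<le> ennreal (5 ^ CARD('d) * m + real CARD('s) * m / \<theta> + \<theta> / 4)"
        by (rule trunc[rule_format, where \<zeta>=\<zeta>]) (use \<zeta>i Hi Hw \<Omega> Om R \<theta> th4 m0 \<theta>' m1 m2 in \<open>simp_all\<close>)
      then obtain w where w: "\<And>i k. Ck k (w i)" "\<And>i x. \<bar>w i x\<bar> \<le> \<theta>" "\<And>x i j. x \<in> \<Omega> \<Longrightarrow> \<bar>pdiff j (w i) x\<bar> \<le> C * (R + 1)"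
       "emeasure lborel {x \<in> \<Omega>. \<exists>i j. \<bar>pdiff j (w i) x - H i j x\<bar> > \<theta>'} \<le> ennreal (5 ^ CARD('d) * m + real CARD('s) * m / \<theta> + \<theta> / 4)" by blast
      define u where "u x = A *v x + (\<chi> i. w i x)" for x
      have ui: "(\<lambda>x. u x $ i) = (\<lambda>x. (A *v x) $ i + w i x)" for i by (simp add: u_def)
      have uk: "Ck k (\<lambda>x. u x $ i)" for i k unfolding ui by (intro Ck_add linear_component(1) w(1))
      have Du: "pdiff j (\<lambda>x. u x $ i) x = A $ i $ j + pdiff j (w i) x" for i j x
        unfolding ui using fun_cong[OF frechet_derivative_at[OF has_derivative_add[OF smooth_has_derivative[OF linear_component(1)[where A=A and i=i], where x=x] smooth_has_derivative[OF w(1), where x=x]]], of "axis j 1"]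
          by (simp add: linear_component(2))
      have pm[measurable]: "pdiff j (w i) \<in> borel_measurable borel" for i j
        using smooth_frechet_derivative[OF w(1), of 0 i] by (simp add: borel_measurable_continuous_onI)
      have Hm[measurable]: "H i j \<in> borel_measurable borel" for i j using Hi[of i j] by auto
      define S1 where "S1 = {x \<in> \<Omega>. \<exists>i j. \<bar>pdiff j (w i) x - H i j x\<bar> > \<theta>'}"
      have S1m: "S1 \<in> sets borel" unfolding S1_def by measurable
      define S3 where "S3 = {x \<in> \<Omega>. \<bar>(\<Sum>k\<in>{1..n}. indicator (P k) (frac_vec (x /\<^sub>R \<epsilon>)) * infdist (G x) (W k -` {0})) - 0\<bar> > \<theta> / 2}"
      have S3m: "S3 \<in> sets lebesgue" unfolding S3_def by (rule dist_level_set_measurable[OF \<Omega>(1) P \<epsilon> Gm])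
      have S3b: "emeasure lebesgue S3 \<le> ennreal (\<theta> / 4)"
      proof -
        have "emeasure lebesgue S3 \<le> ennreal (\<kappa> / c\<theta>)" unfolding S3_def
          by (rule dist_level_set_le[OF \<Omega>(1) P \<epsilon> Gm en[folded G_def] low\<theta> c\<theta>])
        also have "\<dots> \<le> ennreal (\<theta> / 4)" using c\<theta> by (intro ennreal_leI) (auto simp: \<kappa>_def field_simps min_le_iff_disj)
        finally show ?thesis .
      qed
      let ?D = "{x \<in> \<Omega>. \<bar>(\<Sum>k\<in>{1..n}. indicator (P k) (frac_vec (x /\<^sub>R \<epsilon>)) * infdist (\<chi> i j. pdiff j (\<lambda>x. u x $ i) x) (W k -` {0})) - 0\<bar> > \<theta>}"
      have OKm: "\<Omega> - K \<in> sets borel" using Om K(1) by (simp add: compact_imp_closed)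
      have OKl: "\<Omega> - K \<in> sets lebesgue" and S1l: "S1 \<in> sets lebesgue" using OKm S1m by (auto intro: sets_completionI_sets)
      \<comment> \<open>Inclusion only almost everywhere, because \<open>g\<close> agrees with
        \<open>G - A\<close> on \<open>\<Omega>\<close> only almost everywhere.\<close>
      have sub: "AE x in lebesgue. x \<in> ?D \<longrightarrow> x \<in> (\<Omega> - K) \<union> (S1 \<union> S3)"
        using gAE
      proof (eventually_elim, intro impI)
        fix x assume gx: "x \<in> \<Omega> \<longrightarrow> (\<chi> i j. g i j x) = G x - A" and x: "x \<in> ?D"
        show "x \<in> (\<Omega> - K) \<union> (S1 \<union> S3)"
        proof (rule ccontr)
        assume nx: "x \<notin> (\<Omega> - K) \<union> (S1 \<union> S3)"
        have xO: "x \<in> \<Omega>" and xK: "x \<in> K" using x nx by auto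
        obtain k where k: "k \<in> {1..n}" "frac_vec (x /\<^sub>R \<epsilon>) \<in> P k" "\<And>g :: nat \<Rightarrow> real. (\<Sum>k\<in>{1..n}. indicator (P k) (frac_vec (x /\<^sub>R \<epsilon>)) * g k) = g k"
          using partition_sum[OF P, of "x /\<^sub>R \<epsilon>"] by blast
        let ?U = "\<chi> i j. pdiff j (\<lambda>x. u x $ i) x"
        have 1: "infdist ?U (W k -` {0}) > \<theta>" using x k(3) by (simp add: infdist_nonneg)
        have "x \<notin> S3" using nx by simp
        then have 2: "infdist (G x) (W k -` {0}) \<le> \<theta> / 2" using xO k(3) by (simp add: S3_def infdist_nonneg)
        \<comment> \<open>On \<open>K\<close> the cutoff equals 1 and has zero derivative, so the
          cutoff leaves the gradient unchanged there.\<close>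
        have Hx: "H i j x = g i j x" for i j
          using \<phi>(3) xK cutoff_pdiff_zero[OF \<phi>(1) _ , of x j] \<phi>(2) by (simp add: H_def)
        have "dist ?U (G x) = norm (?U - G x)" by (rule dist_norm)
        also have "?U - G x = (\<chi> i j. pdiff j (w i) x - H i j x)"
        proof -
          have "G x = A + (\<chi> i j. g i j x)" using gx xO by simp
          then show ?thesis by (simp add: vec_eq_iff Du Hx)
        qed
        also have "norm (\<chi> i j. pdiff j (w i) x - H i j x) \<le> (\<Sum>i\<in>(UNIV::'s set). \<Sum>j\<in>(UNIV::'d set). \<bar>pdiff j (w i) x - H i j x\<bar>)"
          using norm_matrix_le_sum[of "\<chi> i j. pdiff j (w i) x - H i j x"] by simp
        also have "\<dots> \<le> (\<Sum>i\<in>(UNIV::'s set). \<Sum>j\<in>(UNIV::'d set). \<theta>')"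
        proof (intro sum_mono)
          have "x \<notin> S1" using nx by simp
          then show "\<bar>pdiff j (w i) x - H i j x\<bar> \<le> \<theta>'" for i j using xO unfolding S1_def by (auto simp: not_less)
        qed
        also have "\<dots> = SD * \<theta>'" by (simp add: SD_def)
        also have "\<dots> = \<theta> / 2" using SD by (simp add: \<theta>'_def)
        finally have 3: "dist ?U (G x) \<le> \<theta> / 2" .
        show False using 1 2 3 infdist_triangle[of ?U "W k -` {0}" "G x"] by linarith
        qed
      qed
      have L: "emeasure lebesgue X = emeasure lborel X" if "X \<in> sets borel" for X :: "(real^'d) set" using that by simp
      have "emeasure lebesgue ?D \<le> emeasure lebesgue ((\<Omega> - K) \<union> (S1 \<union> S3))"
        using OKl S1l S3m by (intro emeasure_mono_AE[OF sub] sets.Un)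
      also have "\<dots> \<le> emeasure lebesgue (\<Omega> - K) + (emeasure lebesgue S1 + emeasure lebesgue S3)"
        using OKl S1l S3m by (intro order_trans[OF emeasure_subadditive] add_left_mono emeasure_subadditive sets.Un order_refl)
      also have "\<dots> \<le> ennreal (\<theta> / 4) + (ennreal (5 ^ CARD('d) * m + real CARD('s) * m / \<theta> + \<theta> / 4) + ennreal (\<theta> / 4))"
        unfolding L[OF OKm] L[OF S1m] by (intro add_mono K(3) S3b w(4)[folded S1_def])
      also have "\<dots> = ennreal (\<theta> / 4 + ((5 ^ CARD('d) * m + real CARD('s) * m / \<theta> + \<theta> / 4) + \<theta> / 4))"
      proof -
        have a: "0 \<le> \<theta> / 4" "0 \<le> 5 ^ CARD('d) * m + real CARD('s) * m / \<theta> + \<theta> / 4" using \<theta> m0 by auto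
        show ?thesis by (simp only: ennreal_plus[OF a(1) add_nonneg_nonneg[OF a(2) a(1)]] ennreal_plus[OF a(2) a(1)])
      qed
      also have "\<dots> \<le> ennreal \<theta>"
      proof (rule ennreal_leI)
        have "5 ^ CARD('d) * m + real CARD('s) * m / \<theta> = T * m" by (simp add: T_def distrib_right)
        then show "\<theta> / 4 + ((5 ^ CARD('d) * m + real CARD('s) * m / \<theta> + \<theta> / 4) + \<theta> / 4) \<le> \<theta>" using mT by linarith
      qed
      finally have Db: "emeasure lebesgue ?D \<le> ennreal \<theta>" .
      show "\<exists>u :: real^'d \<Rightarrow> real^'s. (\<forall>i k. Ck k (\<lambda>x. u x $ i)) \<and> (\<forall>x i. \<bar>(u x - A *v x) $ i\<bar> \<le> \<theta>) \<and>
      (\<forall>x\<in>\<Omega>. \<forall>i j. \<bar>pdiff j (\<lambda>x. u x $ i) x - A $ i $ j\<bar> \<le> C * (R + 1)) \<and>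
      emeasure lebesgue {x \<in> \<Omega>. \<bar>(\<Sum>k\<in>{1..n}. indicator (P k) (frac_vec (x /\<^sub>R \<epsilon>)) * infdist (\<chi> i j. pdiff j (\<lambda>x. u x $ i) x) (W k -` {0})) - 0\<bar> > \<theta>} \<le> ennreal \<theta>"
      proof (intro exI[of _ u] conjI allI ballI)
        show "Ck k (\<lambda>x. u x $ i)" for i k by (rule uk)
        show "\<bar>(u x - A *v x) $ i\<bar> \<le> \<theta>" for x i using w(2)[of i x] by (simp add: u_def)
        show "\<bar>pdiff j (\<lambda>x. u x $ i) x - A $ i $ j\<bar> \<le> C * (R + 1)" if "x \<in> \<Omega>" for x i j using w(3)[OF that] by (simp add: Du)
      qed (rule Db)
    qed
  qed
qed


subsection \<open>The zero set is contained in the homogenized set\<close>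

text \<open>\<open>\<mu> h\<close> is the largest level up to \<open>h\<close> that can be attained
  at \<open>h\<close>. The cap \<open>h\<close> makes the maximum exist, and level 0, always
  attainable, makes the set nonempty; every fixed level is eventually reached.\<close>

lemma diagonal_choice:
  fixes Q :: "nat \<Rightarrow> nat \<Rightarrow> 'a \<Rightarrow> bool"
  assumes ev: "\<And>m. \<forall>\<^sub>F h in sequentially. \<exists>u. Q m h u" and base: "\<And>h. \<exists>u. Q 0 h u"
  shows "\<exists>u \<mu>. (\<forall>h. Q (\<mu> h) h (u h)) \<and> filterlim \<mu> at_top sequentially"
proof -
  define \<mu> where "\<mu> h = Max {m. m \<le> h \<and> (\<exists>u. Q m h u)}" for h
  have fin: "finite {m. m \<le> h \<and> (\<exists>u. Q m h u)}" for h by simp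
  have "\<mu> h \<in> {m. m \<le> h \<and> (\<exists>u. Q m h u)}" for h
    unfolding \<mu>_def using base[of h] by (intro Max_in fin) blast
  then have "\<forall>h. \<exists>u. Q (\<mu> h) h u" by blast
  from choice[OF this] obtain u where u: "\<forall>h. Q (\<mu> h) h (u h)" by blast
  have lim: "filterlim \<mu> at_top sequentially"
    unfolding filterlim_at_top
  proof
    fix M :: nat
    show "\<forall>\<^sub>F h in sequentially. M \<le> \<mu> h"
      using ev[of M] eventually_ge_at_top[of M]
    proof eventually_elim
      case (elim h)
      then show ?case unfolding \<mu>_def by (intro Max_ge fin) auto
    qed
  qed
  show "\<exists>u \<mu>. (\<forall>h. Q (\<mu> h) h (u h)) \<and> filterlim \<mu> at_top sequentially" using u lim by blast
qed

lemma smooth_in_W1inf: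
  fixes u :: "real^'d \<Rightarrow> real^'s"
  assumes \<Omega>: "open \<Omega>" "bounded \<Omega>" and u: "\<And>i k. Ck k (\<lambda>x. u x $ i)" and b1: "\<And>x i. x \<in> \<Omega> \<Longrightarrow> \<bar>(u x - A *v x) $ i\<bar> \<le> B"
    and b2: "\<And>x i j. x \<in> \<Omega> \<Longrightarrow> \<bar>pdiff j (\<lambda>x. u x $ i) x - A $ i $ j\<bar> \<le> C"
  shows "u \<in> W1inf \<Omega>"
proof -
  let ?G = "\<lambda>x. \<chi> i j. pdiff j (\<lambda>x. u x $ i) x"
  have wg: "has_weak_gradient \<Omega> u ?G" by (rule smooth_has_weak_gradient[OF \<Omega>(1) u])
  have m: "set_borel_measurable lebesgue \<Omega> u" "set_borel_measurable lebesgue \<Omega> ?G"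
    by (rule locally_integrable_measurable[OF \<Omega>(1) has_weak_gradientD(1)[OF wg]], rule locally_integrable_measurable[OF \<Omega>(1) has_weak_gradientD(2)[OF wg]])
  obtain BA where BA: "AE x in lebesgue. x \<in> \<Omega> \<longrightarrow> norm ((0::real^'s) - A *v x) \<le> BA"
    using AE_bounded_minus_linear[OF \<Omega>(2), of "\<lambda>x. 0" 0 A] by auto
  have "AE x in lebesgue. x \<in> \<Omega> \<longrightarrow> norm (u x) \<le> BA + (\<Sum>i\<in>(UNIV::'s set). B)"
    using BA
  proof (eventually_elim, intro impI)
    fix x assume x: "x \<in> \<Omega> \<longrightarrow> norm ((0::real^'s) - A *v x) \<le> BA" "x \<in> \<Omega>"
    have "norm (u x) \<le> norm (A *v x) + norm (u x - A *v x)" by (rule norm_triangle_sub)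
    also have "norm (u x - A *v x) \<le> (\<Sum>i\<in>UNIV. \<bar>(u x - A *v x) $ i\<bar>)" by (rule norm_le_l1_cart)
    also have "\<dots> \<le> (\<Sum>i\<in>(UNIV::'s set). B)" by (intro sum_mono b1 x)
    finally show "norm (u x) \<le> BA + (\<Sum>i\<in>(UNIV::'s set). B)" using x by simp
  qed
  then have "u \<in> Linf \<Omega>" using m(1) unfolding Linf_def by blast
  moreover have "norm (?G x) \<le> norm A + (\<Sum>i\<in>(UNIV::'s set). \<Sum>j\<in>(UNIV::'d set). C)" if "x \<in> \<Omega>" for x
  proof -
    have "norm (?G x) \<le> norm A + norm (?G x - A)" by (rule norm_triangle_sub)
    also have "norm (?G x - A) \<le> (\<Sum>i\<in>UNIV. \<Sum>j\<in>UNIV. \<bar>(?G x - A) $ i $ j\<bar>)" by (rule norm_matrix_le_sum)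
    also have "\<dots> \<le> (\<Sum>i\<in>(UNIV::'s set). \<Sum>j\<in>(UNIV::'d set). C)" using b2[OF that] by (intro sum_mono) simp
    finally show ?thesis by simp
  qed
  then have "?G \<in> Linf \<Omega>" using m(2) unfolding Linf_def by (auto intro!: exI[of _ "norm A + (\<Sum>i\<in>(UNIV::'s set). \<Sum>j\<in>(UNIV::'d set). C)"])
  ultimately show ?thesis using wg unfolding W1inf_def by blast
qed

text \<open>Reduction to scalar tests: expand the test function in the basis and replace each
  coefficient by a Borel representative that vanishes off \<open>\<Omega>\<close>.\<close>

lemma weakstar_LinfI:
  fixes U :: "nat \<Rightarrow> 'a::euclidean_space \<Rightarrow> 'b::euclidean_space"
  assumes \<Omega>: "\<Omega> \<in> sets borel" and U: "\<And>h. set_borel_measurable lebesgue \<Omega> (U h)" "\<And>h. \<exists>B. AE x in lebesgue. x \<in> \<Omega> \<longrightarrow> norm (U h x) \<le> B"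
    and V: "set_borel_measurable lebesgue \<Omega> V" "\<exists>B. AE x in lebesgue. x \<in> \<Omega> \<longrightarrow> norm (V x) \<le> B"
    and lim: "\<And>b f. b \<in> Basis \<Longrightarrow> integrable lborel f \<Longrightarrow> (\<And>x. x \<notin> \<Omega> \<Longrightarrow> f x = 0) \<Longrightarrow> (\<lambda>h. LINT x:\<Omega>|lebesgue. ((U h x - V x) \<bullet> b) * f x) \<longlonglongrightarrow> 0"
  shows "weakstar_Linf \<Omega> U V"
  unfolding weakstar_Linf_def
proof (intro allI impI)
  fix g :: "'a \<Rightarrow> 'b" assume g: "set_integrable lebesgue \<Omega> g"
  have gb: "set_integrable lebesgue \<Omega> (\<lambda>x. g x \<bullet> b)" for b
  proof -
    have "integrable lebesgue (\<lambda>x. indicator \<Omega> x *\<^sub>R g x)" using g by (simp add: set_integrable_def)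
    from integrable_bounded_linear[OF bounded_linear_inner_left this, of b] show ?thesis by (simp add: set_integrable_def)
  qed
  define f where "f b = (SOME z. integrable_rep \<Omega> (\<lambda>x. g x \<bullet> b) z)" for b
  have ff: "integrable_rep \<Omega> (\<lambda>x. g x \<bullet> b) (f b)" for b unfolding f_def by (rule someI_ex[OF ex_integrable_rep[OF gb \<Omega>]])
  note f = integrable_repD[OF ff]
  have I: "set_integrable lebesgue \<Omega> (\<lambda>x. (X x \<bullet> b) * f b x)"
    if X: "set_borel_measurable lebesgue \<Omega> X" "\<exists>B. AE x in lebesgue. x \<in> \<Omega> \<longrightarrow> norm (X x) \<le> B" for X :: "'a \<Rightarrow> 'b" and b
  proof -
    obtain B where B: "AE x in lebesgue. x \<in> \<Omega> \<longrightarrow> norm (X x) \<le> B" using X(2) by blast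
    have "AE x in lebesgue. x \<in> \<Omega> \<longrightarrow> \<bar>X x \<bullet> b\<bar> \<le> B * norm b"
      using B by eventually_elim (meson Cauchy_Schwarz_ineq2 mult_right_mono norm_ge_zero order_trans)
    from bounded_times_set_integrable[OF set_borel_measurable_inner[OF X(1)] this f(1)] show ?thesis .
  qed
  have eq: "(LINT x:\<Omega>|lebesgue. X x \<bullet> g x) = (\<Sum>b\<in>Basis. LINT x:\<Omega>|lebesgue. (X x \<bullet> b) * f b x)"
    if X: "set_borel_measurable lebesgue \<Omega> X" "\<exists>B. AE x in lebesgue. x \<in> \<Omega> \<longrightarrow> norm (X x) \<le> B" for X :: "'a \<Rightarrow> 'b"
  proof -
    have Ib: "integrable lebesgue (\<lambda>x. indicator \<Omega> x *\<^sub>R ((X x \<bullet> b) * f b x))" for b using I[OF X] by (simp add: set_integrable_def)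
    have ae: "AE x in lebesgue. \<forall>b\<in>Basis. indicator \<Omega> x * (g x \<bullet> b) = f b x"
      by (rule AE_completion, rule AE_finite_allI[OF finite_Basis f(3)])
    have "(LINT x:\<Omega>|lebesgue. X x \<bullet> g x) = (LINT x|lebesgue. (\<Sum>b\<in>Basis. indicator \<Omega> x *\<^sub>R ((X x \<bullet> b) * f b x)))"
      unfolding set_lebesgue_integral_def
    proof (rule integral_cong_AE)
      have "(\<lambda>x. (indicator \<Omega> x *\<^sub>R X x) \<bullet> (indicator \<Omega> x *\<^sub>R g x)) \<in> borel_measurable lebesgue"
        using X(1) g unfolding set_borel_measurable_def set_integrable_def by (intro borel_measurable_inner) auto
      moreover have "(\<lambda>x. (indicator \<Omega> x *\<^sub>R X x) \<bullet> (indicator \<Omega> x *\<^sub>R g x)) = (\<lambda>x. indicator \<Omega> x *\<^sub>R (X x \<bullet> g x))"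
        by (intro ext) (auto split: split_indicator)
      ultimately show "(\<lambda>x. indicator \<Omega> x *\<^sub>R (X x \<bullet> g x)) \<in> borel_measurable lebesgue" by (simp only:)
      show "(\<lambda>x. \<Sum>b\<in>Basis. indicator \<Omega> x *\<^sub>R ((X x \<bullet> b) * f b x)) \<in> borel_measurable lebesgue"
        by (intro borel_measurable_sum borel_measurable_integrable Ib)
      show "AE x in lebesgue. indicator \<Omega> x *\<^sub>R (X x \<bullet> g x) = (\<Sum>b\<in>Basis. indicator \<Omega> x *\<^sub>R ((X x \<bullet> b) * f b x))"
        using ae
      proof eventually_elim
        case (elim x)
        show ?case
        proof (cases "x \<in> \<Omega>")
          case True
          have "X x \<bullet> g x = (\<Sum>b\<in>Basis. (X x \<bullet> b) * (g x \<bullet> b))" by (rule euclidean_inner)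
          also have "\<dots> = (\<Sum>b\<in>Basis. (X x \<bullet> b) * f b x)" using elim True by (intro sum.cong) auto
          finally show ?thesis using True by simp
        qed simp
      qed
    qed
    also have "\<dots> = (\<Sum>b\<in>Basis. LINT x:\<Omega>|lebesgue. (X x \<bullet> b) * f b x)"
      unfolding set_lebesgue_integral_def by (rule Bochner_Integration.integral_sum) (rule Ib)
    finally show ?thesis .
  qed
  have "(LINT x:\<Omega>|lebesgue. U h x \<bullet> g x) = (LINT x:\<Omega>|lebesgue. V x \<bullet> g x) + (\<Sum>b\<in>Basis. LINT x:\<Omega>|lebesgue. ((U h x - V x) \<bullet> b) * f b x)" for h
    unfolding eq[OF U] eq[OF V] using set_integral_diff(2)[OF I[OF U] I[OF V], of h]
    by (simp add: inner_diff_left left_diff_distrib sum_subtractf)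
  moreover have "(\<lambda>h. \<Sum>b\<in>Basis. LINT x:\<Omega>|lebesgue. ((U h x - V x) \<bullet> b) * f b x) \<longlonglongrightarrow> (\<Sum>b\<in>(Basis::'b set). 0)"
    by (intro tendsto_sum lim f)
  then have "(\<lambda>h. (LINT x:\<Omega>|lebesgue. V x \<bullet> g x) + (\<Sum>b\<in>Basis. LINT x:\<Omega>|lebesgue. ((U h x - V x) \<bullet> b) * f b x)) \<longlonglongrightarrow> (LINT x:\<Omega>|lebesgue. V x \<bullet> g x) + 0"
    by (intro tendsto_add tendsto_const) simp
  ultimately show "(\<lambda>h. LINT x:\<Omega>|lebesgue. U h x \<bullet> g x) \<longlonglongrightarrow> (LINT x:\<Omega>|lebesgue. V x \<bullet> g x)" by simp
qed

text \<open>Density of test functions in \<open>L^1\<close> transfers null pairings to all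
  integrable functions, since the uniform bound on \<open>a\<close> controls the error.\<close>

lemma bounded_tested_null:
  fixes a :: "nat \<Rightarrow> 'a::euclidean_space \<Rightarrow> real"
  assumes \<Omega>: "open \<Omega>" and a: "\<And>h. set_borel_measurable lebesgue \<Omega> (a h)" "\<And>h. AE x in lebesgue. x \<in> \<Omega> \<longrightarrow> \<bar>a h x\<bar> \<le> B"
    and lim: "\<And>\<phi>. test_function \<Omega> \<phi> \<Longrightarrow> (\<lambda>h. LINT x:\<Omega>|lebesgue. a h x * \<phi> x) \<longlonglongrightarrow> 0"
    and f: "integrable lborel f" "\<And>x. x \<notin> \<Omega> \<Longrightarrow> f x = 0"
  shows "(\<lambda>h. LINT x:\<Omega>|lebesgue. a h x * f x) \<longlonglongrightarrow> 0"
proof (rule LIMSEQ_I)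
  fix e :: real assume e: "e > 0"
  define M where "M = max B 0 + 1"
  have M: "M > 0" "B \<le> M" by (auto simp: M_def)
  have "e / (2 * M) > 0" using e M by simp
  then obtain \<phi> where \<phi>: "test_function \<Omega> \<phi>" "(LINT x|lborel. \<bar>f x - \<phi> x\<bar>) < e / (2 * M)"
    using test_functions_dense_L1[OF \<Omega> f] by blast
  have \<phi>i: "integrable lborel \<phi>" by (rule test_function_integrable[OF \<phi>(1)])
  have d: "integrable lborel (\<lambda>x. f x - \<phi> x)" using f \<phi>i by auto
  have e2: "e / 2 > 0" using e by simp
  obtain N where N: "\<And>h. h \<ge> N \<Longrightarrow> norm ((LINT x:\<Omega>|lebesgue. a h x * \<phi> x) - 0) < e / 2"
    using LIMSEQ_D[OF lim[OF \<phi>(1)] e2] by blast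
  show "\<exists>no. \<forall>h\<ge>no. norm ((LINT x:\<Omega>|lebesgue. a h x * f x) - 0) < e"
  proof (intro exI[of _ N] allI impI)
    fix h assume h: "h \<ge> N"
    note I = bounded_times_set_integrable[OF a(1,2)]
    have "(LINT x:\<Omega>|lebesgue. a h x * f x) - (LINT x:\<Omega>|lebesgue. a h x * \<phi> x) = (LINT x:\<Omega>|lebesgue. a h x * (f x - \<phi> x))"
      using set_integral_diff(2)[OF I[OF f(1)] I[OF \<phi>i], of h] by (simp add: right_diff_distrib)
    also have "\<bar>(LINT x:\<Omega>|lebesgue. a h x * (f x - \<phi> x))\<bar> \<le> (LINT x|lebesgue. M * \<bar>f x - \<phi> x\<bar>)"
    proof -
      have dl: "integrable lebesgue (\<lambda>x. f x - \<phi> x)" using d by (subst integrable_completion) auto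
      have "\<bar>(LINT x:\<Omega>|lebesgue. a h x * (f x - \<phi> x))\<bar> \<le> (LINT x|lebesgue. norm (indicator \<Omega> x *\<^sub>R (a h x * (f x - \<phi> x))))"
        unfolding set_lebesgue_integral_def real_norm_def[symmetric] by (rule integral_norm_bound)
      also have "\<dots> \<le> (LINT x|lebesgue. M * \<bar>f x - \<phi> x\<bar>)"
      proof (rule integral_mono_AE')
        show "AE x in lebesgue. norm (indicator \<Omega> x *\<^sub>R (a h x * (f x - \<phi> x))) \<le> M * \<bar>f x - \<phi> x\<bar>"
          using a(2)[of h] by eventually_elim (use M in \<open>auto simp: abs_mult split: split_indicator intro!: mult_right_mono\<close>)
      qed (use dl M in auto)
      finally show ?thesis .
    qed
    also have "(LINT x|lebesgue. M * \<bar>f x - \<phi> x\<bar>) = M * (LINT x|lborel. \<bar>f x - \<phi> x\<bar>)"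
      using borel_measurable_integrable[OF d] by (subst integral_completion) auto
    also have "\<dots> < M * (e / (2 * M))" using M \<phi>(2) by (intro mult_strict_left_mono) auto
    also have "\<dots> = e / 2" using M by simp
    finally show "norm ((LINT x:\<Omega>|lebesgue. a h x * f x) - 0) < e" using N[OF h] unfolding real_norm_def by linarith
  qed
qed


lemma uniformly_null_tested:
  fixes a :: "nat \<Rightarrow> 'a::euclidean_space \<Rightarrow> real"
  assumes \<Omega>: "open \<Omega>" and f: "integrable lborel f" and b: "\<And>h. AE x in lebesgue. x \<in> \<Omega> \<longrightarrow> \<bar>a h x\<bar> \<le> s h" and s: "s \<longlonglongrightarrow> 0" "\<And>h. s h \<ge> 0"
  shows "(\<lambda>h. LINT x:\<Omega>|lebesgue. a h x * f x) \<longlonglongrightarrow> 0"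
proof (rule Lim_null_comparison)
  have fl: "integrable lebesgue f" using f borel_measurable_integrable[OF f] by (subst integrable_completion) auto
  have "norm (LINT x:\<Omega>|lebesgue. a h x * f x) \<le> s h * (LINT x|lebesgue. \<bar>f x\<bar>)" for h
  proof -
    have "norm (LINT x:\<Omega>|lebesgue. a h x * f x) \<le> (LINT x|lebesgue. norm (indicator \<Omega> x *\<^sub>R (a h x * f x)))"
      unfolding set_lebesgue_integral_def by (rule integral_norm_bound)
    also have "\<dots> \<le> (LINT x|lebesgue. s h * \<bar>f x\<bar>)"
    proof (rule integral_mono_AE')
      show "AE x in lebesgue. norm (indicator \<Omega> x *\<^sub>R (a h x * f x)) \<le> s h * \<bar>f x\<bar>"
        using b[of h] by eventually_elim (use s(2)[of h] in \<open>auto simp: abs_mult split: split_indicator intro!: mult_right_mono\<close>)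
    qed (use fl s(2)[of h] in auto)
    finally show ?thesis by simp
  qed
  then show "\<forall>\<^sub>F h in sequentially. norm (LINT x:\<Omega>|lebesgue. a h x * f x) \<le> s h * (LINT x|lebesgue. \<bar>f x\<bar>)"
    by (intro always_eventually allI)
  show "(\<lambda>h. s h * (LINT x|lebesgue. \<bar>f x\<bar>)) \<longlonglongrightarrow> 0" by (rule tendsto_mult_left_zero[OF s(1)])
qed

text \<open>The gradients need not converge strongly. Against a test function, integration by parts
  moves the derivative off \<open>u h x - A *v x\<close>, which tends to zero uniformly; the uniform
  gradient bound then extends this to all integrable functions.\<close>

lemma smooth_uniform_limit_weakstar_W1inf:
  fixes u :: "nat \<Rightarrow> real^'d \<Rightarrow> real^'s"
  assumes \<Omega>: "open \<Omega>" "bounded \<Omega>" and u: "\<And>h i k. Ck k (\<lambda>x. u h x $ i)" and b1: "\<And>h x i. \<bar>(u h x - A *v x) $ i\<bar> \<le> s h"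
    and b2: "\<And>h x i j. x \<in> \<Omega> \<Longrightarrow> \<bar>pdiff j (\<lambda>x. u h x $ i) x - A $ i $ j\<bar> \<le> C" and s: "s \<longlonglongrightarrow> 0"
  shows "weakstar_W1inf \<Omega> u (\<lambda>x. A *v x)"
proof -
  have Om: "\<Omega> \<in> sets borel" using \<Omega> by simp
  have s0: "s h \<ge> 0" for h using order_trans[OF abs_ge_zero b1] by blast
  note meas = locally_integrable_measurable[OF \<Omega>(1)]
  have lin: "has_weak_gradient \<Omega> (\<lambda>x. A *v x) (\<lambda>x. A)" by (rule linear_map_weak_gradient[OF \<Omega>(1)])
  define H where "H h = weak_grad \<Omega> (u h)" for h
  define H0 where "H0 = weak_grad \<Omega> (\<lambda>x. A *v x)"
  have H0: "AE x in lebesgue. x \<in> \<Omega> \<longrightarrow> H0 x = A" "has_weak_gradient \<Omega> (\<lambda>x. A *v x) H0"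
    unfolding H0_def by (rule weak_grad_AE_eq[OF \<Omega>(1) lin])+
  have wg: "has_weak_gradient \<Omega> (u h) (\<lambda>x. \<chi> i j. pdiff j (\<lambda>x. u h x $ i) x)" for h by (rule smooth_has_weak_gradient[OF \<Omega>(1) u])
  have H: "AE x in lebesgue. x \<in> \<Omega> \<longrightarrow> H h x = (\<chi> i j. pdiff j (\<lambda>x. u h x $ i) x)" "has_weak_gradient \<Omega> (u h) (H h)" for h
    unfolding H_def by (rule weak_grad_AE_eq[OF \<Omega>(1) wg])+
  have W: "u h \<in> W1inf \<Omega>" for h by (rule smooth_in_W1inf[OF \<Omega> u b1 b2])
  have ub: "\<exists>B. AE x in lebesgue. x \<in> \<Omega> \<longrightarrow> norm (u h x) \<le> B" for h using W[of h] unfolding W1inf_def Linf_def by blast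
  have Hb: "\<exists>B. AE x in lebesgue. x \<in> \<Omega> \<longrightarrow> norm (H h x) \<le> B" for h
  proof -
    obtain G where G: "G \<in> Linf \<Omega>" "has_weak_gradient \<Omega> (u h) G" using W[of h] unfolding W1inf_def by blast
    obtain B where "AE x in lebesgue. x \<in> \<Omega> \<longrightarrow> norm (G x) \<le> B" using G(1) unfolding Linf_def by blast
    then have "AE x in lebesgue. x \<in> \<Omega> \<longrightarrow> norm (H h x) \<le> B"
      using weak_grad_AE_eq(1)[OF \<Omega>(1) G(2)] unfolding H_def by eventually_elim auto
    then show ?thesis by blast
  qed
  have H0b: "\<exists>B. AE x in lebesgue. x \<in> \<Omega> \<longrightarrow> norm (H0 x) \<le> B"
    using H0(1) by (intro exI[of _ "norm A"]) (auto elim!: eventually_mono)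
  have A0b: "\<exists>B. AE x in lebesgue. x \<in> \<Omega> \<longrightarrow> norm (A *v x) \<le> B"
    using AE_bounded_minus_linear[OF \<Omega>(2), of "\<lambda>x. 0" 0 A] by simp
  define V where "V h x = H h x - H0 x" for h x
  have D: "has_weak_gradient \<Omega> (\<lambda>x. u h x - A *v x) (V h)" for h
    unfolding V_def[abs_def] by (rule has_weak_gradient_diff[OF H(2) H0(2)])
  have VC: "AE x in lebesgue. x \<in> \<Omega> \<longrightarrow> \<bar>V h x $ i $ j\<bar> \<le> C" for h i j
    using H(1)[of h] H0(1) by eventually_elim (use b2 in \<open>auto simp: V_def\<close>)
  have w1: "weakstar_Linf \<Omega> u (\<lambda>x. A *v x)"
  proof (rule weakstar_LinfI[OF Om meas[OF has_weak_gradientD(1)[OF H(2)]] ub meas[OF has_weak_gradientD(1)[OF lin]] A0b])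
    fix b :: "real^'s" and f :: "real^'d \<Rightarrow> real" assume b: "b \<in> Basis" and f: "integrable lborel f"
    have "\<bar>(u h x - A *v x) \<bullet> b\<bar> \<le> real CARD('s) * s h" for h x
    proof -
      have "\<bar>(u h x - A *v x) \<bullet> b\<bar> \<le> norm (u h x - A *v x)" by (rule Basis_le_norm[OF b])
      also have "\<dots> \<le> (\<Sum>i\<in>UNIV. \<bar>(u h x - A *v x) $ i\<bar>)" by (rule norm_le_l1_cart)
      also have "\<dots> \<le> (\<Sum>i\<in>(UNIV::'s set). s h)" by (intro sum_mono b1)
      finally show ?thesis by simp
    qed
    then show "(\<lambda>h. LINT x:\<Omega>|lebesgue. (u h x - A *v x) \<bullet> b * f x) \<longlonglongrightarrow> 0"
      by (intro uniformly_null_tested[OF \<Omega>(1) f, where s="\<lambda>h. real CARD('s) * s h"] tendsto_mult_right_zero s) (use s0 in auto)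
  qed
  have w2: "weakstar_Linf \<Omega> H H0"
  proof (rule weakstar_LinfI[OF Om meas[OF has_weak_gradientD(2)[OF H(2)]] Hb meas[OF has_weak_gradientD(2)[OF H0(2)]] H0b])
    fix b :: "real^'d^'s" and f :: "real^'d \<Rightarrow> real" assume b: "b \<in> Basis" and f: "integrable lborel f" "\<And>x. x \<notin> \<Omega> \<Longrightarrow> f x = 0"
    obtain i j where ij: "b = axis i (axis j 1)" using b by (auto simp: Basis_vec_def)
    have "(\<lambda>h. LINT x:\<Omega>|lebesgue. V h x $ i $ j * f x) \<longlonglongrightarrow> 0"
    proof (rule bounded_tested_null[OF \<Omega>(1) meas[OF locally_integrable_component2[OF has_weak_gradientD(2)[OF D]]] VC _ f])
      fix \<phi> :: "real^'d \<Rightarrow> real" assume \<phi>: "test_function \<Omega> \<phi>"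
      have "(\<lambda>h. LINT x:\<Omega>|lebesgue. (u h x - A *v x) $ i * pdiff j \<phi> x) \<longlonglongrightarrow> 0"
        by (rule uniformly_null_tested[OF \<Omega>(1) test_function_integrable[OF test_function_frechet_derivative[OF \<phi>]] _ s s0]) (use b1 in auto)
      then have "(\<lambda>h. - (LINT x:\<Omega>|lebesgue. (u h x - A *v x) $ i * pdiff j \<phi> x)) \<longlonglongrightarrow> - 0" by (rule tendsto_minus)
      then show "(\<lambda>h. LINT x:\<Omega>|lebesgue. V h x $ i $ j * \<phi> x) \<longlonglongrightarrow> 0"
        using has_weak_gradientD(3)[OF D \<phi>, of _ i j] by simp
    qed
    then show "(\<lambda>h. LINT x:\<Omega>|lebesgue. (H h x - H0 x) \<bullet> b * f x) \<longlonglongrightarrow> 0" by (simp add: ij axis_inner_matrix V_def)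
  qed
  show ?thesis unfolding weakstar_W1inf_def using w1 w2 by (simp add: H_def[abs_def] H0_def)
qed

lemma zero_imp_homogenized_set:
  fixes \<Omega> :: "(real^'d) set" and W :: "nat \<Rightarrow> real^'d^'s \<Rightarrow> real"
  assumes n: "1 \<le> n" and p: "1 < p" and \<Omega>: "open \<Omega>" "bounded \<Omega>"
    and W0: "\<And>k \<Lambda>. k \<in> {1..n} \<Longrightarrow> 0 \<le> W k \<Lambda>"
    and Wc: "\<And>k. k \<in> {1..n} \<Longrightarrow> continuous_on UNIV (W k)"
    and P: "measurable_partition n P"
    and Wg: "\<And>k. k \<in> {1..n} \<Longrightarrow> coercive_growth p (W k)"
    and WZ: "\<And>k. k \<in> {1..n} \<Longrightarrow> W k -` {0} \<noteq> {}"
    and hom: "homogenized_integrand \<Omega> p (\<lambda>y \<Lambda>. \<Sum>k\<in>{1..n}. indicator (P k) y * W k \<Lambda>) Whom"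
    and A: "Whom A = 0"
  shows "A \<in> homogenized_set \<Omega> n (\<lambda>k. W k -` {0}) P"
  unfolding homogenized_set_def
proof (intro CollectI allI impI)
  fix \<epsilon> assume v\<epsilon>: "vanishing_positive \<epsilon>"
  then have e: "\<epsilon> h > 0" for h by (simp add: vanishing_positive_def)
  define E where "E h = energy \<Omega> p (\<lambda>x \<Lambda>. \<Sum>k\<in>{1..n}. indicator (P k) (frac_vec (x /\<^sub>R \<epsilon> h)) * W k \<Lambda>)" for h
  define \<theta> where "\<theta> m = inverse (real (Suc m))" for m
  have \<theta>: "\<theta> m > 0" for m by (simp add: \<theta>_def)
  define lev where "lev h \<delta> G = {x \<in> \<Omega>. \<bar>(\<Sum>k\<in>{1..n}. indicator (P k) (frac_vec (x /\<^sub>R \<epsilon> h)) * infdist (G x) (W k -` {0})) - 0\<bar> > \<delta>}" for h \<delta> and G :: "real^'d \<Rightarrow> real^'d^'s"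
  define Du where "Du u x = (\<chi> i j. pdiff j (\<lambda>x. u x $ i) x)" for u :: "real^'d \<Rightarrow> real^'s" and x
  obtain C where C: "\<forall>\<theta>>0. \<exists>\<kappa>>0. \<forall>\<epsilon>>0. \<forall>v\<in>W1p \<Omega> p.
    (\<integral>\<^sup>+x\<in>\<Omega>. ennreal (\<Sum>k\<in>{1..n}. indicator (P k) (frac_vec (x /\<^sub>R \<epsilon>)) * W k (weak_grad \<Omega> v x)) \<partial>lebesgue) \<le> ennreal \<kappa> \<longrightarrow>
    (LINT x:\<Omega>|lebesgue. norm (v x - A *v x) powr p) \<le> \<kappa> \<longrightarrow>
    (\<exists>u :: real^'d \<Rightarrow> real^'s. (\<forall>i k. Ck k (\<lambda>x. u x $ i)) \<and> (\<forall>x i. \<bar>(u x - A *v x) $ i\<bar> \<le> \<theta>) \<and>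
      (\<forall>x\<in>\<Omega>. \<forall>i j. \<bar>pdiff j (\<lambda>x. u x $ i) x - A $ i $ j\<bar> \<le> C) \<and>
      emeasure lebesgue {x \<in> \<Omega>. \<bar>(\<Sum>k\<in>{1..n}. indicator (P k) (frac_vec (x /\<^sub>R \<epsilon>)) * infdist (\<chi> i j. pdiff j (\<lambda>x. u x $ i) x) (W k -` {0})) - 0\<bar> > \<theta>} \<le> ennreal \<theta>)"
    by (rule low_energy_lipschitz_approximation[where W=W and A=A and n=n and p=p and \<Omega>=\<Omega> and P=P, THEN exE])
      (rule n p \<Omega> P | erule W0 Wc Wg WZ | rule that, assumption)+
  \<comment> \<open>Level 0 omits the measure condition, so the linear map itself attains it for
    every \<open>h\<close>; \<open>max C 0\<close> leaves room for its vanishing gradient difference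
    should \<open>C\<close> be negative.\<close>
  define Q where "Q m h u \<longleftrightarrow> (\<forall>i k. Ck k (\<lambda>x. u x $ i)) \<and> (\<forall>x i. \<bar>(u x - A *v x) $ i\<bar> \<le> \<theta> m) \<and>
      (\<forall>x\<in>\<Omega>. \<forall>i j. \<bar>pdiff j (\<lambda>x. u x $ i) x - A $ i $ j\<bar> \<le> max C 0) \<and> (m > 0 \<longrightarrow> emeasure lebesgue (lev h (\<theta> m) (Du u)) \<le> ennreal (\<theta> m))"
    for m h and u :: "real^'d \<Rightarrow> real^'s"
  have base: "\<exists>u. Q 0 h u" for h
    unfolding Q_def by (intro exI[of _ "\<lambda>x. A *v x"]) (simp add: linear_component \<theta>_def)
  have ev: "\<forall>\<^sub>F h in sequentially. \<exists>u. Q m h u" for m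
  proof -
    from C[rule_format, OF \<theta>[of m]] obtain \<kappa> where \<kappa>: "\<kappa> > 0" "\<forall>\<epsilon>>0. \<forall>v\<in>W1p \<Omega> p.
    (\<integral>\<^sup>+x\<in>\<Omega>. ennreal (\<Sum>k\<in>{1..n}. indicator (P k) (frac_vec (x /\<^sub>R \<epsilon>)) * W k (weak_grad \<Omega> v x)) \<partial>lebesgue) \<le> ennreal \<kappa> \<longrightarrow>
    (LINT x:\<Omega>|lebesgue. norm (v x - A *v x) powr p) \<le> \<kappa> \<longrightarrow>
    (\<exists>u :: real^'d \<Rightarrow> real^'s. (\<forall>i k. Ck k (\<lambda>x. u x $ i)) \<and> (\<forall>x i. \<bar>(u x - A *v x) $ i\<bar> \<le> \<theta> m) \<and>
      (\<forall>x\<in>\<Omega>. \<forall>i j. \<bar>pdiff j (\<lambda>x. u x $ i) x - A $ i $ j\<bar> \<le> C) \<and>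
      emeasure lebesgue {x \<in> \<Omega>. \<bar>(\<Sum>k\<in>{1..n}. indicator (P k) (frac_vec (x /\<^sub>R \<epsilon>)) * infdist (\<chi> i j. pdiff j (\<lambda>x. u x $ i) x) (W k -` {0})) - 0\<bar> > \<theta> m} \<le> ennreal (\<theta> m))"
      by (elim exE conjE)
    have p0: "p > 0" using p by simp
    have "gamma_limit \<Omega> p E (energy \<Omega> p (\<lambda>x. Whom))"
      using hom v\<epsilon> unfolding homogenized_integrand_def E_def[abs_def] by blast
    \<comment> \<open>An infimum equal to 0 yields, for each threshold \<open>\<kappa>\<close>, a
      sequence with upper limit below it. That sequence may depend on \<open>m\<close>; the diagonal
      choice absorbs this.\<close>
    then have "Inf {limsup (\<lambda>h. E h (v h)) | v. (\<forall>h. v h \<in> Lp \<Omega> p) \<and> converges_Lp \<Omega> p v (\<lambda>x. A *v x)} \<le> energy \<Omega> p (\<lambda>x. Whom) (\<lambda>x. A *v x)"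
      using energy_linear(1)[OF \<Omega> p0, of A] unfolding gamma_limit_def by blast
    also have "\<dots> = 0" using energy_linear(2)[OF \<Omega> p0, of Whom A] A by simp
    also have "\<dots> < ennreal \<kappa>" using \<kappa>(1) by simp
    finally obtain v where v: "converges_Lp \<Omega> p v (\<lambda>x. A *v x)" "limsup (\<lambda>h. E h (v h)) < ennreal \<kappa>"
      unfolding Inf_less_iff by blast
    have "\<forall>\<^sub>F h in sequentially. E h (v h) < ennreal \<kappa>" using v(2) by (rule Limsup_lessD)
    moreover have "\<forall>\<^sub>F h in sequentially. (LINT x:\<Omega>|lebesgue. norm (v h x - A *v x) powr p) < \<kappa>"
      using v(1) \<kappa>(1) unfolding converges_Lp_def by (rule order_tendstoD(2))
    ultimately show ?thesis
    proof eventually_elim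
      case (elim h)
      \<comment> \<open>Outside \<open>W1p\<close> the energy is infinite.\<close>
      have W1: "v h \<in> W1p \<Omega> p" using elim(1) unfolding E_def energy_def by (auto split: if_splits)
      have "(\<integral>\<^sup>+x\<in>\<Omega>. ennreal (\<Sum>k\<in>{1..n}. indicator (P k) (frac_vec (x /\<^sub>R \<epsilon> h)) * W k (weak_grad \<Omega> (v h) x)) \<partial>lebesgue) \<le> ennreal \<kappa>"
        using elim(1) W1 unfolding E_def energy_def by simp
      from \<kappa>(2)[rule_format, OF e W1 this less_imp_le[OF elim(2)]] obtain u where u: "\<forall>i k. Ck k (\<lambda>x. u x $ i)" "\<forall>x i. \<bar>(u x - A *v x) $ i\<bar> \<le> \<theta> m"
        "\<forall>x\<in>\<Omega>. \<forall>i j. \<bar>pdiff j (\<lambda>x. u x $ i) x - A $ i $ j\<bar> \<le> C" "emeasure lebesgue (lev h (\<theta> m) (Du u)) \<le> ennreal (\<theta> m)"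
        unfolding lev_def Du_def by (elim exE conjE)
      have "\<forall>x\<in>\<Omega>. \<forall>i j. \<bar>pdiff j (\<lambda>x. u x $ i) x - A $ i $ j\<bar> \<le> max C 0" using u(3) by (simp add: le_max_iff_disj)
      then show ?case unfolding Q_def using u by (intro exI[of _ u]) simp
    qed
  qed
  obtain u \<mu> where u: "\<And>h. Q (\<mu> h) h (u h)" and \<mu>: "filterlim \<mu> at_top sequentially"
    using diagonal_choice[of Q, OF ev base] by blast
  have uk: "Ck k (\<lambda>x. u h x $ i)" for h i k using u[of h] unfolding Q_def by blast
  have b1: "\<bar>(u h x - A *v x) $ i\<bar> \<le> \<theta> (\<mu> h)" for h x i using u[of h] unfolding Q_def by blast
  have b2: "\<bar>pdiff j (\<lambda>x. u h x $ i) x - A $ i $ j\<bar> \<le> max C 0" if "x \<in> \<Omega>" for h x i j using u[of h] that unfolding Q_def by blast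
  have lim: "(\<lambda>h. \<theta> (\<mu> h)) \<longlonglongrightarrow> 0"
    unfolding \<theta>_def by (rule filterlim_compose[OF LIMSEQ_inverse_real_of_nat \<mu>])
  have Dwg: "has_weak_gradient \<Omega> (u h) (Du (u h))" for h unfolding Du_def[abs_def] by (rule smooth_has_weak_gradient[OF \<Omega>(1) uk])
  have Dm: "set_borel_measurable lebesgue \<Omega> (Du (u h))" for h by (rule locally_integrable_measurable[OF \<Omega>(1) has_weak_gradientD(2)[OF Dwg]])
  have "converges_in_measure \<Omega> (\<lambda>h x. \<Sum>k\<in>{1..n}. indicator (P k) (frac_vec (x /\<^sub>R \<epsilon> h)) * infdist (weak_grad \<Omega> (u h) x) (W k -` {0})) (\<lambda>x. 0)"
    unfolding converges_in_measure_def lev_def[symmetric]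
  proof (intro allI impI)
    fix \<delta> :: real assume \<delta>: "\<delta> > 0"
    show "(\<lambda>h. emeasure lebesgue (lev h \<delta> (weak_grad \<Omega> (u h)))) \<longlonglongrightarrow> 0"
    proof (rule tendsto_sandwich[where f="\<lambda>h. 0" and h="\<lambda>h. ennreal (\<theta> (\<mu> h))"])
      \<comment> \<open>Once \<open>\<theta> (\<mu> h)\<close> is below \<open>\<delta>\<close>, the
        level set for \<open>\<delta>\<close> lies in the one for \<open>\<theta> (\<mu> h)\<close>;
        requiring \<open>1 \<le> \<mu> h\<close> excludes level 0, which carries no measure
        bound.\<close>
      have "\<forall>\<^sub>F h in sequentially. \<theta> (\<mu> h) < \<delta>" using lim \<delta> by (rule order_tendstoD(2))
      moreover have "\<forall>\<^sub>F h in sequentially. 1 \<le> \<mu> h" using \<mu> unfolding filterlim_at_top by blast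
      ultimately show "\<forall>\<^sub>F h in sequentially. emeasure lebesgue (lev h \<delta> (weak_grad \<Omega> (u h))) \<le> ennreal (\<theta> (\<mu> h))"
      proof eventually_elim
        case (elim h)
        have "emeasure lebesgue (lev h \<delta> (weak_grad \<Omega> (u h))) \<le> emeasure lebesgue (lev h (\<theta> (\<mu> h)) (Du (u h)))"
        proof (rule emeasure_mono_AE)
          show "AE x in lebesgue. x \<in> lev h \<delta> (weak_grad \<Omega> (u h)) \<longrightarrow> x \<in> lev h (\<theta> (\<mu> h)) (Du (u h))"
            using weak_grad_AE_eq(1)[OF \<Omega>(1) Dwg[of h]] by eventually_elim (use elim(1) in \<open>auto simp: lev_def\<close>)
          show "lev h (\<theta> (\<mu> h)) (Du (u h)) \<in> sets lebesgue" unfolding lev_def by (rule dist_level_set_measurable[OF \<Omega>(1) P e Dm])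
        qed
        also have "\<dots> \<le> ennreal (\<theta> (\<mu> h))" using u[of h] elim(2) unfolding Q_def by simp
        finally show ?case .
      qed
      show "(\<lambda>h. ennreal (\<theta> (\<mu> h))) \<longlonglongrightarrow> 0" using tendsto_ennrealI[OF lim] by simp
    qed auto
  qed
  moreover have "weakstar_W1inf \<Omega> u (\<lambda>x. A *v x)" by (rule smooth_uniform_limit_weakstar_W1inf[OF \<Omega> uk b1 b2 lim])
  moreover have "u h \<in> W1inf \<Omega>" for h by (rule smooth_in_W1inf[OF \<Omega> uk b1 b2])
  ultimately show "\<exists>u. (\<forall>h. u h \<in> W1inf \<Omega>) \<and> weakstar_W1inf \<Omega> u (\<lambda>x. A *v x) \<and>
       converges_in_measure \<Omega> (\<lambda>h x. \<Sum>k\<in>{1..n}. indicator (P k) (frac_vec (x /\<^sub>R \<epsilon> h)) * infdist (weak_grad \<Omega> (u h) x) (W k -` {0})) (\<lambda>x. 0)"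
    by (intro exI[of _ u] conjI allI)
qed

theorem theorem1p2:
  fixes \<Omega> :: "(real^'d) set"
    and p :: real
    and n :: nat
    and W :: "nat \<Rightarrow> real^'d^'s \<Rightarrow> real"
    and P :: "nat \<Rightarrow> (real^'d) set"
    and Whom :: "real^'d^'s \<Rightarrow> real"
  assumes "1 \<le> n"
    and "1 < p"
    and "open \<Omega>" "bounded \<Omega>" "\<Omega> \<noteq> {}"
    and "\<And>k \<Lambda>. k \<in> {1..n} \<Longrightarrow> 0 \<le> W k \<Lambda>"
    and "\<And>k. k \<in> {1..n} \<Longrightarrow> continuous_on UNIV (W k)"
    and "measurable_partition n P"
    and "\<And>k. k \<in> {1..n} \<Longrightarrow> coercive_growth p (W k)"
    and "\<And>k. k \<in> {1..n} \<Longrightarrow> W k -` {0} \<noteq> {}"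
    and "homogenized_integrand \<Omega> p (\<lambda>y \<Lambda>. \<Sum>k\<in>{1..n}. indicator (P k) y * W k \<Lambda>) Whom"
  shows "homogenized_set \<Omega> n (\<lambda>k. W k -` {0}) P = Whom -` {0}"
proof (intro equalityI subsetI)
  fix A assume A: "A \<in> homogenized_set \<Omega> n (\<lambda>k. W k -` {0}) P"
  have "Whom A = 0"
    by (rule homogenized_set_imp_zero[where W=W and \<Omega>=\<Omega> and n=n and p=p and P=P])
      (rule assms(1-5,8,11) A | erule assms(6,7,10))+
  then show "A \<in> Whom -` {0}" by simp
next
  fix A assume "A \<in> Whom -` {0}"
  then have A: "Whom A = 0" by simp
  show "A \<in> homogenized_set \<Omega> n (\<lambda>k. W k -` {0}) P"
    by (rule zero_imp_homogenized_set[where W=W and \<Omega>=\<Omega> and n=n and p=p and P=P])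
      (rule assms(1-4,8,11) A | erule assms(6,7,9,10))+
qed

end
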